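(* Let $(A\xrightarrow{\psi_n}F_n\xrightarrow{\varphi_n}A)_n$ be a system of c.p.c. approximations of a separable nuclear $C^*$-algebra $A$. Then, after possibly passing to a summable subsystem of approximations $(A\xrightarrow{\psi_{n_j}}F_{n_j}\xrightarrow{\varphi_{n_j}}A)_j$ (with $(n_j)_j$ strictly increasing; relabelled again as $(A\xrightarrow{\psi_n}F_n\xrightarrow{\varphi_n}A)_n$), the associated c.p.c. system $(F_n,\psi_{n+1}\circ\varphi_n)_n$ is $C^*$-encoding, and the map $\Psi\colon A\to F_\infty=\prod_m F_m/\bigoplus_m F_m$, $\Psi(a)=[(\psi_m(a))_m]$, gives a complete order isomorphism between $A$ and the limit of this $C^*$-encoding system.
   Context: A map is c.p.c. if it is completely positive and contractive. A system of c.p.c. approximations $(A\xrightarrow{\psi_n}F_n\xrightarrow{\varphi_n}A)_n$ of a separable $C^*$-algebra $A$ consists of finite-dimensional $C^*$-algebras $F_n$ ($n\ge 0$) and c.p.c. maps $\psi_n\colon A\to F_n$, $\varphi_n\colon F_n\to A$ with $\lim_n\|\varphi_n(\psi_n(a))-a\|=0$ for all $a\in A$. It is summable if there is a decreasing sequence $(\varepsilon_m)_m$ of non-negative reals with $\sum_m\varepsilon_m\le 1$ such that $\|\varphi_n-\varphi_m\circ\psi_m\circ\varphi_n\|<\varepsilon_m$ for all $m>n\ge0$. Its associated c.p.c. system is $(F_n,\rho_{n+1,n})_n$ with $\rho_{n+1,n}=\psi_{n+1}\circ\varphi_n$. For a sequence $(A_n)_{n\ge 0}$ of $C^*$-algebras,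 $\prod_n A_n$ denotes the $C^*$-algebra of norm bounded sequences, $\bigoplus_n A_n$ its ideal of sequences converging to $0$ in norm, $A_\infty=\prod_n A_n/\bigoplus_n A_n$, and $[(a_n)_n]$ the class of $(a_n)_n$. A c.p.c. system $(A_n,\rho_{n+1,n})_n$ consists of $C^*$-algebras $(A_n)_{n\ge0}$ and c.p.c. maps $\rho_{n+1,n}\colon A_n\to A_{n+1}$. For $m>n$ set $\rho_{m,n}=\rho_{m,m-1}\circ\cdots\circ\rho_{n+1,n}$ and $\rho_{n,n}=\mathrm{id}_{A_n}$. Define $\rho_n\colon A_n\to A_\infty$ by $\rho_n(x)=[(\rho_{m,n}(x))_{m>n}]$. The limit of the system is the closed self-adjoint subspace $\overline{\bigcup_n\rho_n(A_n)}\subset A_\infty$. A c.p.c. system is $C^*$-encoding if for any $k\ge0$, $x,y\in A_k$ and $\varepsilon>0$ there is $M>k$ such that for all $m>n,j>M$ (that is, $n,j>M$ and $m>\max\{n,j\}$), $$\|\rho_{m,n}(\rho_{n,k}(x)\rho_{n,k}(y))-\rho_{m,j}(\rho_{j,k}(x)\rho_{j,k}(y))\|<\varepsilon .$$ For self-adjoint subspaces $X\subset A$, $Y\subset B$ of $C^*$-algebras, a $*$-linear map $\theta\colon X\to Y$ is completely positive (c.p.) if for every $r\ge1$ the amplification $\theta^{(r)}\colon M_r(X)\to M_r(Y)$ sends elements that are positive in $M_r(A)$ to elements positive in $M_r(B)$; it is completely isometric if every $\theta^{(r)}$ is isometric for the norms of $M_r(A)$ and $M_r(B)$. It is a complete order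 isomorphism if it is surjective, c.p., completely isometric and $\theta^{-1}$ is c.p. *)

theory Defs
  imports "HOL-Analysis.Analysis" "HOL-Algebra.QuotRing" "HOL-Algebra.Module"
begin

section \<open>C*-algebras\<close>

definition complex_ring :: "complex ring" where
  "complex_ring = \<lparr>carrier = UNIV, monoid.mult = (*), one = 1, zero = 0, add = (+)\<rparr>"

text \<open>
  C*-algebras are not assumed to be unital: the field \<^term>\<open>one\<close>, inherited from the library's
  records, is never constrained or used, and is \<^term>\<open>undefined\<close> in the constructions below.
\<close>

record 'a cstar = "(complex, 'a) module" +
  star :: "'a \<Rightarrow> 'a"
  cnorm :: "'a \<Rightarrow> real"

locale cstar_algebra = module complex_ring A for A :: "'a cstar" (structure) +
  assumes m_closed: "\<lbrakk>x \<in> carrier A; y \<in> carrier A\<rbrakk> \<Longrightarrow> x \<otimes> y \<in> carrier A"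
    and m_assoc: "\<lbrakk>x \<in> carrier A; y \<in> carrier A; z \<in> carrier A\<rbrakk> \<Longrightarrow> (x \<otimes> y) \<otimes> z = x \<otimes> (y \<otimes> z)"
    and l_distr: "\<lbrakk>x \<in> carrier A; y \<in> carrier A; z \<in> carrier A\<rbrakk> \<Longrightarrow> (x \<oplus> y) \<otimes> z = x \<otimes> z \<oplus> y \<otimes> z"
    and r_distr: "\<lbrakk>x \<in> carrier A; y \<in> carrier A; z \<in> carrier A\<rbrakk> \<Longrightarrow> z \<otimes> (x \<oplus> y) = z \<otimes> x \<oplus> z \<otimes> y"
    and smult_mult_l: "\<lbrakk>x \<in> carrier A; y \<in> carrier A\<rbrakk> \<Longrightarrow> (c \<odot> x) \<otimes> y = c \<odot> (x \<otimes> y)"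
    and smult_mult_r: "\<lbrakk>x \<in> carrier A; y \<in> carrier A\<rbrakk> \<Longrightarrow> x \<otimes> (c \<odot> y) = c \<odot> (x \<otimes> y)"
    and star_closed: "x \<in> carrier A \<Longrightarrow> star A x \<in> carrier A"
    and star_add: "\<lbrakk>x \<in> carrier A; y \<in> carrier A\<rbrakk> \<Longrightarrow> star A (x \<oplus> y) = star A x \<oplus> star A y"
    and star_smult: "x \<in> carrier A \<Longrightarrow> star A (c \<odot> x) = cnj c \<odot> star A x"
    and star_mult: "\<lbrakk>x \<in> carrier A; y \<in> carrier A\<rbrakk> \<Longrightarrow> star A (x \<otimes> y) = star A y \<otimes> star A x"
    and star_star: "x \<in> carrier A \<Longrightarrow> star A (star A x) = x"
    and norm_nonneg: "x \<in> carrier A \<Longrightarrow> 0 \<le> cnorm A x"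
    and norm_eq_0_iff: "x \<in> carrier A \<Longrightarrow> cnorm A x = 0 \<longleftrightarrow> x = \<zero>"
    and norm_triangle: "\<lbrakk>x \<in> carrier A; y \<in> carrier A\<rbrakk> \<Longrightarrow> cnorm A (x \<oplus> y) \<le> cnorm A x + cnorm A y"
    and norm_smult: "x \<in> carrier A \<Longrightarrow> cnorm A (c \<odot> x) = cmod c * cnorm A x"
    and norm_mult: "\<lbrakk>x \<in> carrier A; y \<in> carrier A\<rbrakk> \<Longrightarrow> cnorm A (x \<otimes> y) \<le> cnorm A x * cnorm A y"
    and norm_star_mult: "x \<in> carrier A \<Longrightarrow> cnorm A (star A x \<otimes> x) = (cnorm A x)\<^sup>2"
    and complete: "\<lbrakk>range s \<subseteq> carrier A; \<forall>e>0. \<exists>N. \<forall>m\<ge>N. \<forall>n\<ge>N. cnorm A (s m \<ominus> s n) < e\<rbrakk>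
      \<Longrightarrow> \<exists>x\<in>carrier A. (\<lambda>n. cnorm A (s n \<ominus> x)) \<longlonglongrightarrow> 0"

definition positive :: "'a cstar \<Rightarrow> 'a \<Rightarrow> bool" where
  "positive A x \<longleftrightarrow> (\<exists>b\<in>carrier A. x = star A b \<otimes>\<^bsub>A\<^esub> b)"

definition separable :: "'a cstar \<Rightarrow> bool" where
  "separable A \<longleftrightarrow> (\<exists>D \<subseteq> carrier A. countable D \<and>
     (\<forall>x\<in>carrier A. \<forall>e>0. \<exists>d\<in>D. cnorm A (x \<ominus>\<^bsub>A\<^esub> d) < e))"

definition finite_dimensional :: "'a cstar \<Rightarrow> bool" where
  "finite_dimensional A \<longleftrightarrow> (\<exists>S \<subseteq> carrier A. finite S \<and>
     (\<forall>x\<in>carrier A. \<exists>c. x = (\<Oplus>\<^bsub>A\<^esub>s\<in>S. c s \<odot>\<^bsub>A\<^esub> s)))"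

definition complex_cstar :: "complex cstar" where
  "complex_cstar = \<lparr>carrier = UNIV, monoid.mult = (*), one = undefined, zero = 0, add = (+),
     smult = (*), star = cnj, cnorm = cmod\<rparr>"


section \<open>Matrix amplifications\<close>

definition mats :: "nat \<Rightarrow> 'a set \<Rightarrow> (nat \<Rightarrow> nat \<Rightarrow> 'a) set" where
  "mats r X = {..<r} \<rightarrow>\<^sub>E ({..<r} \<rightarrow>\<^sub>E X)"

definition mk_mat :: "nat \<Rightarrow> (nat \<Rightarrow> nat \<Rightarrow> 'a) \<Rightarrow> nat \<Rightarrow> nat \<Rightarrow> 'a" where
  "mk_mat r f = (\<lambda>i\<in>{..<r}. \<lambda>j\<in>{..<r}. f i j)"

text \<open>
  The C*-norm of \<open>M\<^sub>r(A)\<close> is the operator norm for the faithful action of \<open>M\<^sub>r(A)\<close> on the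
  Hilbert module \<open>A\<^sup>r\<close> of columns, whose norm is \<open>\<parallel>v\<parallel> = \<parallel>\<Sum>\<^sub>i v\<^sub>i\<^sup>* v\<^sub>i\<parallel>\<^bsup>1/2\<^esup>\<close>.
\<close>

definition col_norm :: "'a cstar \<Rightarrow> nat \<Rightarrow> (nat \<Rightarrow> 'a) \<Rightarrow> real" where
  "col_norm A r v = sqrt (cnorm A (\<Oplus>\<^bsub>A\<^esub>i\<in>{..<r}. star A (v i) \<otimes>\<^bsub>A\<^esub> v i))"

definition mat_norm :: "'a cstar \<Rightarrow> nat \<Rightarrow> (nat \<Rightarrow> nat \<Rightarrow> 'a) \<Rightarrow> real" where
  "mat_norm A r X =
     Sup {col_norm A r (\<lambda>i\<in>{..<r}. \<Oplus>\<^bsub>A\<^esub>j\<in>{..<r}. X i j \<otimes>\<^bsub>A\<^esub> v j) | v.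
          v \<in> {..<r} \<rightarrow>\<^sub>E carrier A \<and> col_norm A r v \<le> 1}"

definition mat_cstar :: "nat \<Rightarrow> 'a cstar \<Rightarrow> (nat \<Rightarrow> nat \<Rightarrow> 'a) cstar" where
  "mat_cstar r A =
     \<lparr>carrier = mats r (carrier A),
      monoid.mult = (\<lambda>X Y. mk_mat r (\<lambda>i j. \<Oplus>\<^bsub>A\<^esub>k\<in>{..<r}. X i k \<otimes>\<^bsub>A\<^esub> Y k j)),
      one = undefined,
      zero = mk_mat r (\<lambda>i j. \<zero>\<^bsub>A\<^esub>),
      add = (\<lambda>X Y. mk_mat r (\<lambda>i j. X i j \<oplus>\<^bsub>A\<^esub> Y i j)),
      smult = (\<lambda>c X. mk_mat r (\<lambda>i j. c \<odot>\<^bsub>A\<^esub> X i j)),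
      star = (\<lambda>X. mk_mat r (\<lambda>i j. star A (X j i))),
      cnorm = mat_norm A r\<rparr>"

definition amplify :: "nat \<Rightarrow> ('a \<Rightarrow> 'b) \<Rightarrow> (nat \<Rightarrow> nat \<Rightarrow> 'a) \<Rightarrow> nat \<Rightarrow> nat \<Rightarrow> 'b" where
  "amplify r \<theta> X = mk_mat r (\<lambda>i j. \<theta> (X i j))"


section \<open>Completely positive maps\<close>

definition selfadjoint_subspace :: "'a cstar \<Rightarrow> 'a set \<Rightarrow> bool" where
  "selfadjoint_subspace A X \<longleftrightarrow> submodule X complex_ring A \<and> (\<forall>x\<in>X. star A x \<in> X)"

definition star_linear :: "'a cstar \<Rightarrow> 'a set \<Rightarrow> 'b cstar \<Rightarrow> 'b set \<Rightarrow> ('a \<Rightarrow> 'b) \<Rightarrow> bool" where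
  "star_linear A X B Y \<theta> \<longleftrightarrow>
     selfadjoint_subspace A X \<and> selfadjoint_subspace B Y \<and> \<theta> \<in> X \<rightarrow> Y \<and>
     (\<forall>x\<in>X. \<forall>y\<in>X. \<theta> (x \<oplus>\<^bsub>A\<^esub> y) = \<theta> x \<oplus>\<^bsub>B\<^esub> \<theta> y) \<and>
     (\<forall>c. \<forall>x\<in>X. \<theta> (c \<odot>\<^bsub>A\<^esub> x) = c \<odot>\<^bsub>B\<^esub> \<theta> x) \<and>
     (\<forall>x\<in>X. \<theta> (star A x) = star B (\<theta> x))"

definition completely_positive :: "'a cstar \<Rightarrow> 'a set \<Rightarrow> 'b cstar \<Rightarrow> 'b set \<Rightarrow> ('a \<Rightarrow> 'b) \<Rightarrow> bool" where
  "completely_positive A X B Y \<theta> \<longleftrightarrow> star_linear A X B Y \<theta> \<and>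
     (\<forall>r\<ge>1. \<forall>x\<in>mats r X. positive (mat_cstar r A) x \<longrightarrow> positive (mat_cstar r B) (amplify r \<theta> x))"

definition completely_isometric :: "'a cstar \<Rightarrow> 'a set \<Rightarrow> 'b cstar \<Rightarrow> 'b set \<Rightarrow> ('a \<Rightarrow> 'b) \<Rightarrow> bool" where
  "completely_isometric A X B Y \<theta> \<longleftrightarrow> star_linear A X B Y \<theta> \<and>
     (\<forall>r\<ge>1. \<forall>x\<in>mats r X. cnorm (mat_cstar r B) (amplify r \<theta> x) = cnorm (mat_cstar r A) x)"

definition complete_order_isomorphism ::
    "'a cstar \<Rightarrow> 'a set \<Rightarrow> 'b cstar \<Rightarrow> 'b set \<Rightarrow> ('a \<Rightarrow> 'b) \<Rightarrow> bool" where
  "complete_order_isomorphism A X B Y \<theta> \<longleftrightarrow>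
     \<theta> ` X = Y \<and> completely_positive A X B Y \<theta> \<and> completely_isometric A X B Y \<theta> \<and>
     completely_positive B Y A X (inv_into X \<theta>)"

definition cpc :: "'a cstar \<Rightarrow> 'b cstar \<Rightarrow> ('a \<Rightarrow> 'b) \<Rightarrow> bool" where
  "cpc A B \<theta> \<longleftrightarrow> completely_positive A (carrier A) B (carrier B) \<theta> \<and>
     (\<forall>x\<in>carrier A. cnorm B (\<theta> x) \<le> cnorm A x)"

definition op_norm :: "'a cstar \<Rightarrow> 'b cstar \<Rightarrow> ('a \<Rightarrow> 'b) \<Rightarrow> real" where
  "op_norm A B T = Sup {cnorm B (T x) | x. x \<in> carrier A \<and> cnorm A x \<le> 1}"

text \<open>
  Nuclearity in the form of the completely positive approximation property: the identity map factors approximately, in the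
  point-norm topology, through matrix algebras by c.p.c. maps.
\<close>

definition nuclear :: "'a cstar \<Rightarrow> bool" where
  "nuclear A \<longleftrightarrow> (\<forall>S e. finite S \<and> S \<subseteq> carrier A \<and> e > 0 \<longrightarrow>
     (\<exists>k\<ge>1. \<exists>\<psi> \<phi>. cpc A (mat_cstar k complex_cstar) \<psi> \<and> cpc (mat_cstar k complex_cstar) A \<phi> \<and>
        (\<forall>a\<in>S. cnorm A (\<phi> (\<psi> a) \<ominus>\<^bsub>A\<^esub> a) < e)))"


section \<open>Bounded sequences modulo null sequences\<close>

definition prod_cstar :: "(nat \<Rightarrow> 'a cstar) \<Rightarrow> (nat \<Rightarrow> 'a) cstar" where
  "prod_cstar F =
     \<lparr>carrier = {s. (\<forall>n. s n \<in> carrier (F n)) \<and> (\<exists>K. \<forall>n. cnorm (F n) (s n) \<le> K)},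
      monoid.mult = (\<lambda>s t n. s n \<otimes>\<^bsub>F n\<^esub> t n),
      one = undefined,
      zero = (\<lambda>n. \<zero>\<^bsub>F n\<^esub>),
      add = (\<lambda>s t n. s n \<oplus>\<^bsub>F n\<^esub> t n),
      smult = (\<lambda>c s n. c \<odot>\<^bsub>F n\<^esub> s n),
      star = (\<lambda>s n. star (F n) (s n)),
      cnorm = (\<lambda>s. SUP n. cnorm (F n) (s n))\<rparr>"

definition null_seqs :: "(nat \<Rightarrow> 'a cstar) \<Rightarrow> (nat \<Rightarrow> 'a) set" where
  "null_seqs F = {s \<in> carrier (prod_cstar F). (\<lambda>n. cnorm (F n) (s n)) \<longlonglongrightarrow> 0}"

definition quot_cstar :: "'a cstar \<Rightarrow> 'a set \<Rightarrow> 'a set cstar" where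
  "quot_cstar A I =
     \<lparr>carrier = a_rcosets\<^bsub>A\<^esub> I,
      monoid.mult = rcoset_mult A I,
      one = undefined,
      zero = I,
      add = set_add A,
      smult = (\<lambda>c X. \<Union>x\<in>X. I +>\<^bsub>A\<^esub> (c \<odot>\<^bsub>A\<^esub> x)),
      star = (\<lambda>X. \<Union>x\<in>X. I +>\<^bsub>A\<^esub> star A x),
      cnorm = (\<lambda>X. INF x\<in>X. cnorm A x)\<rparr>"

definition seq_cstar :: "(nat \<Rightarrow> 'a cstar) \<Rightarrow> (nat \<Rightarrow> 'a) set cstar" where
  "seq_cstar F = quot_cstar (prod_cstar F) (null_seqs F)"

definition seq_class :: "(nat \<Rightarrow> 'a cstar) \<Rightarrow> (nat \<Rightarrow> 'a) \<Rightarrow> (nat \<Rightarrow> 'a) set" where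
  "seq_class F s = null_seqs F +>\<^bsub>prod_cstar F\<^esub> s"


section \<open>C.p.c. systems\<close>

text \<open>
  A system is given by algebras \<open>F n\<close> and maps \<open>\<rho> n\<close> from \<open>F n\<close> to \<open>F (Suc n)\<close>.
\<close>

definition cpc_system :: "(nat \<Rightarrow> 'a cstar) \<Rightarrow> (nat \<Rightarrow> 'a \<Rightarrow> 'a) \<Rightarrow> bool" where
  "cpc_system F \<rho> \<longleftrightarrow> (\<forall>n. cstar_algebra (F n) \<and> cpc (F n) (F (Suc n)) (\<rho> n))"

text \<open>The composite \<open>\<rho> (m - 1) \<circ> \<dots> \<circ> \<rho> n\<close>, which is the identity if \<open>m = n\<close>.\<close>

definition connecting :: "(nat \<Rightarrow> 'a \<Rightarrow> 'a) \<Rightarrow> nat \<Rightarrow> nat \<Rightarrow> 'a \<Rightarrow> 'a" where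
  "connecting \<rho> m n = fold \<rho> [n..<m]"

text \<open>The entries with index at most \<open>n\<close> do not affect the class and are filled with zero.\<close>

definition to_limit :: "(nat \<Rightarrow> 'a cstar) \<Rightarrow> (nat \<Rightarrow> 'a \<Rightarrow> 'a) \<Rightarrow> nat \<Rightarrow> 'a \<Rightarrow> (nat \<Rightarrow> 'a) set" where
  "to_limit F \<rho> n x = seq_class F (\<lambda>m. if n < m then connecting \<rho> m n x else \<zero>\<^bsub>F m\<^esub>)"

definition system_limit :: "(nat \<Rightarrow> 'a cstar) \<Rightarrow> (nat \<Rightarrow> 'a \<Rightarrow> 'a) \<Rightarrow> (nat \<Rightarrow> 'a) set set" where
  "system_limit F \<rho> = {y \<in> carrier (seq_cstar F).
     \<forall>e>0. \<exists>n. \<exists>x\<in>carrier (F n). cnorm (seq_cstar F) (y \<ominus>\<^bsub>seq_cstar F\<^esub> to_limit F \<rho> n x) < e}"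

definition cstar_encoding :: "(nat \<Rightarrow> 'a cstar) \<Rightarrow> (nat \<Rightarrow> 'a \<Rightarrow> 'a) \<Rightarrow> bool" where
  "cstar_encoding F \<rho> \<longleftrightarrow> cpc_system F \<rho> \<and>
     (\<forall>k. \<forall>x\<in>carrier (F k). \<forall>y\<in>carrier (F k). \<forall>e>0. \<exists>M>k. \<forall>m n j. n > M \<and> j > M \<and> m > max n j \<longrightarrow>
        cnorm (F m)
          (connecting \<rho> m n (connecting \<rho> n k x \<otimes>\<^bsub>F n\<^esub> connecting \<rho> n k y) \<ominus>\<^bsub>F m\<^esub>
           connecting \<rho> m j (connecting \<rho> j k x \<otimes>\<^bsub>F j\<^esub> connecting \<rho> j k y)) < e)"


section \<open>Systems of c.p.c. approximations\<close>

definition cpc_approximations ::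
    "'a cstar \<Rightarrow> (nat \<Rightarrow> 'f cstar) \<Rightarrow> (nat \<Rightarrow> 'a \<Rightarrow> 'f) \<Rightarrow> (nat \<Rightarrow> 'f \<Rightarrow> 'a) \<Rightarrow> bool" where
  "cpc_approximations A F \<psi> \<phi> \<longleftrightarrow>
     (\<forall>n. cstar_algebra (F n) \<and> finite_dimensional (F n) \<and> cpc A (F n) (\<psi> n) \<and> cpc (F n) A (\<phi> n)) \<and>
     (\<forall>a\<in>carrier A. (\<lambda>n. cnorm A (\<phi> n (\<psi> n a) \<ominus>\<^bsub>A\<^esub> a)) \<longlonglongrightarrow> 0)"

definition summable_approximations ::
    "'a cstar \<Rightarrow> (nat \<Rightarrow> 'f cstar) \<Rightarrow> (nat \<Rightarrow> 'a \<Rightarrow> 'f) \<Rightarrow> (nat \<Rightarrow> 'f \<Rightarrow> 'a) \<Rightarrow> bool" where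
  "summable_approximations A F \<psi> \<phi> \<longleftrightarrow> cpc_approximations A F \<psi> \<phi> \<and>
     (\<exists>\<epsilon> :: nat \<Rightarrow> real. decseq \<epsilon> \<and> (\<forall>m. 0 \<le> \<epsilon> m) \<and> summable \<epsilon> \<and> (\<Sum>m. \<epsilon> m) \<le> 1 \<and>
        (\<forall>m n. n < m \<longrightarrow> op_norm (F n) A (\<lambda>x. \<phi> n x \<ominus>\<^bsub>A\<^esub> \<phi> m (\<psi> m (\<phi> n x))) < \<epsilon> m))"

definition associated_maps ::
    "(nat \<Rightarrow> 'a \<Rightarrow> 'f) \<Rightarrow> (nat \<Rightarrow> 'f \<Rightarrow> 'a) \<Rightarrow> nat \<Rightarrow> 'f \<Rightarrow> 'f" where
  "associated_maps \<psi> \<phi> n = \<psi> (Suc n) \<circ> \<phi> n"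

definition Psi_map :: "(nat \<Rightarrow> 'f cstar) \<Rightarrow> (nat \<Rightarrow> 'a \<Rightarrow> 'f) \<Rightarrow> 'a \<Rightarrow> (nat \<Rightarrow> 'f) set" where
  "Psi_map F \<psi> a = seq_class F (\<lambda>m. \<psi> m a)"

end

theory Submission
  imports Defs
begin

text \<open>
  With \<open>\<parallel>\<phi>\<^sub>n - \<phi>\<^sub>m \<psi>\<^sub>m \<phi>\<^sub>n\<parallel> < \<epsilon>\<^sub>m\<close> for \<open>m > n\<close>, which finite-dimensionality of the \<open>F\<^sub>n\<close> allows one to
  arrange along a subsequence, \<open>\<rho>\<^sub>m\<^sub>,\<^sub>n\<close> differs from \<open>\<psi>\<^sub>m \<phi>\<^sub>n\<close> by at most a tail of \<open>\<Sum> \<epsilon>\<^sub>j\<close>.  Hence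
  \<open>\<phi>\<^sub>n (\<rho>\<^sub>n\<^sub>,\<^sub>k x)\<close> converges to some \<open>a\<close> in \<open>A\<close> with \<open>\<rho>\<^sub>k x = \<Psi> a\<close>, and the limit of the system is
  the range of \<open>\<Psi>\<close>.  The Schwarz inequality shows that \<open>\<phi>\<^sub>n (\<psi>\<^sub>n a \<cdot> \<psi>\<^sub>n b)\<close> converges to \<open>a b\<close>, so
  \<open>\<rho>\<^sub>m\<^sub>,\<^sub>n (\<rho>\<^sub>n\<^sub>,\<^sub>k x \<cdot> \<rho>\<^sub>n\<^sub>,\<^sub>k y)\<close> is close to \<open>\<psi>\<^sub>m (a b)\<close> for large \<open>n\<close>, which is the encoding condition.
  Complete contractivity of \<open>\<psi>\<^sub>n\<close> and \<open>\<phi>\<^sub>n\<close> makes \<open>\<Psi>\<close> completely isometric, and closedness of the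
  positive cone of \<open>M\<^sub>r(A)\<close> makes its inverse completely positive.
\<close>

section \<open>Positive elements of a unital C*-algebra\<close>

text \<open>Three obstacles shape the development. The algebras are records on a carrier and need
  not have a unit, so calculation takes place in the type class \<open>cstar_alg_1\<close>:
  \<open>emb\<close> carries every C*-algebra on \<open>'a\<close> isometrically into one unital
  algebra of that class, and \<open>positive_iff\<close> says that positivity is neither gained nor
  lost on the way. Positivity itself is treated without spectra or Hilbert spaces: it means being
  the square of a self-adjoint element, square roots come from an iteration, and the test
  \<parallel>t 1 - x\<parallel> \<le> t takes the place of statements about the spectrum. Finally,
  \<open>cpc\<close> bounds norms at matrix level one only, and there need not be a unit at which a
  map could be evaluated, so complete contractivity is derived with approximate units. The quotient
  \<open>seq_cstar\<close> is handled through representing sequences: operations, norm and matrix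
  norms are computed on representatives, and as an abstract structure only its additive group is
  established.\<close>

class cstar_alg = real_normed_algebra + complete_space +
  fixes adj :: "'a \<Rightarrow> 'a" and scaleC :: "complex \<Rightarrow> 'a \<Rightarrow> 'a"  (infixr \<open>*\<^sub>C\<close> 75)
  assumes adj_add: "adj (x + y) = adj x + adj y"
    and adj_mult: "adj (x * y) = adj y * adj x"
    and adj_adj [simp]: "adj (adj x) = x"
    and adj_scaleC: "adj (c *\<^sub>C x) = cnj c *\<^sub>C adj x"
    and scaleC_add_right: "c *\<^sub>C (x + y) = c *\<^sub>C x + c *\<^sub>C y"
    and scaleC_add_left: "(c + d) *\<^sub>C x = c *\<^sub>C x + d *\<^sub>C x"
    and scaleC_scaleC [simp]: "c *\<^sub>C (d *\<^sub>C x) = (c * d) *\<^sub>C x"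
    and scaleR_scaleC: "r *\<^sub>R x = complex_of_real r *\<^sub>C x"
    and mult_scaleC_left [simp]: "(c *\<^sub>C x) * y = c *\<^sub>C (x * y)"
    and mult_scaleC_right [simp]: "x * (c *\<^sub>C y) = c *\<^sub>C (x * y)"
    and norm_adj_mult: "norm (adj x * x) = (norm x)\<^sup>2"

class cstar_alg_1 = cstar_alg + real_normed_algebra_1

section \<open>Involution and complex scalars\<close>

lemma adj_zero [simp]: "adj 0 = 0"
  using adj_add[of 0 0] by simp

lemma adj_minus: "adj (- x) = - adj x"
  using adj_add[of x "- x"] by (simp add: eq_neg_iff_add_eq_0 add.commute)

lemma adj_diff: "adj (x - y) = adj x - adj y"
  using adj_add[of x "- y"] by (simp add: adj_minus)

lemma adj_scaleR: "adj (r *\<^sub>R x) = r *\<^sub>R adj x"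
  by (simp add: scaleR_scaleC adj_scaleC)

lemma adj_sum: "adj (sum f S) = (\<Sum>i\<in>S. adj (f i))"
  by (induction S rule: infinite_finite_induct) (auto simp: adj_add)

lemma norm_adj [simp]: "norm (adj x) = norm x"
proof -
  have le: "norm x \<le> norm (adj x)" for x
  proof (cases "norm x = 0")
    case False
    have "norm x * norm x \<le> norm (adj x) * norm x"
      using norm_mult_ineq[of "adj x" x] norm_adj_mult[of x] by (simp add: power2_eq_square)
    then show ?thesis using False norm_ge_zero[of x] by (simp add: mult_le_cancel_right)
  next
    case True then show ?thesis by (simp del: norm_eq_zero add: norm_ge_zero)
  qed
  show ?thesis using le[of x] le[of "adj x"] by simp
qed

lemma norm_self_mult: "adj x = x \<Longrightarrow> norm (x * x) = (norm x)\<^sup>2"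
  using norm_adj_mult[of x] by simp

lemma norm_mult_adj: "norm (x * adj x) = (norm x)\<^sup>2"
  using norm_adj_mult[of "adj x"] by simp

lemma adj_mult_eq_0_iff [simp]: "adj x * x = 0 \<longleftrightarrow> x = 0"
  using norm_adj_mult[of x] by auto

lemma scaleC_zero_left [simp]: "0 *\<^sub>C x = (0::'a::cstar_alg)"
  using scaleR_scaleC[of 0 x, symmetric] by simp

lemma scaleC_one [simp]: "1 *\<^sub>C x = x"
  using scaleR_scaleC[of 1 x, symmetric] by simp

lemma scaleC_zero_right [simp]: "c *\<^sub>C 0 = 0"
  using scaleC_add_right[of c 0 0] by simp

lemma scaleC_minus_one: "(- 1) *\<^sub>C x = - x"
  using scaleR_scaleC[of "-1" x, symmetric] by simp

lemma scaleC_minus_right: "c *\<^sub>C (- x) = - (c *\<^sub>C x)"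
  using scaleC_add_right[of c x "- x"] by (simp add: eq_neg_iff_add_eq_0 add.commute)

lemma scaleC_minus_left: "(- c) *\<^sub>C x = - (c *\<^sub>C x)"
  using scaleC_add_left[of c "- c" x] by (simp add: eq_neg_iff_add_eq_0 add.commute)

lemma scaleC_diff_right: "c *\<^sub>C (x - y) = c *\<^sub>C x - c *\<^sub>C y"
  using scaleC_add_right[of c x "- y"] by (simp add: scaleC_minus_right)

lemma scaleC_diff_left: "(c - d) *\<^sub>C x = c *\<^sub>C x - d *\<^sub>C x"
  using scaleC_add_left[of c "- d" x] by (simp add: scaleC_minus_left)

lemma scaleC_sum_right: "c *\<^sub>C (sum f S) = (\<Sum>i\<in>S. c *\<^sub>C f i)"
  by (induction S rule: infinite_finite_induct) (auto simp: scaleC_add_right)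

text \<open>The class provides homogeneity of the norm for real scalars only. For complex ones it
  follows from the C*-identity, because \<open>adj (c *\<^sub>C x) * (c *\<^sub>C x)\<close> is the
  real multiple of \<open>adj x * x\<close> by the square of \<open>cmod c\<close>.\<close>

lemma norm_scaleC: "norm (c *\<^sub>C x) = cmod c * norm x"
proof -
  have "adj (c *\<^sub>C x) * (c *\<^sub>C x) = scaleR ((cmod c)\<^sup>2) (adj x * x)"
    unfolding adj_scaleC mult_scaleC_left mult_scaleC_right scaleC_scaleC scaleR_scaleC
    by (metis complex_norm_square mult.commute)
  then have "(norm (c *\<^sub>C x))\<^sup>2 = (cmod c * norm x)\<^sup>2"
    using norm_adj_mult[of "c *\<^sub>C x"] norm_adj_mult[of x] by (simp add: power_mult_distrib)
  then show ?thesis by (simp add: power2_eq_iff_nonneg)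
qed

lemma bounded_linear_adj: "bounded_linear (adj :: 'a::cstar_alg \<Rightarrow> 'a)"
  by (rule bounded_linear_intro[where K = 1]) (auto simp: adj_add adj_scaleR)

lemmas tendsto_adj = bounded_linear.tendsto[OF bounded_linear_adj]

lemma adj_one [simp]: "adj (1::'a::cstar_alg_1) = 1"
  by (metis adj_adj adj_mult mult.right_neutral)

text \<open>The iterates of \<open>z \<mapsto> (y + z\<^sup>2) / 2\<close> are dominated by those of \<open>t \<mapsto> (1 + t\<^sup>2) / 2\<close> on the
  reals, which increase to \<open>1\<close>; this covers the boundary case \<open>\<parallel>y\<parallel> = 1\<close>.\<close>

lemma quadratic_root_exists:
  fixes y :: "'a::cstar_alg_1"
  assumes "norm y \<le> 1"
  shows "\<exists>z. norm z \<le> 1 \<and> 2 *\<^sub>R z = y + z * z \<and> (adj y = y \<longrightarrow> adj z = z) \<and>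
    (\<forall>w. w * y = y * w \<longrightarrow> w * z = z * w)"
proof -
  \<comment> \<open>A fixed point \<open>z\<close> of this iteration satisfies
    \<open>(1 - z) * (1 - z) = 1 - y\<close>, so \<open>1 - z\<close> is a square root of
    \<open>1 - y\<close>. This is the form in which the lemma is used.\<close>
  define s where "s = rec_nat 0 (\<lambda>_ z. (1/2) *\<^sub>R (y + z * z))"
  define q where "q = rec_nat (0::real) (\<lambda>_ t. (1 + t * t) / 2)"
  have s0: "s 0 = 0" and sS: "s (Suc n) = (1/2) *\<^sub>R (y + s n * s n)" for n
    by (simp_all add: s_def)
  have q0: "q 0 = 0" and qS: "q (Suc n) = (1 + q n * q n) / 2" for n
    by (simp_all add: q_def)
  have q01: "0 \<le> q n \<and> q n \<le> 1" for n
    by (induction n) (auto simp: q0 qS intro: mult_le_one)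
  have "incseq q"
  proof (rule incseq_SucI)
    fix n show "q n \<le> q (Suc n)"
      using zero_le_power2[of "1 - q n"] by (simp add: qS power2_eq_square algebra_simps)
  qed
  moreover have "bdd_above (range q)" using q01 by (intro bdd_aboveI[of _ 1]) auto
  ultimately have "Cauchy q"
    using LIMSEQ_incseq_SUP[of q] by (auto intro: LIMSEQ_imp_Cauchy)
  have com: "w * s n = s n * w" if "w * y = y * w" for w n
  proof (induction n)
    case (Suc n)
    have "w * (s n * s n) = (s n * s n) * w" by (metis Suc mult.assoc)
    then show ?case using that by (simp add: sS distrib_left distrib_right)
  qed (simp add: s0)
  have com2: "s m * s n = s n * s m" for m n
    using com[OF com[of y m, symmetric]] by simp
  have nq: "norm (s n) \<le> q n" for n
  proof (induction n)
    case (Suc n)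
    have "norm (s n * s n) \<le> q n * q n"
      using norm_mult_ineq[of "s n" "s n"] mult_mono[OF Suc Suc] q01[of n] by simp
    then have "norm (y + s n * s n) \<le> 1 + q n * q n"
      using norm_triangle_ineq[of y "s n * s n"] assms by linarith
    then show ?case by (simp add: sS qS)
  qed (simp add: s0 q0)
  \<comment> \<open>A difference of squares of commuting iterates factors exactly as for the reals,
    so the increments of \<open>s\<close> are dominated by those of \<open>q\<close>; hence
    \<open>s\<close> is Cauchy because \<open>q\<close> is.\<close>
  have step: "norm (s (Suc n) - s n) \<le> q (Suc n) - q n" for n
  proof (induction n)
    case 0 show ?case using assms by (simp add: s0 sS qS q0)
  next
    case (Suc n)
    have "s (Suc (Suc n)) - s (Suc n) = (1/2) *\<^sub>R ((s (Suc n) - s n) * (s (Suc n) + s n))"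
    proof -
      have "s (Suc (Suc n)) - s (Suc n) = (1/2) *\<^sub>R (y + s (Suc n) * s (Suc n)) - (1/2) *\<^sub>R (y + s n * s n)"
        by (metis sS)
      also have "\<dots> = (1/2) *\<^sub>R (s (Suc n) * s (Suc n) - s n * s n)"
        by (simp add: scaleR_diff_right[symmetric])
      also have "s (Suc n) * s (Suc n) - s n * s n = (s (Suc n) - s n) * (s (Suc n) + s n)"
        by (simp add: algebra_simps com2[of n "Suc n"])
      finally show ?thesis .
    qed
    then have "norm (s (Suc (Suc n)) - s (Suc n)) \<le> (norm (s (Suc n) - s n) * norm (s (Suc n) + s n)) / 2"
      using norm_mult_ineq[of "s (Suc n) - s n" "s (Suc n) + s n"] by simp
    also have "\<dots> \<le> ((q (Suc n) - q n) * (q (Suc n) + q n)) / 2"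
      using Suc norm_triangle_ineq[of "s (Suc n)" "s n"] nq[of n] nq[of "Suc n"] q01[of n] q01[of "Suc n"]
        \<open>incseq q\<close>[THEN incseq_SucD, of n]
      by (intro divide_right_mono mult_mono) auto
    also have "\<dots> = q (Suc (Suc n)) - q (Suc n)"
      unfolding qS[of "Suc n"] by (simp add: qS[of n] field_simps)
    finally show ?case .
  qed
  have mono: "norm (s (m + d) - s m) \<le> q (m + d) - q m" for m d
  proof (induction d)
    case (Suc d)
    have "norm (s (m + Suc d) - s m) \<le> norm (s (Suc (m + d)) - s (m + d)) + norm (s (m + d) - s m)"
      using norm_triangle_ineq[of "s (Suc (m + d)) - s (m + d)" "s (m + d) - s m"] by simp
    then show ?case using Suc step[of "m + d"] by simp
  qed simp
  have "dist (s m) (s n) \<le> dist (q m) (q n)" for m n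
  proof (cases "m \<le> n")
    case True then show ?thesis using mono[of m "n - m"]
      by (simp add: dist_norm norm_minus_commute)
  next
    case False then show ?thesis using mono[of n "m - n"]
      by (simp add: dist_norm)
  qed
  then have "Cauchy s" using \<open>Cauchy q\<close> unfolding Cauchy_def by (meson order_le_less_trans)
  then obtain z where z: "s \<longlonglongrightarrow> z" using Cauchy_convergent convergent_def by blast
  have "norm z \<le> 1"
    by (rule LIMSEQ_le_const2[OF tendsto_norm[OF z]]) (meson nq q01 order_trans)
  moreover have "2 *\<^sub>R z = y + z * z"
  proof -
    have "(\<lambda>n. (1/2) *\<^sub>R (y + s n * s n)) \<longlonglongrightarrow> (1/2) *\<^sub>R (y + z * z)"
      by (intro tendsto_intros z)
    then have "(\<lambda>n. s (Suc n)) \<longlonglongrightarrow> (1/2) *\<^sub>R (y + z * z)" by (simp add: sS)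
    with z have "z = (1/2) *\<^sub>R (y + z * z)" using LIMSEQ_unique LIMSEQ_Suc by blast
    then have "2 *\<^sub>R z = 2 *\<^sub>R (1/2) *\<^sub>R (y + z * z)" by simp
    then show ?thesis by simp
  qed
  moreover have "adj z = z" if "adj y = y"
  proof -
    have "adj (s n) = s n" for n
      by (induction n) (simp_all add: s0 sS adj_scaleR adj_add adj_mult that)
    moreover have "(\<lambda>n. adj (s n)) \<longlonglongrightarrow> adj z" by (rule tendsto_adj[OF z])
    ultimately have "s \<longlonglongrightarrow> adj z" by simp
    then show ?thesis by (rule LIMSEQ_unique[OF _ z])
  qed
  moreover have "w * z = z * w" if "w * y = y * w" for w
  proof -
    have "(\<lambda>n. w * s n) \<longlonglongrightarrow> z * w"
      unfolding com[OF that] by (intro tendsto_intros z)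
    moreover have "(\<lambda>n. w * s n) \<longlonglongrightarrow> w * z" by (intro tendsto_intros z)
    ultimately show ?thesis using LIMSEQ_unique by blast
  qed
  ultimately show ?thesis by blast
qed

text \<open>A self-adjoint root is demanded, not merely the form \<open>adj b * b\<close>: with a
  root in hand the order properties follow from the square root construction. That the two notions
  agree is the content of \<open>pos_adj_mult\<close>.\<close>

definition pos :: "'a::cstar_alg_1 \<Rightarrow> bool" where
  "pos x \<longleftrightarrow> (\<exists>k. adj k = k \<and> x = k * k)"

lemma pos_selfadj: "pos x \<Longrightarrow> adj x = x"
  by (auto simp: pos_def adj_mult)

lemma pos_0 [simp]: "pos 0"
  unfolding pos_def by (rule exI[of _ 0]) simp

lemma pos_1 [simp]: "pos 1"
  unfolding pos_def by (rule exI[of _ 1]) simp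

lemma pos_square: "adj k = k \<Longrightarrow> pos (k * k)"
  by (auto simp: pos_def)

lemma pos_scaleR: "pos x \<Longrightarrow> 0 \<le> t \<Longrightarrow> pos (t *\<^sub>R x)"
  unfolding pos_def
proof (elim exE conjE)
  fix k assume "0 \<le> t" "adj k = k" "x = k * k"
  then show "\<exists>k. adj k = k \<and> t *\<^sub>R x = k * k"
    by (intro exI[of _ "sqrt t *\<^sub>R k"]) (simp add: adj_scaleR)
qed

text \<open>Norm at most one because \<open>k + i l\<close> is unitary.\<close>

lemma norm_le_1_of_squares:
  fixes k l :: "'a::cstar_alg_1"
  assumes "adj k = k" "adj l = l" "k * l = l * k" "k * k + l * l = 1"
  shows "norm k \<le> 1"
proof -
  define u where "u = k + \<i> *\<^sub>C l"
  have au: "adj u = k - \<i> *\<^sub>C l"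
    by (simp add: u_def adj_add adj_scaleC assms scaleC_minus_left)
  have "adj u * u = k * k + l * l"
    unfolding au unfolding u_def by (simp add: algebra_simps assms(3) scaleC_minus_one scaleC_add_right scaleC_diff_right)
  then have "(norm u)\<^sup>2 = 1" using norm_adj_mult[of u] assms(4) by simp
  then have "norm u = 1" by (simp add: power2_eq_1_iff) (smt (verit) norm_ge_zero)
  moreover have "2 *\<^sub>R k = u + adj u" unfolding au by (simp add: u_def scaleR_2)
  ultimately have "2 * norm k \<le> 2"
    using norm_triangle_ineq[of u "adj u"] by (metis norm_adj norm_scaleR abs_numeral one_add_one)
  then show ?thesis by simp
qed

text \<open>After scaling, \<open>x = t *\<^sub>R (k * k)\<close> with \<open>k * k\<close> of norm
  at most 1. The iteration gives a self-adjoint root \<open>l\<close> of \<open>1 - k * k\<close>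
  commuting with \<open>k\<close>, so \<open>l\<close> is a part of a unitary and has norm at most
  1, and \<open>t *\<^sub>R 1 - x = t *\<^sub>R (l * l)\<close>. Together with \<open>posI\<close>
  this makes the norm test a characterization of positivity.\<close>

lemma pos_norm_diff_le:
  fixes x :: "'a::cstar_alg_1"
  assumes "pos x" "norm x \<le> t"
  shows "norm (t *\<^sub>R 1 - x) \<le> t"
proof (cases "t = 0")
  case True then show ?thesis using assms by simp
next
  case False
  then have t: "t > 0" using assms(2) norm_ge_zero[of x] by linarith
  obtain k0 where k0: "adj k0 = k0" "x = k0 * k0" using assms by (auto simp: pos_def)
  define k where "k = (1 / sqrt t) *\<^sub>R k0"
  have k: "adj k = k" "x = t *\<^sub>R (k * k)" using k0 t by (simp_all add: k_def adj_scaleR)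
  have "norm (k * k) \<le> 1" using assms(2) t k by simp
  then obtain z where z: "2 *\<^sub>R z = k * k + z * z" "adj (k*k) = k * k \<longrightarrow> adj z = z"
    "\<And>w. w * (k * k) = (k * k) * w \<Longrightarrow> w * z = z * w"
    using quadratic_root_exists by metis
  define l where "l = 1 - z"
  have l: "adj l = l" using z(2) k by (simp add: l_def adj_diff adj_mult)
  have "k * z = z * k" using z(3)[of k] by (simp add: mult.assoc)
  then have com: "l * k = k * l" by (simp add: l_def algebra_simps)
  have ll: "l * l = 1 - k * k" using z(1) by (simp add: l_def algebra_simps scaleR_2)
  have "norm l \<le> 1" by (rule norm_le_1_of_squares[OF l k(1) com]) (simp add: ll)
  then have "norm (l * l) \<le> 1" using norm_self_mult[OF l] by (simp add: power_le_one)
  moreover have "t *\<^sub>R 1 - x = t *\<^sub>R (l * l)" using k ll by (simp add: scaleR_diff_right)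
  ultimately show ?thesis using t by simp
qed

text \<open>For \<open>y = 1 - x / t\<close> the iteration yields \<open>z\<close>, and
  \<open>k = sqrt t *\<^sub>R (1 - z)\<close> squares to \<open>x\<close>. Since \<open>z\<close>
  has norm at most 1, \<open>k\<close> passes the same norm test with \<open>sqrt t\<close> for
  \<open>t\<close>; a second application of the construction therefore shows that the root is itself
  positive.\<close>

lemma square_root_exists:
  fixes x :: "'a::cstar_alg_1"
  assumes "adj x = x" "norm (t *\<^sub>R 1 - x) \<le> t"
  shows "\<exists>k. adj k = k \<and> k * k = x \<and> pos k \<and> (\<forall>w. w * x = x * w \<longrightarrow> w * k = k * w)"
proof -
  have weak: "\<exists>k. adj k = k \<and> k * k = x \<and> norm (s *\<^sub>R 1 - k) \<le> s \<and> (\<forall>w. w * x = x * w \<longrightarrow> w * k = k * w)"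
    if "adj x = x" "norm (t *\<^sub>R 1 - x) \<le> t" "s = sqrt t" for x :: 'a and t s
  proof (cases "t = 0")
    case True then show ?thesis using that by (intro exI[of _ 0]) auto
  next
    case False
    then have t: "t > 0" using that norm_ge_zero[of "t *\<^sub>R 1 - x"] by linarith
    define y where "y = (1/t) *\<^sub>R (t *\<^sub>R 1 - x)"
    have "norm y \<le> 1" using that t by (simp add: y_def)
    moreover have "adj y = y" using that by (simp add: y_def adj_scaleR adj_diff)
    ultimately obtain z where z: "norm z \<le> 1" "2 *\<^sub>R z = y + z * z" "adj z = z"
      "\<And>w. w * y = y * w \<Longrightarrow> w * z = z * w"
      using quadratic_root_exists by metis
    define k where "k = s *\<^sub>R (1 - z)"
    have "k * k = t *\<^sub>R ((1 - z) * (1 - z))" using that t by (simp add: k_def)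
    also have "(1 - z) * (1 - z) = 1 - y" using z(2) by (simp add: algebra_simps scaleR_2)
    also have "t *\<^sub>R (1 - y) = x" using t by (simp add: y_def scaleR_diff_right)
    finally have "k * k = x" .
    moreover have "adj k = k" using z(3) by (simp add: k_def adj_scaleR adj_diff)
    moreover have "norm (s *\<^sub>R 1 - k) \<le> s"
      using z(1) that t by (simp add: k_def scaleR_diff_right mult_left_le)
    moreover have "w * k = k * w" if "w * x = x * w" for w
    proof -
      have "w * y = y * w" using that by (simp add: y_def algebra_simps)
      then show ?thesis using z(4) by (simp add: k_def algebra_simps)
    qed
    ultimately show ?thesis by blast
  qed
  from weak[OF assms refl] obtain k where k: "adj k = k" "k * k = x" "norm (sqrt t *\<^sub>R 1 - k) \<le> sqrt t"
    "\<forall>w. w * x = x * w \<longrightarrow> w * k = k * w" by blast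
  from weak[OF k(1) k(3) refl] have "pos k" unfolding pos_def by metis
  then show ?thesis using k by blast
qed

lemma posI: "adj x = x \<Longrightarrow> norm (t *\<^sub>R 1 - x) \<le> t \<Longrightarrow> pos x"
  using square_root_exists[of x t] unfolding pos_def by blast

lemma pos_sqrt:
  assumes "pos x"
  obtains k where "pos k" "k * k = x" "\<And>w. w * x = x * w \<Longrightarrow> w * k = k * w"
  using square_root_exists[OF pos_selfadj[OF assms] pos_norm_diff_le[OF assms order_refl]] by blast

text \<open>A sum of squares is not visibly a square, but the norm test is additive: the triangle
  inequality adds the tests for \<open>x\<close> with \<parallel>x\<parallel> and for
  \<open>y\<close> with \<parallel>y\<parallel>.\<close>

lemma pos_add: assumes "pos x" "pos y" shows "pos (x + y)"
proof (rule posI)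
  show "adj (x + y) = x + y" using assms by (simp add: adj_add pos_selfadj)
  have "norm ((norm x *\<^sub>R 1 - x) + (norm y *\<^sub>R 1 - y)) \<le> norm x + norm y"
    using pos_norm_diff_le[OF assms(1) order_refl] pos_norm_diff_le[OF assms(2) order_refl]
    by (intro norm_triangle_le) linarith
  then show "norm ((norm x + norm y) *\<^sub>R 1 - (x + y)) \<le> norm x + norm y"
    by (simp add: algebra_simps)
qed

lemma pos_sum: "(\<And>i. i \<in> S \<Longrightarrow> pos (f i)) \<Longrightarrow> pos (sum f S)"
  by (induction S rule: infinite_finite_induct) (auto intro: pos_add)

text \<open>A convergent sequence is bounded, so all its members pass the norm test with one common
  \<open>t\<close>, and that inequality survives the limit.\<close>

lemma pos_limit:
  assumes "\<And>n. pos (f n)" "f \<longlonglongrightarrow> x"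
  shows "pos x"
proof -
  have "Bseq f" using assms(2) convergentI convergent_imp_Bseq by blast
  then obtain t where t: "\<And>n. norm (f n) \<le> t" unfolding Bseq_def by blast
  have "(\<lambda>n. adj (f n)) \<longlonglongrightarrow> adj x" by (rule tendsto_adj[OF assms(2)])
  then have "f \<longlonglongrightarrow> adj x" by (simp add: pos_selfadj[OF assms(1)])
  then have "adj x = x" by (rule LIMSEQ_unique[OF _ assms(2)])
  moreover have "(\<lambda>n. norm (t *\<^sub>R 1 - f n)) \<longlonglongrightarrow> norm (t *\<^sub>R 1 - x)"
    by (intro tendsto_intros assms)
  then have "norm (t *\<^sub>R 1 - x) \<le> t"
    by (rule LIMSEQ_le_const2) (use pos_norm_diff_le[OF assms(1) t] in blast)
  ultimately show ?thesis by (rule posI)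
qed

lemma pos_norm_diff: "adj x = x \<Longrightarrow> norm x \<le> s \<Longrightarrow> pos (s *\<^sub>R 1 - x)"
  by (rule posI[where t = s]) (auto simp: adj_diff adj_scaleR)

text \<open>The roots of \<open>a / s\<close> and of \<open>1 - a / s\<close> commute and their
  squares add up to 1, which is the situation of \<open>norm_le_1_of_squares\<close>.\<close>

lemma norm_le_of_pos_diff_1:
  fixes a :: "'a::cstar_alg_1"
  assumes "pos a" "pos (s *\<^sub>R 1 - a)" "s > 0"
  shows "norm a \<le> s"
proof -
  have 1: "pos ((1/s) *\<^sub>R a)" and 2: "pos ((1/s) *\<^sub>R (s *\<^sub>R 1 - a))"
    using assms pos_scaleR[of _ "1/s"] by simp_all
  obtain k where k: "pos k" "k * k = (1/s) *\<^sub>R a"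
    "\<And>w. w * ((1/s) *\<^sub>R a) = ((1/s) *\<^sub>R a) * w \<Longrightarrow> w * k = k * w" using pos_sqrt[OF 1] by metis
  obtain l where l: "pos l" "l * l = (1/s) *\<^sub>R (s *\<^sub>R 1 - a)"
    "\<And>w. w * ((1/s) *\<^sub>R (s *\<^sub>R 1 - a)) = ((1/s) *\<^sub>R (s *\<^sub>R 1 - a)) * w \<Longrightarrow> w * l = l * w" using pos_sqrt[OF 2] by metis
  have "a * k = k * a" using k(3)[of a] by simp
  then have "k * l = l * k" by (intro l(3)) (simp add: algebra_simps)
  moreover have "k * k + l * l = 1" using k(2) l(2) assms by (simp add: algebra_simps)
  ultimately have "norm k \<le> 1" using norm_le_1_of_squares k(1) l(1) pos_selfadj by metis
  then have "norm (k * k) \<le> 1" using norm_self_mult[OF pos_selfadj[OF k(1)]] by (simp add: power_le_one)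
  then show ?thesis using k(2) assms by simp
qed

text \<open>From \<open>b\<close> \<le> \<parallel>b\<parallel> 1 one gets \<open>a\<close> \<le>
  \<parallel>b\<parallel> 1 and hence the bound on the norm. The extra \<open>e\<close> keeps the
  scalar positive when \<open>b\<close> is zero.\<close>

lemma norm_mono:
  fixes a :: "'a::cstar_alg_1"
  assumes "pos a" "pos (b - a)"
  shows "norm a \<le> norm b"
proof -
  have b: "pos b" using pos_add[OF assms] by simp
  have "norm a \<le> norm b + e" if "e > 0" for e
  proof (rule norm_le_of_pos_diff_1[OF assms(1)])
    have "pos ((norm b + e) *\<^sub>R 1 - b)" using b that by (intro pos_norm_diff pos_selfadj) auto
    from pos_add[OF this assms(2)] show "pos ((norm b + e) *\<^sub>R 1 - a)" by simp
    show "norm b + e > 0" using that norm_ge_zero[of b] by linarith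
  qed
  then show ?thesis using field_le_epsilon by blast
qed

lemma pos_antisym: "pos x \<Longrightarrow> pos (- x) \<Longrightarrow> x = 0"
  using norm_mono[of x 0] by simp

text \<open>Each root commutes with everything that commutes with its square. Applied twice, this
  makes the roots \<open>k\<close> and \<open>l\<close> commute with each other, so that
  \<open>x * y\<close> is the square of the self-adjoint \<open>k * l\<close>.\<close>

lemma pos_mult_commute:
  assumes "pos x" "pos y" "x * y = y * x"
  shows "pos (x * y)"
proof -
  obtain k where k: "pos k" "k * k = x" "\<And>w. w * x = x * w \<Longrightarrow> w * k = k * w" using pos_sqrt[OF assms(1)] by metis
  obtain l where l: "pos l" "l * l = y" "\<And>w. w * y = y * w \<Longrightarrow> w * l = l * w" using pos_sqrt[OF assms(2)] by metis
  have "y * k = k * y" using k(3)[of y] assms(3) by simp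
  then have com: "k * l = l * k" using l(3)[of k] by simp
  then have "x * y = (k * l) * (k * l)" unfolding k(2)[symmetric] l(2)[symmetric] by (metis mult.assoc)
  moreover have "adj (k * l) = k * l" using com by (simp add: adj_mult pos_selfadj k l)
  ultimately show ?thesis by (metis pos_square)
qed

lemma pos_power: "pos r \<Longrightarrow> pos (r ^ n)"
  by (induction n) (auto intro: pos_mult_commute simp: power_commutes)

text \<open>Up to a scalar, \<open>h + e\<close> has the form \<open>1 - r\<close> with \<open>r\<close> positive and \<open>\<parallel>r\<parallel> < 1\<close>, so \<open>x\<close> is the limit of the
  partial Neumann sums \<open>\<Sum> x (1 - r) r\<^sup>i\<close>, which are positive.\<close>

lemma pos_divide:
  fixes x h :: "'a::cstar_alg_1"
  assumes h: "pos h" and e: "e > 0" and com: "x * h = h * x" and p: "pos (x * (h + e *\<^sub>R 1))"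
  shows "pos x"
proof -
  define t where "t = norm h + e"
  have t: "t > 0" using e norm_ge_zero[of h] by (simp add: t_def add_nonneg_pos)
  define g where "g = (1/t) *\<^sub>R (h + e *\<^sub>R 1)"
  define r where "r = 1 - g"
  have r_eq: "r = (1/t) *\<^sub>R (norm h *\<^sub>R 1 - h)"
  proof -
    have "(1/t) *\<^sub>R (norm h *\<^sub>R 1 - h) = (1/t) *\<^sub>R (t *\<^sub>R 1 - (h + e *\<^sub>R 1))"
      by (simp add: t_def scaleR_left_distrib)
    then show ?thesis using t by (simp add: r_def g_def scaleR_diff_right)
  qed
  have "pos r" unfolding r_eq using t by (intro pos_scaleR pos_norm_diff pos_selfadj h) auto
  have "norm r \<le> norm h / t"
    unfolding r_eq using pos_norm_diff_le[OF h order_refl] t by (simp add: divide_right_mono)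
  also have "\<dots> < 1" using t e by (simp add: t_def)
  finally have "norm r < 1" .
  define p where "p = x * g"
  have pp: "pos p" using assms(4) t pos_scaleR[of "x * (h + e *\<^sub>R 1)" "1/t"] by (simp add: p_def g_def)
  have "x * g = g * x" by (simp add: g_def algebra_simps com)
  then have pr: "p * r = r * p" by (simp add: p_def r_def algebra_simps)
  then have prn: "p * r ^ n = r ^ n * p" for n
    by (simp add: power_commuting_commutes)
  have gr: "g * r = r * g" by (simp add: r_def algebra_simps)
  then have grn: "g * r ^ n = r ^ n * g" for n
    by (simp add: power_commuting_commutes)
  have "pos (x * (1 - r ^ n))" for n
  proof (induction n)
    case (Suc n)
    have "x * (1 - r ^ Suc n) = x * (1 - r ^ n) + p * r ^ n"
    proof -
      have "r ^ Suc n = r ^ n - g * r ^ n" by (simp add: r_def algebra_simps)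
      then have "1 - r ^ Suc n = 1 - r ^ n + g * r ^ n" by (metis add_diff_eq diff_diff_eq2 diff_add_eq)
      then have "x * (1 - r ^ Suc n) = x * (1 - r ^ n + g * r ^ n)" by (rule arg_cong)
      then show ?thesis by (simp add: p_def distrib_left mult.assoc)
    qed
    moreover have "pos (p * r ^ n)" using pp \<open>pos r\<close> prn by (intro pos_mult_commute pos_power)
    ultimately show ?case using Suc pos_add by simp
  qed simp
  moreover have "(\<lambda>n. x * (1 - r ^ n)) \<longlonglongrightarrow> x * (1 - 0)"
    by (intro tendsto_intros LIMSEQ_power_zero \<open>norm r < 1\<close>)
  ultimately show ?thesis using pos_limit[of "\<lambda>n. x * (1 - r ^ n)"] by simp
qed

lemma pos_of_add_eps:
  assumes "\<And>d. d > 0 \<Longrightarrow> pos (x + d *\<^sub>R 1)"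
  shows "pos x"
proof (rule pos_limit)
  show "pos (x + inverse (real (Suc n)) *\<^sub>R 1)" for n by (rule assms) simp
  have "(\<lambda>n. x + inverse (real (Suc n)) *\<^sub>R 1) \<longlonglongrightarrow> x + 0 *\<^sub>R 1"
    by (intro tendsto_intros LIMSEQ_inverse_real_of_nat)
  then show "(\<lambda>n. x + inverse (real (Suc n)) *\<^sub>R 1) \<longlonglongrightarrow> x" by simp
qed

text \<open>Here \<open>q\<close> plays the role of the absolute value of \<open>c\<close>. The
  difference \<open>w = q - c\<close> satisfies \<open>w * w = 2 *\<^sub>R (q * w)\<close>, so
  completing the square turns \<open>(w + d) (2 q + d)\<close> into
  \<open>(w + d/2)^2 + 2 d q + 3/4 d^2\<close>, a positive element. Dividing by
  \<open>2 q + d\<close> and letting \<open>d\<close> tend to 0 gives the claim.\<close>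

lemma pos_abs_diff:
  fixes q c :: "'a::cstar_alg_1"
  assumes q: "pos q" and c: "adj c = c" and com: "q * c = c * q" and sq: "q * q = c * c"
  shows "pos (q - c)"
proof (rule pos_of_add_eps)
  fix d :: real assume d: "d > 0"
  define w where "w = q - c"
  have ww: "w * w = 2 *\<^sub>R (q * w)"
    by (simp add: w_def algebra_simps com sq scaleR_2)
  have aw: "adj w = w" by (simp add: w_def adj_diff c pos_selfadj[OF q])
  have "(w + d *\<^sub>R 1) * (2 *\<^sub>R q + d *\<^sub>R 1)
      = 2 *\<^sub>R (q * w) + d *\<^sub>R w + (2 * d) *\<^sub>R q + (d * d) *\<^sub>R 1"
    by (simp add: w_def algebra_simps com)
  also have "\<dots> = (w + (d/2) *\<^sub>R 1) * (w + (d/2) *\<^sub>R 1) + (2 * d) *\<^sub>R q + (3 * d * d / 4) *\<^sub>R 1"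
    unfolding ww[symmetric]
    by (simp add: algebra_simps scaleR_add_left[symmetric] del: scaleR_add_left)
  finally have eq: "(w + d *\<^sub>R 1) * (2 *\<^sub>R q + d *\<^sub>R 1) = \<dots>" .
  show "pos (q - c + d *\<^sub>R 1)"
    unfolding w_def[symmetric]
  proof (rule pos_divide[OF _ d])
    show "pos (2 *\<^sub>R q)" using q by (simp add: pos_scaleR)
    show "(w + d *\<^sub>R 1) * 2 *\<^sub>R q = 2 *\<^sub>R q * (w + d *\<^sub>R 1)"
      by (simp add: w_def algebra_simps com)
    show "pos ((w + d *\<^sub>R 1) * (2 *\<^sub>R q + d *\<^sub>R 1))"
      unfolding eq using d q aw by (intro pos_add pos_square pos_scaleR) (auto simp: adj_add adj_scaleR)
  qed
qed

text \<open>In the Cartesian decomposition \<open>y = h + \<i> *\<^sub>C k\<close> with self-adjoint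
  parts, the mixed terms cancel and the sum is \<open>2 *\<^sub>R (h * h + k * k)\<close>.\<close>

lemma pos_adj_mult_add: "pos (adj y * y + y * adj y)"
proof -
  define h where "h = (1/2) *\<^sub>R (y + adj y)"
  define k where "k = (- \<i> / 2) *\<^sub>C (y - adj y)"
  have h: "adj h = h" by (simp add: h_def adj_scaleR adj_add add.commute)
  have "adj k = (\<i> / 2) *\<^sub>C (adj y - y)" by (simp add: k_def adj_scaleC adj_diff)
  also have "\<dots> = k" by (simp add: k_def scaleC_diff_right scaleC_minus_left)
  finally have k: "adj k = k" .
  have kk: "k * k = (- 1/4) *\<^sub>R ((y - adj y) * (y - adj y))"
    by (simp add: k_def scaleR_scaleC)
  have hh: "h * h = (1/4) *\<^sub>R ((y + adj y) * (y + adj y))"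
    by (simp add: h_def)
  have "h * h + k * k = (1/4) *\<^sub>R ((y + adj y) * (y + adj y) - (y - adj y) * (y - adj y))"
    unfolding hh kk by (simp add: scaleR_diff_right)
  also have "(y + adj y) * (y + adj y) - (y - adj y) * (y - adj y) = 2 *\<^sub>R (adj y * y + y * adj y)"
    by (simp add: algebra_simps scaleR_2)
  finally have "adj y * y + y * adj y = 2 *\<^sub>R (h * h + k * k)" by simp
  then show ?thesis by (simp only:) (intro pos_scaleR pos_add pos_square h k, simp)
qed

lemma selfadj_square_eq_0: "adj k = k \<Longrightarrow> k * k = 0 \<Longrightarrow> k = (0::'a::cstar_alg)"
  using norm_self_mult[of k] by simp

text \<open>The usual argument compares the spectra of \<open>adj y * y\<close> and
  \<open>y * adj y\<close>; here \<open>pos_adj_mult_add\<close> does that work. It first makes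
  \<open>y * adj y\<close> a square \<open>m * m\<close>. Then \<open>w = y * k\<close> has both
  \<open>adj w * w = - k^4\<close> and \<open>w * adj w = - m^4\<close>, while their sum is
  positive. Hence \<open>k^4\<close> is positive and negative at once, so \<open>k\<close> and with
  it \<open>y\<close> vanish.\<close>

lemma neg_adj_mult_eq_0:
  assumes "pos (- (adj y * y))"
  shows "y = 0"
proof -
  have "pos (y * adj y)" using pos_add[OF assms pos_adj_mult_add[of y]] by simp
  then obtain m where m: "adj m = m" "y * adj y = m * m" by (auto simp: pos_def)
  obtain k where k: "adj k = k" "- (adj y * y) = k * k" using assms by (auto simp: pos_def)
  define w where "w = y * k"
  have "adj w * w = k * (adj y * y) * k" by (simp add: w_def adj_mult k mult.assoc)
  also have "adj y * y = - (k * k)" using k(2) by (metis minus_minus)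
  finally have 1: "adj w * w = - ((k * k) * (k * k))" by (simp add: mult.assoc)
  have "w * adj w = y * (k * k) * adj y" by (simp add: w_def adj_mult k mult.assoc)
  also have "\<dots> = - ((y * adj y) * (y * adj y))" unfolding k(2)[symmetric] by (simp add: mult.assoc)
  finally have 2: "w * adj w = - ((m * m) * (m * m))" by (simp only: m)
  have p: "pos ((k * k) * (k * k))" "pos ((m * m) * (m * m))"
    by (intro pos_square; simp add: adj_mult k(1) m(1))+
  have "adj w * w + w * adj w = - ((k * k) * (k * k) + (m * m) * (m * m))" unfolding 1 2 by simp
  then have "pos (- ((k * k) * (k * k) + (m * m) * (m * m)))" using pos_adj_mult_add[of w] by metis
  from pos_add[OF this p(2)] have "pos (- ((k * k) * (k * k)))" by simp
  then have "(k * k) * (k * k) = 0" by (rule pos_antisym[OF p(1)])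
  then have "k * k = 0" by (rule selfadj_square_eq_0[rotated]) (simp_all add: adj_mult k(1))
  then show ?thesis using k(2) by simp
qed

text \<open>Split \<open>x\<^sup>* x\<close> into its positive part \<open>p\<close> and negative part \<open>n\<close>; then \<open>y = x n\<close> has
  \<open>y\<^sup>* y = - n\<^sup>3\<close>, which forces \<open>y = 0\<close> and hence \<open>n = 0\<close>.\<close>

theorem pos_adj_mult: "pos (adj x * x)"
proof -
  define c where "c = adj x * x"
  have c: "adj c = c" by (simp add: c_def adj_mult)
  \<comment> \<open>\<open>q\<close> is the absolute value of \<open>c\<close>; half of
    \<open>q + c\<close> and half of \<open>q - c\<close> are the two parts, and their product
    vanishes because \<open>q\<close> and \<open>c\<close> commute and have equal squares.\<close>
  obtain q where q: "pos q" "q * q = c * c" "\<And>w. w * (c * c) = (c * c) * w \<Longrightarrow> w * q = q * w"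
    using pos_sqrt[OF pos_square[OF c]] by metis
  have com: "q * c = c * q" using q(3)[of c] by (simp add: mult.assoc)
  define n where "n = (1/2) *\<^sub>R (q - c)"
  define p where "p = (1/2) *\<^sub>R (q + c)"
  have n: "pos n" unfolding n_def using pos_abs_diff[OF q(1) c com q(2)] by (intro pos_scaleR) auto
  have p: "pos p"
    unfolding p_def using pos_abs_diff[OF q(1), of "- c"] c com q(2) by (intro pos_scaleR) (auto simp: adj_minus)
  have np: "n * p = 0" by (simp add: n_def p_def algebra_simps com q(2))
  have "p - n = (1/2) *\<^sub>R ((q + c) - (q - c))" by (simp only: n_def p_def scaleR_diff_right)
  also have "(q + c) - (q - c) = c + c" by simp
  finally have cpn: "c = p - n" by simp
  have an: "adj n = n" using n by (rule pos_selfadj)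
  define y where "y = x * n"
  have "adj y * y = n * c * n" by (simp add: y_def c_def adj_mult an mult.assoc)
  also have "\<dots> = - (n * n * n)" by (simp add: cpn right_diff_distrib left_diff_distrib np)
  finally have yy: "adj y * y = - (n * n * n)" .
  have "pos (n * n * n)" using n an by (intro pos_mult_commute pos_square) (auto simp: mult.assoc)
  then have "y = 0" using neg_adj_mult_eq_0[of y] yy by simp
  then have "n * n * n = 0" using yy by simp
  then have "(n * n) * (n * n) = 0" by (simp add: mult.assoc[symmetric])
  then have "n * n = 0" by (rule selfadj_square_eq_0[rotated]) (simp_all add: adj_mult an)
  then have "n = 0" using an selfadj_square_eq_0 by blast
  then show ?thesis using cpn p by (simp add: c_def)
qed

lemma pos_mult_adj: "pos (x * adj x)"
  using pos_adj_mult[of "adj x"] by simp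

lemma pos_conj: assumes "pos c" shows "pos (adj a * c * a)"
proof -
  obtain k where "adj k = k" "c = k * k" using assms by (auto simp: pos_def)
  then have "adj a * c * a = adj (k * a) * (k * a)" by (simp add: adj_mult mult.assoc)
  then show ?thesis using pos_adj_mult by metis
qed

lemma pos_conj_diff: "pos (b - c) \<Longrightarrow> pos (adj a * b * a - adj a * c * a)"
  using pos_conj[of "b - c" a] by (simp add: algebra_simps)

lemma pos_conj_le:
  assumes "adj c = c" "norm c \<le> s"
  shows "pos (s *\<^sub>R (adj a * a) - adj a * c * a)"
  using pos_conj_diff[OF pos_norm_diff[OF assms], of a] by simp

text \<open>Cauchy-Schwarz for a positive 2 by 2 form with entries \<open>a\<close>,
  \<open>b\<close>, \<open>adj b\<close>, \<open>c\<close>. Inserting \<open>v = - b\<close> and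
  \<open>w = t *\<^sub>R 1\<close> with \<open>t\<close> \<ge> \<parallel>a\<parallel> gives
  \<open>2 t b^* b \<le> b^* a b + t^2 c\<close>, hence \<parallel>b\<parallel>^2 \<le> t
  \<parallel>c\<parallel>. Since \<open>t\<close> must be positive, \<parallel>a\<parallel> is
  reached only as a limit.\<close>

lemma quad_form_bound:
  fixes a b c :: "'a::cstar_alg_1"
  assumes *: "\<And>v w. pos (adj v * a * v + adj v * b * w + adj w * adj b * v + adj w * c * w)"
  shows "(norm b)\<^sup>2 \<le> norm a * norm c"
proof -
  have "(norm b)\<^sup>2 \<le> t * norm c" if t: "t \<ge> norm a" "t > 0" for t
  proof -
    have two: "(2 * t) *\<^sub>R x = t *\<^sub>R x + t *\<^sub>R x" for x :: 'a
      by (simp add: scaleR_add_left[symmetric])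
    have "pos (adj (-b) * a * (-b) + adj (-b) * b * (t *\<^sub>R 1) + adj (t *\<^sub>R 1) * adj b * (-b) + adj (t *\<^sub>R 1) * c * (t *\<^sub>R 1))"
      by (rule *)
    also have "adj (-b) * a * (-b) + adj (-b) * b * (t *\<^sub>R 1) + adj (t *\<^sub>R 1) * adj b * (-b) + adj (t *\<^sub>R 1) * c * (t *\<^sub>R 1)
      = (adj b * a * b + (t * t) *\<^sub>R c) - (2 * t) *\<^sub>R (adj b * b)"
      by (simp add: adj_minus adj_scaleR two mult.assoc)
    finally have P: "pos ((adj b * a * b + (t * t) *\<^sub>R c) - (2 * t) *\<^sub>R (adj b * b))" .
    then have "norm ((2 * t) *\<^sub>R (adj b * b)) \<le> norm (adj b * a * b + (t * t) *\<^sub>R c)"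
      using t by (intro norm_mono[OF _ P] pos_scaleR pos_adj_mult) simp
    also have "\<dots> \<le> norm (adj b * a) * norm b + (t * t) * norm c"
      by (intro norm_triangle_le add_mono norm_mult_ineq) simp
    also have "norm (adj b * a) * norm b \<le> (norm b * norm a) * norm b"
      using norm_mult_ineq[of "adj b" a] by (intro mult_right_mono) simp_all
    also have "\<dots> \<le> (norm b * t) * norm b" using t by (intro mult_right_mono mult_left_mono) auto
    finally have "t * (norm b)\<^sup>2 \<le> t * (t * norm c)"
      using t by (simp add: norm_adj_mult power2_eq_square algebra_simps)
    then show ?thesis using t by simp
  qed
  then have "(norm b)\<^sup>2 \<le> (norm a + inverse (real (Suc n))) * norm c" for n
    by (meson add_nonneg_pos inverse_positive_iff_positive less_add_same_cancel1 less_imp_le norm_ge_zero of_nat_0_less_iff zero_less_Suc)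
  moreover have "(\<lambda>n. (norm a + inverse (real (Suc n))) * norm c) \<longlonglongrightarrow> (norm a + 0) * norm c"
    by (intro tendsto_intros LIMSEQ_inverse_real_of_nat)
  ultimately have "(norm b)\<^sup>2 \<le> (norm a + 0) * norm c"
    by (intro LIMSEQ_le_const) auto
  then show ?thesis by simp
qed

section \<open>Columns over the algebra as a Hilbert module\<close>

definition ip :: "nat \<Rightarrow> (nat \<Rightarrow> 'a::cstar_alg_1) \<Rightarrow> (nat \<Rightarrow> 'a) \<Rightarrow> 'a" where
  "ip n u v = (\<Sum>i<n. adj (u i) * v i)"

definition cn :: "nat \<Rightarrow> (nat \<Rightarrow> 'a::cstar_alg_1) \<Rightarrow> real" where
  "cn n v = sqrt (norm (ip n v v))"

lemma ip_cong: "(\<And>i. i < n \<Longrightarrow> u i = u' i) \<Longrightarrow> (\<And>i. i < n \<Longrightarrow> v i = v' i) \<Longrightarrow> ip n u v = ip n u' v'"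
  by (simp add: ip_def)

lemma cn_cong: "(\<And>i. i < n \<Longrightarrow> u i = u' i) \<Longrightarrow> cn n u = cn n u'"
  unfolding cn_def using ip_cong[of n u u' u u'] by simp

lemma ip_add_right: "ip n u (\<lambda>i. v i + w i) = ip n u v + ip n u w"
  by (simp add: ip_def distrib_left sum.distrib)

lemma ip_add_left: "ip n (\<lambda>i. v i + w i) u = ip n v u + ip n w u"
  by (simp add: ip_def distrib_right sum.distrib adj_add)

lemma ip_mult_right: "ip n u (\<lambda>i. v i * a) = ip n u v * a"
  by (simp add: ip_def sum_distrib_right mult.assoc)

lemma ip_mult_left: "ip n (\<lambda>i. v i * a) u = adj a * ip n v u"
  by (simp add: ip_def sum_distrib_left mult.assoc adj_mult)

lemma adj_ip: "adj (ip n u v) = ip n v u"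
  by (simp add: ip_def adj_sum adj_mult)

lemma pos_ip: "pos (ip n v v)"
  unfolding ip_def by (intro pos_sum pos_adj_mult)

lemma cn_nonneg [simp]: "0 \<le> cn n v"
  by (simp add: cn_def)

lemma cn_power2: "(cn n v)\<^sup>2 = norm (ip n v v)"
  by (simp add: cn_def)

text \<open>The 2 by 2 form built from the three inner products, evaluated at \<open>x\<close> and
  \<open>y\<close>, is the inner product of the column \<open>u x + v y\<close> with itself.\<close>

lemma norm_ip_le: "norm (ip n u v) \<le> cn n u * cn n v"
proof -
  have "(norm (ip n u v))\<^sup>2 \<le> norm (ip n u u) * norm (ip n v v)"
  proof (rule quad_form_bound)
    fix x y
    have eq: "adj x * ip n u u * x + adj x * ip n u v * y + adj y * adj (ip n u v) * x + adj y * ip n v v * y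
       = ip n (\<lambda>i. u i * x + v i * y) (\<lambda>i. u i * x + v i * y)"
      by (simp add: ip_add_left ip_add_right ip_mult_left ip_mult_right adj_ip algebra_simps)
    show "pos (adj x * ip n u u * x + adj x * ip n u v * y + adj y * adj (ip n u v) * x + adj y * ip n v v * y)"
      unfolding eq by (rule pos_ip)
  qed
  then have "norm (ip n u v) \<le> sqrt (norm (ip n u u) * norm (ip n v v))" by (rule real_le_rsqrt)
  then show ?thesis by (simp add: cn_def real_sqrt_mult)
qed

lemma cn_triangle: "cn n (\<lambda>i. u i + v i) \<le> cn n u + cn n v"
proof (rule power2_le_imp_le)
  have "(cn n (\<lambda>i. u i + v i))\<^sup>2 = norm (ip n u u + ip n u v + (ip n v u + ip n v v))"
    by (simp add: cn_power2 ip_add_left ip_add_right algebra_simps)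
  also have "\<dots> \<le> (norm (ip n u u) + norm (ip n u v)) + (norm (ip n v u) + norm (ip n v v))"
    by (intro norm_triangle_le add_mono norm_triangle_ineq)
  also have "\<dots> \<le> (cn n u + cn n v)\<^sup>2"
    using norm_ip_le[of n u v] norm_ip_le[of n v u] by (simp add: power2_sum cn_power2[symmetric] algebra_simps)
  finally show "(cn n (\<lambda>i. u i + v i))\<^sup>2 \<le> (cn n u + cn n v)\<^sup>2" .
qed simp

lemma norm_le_cn: "i < n \<Longrightarrow> norm (v i) \<le> cn n v"
proof (rule power2_le_imp_le)
  assume "i < n"
  then have "ip n v v - adj (v i) * v i = (\<Sum>j\<in>{..<n} - {i}. adj (v j) * v j)"
    by (simp add: ip_def sum_diff1)
  then have "norm (adj (v i) * v i) \<le> norm (ip n v v)"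
    by (intro norm_mono pos_adj_mult) (simp add: pos_sum pos_adj_mult)
  then show "(norm (v i))\<^sup>2 \<le> (cn n v)\<^sup>2" by (simp add: norm_adj_mult cn_power2)
qed simp

lemma cn_le_sum: "cn n v \<le> (\<Sum>i<n. norm (v i))"
proof (induction n)
  case (Suc n)
  have "norm (ip (Suc n) v v) \<le> norm (ip n v v) + norm (adj (v n) * v n)"
    by (simp add: ip_def norm_triangle_ineq)
  then have "(cn (Suc n) v)\<^sup>2 \<le> (cn n v)\<^sup>2 + (norm (v n))\<^sup>2" by (simp add: cn_power2 norm_adj_mult)
  also have "\<dots> \<le> (cn n v + norm (v n))\<^sup>2" by (simp add: power2_sum)
  finally have "cn (Suc n) v \<le> cn n v + norm (v n)" by (rule power2_le_imp_le) simp
  then show ?case using Suc by simp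
qed (simp add: cn_def ip_def)

text \<open>The algebra counterpart of the bound \<open>1 / (N + 1)\<close> for
  \<open>s (1 - s)^N\<close> on the unit interval. The elements \<open>s r^i\<close> with
  \<open>r = 1 - s\<close> decrease in \<open>i\<close>, and those with \<open>i\<close> \<le>
  \<open>N\<close> telescope to \<open>1 - r^(N+1)\<close>, which is at most 1; so
  \<open>N + 1\<close> copies of the last one lie below 1.\<close>

lemma mult_power_bound:
  fixes s :: "'a::cstar_alg_1"
  assumes s: "pos s" and r: "pos (1 - s)"
  shows "real (Suc N) * norm (s * (1 - s) ^ N) \<le> 1"
proof -
  define r where "r = 1 - s"
  have sr: "s * r ^ n = r ^ n * s" for n
    by (intro power_commuting_commutes[symmetric]) (simp add: r_def algebra_simps)
  have r: "pos r" using assms by (simp add: r_def)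
  have pn: "pos (s * r ^ n)" for n using s r sr by (intro pos_mult_commute pos_power)
  have dec: "pos (s * r ^ n - s * r ^ Suc n)" for n
  proof -
    have "s * r ^ n - s * r ^ Suc n = s * (s * r ^ n)" by (simp add: r_def algebra_simps)
    moreover have "s * (s * r ^ n) = (s * r ^ n) * s" by (metis mult.assoc sr)
    ultimately show ?thesis using pos_mult_commute[OF s pn] by metis
  qed
  have dec: "pos (s * r ^ n - s * r ^ (n + d))" for n d
  proof (induction d)
    case (Suc d)
    from pos_add[OF this dec[of "n + d"]] show ?case by simp
  qed simp
  have tel: "(\<Sum>i<n. s * r ^ i) = 1 - r ^ n" for n
    by (induction n) (auto simp: r_def algebra_simps)
  have "pos ((\<Sum>i<Suc N. s * r ^ i) - real (Suc N) *\<^sub>R (s * r ^ N))"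
  proof -
    have "(\<Sum>i<Suc N. s * r ^ i) - real (Suc N) *\<^sub>R (s * r ^ N) = (\<Sum>i<Suc N. s * r ^ i - s * r ^ N)"
      by (simp only: sum_subtractf sum_constant_scaleR card_lessThan)
    also have "pos \<dots>" using dec[of _ "N - _"] by (intro pos_sum) (metis le_add_diff_inverse less_Suc_eq_le lessThan_iff)
    finally show ?thesis .
  qed
  then have "pos (1 - r ^ Suc N - real (Suc N) *\<^sub>R (s * r ^ N))" unfolding tel .
  from pos_add[OF this pos_power[OF r, of "Suc N"]]
  have "pos (1 - real (Suc N) *\<^sub>R (s * r ^ N))" by (simp add: algebra_simps)
  then have "norm (real (Suc N) *\<^sub>R (s * r ^ N)) \<le> norm (1::'a)"
    by (intro norm_mono pos_scaleR pn) auto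
  then show ?thesis by (simp add: r_def)
qed

text \<open>With \<open>s = t S\<close> and \<open>r = 1 - s\<close>, the error is
  \<open>z i - e * z i = r^N * z i\<close>. Multiplying it by its adjoint and using that
  \<open>z i * adj (z i)\<close> is at most \<open>S\<close> bounds its square by
  \<open>s r^(2N) / t\<close>, which \<open>mult_power_bound\<close> makes small. The conclusion
  exhibits \<open>e\<close> as a polynomial in the sum without constant term, so that it can be
  pulled back into an algebra without unit.\<close>

lemma approx_unit_exists:
  fixes z :: "'i \<Rightarrow> 'a::cstar_alg_1"
  assumes "finite I" "\<epsilon> > 0"
  obtains t N e where "e = 1 - (1 - t *\<^sub>R (\<Sum>i\<in>I. z i * adj (z i))) ^ N" "adj e = e" "norm e \<le> 1"
    "\<And>i. i \<in> I \<Longrightarrow> norm (z i - e * z i) < \<epsilon>"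
proof -
  define S where "S = (\<Sum>i\<in>I. z i * adj (z i))"
  \<comment> \<open>The summand 1 keeps \<open>t\<close> defined and positive for
    \<open>S = 0\<close>; the factor brings \<open>s\<close> below norm 1.\<close>
  define t where "t = 1 / (norm S + 1)"
  have t: "t > 0" by (simp add: t_def add_nonneg_pos)
  define s where "s = t *\<^sub>R S"
  have S: "pos S" unfolding S_def by (intro pos_sum pos_mult_adj)
  then have s: "pos s" using t by (simp add: s_def pos_scaleR)
  have "norm s \<le> 1" using t by (simp add: s_def t_def divide_le_eq add_nonneg_pos)
  define r where "r = 1 - s"
  have r: "pos r" using pos_norm_diff[OF pos_selfadj[OF s] \<open>norm s \<le> 1\<close>] by (simp add: r_def)
  have nr: "norm r \<le> 1" using norm_le_of_pos_diff_1[OF r, of 1] s by (simp add: r_def)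
  obtain N where N: "real N > 1 / (t * \<epsilon>\<^sup>2)" using reals_Archimedean2 by blast
  define e where "e = 1 - r ^ N"
  have rN: "pos (r ^ N)" by (rule pos_power[OF r])
  have "norm (r ^ N) \<le> 1" using norm_power_ineq[of r N] nr by (meson norm_ge_zero order_trans power_le_one)
  then have "pos e" using pos_norm_diff[OF pos_selfadj[OF rN], of 1] by (simp add: e_def)
  then have "norm e \<le> 1" using norm_le_of_pos_diff_1[of e 1] rN by (simp add: e_def)
  moreover have "norm (z i - e * z i) < \<epsilon>" if i: "i \<in> I" for i
  proof -
    have "S - z i * adj (z i) = (\<Sum>j\<in>I - {i}. z j * adj (z j))"
      using assms(1) i by (simp add: S_def sum_diff1)
    then have "pos (S - z i * adj (z i))" by (simp add: pos_sum pos_mult_adj)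
    from pos_conj_diff[OF this, of "r ^ N"]
    have "pos (r ^ N * S * r ^ N - r ^ N * (z i * adj (z i)) * r ^ N)" by (simp add: pos_selfadj[OF rN])
    moreover have "z i - e * z i = r ^ N * z i" by (simp add: e_def algebra_simps)
    then have "r ^ N * (z i * adj (z i)) * r ^ N = (z i - e * z i) * adj (z i - e * z i)"
      by (simp add: adj_mult pos_selfadj[OF rN] mult.assoc)
    ultimately have "norm ((z i - e * z i) * adj (z i - e * z i)) \<le> norm (r ^ N * S * r ^ N)"
      by (intro norm_mono pos_mult_adj) simp
    then have 1: "t * (norm (z i - e * z i))\<^sup>2 \<le> norm (r ^ N * s * r ^ N)"
      using t by (simp add: norm_mult_adj s_def)
    have "s * r ^ N = r ^ N * s"
      by (intro power_commuting_commutes[symmetric]) (simp add: r_def algebra_simps)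
    then have "r ^ N * s * r ^ N = s * r ^ (N + N)" by (simp add: power_add mult.assoc[symmetric])
    then have "real (Suc (N + N)) * norm (r ^ N * s * r ^ N) \<le> 1"
      using mult_power_bound[OF s, of "N + N"] r by (simp add: r_def)
    moreover have "real N * norm (r ^ N * s * r ^ N) \<le> real (Suc (N + N)) * norm (r ^ N * s * r ^ N)"
      by (intro mult_right_mono) auto
    ultimately have 2: "real N * norm (r ^ N * s * r ^ N) \<le> 1" by linarith
    have "real N * (t * (norm (z i - e * z i))\<^sup>2) \<le> 1"
      using mult_left_mono[OF 1, of "real N"] 2 by simp
    also have "1 < real N * (t * \<epsilon>\<^sup>2)" using N t assms(2) by (simp add: divide_less_eq mult.commute mult.left_commute)
    finally have "(norm (z i - e * z i))\<^sup>2 < \<epsilon>\<^sup>2"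
      using t by (metis mult_less_cancel_left_disj of_nat_less_0_iff not_less_iff_gr_or_eq)
    then show ?thesis using assms(2) power2_less_imp_less by fastforce
  qed
  ultimately show ?thesis using that[of e t N] pos_selfadj[OF \<open>pos e\<close>] by (simp add: e_def r_def s_def S_def)
qed

section \<open>Unitization and the embedding of a C*-algebra into a type\<close>

text \<open>The norm of \<open>(a, \<lambda>)\<close> will be the maximum of \<open>|\<lambda>|\<close> and the norm of \<open>b \<mapsto> a b + \<lambda> b\<close>; the latter
  alone is only a seminorm if the algebra already has a unit.\<close>

datatype 'a unitz = Unitz (upart: 'a) (uscal: complex)

definition act :: "'a::cstar_alg unitz \<Rightarrow> 'a \<Rightarrow> 'a" where
  "act u b = upart u * b + uscal u *\<^sub>C b"

lemma unitz_eqI: "upart u = upart v \<Longrightarrow> uscal u = uscal v \<Longrightarrow> u = v"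
  by (cases u; cases v) simp

instantiation unitz :: (cstar_alg) "{real_vector, ring_1}"
begin

definition "0 = Unitz 0 0"
definition "1 = Unitz 0 1"
definition "u + v = Unitz (upart u + upart v) (uscal u + uscal v)"
definition "u - v = Unitz (upart u - upart v) (uscal u - uscal v)"
definition "- u = Unitz (- upart u) (- uscal u)"
definition "r *\<^sub>R u = Unitz (r *\<^sub>R upart u) (r *\<^sub>R uscal u)"
definition "u * v = Unitz (upart u * upart v + uscal v *\<^sub>C upart u + uscal u *\<^sub>C upart v) (uscal u * uscal v)"

lemma unitz_sel [simp]:
  "upart 0 = 0" "uscal 0 = 0" "upart 1 = 0" "uscal 1 = 1"
  "upart (u + v) = upart u + upart v" "uscal (u + v) = uscal u + uscal v"
  "upart (u - v) = upart u - upart v" "uscal (u - v) = uscal u - uscal v"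
  "upart (- u) = - upart u" "uscal (- u) = - uscal u"
  "upart (r *\<^sub>R u) = r *\<^sub>R upart u" "uscal (r *\<^sub>R u) = r *\<^sub>R uscal u"
  "upart (u * v) = upart u * upart v + uscal v *\<^sub>C upart u + uscal u *\<^sub>C upart v"
  "uscal (u * v) = uscal u * uscal v"
  by (simp_all add: zero_unitz_def one_unitz_def plus_unitz_def minus_unitz_def uminus_unitz_def
      scaleR_unitz_def times_unitz_def)

instance
proof
  show "(0 :: 'a unitz) \<noteq> 1" by (simp add: zero_unitz_def one_unitz_def)
qed (rule unitz_eqI; simp add: algebra_simps scaleC_add_left scaleC_add_right)+

end

instantiation unitz :: (cstar_alg) real_normed_algebra_1
begin

definition "norm u = max (Sup {norm (act u b) | b. norm b \<le> 1}) (cmod (uscal u))"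
definition "sgn u = inverse (norm u) *\<^sub>R (u :: 'a unitz)"
definition "dist u v = norm (u - v :: 'a unitz)"
definition [code del]: "(uniformity :: ('a unitz \<times> 'a unitz) filter) = (INF e\<in>{0 <..}. principal {(x, y). dist x y < e})"
definition [code del]: "open (U :: 'a unitz set) \<longleftrightarrow> (\<forall>x\<in>U. eventually (\<lambda>(x', y). x' = x \<longrightarrow> y \<in> U) uniformity)"

lemma norm_unitz_le_iff:
  "norm (u :: 'a unitz) \<le> c \<longleftrightarrow> cmod (uscal u) \<le> c \<and> (\<forall>b. norm (act u b) \<le> c * norm b)"
proof -
  have bdd: "bdd_above {norm (act u b) | b. norm b \<le> 1}"
  proof (rule bdd_aboveI)
    fix x assume "x \<in> {norm (act u b) | b. norm b \<le> 1}"
    then obtain b where b: "x = norm (act u b)" "norm b \<le> 1" by blast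
    have "norm (upart u * b) \<le> norm (upart u) * 1"
      using norm_mult_ineq[of "upart u" b] mult_left_mono[OF b(2), of "norm (upart u)"] by simp
    moreover have "norm (uscal u *\<^sub>C b) \<le> cmod (uscal u) * 1"
      unfolding norm_scaleC using b(2) by (intro mult_left_mono) auto
    ultimately show "x \<le> norm (upart u) + cmod (uscal u)"
      unfolding b(1) act_def by (intro norm_triangle_le) simp
  qed
  have ne: "{norm (act u b) | b. norm b \<le> 1} \<noteq> {}" by (auto intro: exI[of _ 0])
  have "Sup {norm (act u b) | b. norm b \<le> 1} \<le> c \<longleftrightarrow> (\<forall>b. norm b \<le> 1 \<longrightarrow> norm (act u b) \<le> c)"
    unfolding cSup_le_iff[OF ne bdd] by blast
  moreover have "(\<forall>b. norm b \<le> 1 \<longrightarrow> norm (act u b) \<le> c) \<longleftrightarrow> (\<forall>b. norm (act u b) \<le> c * norm b)"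
    if c: "cmod (uscal u) \<le> c"
  proof safe
    fix b assume *: "\<forall>b. norm b \<le> 1 \<longrightarrow> norm (act u b) \<le> c"
    show "norm (act u b) \<le> c * norm b"
    proof (cases "b = 0")
      case False
      have "act u ((1 / norm b) *\<^sub>R b) = (1 / norm b) *\<^sub>R act u b"
        by (simp add: act_def scaleR_scaleC scaleC_add_right mult.commute)
      moreover have "norm (act u ((1 / norm b) *\<^sub>R b)) \<le> c" using * False by simp
      ultimately show ?thesis using False by (simp add: divide_le_eq mult.commute)
    qed (simp add: act_def)
  next
    fix b :: 'a assume *: "\<forall>b. norm (act u b) \<le> c * norm b" "norm b \<le> 1"
    have "c \<ge> 0" using c norm_ge_zero order_trans by blast
    then show "norm (act u b) \<le> c" using * mult_left_mono[of "norm b" 1 c] by (auto intro: order_trans)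
  qed
  ultimately show ?thesis unfolding norm_unitz_def by auto
qed

lemma norm_uscal_le: "cmod (uscal (u :: 'a unitz)) \<le> norm u"
  and norm_act_le: "norm (act u b) \<le> norm u * norm b"
  using norm_unitz_le_iff[of u "norm u"] by auto

lemma act_simps: "act (u + v) b = act u b + act v b" "act (u - v) b = act u b - act v b"
   "act (r *\<^sub>R u) b = r *\<^sub>R act u b" "act 1 b = b" "act 0 b = 0"
  "act (u * v) b = act u (act v b)"
proof -
  show "act (u + v) b = act u b + act v b" by (simp add: act_def distrib_right scaleC_add_left)
  show "act (u - v) b = act u b - act v b" by (simp add: act_def left_diff_distrib scaleC_diff_left)
  show "act (r *\<^sub>R u) b = r *\<^sub>R act u b"
    by (simp add: act_def scaleR_scaleC scaleC_add_right scaleR_conv_of_real)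
  show "act (u * v) b = act u (act v b)"
    by (simp add: act_def distrib_right distrib_left scaleC_add_right mult.assoc mult.commute[of "uscal v"] add_ac)
qed (simp_all add: act_def)

text \<open>Apply the operator to \<open>b = adj (upart u)\<close>: the C*-identity turns
  \<open>upart u * b\<close> into the square of the norm of \<open>upart u\<close>. The bound yields
  the isometric inclusion of the algebra and the completeness of the unitization.\<close>

lemma norm_upart_le: "norm (upart u) \<le> norm (u :: 'a unitz) + cmod (uscal u)"
proof (cases "upart u = 0")
  case True then show ?thesis using norm_uscal_le[of u] norm_ge_zero[of "uscal u"] by (simp del: norm_ge_zero)
next
  case False
  define b where "b = adj (upart u)"
  have "upart u * b = act u b - uscal u *\<^sub>C b" by (simp add: act_def)
  then have "norm (upart u * b) \<le> norm (act u b) + norm (uscal u *\<^sub>C b)"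
    by (simp add: norm_triangle_ineq4)
  then have "(norm (upart u))\<^sup>2 \<le> (norm u + cmod (uscal u)) * norm (upart u)"
    using norm_act_le[of u b] norm_mult_adj[of "upart u"] by (simp add: b_def norm_scaleC algebra_simps)
  then show ?thesis using False by (simp add: power2_eq_square)
qed

instance
proof
  fix u v :: "'a unitz" and r :: real
  show "norm (u + v) \<le> norm u + norm v"
    unfolding norm_unitz_le_iff
  proof (intro conjI allI)
    show "cmod (uscal (u + v)) \<le> norm u + norm v"
      using norm_triangle_ineq[of "uscal u" "uscal v"] norm_uscal_le[of u] norm_uscal_le[of v] by simp
    fix b show "norm (act (u + v) b) \<le> (norm u + norm v) * norm b"
      unfolding act_simps distrib_right by (intro norm_triangle_le add_mono norm_act_le)
  qed
  have sc: "norm (r *\<^sub>R u) \<le> \<bar>r\<bar> * norm u" for r and u :: "'a unitz"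
    unfolding norm_unitz_le_iff
    using norm_uscal_le[of u] norm_act_le[of u]
    by (auto simp: act_simps mult_left_mono mult.assoc norm_mult scaleR_conv_of_real)
  show "norm (r *\<^sub>R u) = \<bar>r\<bar> * norm u"
  proof (cases "r = 0")
    case True
    then show ?thesis using sc[of r u] norm_uscal_le[of "r *\<^sub>R u"] by simp
  next
    case False
    then have "\<bar>r\<bar> * norm (inverse r *\<^sub>R (r *\<^sub>R u)) \<le> \<bar>r\<bar> * (\<bar>inverse r\<bar> * norm (r *\<^sub>R u))"
      by (intro mult_left_mono sc) simp
    then show ?thesis using sc[of r u] False by (simp add: mult.assoc[symmetric] abs_mult[symmetric])
  qed
  show "norm (u * v) \<le> norm u * norm v"
    unfolding norm_unitz_le_iff
  proof (intro conjI allI)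
    have "norm u \<ge> 0" using norm_uscal_le[of u] norm_ge_zero order_trans by blast
    then show "cmod (uscal (u * v)) \<le> norm u * norm v"
      using norm_uscal_le[of u] norm_uscal_le[of v] by (simp add: norm_mult mult_mono)
    fix b
    have "norm (act (u * v) b) \<le> norm u * norm (act v b)" by (simp add: act_simps norm_act_le)
    also have "\<dots> \<le> norm u * (norm v * norm b)" using \<open>norm u \<ge> 0\<close> by (intro mult_left_mono norm_act_le)
    finally show "norm (act (u * v) b) \<le> norm u * norm v * norm b" by (simp add: mult.assoc)
  qed
  show "norm u = 0 \<longleftrightarrow> u = 0"
  proof
    assume "norm u = 0"
    then show "u = 0" using norm_uscal_le[of u] norm_upart_le[of u] by (intro unitz_eqI) auto
  next
    assume "u = 0"
    then show "norm u = 0"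
      using norm_unitz_le_iff[of u 0] norm_uscal_le[of u] by (simp add: act_simps)
  qed
  show "norm (1 :: 'a unitz) = 1"
    using norm_unitz_le_iff[of 1 1] norm_uscal_le[of 1] by (simp add: act_simps)
  show "(r *\<^sub>R u) * v = r *\<^sub>R (u * v)" "u * (r *\<^sub>R v) = r *\<^sub>R (u * v)"
    by (rule unitz_eqI; simp add: scaleR_scaleC scaleR_conv_of_real scaleC_add_right mult.commute)+
qed (auto simp: dist_unitz_def sgn_unitz_def uniformity_unitz_def open_unitz_def algebra_simps intro: unitz_eqI)

end

lemma norm_unitz_le_sum: "norm u \<le> norm (upart u) + cmod (uscal u)"
  unfolding norm_unitz_le_iff
proof (intro conjI allI)
  fix b show "norm (act u b) \<le> (norm (upart u) + cmod (uscal u)) * norm b"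
    unfolding act_def distrib_right norm_scaleC[symmetric]
    by (intro norm_triangle_le add_mono norm_mult_ineq order_refl)
qed simp

lemma norm_Unitz_0 [simp]: "norm (Unitz a 0) = norm a"
  using norm_unitz_le_sum[of "Unitz a 0"] norm_upart_le[of "Unitz a 0"] by simp

instantiation unitz :: (cstar_alg) cstar_alg_1
begin

definition "adj u = Unitz (adj (upart u)) (cnj (uscal u))"
definition "c *\<^sub>C u = Unitz (c *\<^sub>C upart u) (c * uscal u)"

lemma unitz_sel_star [simp]: "upart (adj u) = adj (upart u)" "uscal (adj u) = cnj (uscal u)"
  "upart (c *\<^sub>C u) = c *\<^sub>C upart u" "uscal (c *\<^sub>C u) = c * uscal u"
  by (simp_all add: adj_unitz_def scaleC_unitz_def)

instance
proof
  fix u v :: "'a unitz" and c d :: complex and r :: real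
  show "adj (u + v) = adj u + adj v" "adj (u * v) = adj v * adj u" "adj (adj u) = u"
    "adj (c *\<^sub>C u) = cnj c *\<^sub>C adj u" "c *\<^sub>C (u + v) = c *\<^sub>C u + c *\<^sub>C v"
    "(c + d) *\<^sub>C u = c *\<^sub>C u + d *\<^sub>C u" "c *\<^sub>C (d *\<^sub>C u) = (c * d) *\<^sub>C u"
    "(c *\<^sub>C u) * v = c *\<^sub>C (u * v)"
    "u * (c *\<^sub>C v) = c *\<^sub>C (u * v)"
    by (rule unitz_eqI; simp add: adj_add adj_mult adj_scaleC scaleC_add_left scaleC_add_right
        algebra_simps)+
  show "r *\<^sub>R u = complex_of_real r *\<^sub>C u"
    by (rule unitz_eqI) (simp add: scaleR_scaleC, simp add: scaleR_conv_of_real[of r "uscal u"])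
  \<comment> \<open>The operator part rests on
    \<open>adj (act u b) * act u b = adj b * act (adj u * u) b\<close>, so an operator bound for
    \<open>adj u * u\<close> controls the square of one for \<open>u\<close>. The scalar part is the
    C*-identity of the complex numbers.\<close>
  have le: "(norm u)\<^sup>2 \<le> norm (adj u * u)" for u :: "'a unitz"
  proof -
    have "norm u \<le> sqrt (norm (adj u * u))"
      unfolding norm_unitz_le_iff[of u]
    proof (intro conjI allI)
      have "(cmod (uscal u))\<^sup>2 \<le> norm (adj u * u)"
        using norm_uscal_le[of "adj u * u"] by (simp add: norm_mult power2_eq_square)
      then show "cmod (uscal u) \<le> sqrt (norm (adj u * u))" by (rule real_le_rsqrt)
      fix b
      have "adj (act u b) * act u b = adj b * act (adj u * u) b"
        by (simp add: act_def adj_add adj_mult adj_scaleC algebra_simps scaleC_add_right)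
      then have "(norm (act u b))\<^sup>2 \<le> norm b * norm (act (adj u * u) b)"
        using norm_mult_ineq[of "adj b" "act (adj u * u) b"] norm_adj_mult[of "act u b"] by simp
      also have "\<dots> \<le> norm b * (norm (adj u * u) * norm b)"
        by (intro mult_left_mono norm_act_le) simp
      finally have "(norm (act u b))\<^sup>2 \<le> (sqrt (norm (adj u * u)) * norm b)\<^sup>2"
        by (simp add: power_mult_distrib power2_eq_square mult.commute mult.left_commute)
      then show "norm (act u b) \<le> sqrt (norm (adj u * u)) * norm b"
        by (rule power2_le_imp_le) simp
    qed
    then have "(norm u)\<^sup>2 \<le> (sqrt (norm (adj u * u)))\<^sup>2" by (intro power_mono) simp_all
    then show ?thesis by simp
  qed
  have le': "norm u \<le> norm (adj u)" for u :: "'a unitz"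
  proof (cases "u = 0")
    case False
    have "norm u * norm u \<le> norm (adj u) * norm u"
      using le[of u] norm_mult_ineq[of "adj u" u] by (simp add: power2_eq_square)
    then show ?thesis using False by simp
  qed simp
  have "adj (adj u) = u" by (rule unitz_eqI) simp_all
  then have "norm (adj u) = norm u" using le'[of u] le'[of "adj u"] by simp
  then show "norm (adj u * u) = (norm u)\<^sup>2"
    using le[of u] norm_mult_ineq[of "adj u" u] by (simp add: power2_eq_square)
  show "convergent X" if X: "Cauchy X" for X :: "nat \<Rightarrow> 'a unitz"
  proof -
    have l: "cmod (uscal (X m) - uscal (X n)) \<le> norm (X m - X n)" for m n
      using norm_uscal_le[of "X m - X n"] by simp
    have a: "norm (upart (X m) - upart (X n)) \<le> 2 * norm (X m - X n)" for m n
      using norm_upart_le[of "X m - X n"] norm_uscal_le[of "X m - X n"] by simp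
    have "Cauchy (\<lambda>n. uscal (X n))"
      using X l unfolding Cauchy_def dist_norm by (meson order_le_less_trans)
    then obtain L where L: "(\<lambda>n. uscal (X n)) \<longlonglongrightarrow> L" using Cauchy_convergent convergent_def by blast
    have "Cauchy (\<lambda>n. upart (X n))"
      unfolding Cauchy_def dist_norm
    proof (intro allI impI)
      fix e :: real assume "e > 0"
      then obtain M where "\<forall>m\<ge>M. \<forall>n\<ge>M. norm (X m - X n) < e / 2"
        using CauchyD[OF X, of "e / 2"] by auto
      then show "\<exists>M. \<forall>m\<ge>M. \<forall>n\<ge>M. norm (upart (X m) - upart (X n)) < e"
        using a by (smt (verit, best) field_sum_of_halves)
    qed
    then obtain K where K: "(\<lambda>n. upart (X n)) \<longlonglongrightarrow> K" using Cauchy_convergent convergent_def by blast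
    have "(\<lambda>n. norm (upart (X n) - K) + cmod (uscal (X n) - L)) \<longlonglongrightarrow> 0 + 0"
      using L K by (intro tendsto_add) (simp_all add: tendsto_norm_zero_iff LIM_zero_iff)
    then have "(\<lambda>n. X n - Unitz K L) \<longlonglongrightarrow> 0"
      using norm_unitz_le_sum[of "X _ - Unitz K L"]
      by (intro Lim_null_comparison[of "\<lambda>n. X n - Unitz K L"] always_eventually) auto
    then show ?thesis unfolding convergent_def using LIM_zero_iff by blast
  qed
qed

end

section \<open>Arithmetic and norm in a C*-algebra given by a record\<close>

lemma complex_ring_simps [simp]:
  "carrier complex_ring = UNIV" "\<zero>\<^bsub>complex_ring\<^esub> = 0" "\<one>\<^bsub>complex_ring\<^esub> = 1"
  "x \<oplus>\<^bsub>complex_ring\<^esub> y = x + y" "x \<otimes>\<^bsub>complex_ring\<^esub> y = x * y"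
  by (simp_all add: complex_ring_def)

context cstar_algebra
begin

lemma smult_in [simp, intro]: "x \<in> carrier A \<Longrightarrow> c \<odot> x \<in> carrier A"
  using smult_closed[of c x] by simp

lemma minus_eq_smult: "x \<in> carrier A \<Longrightarrow> \<ominus> x = (-1) \<odot> x"
  using smult_l_distr[of 1 "-1" x] M.minus_equality[of "(-1) \<odot> x" x] smult_one[of x] smult_l_null[of x]
  by (simp add: M.a_comm)

lemma cnorm_zero [simp]: "cnorm A \<zero> = 0"
  using norm_eq_0_iff[of \<zero>] by simp

lemma cnorm_minus [simp]: "x \<in> carrier A \<Longrightarrow> cnorm A (\<ominus> x) = cnorm A x"
  using norm_smult[of x "-1"] by (simp add: minus_eq_smult)

lemma star_zero [simp]: "star A \<zero> = \<zero>"
  using star_smult[of \<zero> 0] smult_l_null[of "star A \<zero>"] star_closed[of \<zero>] smult_l_null[of \<zero>] by simp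

lemma mult_zero_l [simp]: "x \<in> carrier A \<Longrightarrow> \<zero> \<otimes> x = \<zero>"
  using smult_mult_l[of \<zero> x 0] smult_l_null[of \<zero>] smult_l_null[of "\<zero> \<otimes> x"] m_closed[of \<zero> x] by simp

lemma mult_zero_r [simp]: "x \<in> carrier A \<Longrightarrow> x \<otimes> \<zero> = \<zero>"
  using smult_mult_r[of x \<zero> 0] smult_l_null[of \<zero>] smult_l_null[of "x \<otimes> \<zero>"] m_closed[of x \<zero>] by simp

lemma smult_zero_r [simp]: "c \<odot> \<zero> = \<zero>"
  using smult_r_null[of c] by simp

lemma cnorm_diff_le: "x \<in> carrier A \<Longrightarrow> y \<in> carrier A \<Longrightarrow> cnorm A (x \<ominus> y) \<le> cnorm A x + cnorm A y"
  using norm_triangle[of x "\<ominus> y"] by (simp add: a_minus_def)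

lemma cnorm_diff_triangle:
  assumes "x \<in> carrier A" "y \<in> carrier A" "z \<in> carrier A"
  shows "cnorm A (x \<ominus> z) \<le> cnorm A (x \<ominus> y) + cnorm A (y \<ominus> z)"
proof -
  have "x \<ominus> z = (x \<ominus> y) \<oplus> (y \<ominus> z)"
    using assms by (simp add: a_minus_def M.a_assoc M.a_lcomm[of y]) (simp add: M.a_assoc[symmetric] M.l_neg)
  then show ?thesis using assms norm_triangle[of "x \<ominus> y" "y \<ominus> z"] by simp
qed

lemma cnorm_diff_commute: "x \<in> carrier A \<Longrightarrow> y \<in> carrier A \<Longrightarrow> cnorm A (x \<ominus> y) = cnorm A (y \<ominus> x)"
  using cnorm_minus[of "x \<ominus> y"] by (simp add: a_minus_def M.minus_add M.a_comm)

lemma cnorm_star: "x \<in> carrier A \<Longrightarrow> cnorm A (star A x) = cnorm A x"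
proof -
  have le: "cnorm A x \<le> cnorm A (star A x)" if x: "x \<in> carrier A" for x
  proof (cases "cnorm A x = 0")
    case False
    have "cnorm A x * cnorm A x \<le> cnorm A (star A x) * cnorm A x"
      using norm_mult[OF star_closed[OF x] x] norm_star_mult[OF x] by (simp add: power2_eq_square)
    then show ?thesis using False norm_nonneg[OF x] by (simp add: mult_le_cancel_right)
  qed (use norm_nonneg star_closed that in auto)
  assume "x \<in> carrier A"
  then show ?thesis using le[of x] le[of "star A x"] star_closed[of x] star_star[of x] by simp
qed

end

text \<open>A C*-algebra given by a record cannot be made into a type of its own, since a type may not
  depend on a term.  The bounded families indexed by \<^emph>\<open>all\<close> C*-algebra structures on \<open>'a\<close>,
  however, do form a type; each C*-algebra on \<open>'a\<close> is a direct summand of it.\<close>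

typedef 'a cfam = "{s :: 'a cstar \<Rightarrow> 'a. (\<forall>A. cstar_algebra A \<longrightarrow> s A \<in> carrier A) \<and>
    (\<forall>A. \<not> cstar_algebra A \<longrightarrow> s A = undefined) \<and> (\<exists>K. \<forall>A. cstar_algebra A \<longrightarrow> cnorm A (s A) \<le> K)}"
  morphisms entry Abs_cfam
proof -
  have "cnorm A \<zero>\<^bsub>A\<^esub> = 0 \<and> \<zero>\<^bsub>A\<^esub> \<in> carrier A" if "cstar_algebra A" for A :: "'a cstar"
  proof -
    interpret cstar_algebra A by fact
    show ?thesis by simp
  qed
  then show ?thesis
    by (intro exI[of _ "\<lambda>A. if cstar_algebra A then \<zero>\<^bsub>A\<^esub> else undefined"]) (auto intro: exI[of _ 0])
qed

setup_lifting type_definition_cfam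

lemma entry_carrier: "cstar_algebra A \<Longrightarrow> entry s A \<in> carrier A"
  and entry_bounded: "\<exists>K. \<forall>A. cstar_algebra A \<longrightarrow> cnorm A (entry s A) \<le> K"
  using entry[of s] by auto

text \<open>At records that are not C*-algebras every family has the same value
  \<open>undefined\<close>, so only the other entries decide equality.\<close>

lemma cfam_eqI: "(\<And>A. cstar_algebra A \<Longrightarrow> entry s A = entry t A) \<Longrightarrow> s = t"
  using entry[of s] entry[of t] by (intro entry_inject[THEN iffD1] ext) (auto, metis)

definition cfam_of :: "('a cstar \<Rightarrow> 'a) \<Rightarrow> 'a cfam" where
  "cfam_of f = Abs_cfam (\<lambda>A. if cstar_algebra A then f A else undefined)"

lemma entry_cfam_of:
  assumes "\<And>A. cstar_algebra A \<Longrightarrow> f A \<in> carrier A" "\<And>A. cstar_algebra A \<Longrightarrow> cnorm A (f A) \<le> K"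
    and "cstar_algebra B"
  shows "entry (cfam_of f) B = f B"
  unfolding cfam_of_def using assms by (subst Abs_cfam_inverse) auto

section \<open>The C*-algebra of bounded families\<close>

instantiation cfam :: (type) real_normed_algebra
begin

definition "0 = cfam_of (\<lambda>A. \<zero>\<^bsub>A\<^esub>)"
definition "s + t = cfam_of (\<lambda>A. entry s A \<oplus>\<^bsub>A\<^esub> entry t A)"
definition "s - t = cfam_of (\<lambda>A. entry s A \<ominus>\<^bsub>A\<^esub> entry t A)"
definition "- s = cfam_of (\<lambda>A. \<ominus>\<^bsub>A\<^esub> entry s A)"
definition "s * t = cfam_of (\<lambda>A. entry s A \<otimes>\<^bsub>A\<^esub> entry t A)"
definition "r *\<^sub>R s = cfam_of (\<lambda>A. complex_of_real r \<odot>\<^bsub>A\<^esub> entry s A)"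
text \<open>The inserted \<open>0\<close> makes it immediate that the supremum is taken over a
  nonempty set and is nonnegative.\<close>

definition "norm s = Sup (insert 0 {cnorm A (entry s A) | A. cstar_algebra A})"
definition "sgn s = inverse (norm s) *\<^sub>R (s :: 'a cfam)"
definition "dist s t = norm (s - t :: 'a cfam)"
definition [code del]: "(uniformity :: ('a cfam \<times> 'a cfam) filter) = (INF e\<in>{0 <..}. principal {(x, y). dist x y < e})"
definition [code del]: "open (U :: 'a cfam set) \<longleftrightarrow> (\<forall>x\<in>U. eventually (\<lambda>(x', y). x' = x \<longrightarrow> y \<in> U) uniformity)"

lemma norm_cfam_le_iff:
  fixes s :: "'a cfam"
  shows "norm s \<le> c \<longleftrightarrow> 0 \<le> c \<and> (\<forall>A. cstar_algebra A \<longrightarrow> cnorm A (entry s A) \<le> c)"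
proof -
  obtain K where "\<forall>A. cstar_algebra A \<longrightarrow> cnorm A (entry s A) \<le> K" using entry_bounded by blast
  then have "bdd_above (insert 0 {cnorm A (entry s A) | A. cstar_algebra A})"
    by (intro bdd_aboveI[of _ "max 0 K"]) (auto simp: max.coboundedI2)
  then show ?thesis unfolding norm_cfam_def by (subst cSup_le_iff) auto
qed

lemma norm_cfam_nonneg: "0 \<le> norm (s :: 'a cfam)"
  and cnorm_entry_le: "cstar_algebra A \<Longrightarrow> cnorm A (entry s A) \<le> norm s"
  using norm_cfam_le_iff[of s "norm s"] by auto

lemma entry_ops:
  fixes s t :: "'a cfam"
  assumes "cstar_algebra B"
  shows "entry 0 B = \<zero>\<^bsub>B\<^esub>" and "entry (s + t) B = entry s B \<oplus>\<^bsub>B\<^esub> entry t B"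
    and "entry (s - t) B = entry s B \<ominus>\<^bsub>B\<^esub> entry t B" and "entry (- s) B = \<ominus>\<^bsub>B\<^esub> entry s B"
    and "entry (s * t) B = entry s B \<otimes>\<^bsub>B\<^esub> entry t B" and "entry (r *\<^sub>R s) B = complex_of_real r \<odot>\<^bsub>B\<^esub> entry s B"
proof -
  {
    fix A :: "'a cstar" assume *: "cstar_algebra A"
    then interpret cstar_algebra A .
    note [simp] = entry_carrier[OF *]
    have "\<zero>\<^bsub>A\<^esub> \<in> carrier A \<and> cnorm A \<zero>\<^bsub>A\<^esub> \<le> 0" by simp
    moreover have "entry s A \<oplus>\<^bsub>A\<^esub> entry t A \<in> carrier A \<and> cnorm A (entry s A \<oplus>\<^bsub>A\<^esub> entry t A) \<le> norm s + norm t"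
      using norm_triangle[of "entry s A" "entry t A"] cnorm_entry_le[OF *, of s] cnorm_entry_le[OF *, of t] by simp
    moreover have "entry s A \<ominus>\<^bsub>A\<^esub> entry t A \<in> carrier A \<and> cnorm A (entry s A \<ominus>\<^bsub>A\<^esub> entry t A) \<le> norm s + norm t"
      using cnorm_diff_le[of "entry s A" "entry t A"] cnorm_entry_le[OF *, of s] cnorm_entry_le[OF *, of t] by simp
    moreover have "\<ominus>\<^bsub>A\<^esub> entry s A \<in> carrier A \<and> cnorm A (\<ominus>\<^bsub>A\<^esub> entry s A) \<le> norm s"
      using cnorm_entry_le[OF *, of s] by simp
    moreover have "entry s A \<otimes>\<^bsub>A\<^esub> entry t A \<in> carrier A"
      by (simp add: m_closed)
    moreover have "cnorm A (entry s A \<otimes>\<^bsub>A\<^esub> entry t A) \<le> norm s * norm t"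
      using norm_mult[of "entry s A" "entry t A"] cnorm_entry_le[OF *, of s] cnorm_entry_le[OF *, of t]
        mult_mono[OF cnorm_entry_le[OF *, of s] cnorm_entry_le[OF *, of t] norm_cfam_nonneg] norm_nonneg[of "entry t A"] by simp
    moreover have "complex_of_real r \<odot>\<^bsub>A\<^esub> entry s A \<in> carrier A \<and> cnorm A (complex_of_real r \<odot>\<^bsub>A\<^esub> entry s A) \<le> \<bar>r\<bar> * norm s"
      using norm_smult[of "entry s A" "complex_of_real r"] cnorm_entry_le[OF *, of s] by (simp add: mult_left_mono)
    moreover note calculation
  } note * = this
  show "entry 0 B = \<zero>\<^bsub>B\<^esub>" "entry (s + t) B = entry s B \<oplus>\<^bsub>B\<^esub> entry t B"
    "entry (s - t) B = entry s B \<ominus>\<^bsub>B\<^esub> entry t B" "entry (- s) B = \<ominus>\<^bsub>B\<^esub> entry s B"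
    "entry (s * t) B = entry s B \<otimes>\<^bsub>B\<^esub> entry t B" "entry (r *\<^sub>R s) B = complex_of_real r \<odot>\<^bsub>B\<^esub> entry s B"
    unfolding zero_cfam_def plus_cfam_def minus_cfam_def uminus_cfam_def times_cfam_def scaleR_cfam_def
    using * assms by (intro entry_cfam_of; blast)+
qed

instance
proof
  fix s t u :: "'a cfam" and r q :: real
  {
    fix A :: "'a cstar" assume *: "cstar_algebra A"
    then interpret cstar_algebra A .
    note [simp] = entry_carrier[OF *] entry_ops[OF *]
    have "entry (s + t + u) A = entry (s + (t + u)) A" by (simp add: M.a_assoc)
    moreover have "entry (s + t) A = entry (t + s) A" by (simp add: M.a_comm)
    moreover have "entry (0 + s) A = entry s A" by simp
    moreover have "entry (- s + s) A = entry 0 A" by (simp add: M.l_neg)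
    moreover have "entry (s - t) A = entry (s + - t) A" by (simp add: a_minus_def)
    moreover have "entry (r *\<^sub>R (s + t)) A = entry (r *\<^sub>R s + r *\<^sub>R t) A" by (simp add: smult_r_distr)
    moreover have "entry ((r + q) *\<^sub>R s) A = entry (r *\<^sub>R s + q *\<^sub>R s) A"
      using smult_l_distr[of "complex_of_real r" "complex_of_real q" "entry s A"] by simp
    moreover have "entry (r *\<^sub>R (q *\<^sub>R s)) A = entry ((r * q) *\<^sub>R s) A"
      using smult_assoc1[of "complex_of_real r" "complex_of_real q" "entry s A"] by simp
    moreover have "entry (1 *\<^sub>R s) A = entry s A" using smult_one[of "entry s A"] by simp
    moreover have "entry (s * t * u) A = entry (s * (t * u)) A" by (simp add: m_assoc)
    moreover have "entry ((s + t) * u) A = entry (s * u + t * u) A" by (simp add: l_distr)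
    moreover have "entry (s * (t + u)) A = entry (s * t + s * u) A" by (simp add: r_distr)
    moreover have "entry ((r *\<^sub>R s) * t) A = entry (r *\<^sub>R (s * t)) A" by (simp add: smult_mult_l)
    moreover have "entry (s * (r *\<^sub>R t)) A = entry (r *\<^sub>R (s * t)) A" by (simp add: smult_mult_r)
    moreover note calculation
  } note * = this
  show "s + t + u = s + (t + u)" "s + t = t + s" "0 + s = s" "- s + s = 0" "s - t = s + - t"
    "r *\<^sub>R (s + t) = r *\<^sub>R s + r *\<^sub>R t" "(r + q) *\<^sub>R s = r *\<^sub>R s + q *\<^sub>R s" "r *\<^sub>R (q *\<^sub>R s) = (r * q) *\<^sub>R s"
    "1 *\<^sub>R s = s" "s * t * u = s * (t * u)" "(s + t) * u = s * u + t * u" "s * (t + u) = s * t + s * u"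
    "(r *\<^sub>R s) * t = r *\<^sub>R (s * t)" "s * (r *\<^sub>R t) = r *\<^sub>R (s * t)"
    by (rule cfam_eqI; use * in blast)+
  show "norm (s + t) \<le> norm s + norm t"
    unfolding norm_cfam_le_iff
  proof (intro conjI allI impI)
    fix A :: "'a cstar" assume *: "cstar_algebra A"
    then interpret cstar_algebra A .
    show "cnorm A (entry (s + t) A) \<le> norm s + norm t"
      using norm_triangle[of "entry s A" "entry t A"] cnorm_entry_le[OF *, of s] cnorm_entry_le[OF *, of t]
      by (simp add: entry_carrier[OF *] entry_ops[OF *])
  qed (simp add: norm_cfam_nonneg)
  show "norm (s * t) \<le> norm s * norm t"
    unfolding norm_cfam_le_iff
  proof (intro conjI allI impI)
    fix A :: "'a cstar" assume *: "cstar_algebra A"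
    then interpret cstar_algebra A .
    show "cnorm A (entry (s * t) A) \<le> norm s * norm t"
      using norm_mult[of "entry s A" "entry t A"] norm_nonneg[of "entry t A"]
        mult_mono[OF cnorm_entry_le[OF *, of s] cnorm_entry_le[OF *, of t] norm_cfam_nonneg]
      by (simp add: entry_carrier[OF *] entry_ops[OF *])
  qed (simp add: norm_cfam_nonneg)
  have sc: "norm (r *\<^sub>R s) \<le> \<bar>r\<bar> * norm s" for r and s :: "'a cfam"
    unfolding norm_cfam_le_iff
  proof (intro conjI allI impI)
    fix A :: "'a cstar" assume *: "cstar_algebra A"
    then interpret cstar_algebra A .
    show "cnorm A (entry (r *\<^sub>R s) A) \<le> \<bar>r\<bar> * norm s"
      using norm_smult[of "entry s A" "complex_of_real r"] cnorm_entry_le[OF *, of s]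
      by (simp add: entry_carrier[OF *] entry_ops[OF *] mult_left_mono)
  qed (simp add: norm_cfam_nonneg)
  have norm0: "norm s = 0 \<longleftrightarrow> s = 0" for s :: "'a cfam"
  proof
    assume 0: "norm s = 0"
    show "s = 0"
    proof (rule cfam_eqI)
      fix A :: "'a cstar" assume *: "cstar_algebra A"
      then interpret cstar_algebra A .
      show "entry s A = entry 0 A"
        using cnorm_entry_le[OF *, of s] norm_nonneg[of "entry s A"] norm_eq_0_iff[of "entry s A"]
        by (simp add: entry_carrier[OF *] entry_ops[OF *] 0)
    qed
  next
    assume "s = 0"
    moreover have "norm (0 :: 'a cfam) \<le> 0"
      unfolding norm_cfam_le_iff by (simp add: entry_ops cstar_algebra.cnorm_zero)
    ultimately show "norm s = 0" using norm_cfam_nonneg[of s] by simp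
  qed
  then show "norm s = 0 \<longleftrightarrow> s = 0" .
  show "norm (r *\<^sub>R s) = \<bar>r\<bar> * norm s"
  proof (cases "r = 0")
    case True
    then show ?thesis using sc[of r s] norm_cfam_nonneg[of "r *\<^sub>R s"] by simp
  next
    case False
    have "inverse r *\<^sub>R (r *\<^sub>R s) = s"
    proof (rule cfam_eqI)
      fix A :: "'a cstar" assume *: "cstar_algebra A"
      then interpret cstar_algebra A .
      show "entry (inverse r *\<^sub>R (r *\<^sub>R s)) A = entry s A"
        using smult_assoc1[of "complex_of_real (inverse r)" "complex_of_real r" "entry s A"] smult_one[of "entry s A"] False
        by (simp add: entry_carrier[OF *] entry_ops[OF *])
    qed
    then have "\<bar>r\<bar> * norm s \<le> \<bar>r\<bar> * (\<bar>inverse r\<bar> * norm (r *\<^sub>R s))"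
      using sc[of "inverse r" "r *\<^sub>R s"] by (intro mult_left_mono) auto
    then show ?thesis using sc[of r s] False by (simp add: mult.assoc[symmetric] abs_mult[symmetric])
  qed
qed (simp_all add: dist_cfam_def sgn_cfam_def uniformity_cfam_def open_cfam_def)

end

instantiation cfam :: (type) cstar_alg
begin

definition "adj s = cfam_of (\<lambda>A. star A (entry s A))"
definition "c *\<^sub>C s = cfam_of (\<lambda>A. c \<odot>\<^bsub>A\<^esub> entry s A)"

lemma entry_star_ops:
  fixes s :: "'a cfam"
  assumes "cstar_algebra B"
  shows "entry (adj s) B = star B (entry s B)" and "entry (c *\<^sub>C s) B = c \<odot>\<^bsub>B\<^esub> entry s B"
proof -
  {
    fix A :: "'a cstar" assume *: "cstar_algebra A"
    then interpret cstar_algebra A .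
    note [simp] = entry_carrier[OF *]
    have "star A (entry s A) \<in> carrier A \<and> cnorm A (star A (entry s A)) \<le> norm s"
      using cnorm_star[of "entry s A"] cnorm_entry_le[OF *, of s] by (simp add: star_closed)
    moreover have "c \<odot>\<^bsub>A\<^esub> entry s A \<in> carrier A \<and> cnorm A (c \<odot>\<^bsub>A\<^esub> entry s A) \<le> cmod c * norm s"
      using norm_smult[of "entry s A" c] cnorm_entry_le[OF *, of s] by (simp add: mult_left_mono)
    moreover note calculation
  } note * = this
  show "entry (adj s) B = star B (entry s B)" "entry (c *\<^sub>C s) B = c \<odot>\<^bsub>B\<^esub> entry s B"
    unfolding adj_cfam_def scaleC_cfam_def using * assms by (intro entry_cfam_of; blast)+
qed

instance
proof
  fix s t :: "'a cfam" and c d :: complex and r :: real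
  {
    fix A :: "'a cstar" assume *: "cstar_algebra A"
    then interpret cstar_algebra A .
    note [simp] = entry_carrier[OF *] entry_ops[OF *] entry_star_ops[OF *]
    have "entry (adj (s + t)) A = entry (adj s + adj t) A" by (simp add: star_add)
    moreover have "entry (adj (s * t)) A = entry (adj t * adj s) A" by (simp add: star_mult)
    moreover have "entry (adj (adj s)) A = entry s A" by (simp add: star_star)
    moreover have "entry (adj (c *\<^sub>C s)) A = entry (cnj c *\<^sub>C adj s) A" by (simp add: star_smult)
    moreover have "entry (c *\<^sub>C (s + t)) A = entry (c *\<^sub>C s + c *\<^sub>C t) A" by (simp add: smult_r_distr)
    moreover have "entry ((c + d) *\<^sub>C s) A = entry (c *\<^sub>C s + d *\<^sub>C s) A"
      using smult_l_distr[of c d "entry s A"] by simp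
    moreover have "entry (c *\<^sub>C (d *\<^sub>C s)) A = entry ((c * d) *\<^sub>C s) A"
      using smult_assoc1[of c d "entry s A"] by simp
    moreover have "entry (r *\<^sub>R s) A = entry (complex_of_real r *\<^sub>C s) A" by simp
    moreover have "entry ((c *\<^sub>C s) * t) A = entry (c *\<^sub>C (s * t)) A" by (simp add: smult_mult_l)
    moreover have "entry (s * (c *\<^sub>C t)) A = entry (c *\<^sub>C (s * t)) A" by (simp add: smult_mult_r)
    moreover note calculation
  } note * = this
  show "adj (s + t) = adj s + adj t" "adj (s * t) = adj t * adj s" "adj (adj s) = s"
    "adj (c *\<^sub>C s) = cnj c *\<^sub>C adj s" "c *\<^sub>C (s + t) = c *\<^sub>C s + c *\<^sub>C t"
    "(c + d) *\<^sub>C s = c *\<^sub>C s + d *\<^sub>C s" "c *\<^sub>C (d *\<^sub>C s) = (c * d) *\<^sub>C s"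
    "r *\<^sub>R s = complex_of_real r *\<^sub>C s" "(c *\<^sub>C s) * t = c *\<^sub>C (s * t)" "s * (c *\<^sub>C t) = c *\<^sub>C (s * t)"
    by (rule cfam_eqI; use * in blast)+
  show "norm (adj s * s) = (norm s)\<^sup>2"
  proof (rule antisym)
    show "norm (adj s * s) \<le> (norm s)\<^sup>2"
      unfolding norm_cfam_le_iff[of "adj s * s"]
    proof (intro conjI allI impI)
      fix A :: "'a cstar" assume *: "cstar_algebra A"
      then interpret cstar_algebra A .
      show "cnorm A (entry (adj s * s) A) \<le> (norm s)\<^sup>2"
        using norm_star_mult[of "entry s A"] norm_nonneg[of "entry s A"] cnorm_entry_le[OF *, of s]
        by (simp add: entry_carrier[OF *] entry_ops[OF *] entry_star_ops[OF *] power_mono)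
    qed simp
    have "norm s \<le> sqrt (norm (adj s * s))"
      unfolding norm_cfam_le_iff[of s]
    proof (intro conjI allI impI)
      fix A :: "'a cstar" assume *: "cstar_algebra A"
      then interpret cstar_algebra A .
      show "cnorm A (entry s A) \<le> sqrt (norm (adj s * s))"
        using norm_star_mult[of "entry s A"] cnorm_entry_le[OF *, of "adj s * s"]
        by (intro real_le_rsqrt) (simp add: entry_carrier[OF *] entry_ops[OF *] entry_star_ops[OF *])
    qed simp
    then have "(norm s)\<^sup>2 \<le> (sqrt (norm (adj s * s)))\<^sup>2" by (intro power_mono) simp_all
    then show "(norm s)\<^sup>2 \<le> norm (adj s * s)" by simp
  qed
  show "convergent X" if X: "Cauchy X" for X :: "nat \<Rightarrow> 'a cfam"
  proof -
    have diff: "cnorm A (entry (X m) A \<ominus>\<^bsub>A\<^esub> entry (X n) A) \<le> norm (X m - X n)" if "cstar_algebra A" for A m n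
      using cnorm_entry_le[OF that, of "X m - X n"] by (simp add: entry_ops that)
    have "\<exists>x\<in>carrier A. (\<lambda>n. cnorm A (entry (X n) A \<ominus>\<^bsub>A\<^esub> x)) \<longlonglongrightarrow> 0" if *: "cstar_algebra A" for A
    proof (rule cstar_algebra.complete[OF *])
      show "range (\<lambda>n. entry (X n) A) \<subseteq> carrier A" using entry_carrier[OF *] by auto
      show "\<forall>e>0. \<exists>N. \<forall>m\<ge>N. \<forall>n\<ge>N. cnorm A (entry (X m) A \<ominus>\<^bsub>A\<^esub> entry (X n) A) < e"
        using X diff[OF *] unfolding Cauchy_def dist_norm by (meson order_le_less_trans)
    qed
    then obtain L where L: "\<And>A. cstar_algebra A \<Longrightarrow> L A \<in> carrier A"
      "\<And>A. cstar_algebra A \<Longrightarrow> (\<lambda>n. cnorm A (entry (X n) A \<ominus>\<^bsub>A\<^esub> L A)) \<longlonglongrightarrow> 0" by metis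
    \<comment> \<open>The limits exist separately for each \<open>A\<close>. One threshold for all
      \<open>A\<close> is what makes the limit family bounded and the convergence hold in the
      supremum norm.\<close>
    have unif: "\<exists>N. \<forall>n\<ge>N. \<forall>A. cstar_algebra A \<longrightarrow> cnorm A (entry (X n) A \<ominus>\<^bsub>A\<^esub> L A) \<le> e" if "e > 0" for e
    proof -
      obtain N where N: "\<And>m n. m \<ge> N \<Longrightarrow> n \<ge> N \<Longrightarrow> norm (X m - X n) < e"
        using X \<open>e > 0\<close> unfolding Cauchy_def dist_norm by meson
      have "cnorm A (entry (X n) A \<ominus>\<^bsub>A\<^esub> L A) \<le> e" if n: "n \<ge> N" and *: "cstar_algebra A" for n A
      proof -
        interpret cstar_algebra A by fact
        have "cnorm A (entry (X n) A \<ominus>\<^bsub>A\<^esub> L A) \<le> e + cnorm A (entry (X m) A \<ominus>\<^bsub>A\<^esub> L A)" if "m \<ge> N" for m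
          using cnorm_diff_triangle[of "entry (X n) A" "entry (X m) A" "L A"] diff[OF *, of n m] N[OF n that]
          by (simp add: entry_carrier[OF *] L *)
        moreover have "(\<lambda>m. e + cnorm A (entry (X m) A \<ominus>\<^bsub>A\<^esub> L A)) \<longlonglongrightarrow> e + 0"
          by (intro tendsto_intros L *)
        ultimately show ?thesis using LIMSEQ_le_const[of _ "e + 0"] by auto
      qed
      then show ?thesis by blast
    qed
    obtain N where N: "\<And>A. cstar_algebra A \<Longrightarrow> cnorm A (entry (X N) A \<ominus>\<^bsub>A\<^esub> L A) \<le> 1" using unif[of 1] by auto
    have bd: "cnorm A (L A) \<le> norm (X N) + 1" if *: "cstar_algebra A" for A
    proof -
      interpret cstar_algebra A by fact
      have "L A \<ominus>\<^bsub>A\<^esub> \<zero>\<^bsub>A\<^esub> = L A" using L(1)[OF *] by (simp add: a_minus_def)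
      moreover have "entry (X N) A \<ominus>\<^bsub>A\<^esub> \<zero>\<^bsub>A\<^esub> = entry (X N) A" using entry_carrier[OF *] by (simp add: a_minus_def)
      ultimately show ?thesis
        using cnorm_diff_triangle[of "L A" "entry (X N) A" "\<zero>\<^bsub>A\<^esub>"] N[OF *] cnorm_entry_le[OF *, of "X N"]
          cnorm_diff_commute[of "L A" "entry (X N) A"]
        by (simp add: L * entry_carrier[OF *])
    qed
    define l where "l = cfam_of L"
    have l: "entry l A = L A" if "cstar_algebra A" for A
      unfolding l_def by (rule entry_cfam_of[OF L(1) bd that])
    have "X \<longlonglongrightarrow> l"
      unfolding LIMSEQ_iff
    proof (intro allI impI)
      fix e :: real assume "e > 0"
      then obtain N where N: "\<And>n A. n \<ge> N \<Longrightarrow> cstar_algebra A \<Longrightarrow> cnorm A (entry (X n) A \<ominus>\<^bsub>A\<^esub> L A) \<le> e / 2"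
        using unif[of "e / 2"] by auto
      have le: "norm (X n - l) \<le> e / 2" if "n \<ge> N" for n
        unfolding norm_cfam_le_iff using N[OF that] \<open>e > 0\<close> by (auto simp: entry_ops l)
      then show "\<exists>N. \<forall>n\<ge>N. norm (X n - l) < e" using \<open>e > 0\<close> by (intro exI[of _ N]) (use le in fastforce)
    qed
    then show ?thesis unfolding convergent_def by blast
  qed
qed

end

text \<open>The unit is adjoined once, to the algebra of all families, and not to \<open>A\<close>.
  Hence all C*-algebras on one type share the ambient algebra; in particular all members of a
  sequence \<open>F n\<close> do, and their elements can be calculated with uniformly in
  \<open>n\<close>.\<close>

definition emb :: "'a cstar \<Rightarrow> 'a \<Rightarrow> 'a cfam unitz" where
  "emb A x = Unitz (cfam_of (\<lambda>B. if B = A then x else \<zero>\<^bsub>B\<^esub>)) 0"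

definition unemb :: "'a cstar \<Rightarrow> 'a cfam unitz \<Rightarrow> 'a" where
  "unemb A u = entry (upart u) A"

context cstar_algebra
begin

lemma entry_emb:
  assumes "x \<in> carrier A" "cstar_algebra B"
  shows "entry (upart (emb A x)) B = (if B = A then x else \<zero>\<^bsub>B\<^esub>)"
  unfolding emb_def unitz.sel
proof (rule entry_cfam_of[OF _ _ assms(2)])
  fix C :: "'a cstar" assume "cstar_algebra C"
  then interpret C: cstar_algebra C .
  show "(if C = A then x else \<zero>\<^bsub>C\<^esub>) \<in> carrier C" using assms by simp
  show "cnorm C (if C = A then x else \<zero>\<^bsub>C\<^esub>) \<le> cnorm A x" using norm_nonneg assms by simp
qed

lemma uscal_emb [simp]: "uscal (emb A x) = 0"
  by (simp add: emb_def)

lemma emb_eqI: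
  assumes "uscal u = 0" "\<And>B. cstar_algebra B \<Longrightarrow> entry (upart u) B = (if B = A then x else \<zero>\<^bsub>B\<^esub>)" "x \<in> carrier A"
  shows "emb A x = u"
  by (rule unitz_eqI[OF cfam_eqI]) (simp_all add: assms entry_emb)

lemma unemb_emb [simp]: "x \<in> carrier A \<Longrightarrow> unemb A (emb A x) = x"
  by (simp add: unemb_def entry_emb cstar_algebra_axioms)

lemma unemb_in_carrier [simp]: "unemb A u \<in> carrier A"
  by (simp add: unemb_def entry_carrier cstar_algebra_axioms)

lemma emb_inject: "x \<in> carrier A \<Longrightarrow> y \<in> carrier A \<Longrightarrow> emb A x = emb A y \<longleftrightarrow> x = y"
  by (metis unemb_emb)

lemma emb_add: "x \<in> carrier A \<Longrightarrow> y \<in> carrier A \<Longrightarrow> emb A (x \<oplus> y) = emb A x + emb A y"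
  by (rule emb_eqI) (auto simp: entry_ops entry_emb cstar_algebra.minus_eq_smult abelian_group.r_neg
      intro!: abelian_monoid.l_zero abelian_monoid.zero_closed dest: cstar_algebra.axioms(1) module.axioms(2) abelian_group.axioms)

lemma emb_mult: "x \<in> carrier A \<Longrightarrow> y \<in> carrier A \<Longrightarrow> emb A (x \<otimes> y) = emb A x * emb A y"
proof (rule emb_eqI)
  assume x: "x \<in> carrier A" and y: "y \<in> carrier A"
  fix B :: "'a cstar" assume B: "cstar_algebra B"
  then interpret B: cstar_algebra B .
  show "entry (upart (emb A x * emb A y)) B = (if B = A then x \<otimes> y else \<zero>\<^bsub>B\<^esub>)"
    using x y by (simp add: entry_ops[OF B] entry_emb[OF _ B])
qed (simp_all add: m_closed)

lemma emb_smult: "x \<in> carrier A \<Longrightarrow> emb A (c \<odot> x) = c *\<^sub>C emb A x"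
proof (rule emb_eqI)
  assume x: "x \<in> carrier A"
  fix B :: "'a cstar" assume B: "cstar_algebra B"
  then interpret B: cstar_algebra B .
  show "entry (upart (c *\<^sub>C emb A x)) B = (if B = A then c \<odot> x else \<zero>\<^bsub>B\<^esub>)"
    using x by (simp add: entry_star_ops[OF B] entry_emb[OF _ B])
qed simp_all

lemma emb_star: "x \<in> carrier A \<Longrightarrow> emb A (star A x) = adj (emb A x)"
proof (rule emb_eqI)
  assume x: "x \<in> carrier A"
  fix B :: "'a cstar" assume B: "cstar_algebra B"
  then interpret B: cstar_algebra B .
  show "entry (upart (adj (emb A x))) B = (if B = A then star A x else \<zero>\<^bsub>B\<^esub>)"
    using x by (simp add: entry_star_ops[OF B] entry_emb[OF _ B])
qed (simp_all add: star_closed)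

lemma emb_zero [simp]: "emb A \<zero> = 0"
  using emb_smult[of \<zero> 0] by simp

lemma emb_minus: "x \<in> carrier A \<Longrightarrow> emb A (\<ominus> x) = - emb A x"
  by (simp add: minus_eq_smult emb_smult scaleC_minus_one)

lemma emb_diff: "x \<in> carrier A \<Longrightarrow> y \<in> carrier A \<Longrightarrow> emb A (x \<ominus> y) = emb A x - emb A y"
  by (simp add: a_minus_def emb_add emb_minus)

lemma emb_finsum: "finite S \<Longrightarrow> f \<in> S \<rightarrow> carrier A \<Longrightarrow> emb A (\<Oplus>i\<in>S. f i) = (\<Sum>i\<in>S. emb A (f i))"
  by (induction S rule: finite_induct) (auto simp: emb_add Pi_iff)

lemma norm_emb: "x \<in> carrier A \<Longrightarrow> norm (emb A x) = cnorm A x"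
proof -
  assume x: "x \<in> carrier A"
  have "norm (upart (emb A x)) = cnorm A x"
  proof (rule antisym)
    show "cnorm A x \<le> norm (upart (emb A x))"
      using cnorm_entry_le[OF cstar_algebra_axioms, of "upart (emb A x)"] x by (simp add: entry_emb cstar_algebra_axioms)
    show "norm (upart (emb A x)) \<le> cnorm A x"
      unfolding norm_cfam_le_iff
    proof (intro conjI allI impI)
      fix B :: "'a cstar" assume B: "cstar_algebra B"
      then interpret B: cstar_algebra B .
      show "cnorm B (entry (upart (emb A x)) B) \<le> cnorm A x"
        using x norm_nonneg[OF x] by (simp add: entry_emb[OF x B])
    qed (simp add: norm_nonneg x)
  qed
  then show ?thesis using norm_Unitz_0[of "upart (emb A x)"] by (simp add: emb_def)
qed

text \<open>For the converse a root \<open>k\<close> in the ambient algebra is brought back to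
  \<open>A\<close>: the scalar part of \<open>k * k\<close> is zero, hence so is that of
  \<open>k\<close>, and then the entry of \<open>k\<close> at \<open>A\<close> is a self-adjoint
  square root of \<open>x\<close> inside \<open>A\<close>.\<close>

lemma positive_iff:
  assumes x: "x \<in> carrier A"
  shows "positive A x \<longleftrightarrow> pos (emb A x)"
proof
  assume "positive A x"
  then obtain b where "b \<in> carrier A" "x = star A b \<otimes> b" by (auto simp: positive_def)
  then show "pos (emb A x)" by (simp add: emb_mult emb_star star_closed pos_adj_mult)
next
  assume "pos (emb A x)"
  then obtain k where k: "adj k = k" "emb A x = k * k" by (auto simp: pos_def)
  have "uscal (k * k) = 0" using k(2)[symmetric] by simp
  then have "uscal k = 0" by simp
  then have "entry (upart (k * k)) A = unemb A k \<otimes> unemb A k"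
    by (simp add: entry_ops cstar_algebra_axioms unemb_def)
  then have "x = unemb A k \<otimes> unemb A k" using entry_emb[OF x cstar_algebra_axioms] k(2) by simp
  moreover have "star A (unemb A k) = unemb A k"
    using arg_cong[OF k(1), of "\<lambda>u. entry (upart u) A"] by (simp add: unemb_def entry_star_ops cstar_algebra_axioms)
  ultimately show "positive A x" unfolding positive_def using unemb_in_carrier by metis
qed

end

section \<open>Matrix algebras\<close>

definition mv :: "nat \<Rightarrow> (nat \<Rightarrow> nat \<Rightarrow> 'a::cstar_alg_1) \<Rightarrow> (nat \<Rightarrow> 'a) \<Rightarrow> nat \<Rightarrow> 'a" where
  "mv n X v = (\<lambda>i. \<Sum>j<n. X i j * v j)"

lemma cn_zero [simp]: "cn n (\<lambda>i. 0) = 0"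
  by (simp add: cn_def ip_def)

lemma cn_scaleC: "cn n (\<lambda>i. c *\<^sub>C v i) = cmod c * cn n v"
proof -
  have "ip n (\<lambda>i. c *\<^sub>C v i) (\<lambda>i. c *\<^sub>C v i) = (c * cnj c) *\<^sub>C ip n v v"
    by (simp add: ip_def adj_scaleC scaleC_sum_right mult.commute)
  then show ?thesis
    by (simp add: cn_def norm_scaleC norm_mult real_sqrt_mult power2_eq_square[symmetric])
qed

lemma mv_scaleC: "mv n X (\<lambda>i. c *\<^sub>C v i) = (\<lambda>i. c *\<^sub>C mv n X v i)"
  by (simp add: mv_def scaleC_sum_right)

lemma mv_mult: "mv n (\<lambda>i j. \<Sum>k<n. X i k * Y k j) v = mv n X (mv n Y v)"
  unfolding mv_def sum_distrib_left sum_distrib_right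
  by (subst sum.swap) (simp add: mult.assoc)

lemma ip_mv_left: "ip n (mv n X u) v = ip n u (mv n (\<lambda>i j. adj (X j i)) v)"
  unfolding mv_def ip_def adj_sum sum_distrib_left sum_distrib_right adj_mult
  by (subst sum.swap) (simp add: mult.assoc)

lemma cn_mv_le: "cn n (mv n X v) \<le> (\<Sum>i<n. \<Sum>j<n. norm (X i j)) * cn n v"
proof -
  have "norm (mv n X v i) \<le> (\<Sum>j<n. norm (X i j)) * cn n v" for i
    unfolding mv_def sum_distrib_right
  proof (rule sum_norm_le)
    fix j assume "j \<in> {..<n}"
    then show "norm (X i j * v j) \<le> norm (X i j) * cn n v"
      using norm_mult_ineq[of "X i j" "v j"] mult_left_mono[OF norm_le_cn[of j n v], of "norm (X i j)"] by simp
  qed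
  then have "(\<Sum>i<n. norm (mv n X v i)) \<le> (\<Sum>i<n. (\<Sum>j<n. norm (X i j)) * cn n v)" by (intro sum_mono)
  then show ?thesis using cn_le_sum[of n "mv n X v"] by (simp add: sum_distrib_right)
qed

section \<open>Matrices over a record and their entries in the ambient algebra\<close>

lemma mats_entry: "X \<in> mats r S \<Longrightarrow> i < r \<Longrightarrow> j < r \<Longrightarrow> X i j \<in> S"
  unfolding mats_def by (blast dest: PiE_mem)

lemma mk_mat_apply [simp]: "i < r \<Longrightarrow> j < r \<Longrightarrow> mk_mat r f i j = f i j"
  by (simp add: mk_mat_def)

lemma mk_mat_in: "(\<And>i j. i < r \<Longrightarrow> j < r \<Longrightarrow> f i j \<in> S) \<Longrightarrow> mk_mat r f \<in> mats r S"
  by (auto simp: mk_mat_def mats_def)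

lemma mats_mono: "S \<subseteq> T \<Longrightarrow> mats r S \<subseteq> mats r T"
  unfolding mats_def by (intro PiE_mono) blast

lemma mats_eqI:
  assumes "X \<in> mats r S" "Y \<in> mats r T" "\<And>i j. i < r \<Longrightarrow> j < r \<Longrightarrow> X i j = Y i j"
  shows "X = Y"
proof -
  have XY: "X \<in> {..<r} \<rightarrow>\<^sub>E ({..<r} \<rightarrow>\<^sub>E S \<union> T)" "Y \<in> {..<r} \<rightarrow>\<^sub>E ({..<r} \<rightarrow>\<^sub>E S \<union> T)"
    using assms(1,2) mats_mono[of S "S \<union> T" r] mats_mono[of T "S \<union> T" r] unfolding mats_def by auto
  show ?thesis
  proof (rule PiE_ext[OF XY])
    fix i assume i: "i \<in> {..<r}"
    show "X i = Y i" using assms(3) i by (intro PiE_ext[OF PiE_mem[OF XY(1) i] PiE_mem[OF XY(2) i]]) auto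
  qed
qed

lemma mat_cstar_simps [simp]:
  "carrier (mat_cstar r A) = mats r (carrier A)"
  "cnorm (mat_cstar r A) = mat_norm A r"
  "\<zero>\<^bsub>mat_cstar r A\<^esub> = mk_mat r (\<lambda>i j. \<zero>\<^bsub>A\<^esub>)"
  by (simp_all add: mat_cstar_def)

lemma mat_cstar_apply:
  assumes "i < r" "j < r"
  shows "(X \<otimes>\<^bsub>mat_cstar r A\<^esub> Y) i j = (\<Oplus>\<^bsub>A\<^esub>k\<in>{..<r}. X i k \<otimes>\<^bsub>A\<^esub> Y k j)"
    "(X \<oplus>\<^bsub>mat_cstar r A\<^esub> Y) i j = X i j \<oplus>\<^bsub>A\<^esub> Y i j"
    "(c \<odot>\<^bsub>mat_cstar r A\<^esub> X) i j = c \<odot>\<^bsub>A\<^esub> X i j"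
    "star (mat_cstar r A) X i j = star A (X j i)"
  using assms by (simp_all add: mat_cstar_def)

context cstar_algebra
begin

lemma finsum_mult_closed: "(\<And>k. k \<in> S \<Longrightarrow> f k \<in> carrier A) \<Longrightarrow> (\<And>k. k \<in> S \<Longrightarrow> g k \<in> carrier A) \<Longrightarrow>
   (\<Oplus>k\<in>S. f k \<otimes> g k) \<in> carrier A"
  by (intro M.finsum_closed) (auto intro: m_closed)

lemma emb_finsum_mult: "finite S \<Longrightarrow> (\<And>k. k \<in> S \<Longrightarrow> f k \<in> carrier A) \<Longrightarrow> (\<And>k. k \<in> S \<Longrightarrow> g k \<in> carrier A) \<Longrightarrow>
   emb A (\<Oplus>k\<in>S. f k \<otimes> g k) = (\<Sum>k\<in>S. emb A (f k) * emb A (g k))"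
  by (subst emb_finsum) (auto intro: m_closed simp: emb_mult)

lemma mat_mult_closed: "X \<in> mats r (carrier A) \<Longrightarrow> Y \<in> mats r (carrier A) \<Longrightarrow> X \<otimes>\<^bsub>mat_cstar r A\<^esub> Y \<in> mats r (carrier A)"
  and mat_add_closed: "X \<in> mats r (carrier A) \<Longrightarrow> Y \<in> mats r (carrier A) \<Longrightarrow> X \<oplus>\<^bsub>mat_cstar r A\<^esub> Y \<in> mats r (carrier A)"
  and mat_smult_closed: "X \<in> mats r (carrier A) \<Longrightarrow> c \<odot>\<^bsub>mat_cstar r A\<^esub> X \<in> mats r (carrier A)"
  and mat_star_closed: "X \<in> mats r (carrier A) \<Longrightarrow> star (mat_cstar r A) X \<in> mats r (carrier A)"
  and mat_zero_closed: "mk_mat r (\<lambda>i j. \<zero>) \<in> mats r (carrier A)"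
  unfolding mat_cstar_def
  by (auto intro!: mk_mat_in finsum_mult_closed star_closed dest: mats_entry)

lemmas mat_closed = mat_mult_closed mat_add_closed mat_smult_closed mat_star_closed mat_zero_closed

lemma mat_emb_mult: "X \<in> mats r (carrier A) \<Longrightarrow> Y \<in> mats r (carrier A) \<Longrightarrow> i < r \<Longrightarrow> j < r \<Longrightarrow>
    emb A ((X \<otimes>\<^bsub>mat_cstar r A\<^esub> Y) i j) = (\<Sum>k<r. emb A (X i k) * emb A (Y k j))"
  unfolding mat_cstar_apply by (rule emb_finsum_mult) (auto dest: mats_entry)

lemma mat_emb_add: "X \<in> mats r (carrier A) \<Longrightarrow> Y \<in> mats r (carrier A) \<Longrightarrow> i < r \<Longrightarrow> j < r \<Longrightarrow>
    emb A ((X \<oplus>\<^bsub>mat_cstar r A\<^esub> Y) i j) = emb A (X i j) + emb A (Y i j)"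
  by (simp add: mat_cstar_apply emb_add mats_entry[of _ r "carrier A"])

lemma mat_emb_smult: "X \<in> mats r (carrier A) \<Longrightarrow> i < r \<Longrightarrow> j < r \<Longrightarrow>
    emb A ((c \<odot>\<^bsub>mat_cstar r A\<^esub> X) i j) = c *\<^sub>C emb A (X i j)"
  by (simp add: mat_cstar_apply emb_smult mats_entry[of _ r "carrier A"])

lemma mat_emb_star: "X \<in> mats r (carrier A) \<Longrightarrow> i < r \<Longrightarrow> j < r \<Longrightarrow>
    emb A (star (mat_cstar r A) X i j) = adj (emb A (X j i))"
  by (simp add: mat_cstar_apply emb_star mats_entry[of _ r "carrier A"])

lemmas mat_emb = mat_emb_mult mat_emb_add mat_emb_smult mat_emb_star

lemma mat_emb_eqI:
  assumes "X \<in> mats r (carrier A)" "Y \<in> mats r (carrier A)"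
    "\<And>i j. i < r \<Longrightarrow> j < r \<Longrightarrow> emb A (X i j) = emb A (Y i j)"
  shows "X = Y"
  by (intro mats_eqI[OF assms(1,2)] emb_inject[THEN iffD1] assms(3)
      mats_entry[OF assms(1)] mats_entry[OF assms(2)])

section \<open>The operator norm on matrices\<close>

lemma col_norm_eq:
  assumes "\<And>i. i < r \<Longrightarrow> v i \<in> carrier A"
  shows "col_norm A r v = cn r (\<lambda>i. emb A (v i))"
proof -
  have "emb A (\<Oplus>i\<in>{..<r}. star A (v i) \<otimes> v i) = ip r (\<lambda>i. emb A (v i)) (\<lambda>i. emb A (v i))"
    using assms by (subst emb_finsum_mult) (auto simp: star_closed emb_star ip_def)
  moreover have "(\<Oplus>i\<in>{..<r}. star A (v i) \<otimes> v i) \<in> carrier A"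
    using assms by (intro finsum_mult_closed star_closed) auto
  ultimately show ?thesis by (metis col_norm_def cn_def norm_emb)
qed

lemma emb_mat_col:
  assumes "X \<in> mats r (carrier A)" "\<And>i. i < r \<Longrightarrow> v i \<in> carrier A" "i < r"
  shows "emb A (\<Oplus>j\<in>{..<r}. X i j \<otimes> v j) = mv r (\<lambda>i j. emb A (X i j)) (\<lambda>i. emb A (v i)) i"
  unfolding mv_def using assms mats_entry[OF assms(1)] by (intro emb_finsum_mult) auto

lemma col_norm_mat_col:
  assumes "X \<in> mats r (carrier A)" "\<And>i. i < r \<Longrightarrow> v i \<in> carrier A"
  shows "col_norm A r (\<lambda>i\<in>{..<r}. \<Oplus>j\<in>{..<r}. X i j \<otimes> v j) = cn r (mv r (\<lambda>i j. emb A (X i j)) (\<lambda>i. emb A (v i)))"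
proof -
  have "(\<lambda>i\<in>{..<r}. \<Oplus>j\<in>{..<r}. X i j \<otimes> v j) i \<in> carrier A" if "i < r" for i
    using that assms mats_entry[OF assms(1)] by (auto intro!: finsum_mult_closed)
  then show ?thesis using assms by (subst col_norm_eq) (auto intro!: cn_cong simp: emb_mat_col)
qed

text \<open>The working form of the matrix norm: by homogeneity the supremum over columns of norm at
  most 1 becomes an operator bound. The columns still have entries from \<open>A\<close>, although
  everything is measured in the ambient algebra. Boundedness of the supremum comes from the crude
  estimate \<open>cn_mv_le\<close>.\<close>

lemma mat_norm_le_iff:
  assumes X: "X \<in> mats r (carrier A)"
  shows "mat_norm A r X \<le> c \<longleftrightarrow> 0 \<le> c \<and> (\<forall>v. (\<forall>i<r. v i \<in> carrier A) \<longrightarrow>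
    cn r (mv r (\<lambda>i j. emb A (X i j)) (\<lambda>i. emb A (v i))) \<le> c * cn r (\<lambda>i. emb A (v i)))"
proof -
  let ?X = "\<lambda>i j. emb A (X i j)"
  let ?S = "{col_norm A r (\<lambda>i\<in>{..<r}. \<Oplus>j\<in>{..<r}. X i j \<otimes> v j) | v.
          v \<in> {..<r} \<rightarrow>\<^sub>E carrier A \<and> col_norm A r v \<le> 1}"
  have S: "?S = {cn r (mv r ?X (\<lambda>i. emb A (v i))) | v. v \<in> {..<r} \<rightarrow>\<^sub>E carrier A \<and> cn r (\<lambda>i. emb A (v i)) \<le> 1}"
  proof (intro Collect_cong ex_cong1)
    fix a v
    show "(a = col_norm A r (\<lambda>i\<in>{..<r}. \<Oplus>j\<in>{..<r}. X i j \<otimes> v j) \<and> v \<in> {..<r} \<rightarrow>\<^sub>E carrier A \<and> col_norm A r v \<le> 1)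
     = (a = cn r (mv r ?X (\<lambda>i. emb A (v i))) \<and> v \<in> {..<r} \<rightarrow>\<^sub>E carrier A \<and> cn r (\<lambda>i. emb A (v i)) \<le> 1)"
    proof (cases "v \<in> {..<r} \<rightarrow>\<^sub>E carrier A")
      case True
      then have "v i \<in> carrier A" if "i < r" for i using that by (blast dest: PiE_mem)
      then show ?thesis by (simp add: col_norm_eq col_norm_mat_col[OF X])
    qed auto
  qed
  have bdd: "bdd_above ?S"
    unfolding S
  proof (rule bdd_aboveI)
    fix x assume "x \<in> {cn r (mv r ?X (\<lambda>i. emb A (v i))) | v. v \<in> {..<r} \<rightarrow>\<^sub>E carrier A \<and> cn r (\<lambda>i. emb A (v i)) \<le> 1}"
    then obtain v where v: "x = cn r (mv r ?X (\<lambda>i. emb A (v i)))" "cn r (\<lambda>i. emb A (v i)) \<le> 1" by blast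
    have "(\<Sum>i<r. \<Sum>j<r. norm (?X i j)) * cn r (\<lambda>i. emb A (v i)) \<le> (\<Sum>i<r. \<Sum>j<r. norm (?X i j)) * 1"
      using v(2) by (intro mult_left_mono sum_nonneg) auto
    then show "x \<le> (\<Sum>i<r. \<Sum>j<r. norm (?X i j))"
      using cn_mv_le[of r ?X "\<lambda>i. emb A (v i)"] v(1) by simp
  qed
  have z: "0 \<in> ?S"
  proof -
    have "cn r (\<lambda>i. emb A ((\<lambda>i\<in>{..<r}. \<zero>) i)) = 0"
      using cn_cong[of r "\<lambda>i. emb A ((\<lambda>i\<in>{..<r}. \<zero>) i)" "\<lambda>i. 0"] by simp
    moreover have "mv r ?X (\<lambda>i. emb A ((\<lambda>i\<in>{..<r}. \<zero>) i)) = (\<lambda>i. 0)"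
      unfolding mv_def by (intro ext sum.neutral) simp
    ultimately show ?thesis unfolding S by (intro CollectI exI[of _ "\<lambda>i\<in>{..<r}. \<zero>"]) simp
  qed
  have "mat_norm A r X \<le> c \<longleftrightarrow> (\<forall>x\<in>?S. x \<le> c)"
    unfolding mat_norm_def using z bdd by (intro cSup_le_iff) blast+
  also have "\<dots> \<longleftrightarrow> 0 \<le> c \<and> (\<forall>v. (\<forall>i<r. v i \<in> carrier A) \<longrightarrow>
    cn r (mv r ?X (\<lambda>i. emb A (v i))) \<le> c * cn r (\<lambda>i. emb A (v i)))"
  proof safe
    assume *: "\<forall>x\<in>?S. x \<le> c"
    show "0 \<le> c" using * z by blast
    fix v assume v: "\<forall>i<r. v i \<in> carrier A"
    let ?s = "cn r (\<lambda>i. emb A (v i))"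
    show "cn r (mv r ?X (\<lambda>i. emb A (v i))) \<le> c * ?s"
    proof (cases "?s = 0")
      case True
      then show ?thesis using cn_mv_le[of r ?X "\<lambda>i. emb A (v i)"] by simp
    next
      case False
      then have s: "?s > 0" using cn_nonneg[of r "\<lambda>i. emb A (v i)"] by linarith
      let ?c = "complex_of_real (1 / ?s)"
      define w where "w = (\<lambda>i\<in>{..<r}. ?c \<odot> v i)"
      have w: "w \<in> {..<r} \<rightarrow>\<^sub>E carrier A" using v by (auto simp: w_def)
      have ew: "emb A (w i) = ?c *\<^sub>C emb A (v i)" if "i < r" for i
        using that v by (simp add: w_def emb_smult)
      have nw: "cn r (\<lambda>i. emb A (w i)) = cn r (\<lambda>i. ?c *\<^sub>C emb A (v i))"
        by (rule cn_cong) (simp add: ew)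
      then have nw: "cn r (\<lambda>i. emb A (w i)) \<le> 1" unfolding cn_scaleC using s by (simp add: norm_divide)
      have mw: "mv r ?X (\<lambda>i. emb A (w i)) = mv r ?X (\<lambda>i. ?c *\<^sub>C emb A (v i))"
        by (simp add: mv_def ew)
      have "cn r (mv r ?X (\<lambda>i. emb A (w i))) \<le> c" 
      proof -
        have "cn r (mv r ?X (\<lambda>i. emb A (w i))) \<in> ?S" unfolding S using w nw by blast
        then show ?thesis using * by blast
      qed
      then have "(1 / ?s) * cn r (mv r ?X (\<lambda>i. emb A (v i))) \<le> c"
        unfolding mw mv_scaleC cn_scaleC using s by (simp add: norm_divide)
      then show ?thesis using s by (simp add: divide_le_eq)
    qed
  next
    fix x v assume c: "0 \<le> c" and *: "\<forall>v. (\<forall>i<r. v i \<in> carrier A) \<longrightarrow>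
      cn r (mv r ?X (\<lambda>i. emb A (v i))) \<le> c * cn r (\<lambda>i. emb A (v i))"
    assume v: "v \<in> {..<r} \<rightarrow>\<^sub>E carrier A" "col_norm A r v \<le> 1"
    then have vi: "\<And>i. i < r \<Longrightarrow> v i \<in> carrier A" by (blast dest: PiE_mem)
    have "c * cn r (\<lambda>i. emb A (v i)) \<le> c * 1"
      using v(2) c by (intro mult_left_mono) (simp_all add: col_norm_eq[OF vi])
    moreover have "cn r (mv r ?X (\<lambda>i. emb A (v i))) \<le> c * cn r (\<lambda>i. emb A (v i))"
      using *[rule_format, of v] vi by simp
    moreover have "col_norm A r (\<lambda>i\<in>{..<r}. \<Oplus>j\<in>{..<r}. X i j \<otimes> v j) = cn r (mv r ?X (\<lambda>i. emb A (v i)))"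
      by (rule col_norm_mat_col[OF X vi])
    ultimately show "col_norm A r (\<lambda>i\<in>{..<r}. \<Oplus>j\<in>{..<r}. X i j \<otimes> v j) \<le> c" by linarith
  qed
  finally show ?thesis .
qed

lemma mat_norm_nonneg: "X \<in> mats r (carrier A) \<Longrightarrow> 0 \<le> mat_norm A r X"
  using mat_norm_le_iff[of X r "mat_norm A r X"] by simp

lemma mat_norm_ge:
  assumes "X \<in> mats r (carrier A)" "\<forall>i<r. v i \<in> carrier A"
  shows "cn r (mv r (\<lambda>i j. emb A (X i j)) (\<lambda>i. emb A (v i))) \<le> mat_norm A r X * cn r (\<lambda>i. emb A (v i))"
  using mat_norm_le_iff[OF assms(1), of "mat_norm A r X"] assms(2) by simp

lemma mat_norm_le_sum:
  assumes "X \<in> mats r (carrier A)"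
  shows "mat_norm A r X \<le> (\<Sum>i<r. \<Sum>j<r. cnorm A (X i j))"
proof -
  have "(\<Sum>i<r. \<Sum>j<r. cnorm A (X i j)) = (\<Sum>i<r. \<Sum>j<r. norm (emb A (X i j)))"
    by (intro sum.cong refl) (simp add: norm_emb mats_entry[OF assms])
  then show ?thesis
    unfolding mat_norm_le_iff[OF assms]
    using cn_mv_le[of r "\<lambda>i j. emb A (X i j)"] by (simp add: sum_nonneg)
qed

text \<open>There need not be a unit to serve as a test vector, so the column with
  \<open>star A (X i j)\<close> at position \<open>j\<close> is used. Its image has
  \<open>X i j\<close> times its adjoint at position \<open>i\<close>, and the C*-identity finishes
  the estimate.\<close>

lemma cnorm_entry_le_mat_norm:
  assumes X: "X \<in> mats r (carrier A)" and i: "i < r" and j: "j < r"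
  shows "cnorm A (X i j) \<le> mat_norm A r X"
proof (cases "cnorm A (X i j) = 0")
  case True then show ?thesis using mat_norm_nonneg[OF X] by simp
next
  case False
  have x: "X i j \<in> carrier A" by (rule mats_entry[OF X i j])
  define v where "v = (\<lambda>k. if k = j then star A (X i j) else \<zero>)"
  have v': "\<forall>k<r. v k \<in> carrier A" using x by (simp add: v_def star_closed)
  have ev: "emb A (v k) = (if k = j then adj (emb A (X i j)) else 0)" for k
    using x by (simp add: v_def emb_star)
  have "mv r (\<lambda>i j. emb A (X i j)) (\<lambda>i. emb A (v i)) i = emb A (X i j) * adj (emb A (X i j))"
    unfolding mv_def ev using j by (simp add: if_distrib cong: if_cong)
  then have "norm (emb A (X i j) * adj (emb A (X i j))) \<le> cn r (mv r (\<lambda>i j. emb A (X i j)) (\<lambda>i. emb A (v i)))"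
    using norm_le_cn[OF i, of "mv r (\<lambda>i j. emb A (X i j)) (\<lambda>i. emb A (v i))"] by simp
  also have "\<dots> \<le> mat_norm A r X * cn r (\<lambda>i. emb A (v i))" by (rule mat_norm_ge[OF X v'])
  also have "cn r (\<lambda>i. emb A (v i)) \<le> cnorm A (X i j)"
    using cn_le_sum[of r "\<lambda>i. emb A (v i)"] j x unfolding ev
    by (simp add: if_distrib norm_emb cong: if_cong)
  finally have "(cnorm A (X i j))\<^sup>2 \<le> mat_norm A r X * cnorm A (X i j)"
    using mat_norm_nonneg[OF X] x by (simp add: norm_mult_adj norm_emb mult_left_mono)
  then show ?thesis using False norm_nonneg[OF x] by (simp add: power2_eq_square)
qed

lemma abelian_group_mat: "abelian_group (mat_cstar r A)"
proof (rule abelian_groupI)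
  fix X Y Z assume *: "X \<in> carrier (mat_cstar r A)" "Y \<in> carrier (mat_cstar r A)"
  note m = mats_entry[OF *(1)[simplified]] mats_entry[OF *(2)[simplified]]
  show "X \<oplus>\<^bsub>mat_cstar r A\<^esub> Y \<in> carrier (mat_cstar r A)" using * by (simp add: mat_closed)
  show "X \<oplus>\<^bsub>mat_cstar r A\<^esub> Y = Y \<oplus>\<^bsub>mat_cstar r A\<^esub> X"
    using * by (intro mats_eqI) (auto intro!: mat_closed simp: mat_cstar_apply m M.a_comm)
  assume Z: "Z \<in> carrier (mat_cstar r A)"
  show "X \<oplus>\<^bsub>mat_cstar r A\<^esub> Y \<oplus>\<^bsub>mat_cstar r A\<^esub> Z = X \<oplus>\<^bsub>mat_cstar r A\<^esub> (Y \<oplus>\<^bsub>mat_cstar r A\<^esub> Z)"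
    using * Z by (intro mats_eqI) (auto intro!: mat_closed simp: mat_cstar_apply m mats_entry[OF Z[simplified]] M.a_assoc)
next
  fix X assume X: "X \<in> carrier (mat_cstar r A)"
  note m = mats_entry[OF X[simplified]]
  show "\<zero>\<^bsub>mat_cstar r A\<^esub> \<oplus>\<^bsub>mat_cstar r A\<^esub> X = X"
    using X by (intro mats_eqI) (auto intro!: mat_closed mk_mat_in simp: mat_cstar_apply m)
  show "\<exists>Y\<in>carrier (mat_cstar r A). Y \<oplus>\<^bsub>mat_cstar r A\<^esub> X = \<zero>\<^bsub>mat_cstar r A\<^esub>"
    using X by (intro bexI[of _ "mk_mat r (\<lambda>i j. \<ominus> X i j)"] mats_eqI)
      (auto intro!: mat_closed mk_mat_in simp: mat_cstar_apply m M.l_neg)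
qed (auto intro!: mk_mat_in)

lemma mat_minus_apply:
  assumes X: "X \<in> mats r (carrier A)" and Y: "Y \<in> mats r (carrier A)"
  shows "X \<ominus>\<^bsub>mat_cstar r A\<^esub> Y = mk_mat r (\<lambda>i j. X i j \<ominus> Y i j)"
proof -
  interpret N: abelian_group "mat_cstar r A" by (rule abelian_group_mat)
  note m = mats_entry[OF X] mats_entry[OF Y]
  have inv: "\<ominus>\<^bsub>mat_cstar r A\<^esub> Y = mk_mat r (\<lambda>i j. \<ominus> Y i j)"
    by (rule N.minus_equality, rule mats_eqI)
      (use Y in \<open>auto intro!: mat_closed mk_mat_in simp: mat_cstar_apply m M.l_neg\<close>)
  show ?thesis
    unfolding a_minus_def[of "mat_cstar r A"] inv
    by (rule mats_eqI) (use X Y in \<open>auto intro!: mat_closed mk_mat_in simp: mat_cstar_apply m a_minus_def\<close>)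
qed

text \<open>Moving \<open>X\<close> across the inner product gives \<langle>Xv, Xv\<rangle> =
  \<langle>v, X^*X v\<rangle>, and Cauchy-Schwarz bounds the right-hand side by the norm of X^*X
  times the square of that of \<open>v\<close>.\<close>

lemma mat_norm_self_adj_ge:
  assumes X: "X \<in> mats r (carrier A)"
  shows "(mat_norm A r X)\<^sup>2 \<le> mat_norm A r (star (mat_cstar r A) X \<otimes>\<^bsub>mat_cstar r A\<^esub> X)"
proof -
  let ?N = "mat_norm A r (star (mat_cstar r A) X \<otimes>\<^bsub>mat_cstar r A\<^esub> X)"
  have XX: "star (mat_cstar r A) X \<otimes>\<^bsub>mat_cstar r A\<^esub> X \<in> mats r (carrier A)" using X by (simp add: mat_closed)
  have "mat_norm A r X \<le> sqrt ?N"
    unfolding mat_norm_le_iff[OF X]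
  proof (intro conjI allI impI)
    fix v assume v': "\<forall>i<r. v i \<in> carrier A"
    then have v: "\<And>i. i < r \<Longrightarrow> v i \<in> carrier A" by blast
    let ?v = "\<lambda>i. emb A (v i)" and ?X = "\<lambda>i j. emb A (X i j)"
    have "ip r (mv r ?X ?v) (mv r ?X ?v) = ip r ?v (mv r (\<lambda>i j. \<Sum>k<r. adj (emb A (X k i)) * emb A (X k j)) ?v)"
      unfolding ip_mv_left mv_mult ..
    also have "\<dots> = ip r ?v (mv r (\<lambda>i j. emb A ((star (mat_cstar r A) X \<otimes>\<^bsub>mat_cstar r A\<^esub> X) i j)) ?v)"
      by (rule ip_cong) (use X in \<open>simp_all add: mv_def mat_emb mat_closed\<close>)
    finally have "(cn r (mv r ?X ?v))\<^sup>2 \<le> cn r ?v * (?N * cn r ?v)"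
      unfolding cn_power2 using norm_ip_le[of r ?v] mult_left_mono[OF mat_norm_ge[OF XX v'] cn_nonneg[of r ?v]]
      by (auto intro: order_trans)
    also have "\<dots> = (sqrt ?N * cn r ?v)\<^sup>2"
      using mat_norm_nonneg[OF XX] by (simp add: power_mult_distrib power2_eq_square[of "cn r ?v"])
    finally show "cn r (mv r ?X ?v) \<le> sqrt ?N * cn r ?v"
      by (rule power2_le_imp_le) (simp add: mat_norm_nonneg[OF XX])
  qed (simp add: mat_norm_nonneg[OF XX])
  then have "(mat_norm A r X)\<^sup>2 \<le> (sqrt ?N)\<^sup>2" by (intro power_mono mat_norm_nonneg X)
  then show ?thesis by (simp add: mat_norm_nonneg[OF XX])
qed

lemma mat_norm_mult_le:
  assumes X: "X \<in> mats r (carrier A)" and Y: "Y \<in> mats r (carrier A)"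
  shows "mat_norm A r (X \<otimes>\<^bsub>mat_cstar r A\<^esub> Y) \<le> mat_norm A r X * mat_norm A r Y"
proof -
  have XY: "X \<otimes>\<^bsub>mat_cstar r A\<^esub> Y \<in> mats r (carrier A)" using X Y by (simp add: mat_closed)
  show ?thesis
    unfolding mat_norm_le_iff[OF XY]
  proof (intro conjI allI impI)
    fix v assume v': "\<forall>i<r. v i \<in> carrier A"
    then have v: "\<And>i. i < r \<Longrightarrow> v i \<in> carrier A" by blast
    let ?v = "\<lambda>i. emb A (v i)" and ?X = "\<lambda>i j. emb A (X i j)" and ?Y = "\<lambda>i j. emb A (Y i j)"
    define w where "w = (\<lambda>i. \<Oplus>j\<in>{..<r}. Y i j \<otimes> v j)"
    have w: "w i \<in> carrier A" if "i < r" for i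
      unfolding w_def using mats_entry[OF Y that] v by (auto intro!: finsum_mult_closed)
    have w': "\<forall>i<r. w i \<in> carrier A" using w by blast
    have ew: "emb A (w i) = mv r ?Y ?v i" if "i < r" for i
      unfolding w_def by (rule emb_mat_col[OF Y v that])
    have "cn r (mv r (\<lambda>i j. emb A ((X \<otimes>\<^bsub>mat_cstar r A\<^esub> Y) i j)) ?v)
       = cn r (mv r (\<lambda>i j. \<Sum>k<r. ?X i k * ?Y k j) ?v)"
      by (rule cn_cong) (simp add: mv_def mat_emb X Y)
    also have "\<dots> = cn r (mv r ?X (\<lambda>i. emb A (w i)))"
      unfolding mv_mult by (rule cn_cong) (simp add: mv_def[of _ ?X] ew)
    also have "\<dots> \<le> mat_norm A r X * cn r (\<lambda>i. emb A (w i))" by (rule mat_norm_ge[OF X w'])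
    also have "cn r (\<lambda>i. emb A (w i)) = cn r (mv r ?Y ?v)" by (rule cn_cong) (rule ew)
    also have "\<dots> \<le> mat_norm A r Y * cn r ?v" by (rule mat_norm_ge[OF Y v'])
    finally show "cn r (mv r (\<lambda>i j. emb A ((X \<otimes>\<^bsub>mat_cstar r A\<^esub> Y) i j)) ?v) \<le> mat_norm A r X * mat_norm A r Y * cn r ?v"
      using mat_norm_nonneg[OF X] by (simp add: mult_left_mono mult.assoc)
  qed (simp add: mat_norm_nonneg X Y)
qed

lemma mat_norm_smult_le:
  assumes X: "X \<in> mats r (carrier A)"
  shows "mat_norm A r (c \<odot>\<^bsub>mat_cstar r A\<^esub> X) \<le> cmod c * mat_norm A r X"
proof -
  have cX: "c \<odot>\<^bsub>mat_cstar r A\<^esub> X \<in> mats r (carrier A)" using X by (simp add: mat_closed)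
  show ?thesis
    unfolding mat_norm_le_iff[OF cX]
  proof (intro conjI allI impI)
    fix v assume v': "\<forall>i<r. v i \<in> carrier A"
    then have v: "\<And>i. i < r \<Longrightarrow> v i \<in> carrier A" by blast
    let ?v = "\<lambda>i. emb A (v i)" and ?X = "\<lambda>i j. emb A (X i j)"
    have "cn r (mv r (\<lambda>i j. emb A ((c \<odot>\<^bsub>mat_cstar r A\<^esub> X) i j)) ?v) = cn r (\<lambda>i. c *\<^sub>C mv r ?X ?v i)"
      by (rule cn_cong) (simp add: mv_def mat_emb X scaleC_sum_right)
    also have "\<dots> \<le> cmod c * (mat_norm A r X * cn r ?v)"
      unfolding cn_scaleC by (intro mult_left_mono mat_norm_ge[OF X v']) simp
    finally show "cn r (mv r (\<lambda>i j. emb A ((c \<odot>\<^bsub>mat_cstar r A\<^esub> X) i j)) ?v) \<le> cmod c * mat_norm A r X * cn r ?v"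
      by (simp add: mult.assoc)
  qed (simp add: mat_norm_nonneg X)
qed

text \<open>Multiplicative and involutive laws are compared entrywise in the ambient algebra. The
  C*-identity combines \<open>mat_norm_self_adj_ge\<close> with submultiplicativity, which also show
  that the involution is isometric. Completeness holds because the matrix norm lies between the norm
  of each entry and the sum of all entry norms.\<close>

theorem cstar_algebra_mat: "cstar_algebra (mat_cstar r A)"
proof (intro cstar_algebra.intro moduleI cstar_algebra_axioms.intro)
  show "cring complex_ring" ..
  show "abelian_group (mat_cstar r A)" by (rule abelian_group_mat)
  fix X assume X: "X \<in> carrier (mat_cstar r A)"
  then have X': "X \<in> mats r (carrier A)" by simp
  note m = mats_entry[OF X']
  { fix c show "c \<odot>\<^bsub>mat_cstar r A\<^esub> X \<in> carrier (mat_cstar r A)" using X by (simp add: mat_closed) }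
  { fix c d show "(c \<oplus>\<^bsub>complex_ring\<^esub> d) \<odot>\<^bsub>mat_cstar r A\<^esub> X = c \<odot>\<^bsub>mat_cstar r A\<^esub> X \<oplus>\<^bsub>mat_cstar r A\<^esub> d \<odot>\<^bsub>mat_cstar r A\<^esub> X"
      using X' by (intro mat_emb_eqI) (auto intro!: mat_closed simp: mat_emb mat_closed scaleC_add_left) }
  { fix c d show "(c \<otimes>\<^bsub>complex_ring\<^esub> d) \<odot>\<^bsub>mat_cstar r A\<^esub> X = c \<odot>\<^bsub>mat_cstar r A\<^esub> (d \<odot>\<^bsub>mat_cstar r A\<^esub> X)"
      using X' by (intro mat_emb_eqI) (auto intro!: mat_closed simp: mat_emb mat_closed) }
  show "\<one>\<^bsub>complex_ring\<^esub> \<odot>\<^bsub>mat_cstar r A\<^esub> X = X"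
    using X' by (intro mat_emb_eqI) (auto intro!: mat_closed simp: mat_emb mat_closed)
  show st: "star (mat_cstar r A) X \<in> carrier (mat_cstar r A)" using X by (simp add: mat_closed)
  { fix c show "star (mat_cstar r A) (c \<odot>\<^bsub>mat_cstar r A\<^esub> X) = cnj c \<odot>\<^bsub>mat_cstar r A\<^esub> star (mat_cstar r A) X"
      using X' by (intro mat_emb_eqI) (auto intro!: mat_closed simp: mat_emb mat_closed adj_scaleC) }
  show "star (mat_cstar r A) (star (mat_cstar r A) X) = X"
    using X' by (intro mat_emb_eqI) (auto intro!: mat_closed simp: mat_emb mat_closed)
  show "0 \<le> cnorm (mat_cstar r A) X" using X' by (simp add: mat_norm_nonneg)
  show "cnorm (mat_cstar r A) X = 0 \<longleftrightarrow> X = \<zero>\<^bsub>mat_cstar r A\<^esub>"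
  proof
    assume "cnorm (mat_cstar r A) X = 0"
    then have "cnorm A (X i j) = 0" if "i < r" "j < r" for i j
      using cnorm_entry_le_mat_norm[OF X' that] norm_nonneg[OF m[OF that]] by simp
    then show "X = \<zero>\<^bsub>mat_cstar r A\<^esub>"
      using X' m by (intro mats_eqI[OF X']) (auto intro!: mk_mat_in simp: norm_eq_0_iff)
  next
    assume "X = \<zero>\<^bsub>mat_cstar r A\<^esub>"
    then have "mat_norm A r X \<le> 0" using mat_norm_le_sum[OF X'] by simp
    then show "cnorm (mat_cstar r A) X = 0" using mat_norm_nonneg[OF X'] by simp
  qed
  show "cnorm (mat_cstar r A) (c \<odot>\<^bsub>mat_cstar r A\<^esub> X) = cmod c * cnorm (mat_cstar r A) X" for c
  proof (cases "c = 0")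
    case True
    then show ?thesis using mat_norm_smult_le[OF X', of c] mat_norm_nonneg[OF mat_smult_closed[OF X', of c]] by simp
  next
    case False
    have "inverse c \<odot>\<^bsub>mat_cstar r A\<^esub> (c \<odot>\<^bsub>mat_cstar r A\<^esub> X) = X"
      using X' False by (intro mat_emb_eqI) (auto intro!: mat_closed simp: mat_emb mat_closed)
    then have "mat_norm A r X \<le> cmod (inverse c) * mat_norm A r (c \<odot>\<^bsub>mat_cstar r A\<^esub> X)"
      using mat_norm_smult_le[OF mat_smult_closed[OF X', of c], of "inverse c"] by simp
    then have "cmod c * mat_norm A r X \<le> cmod c * (cmod (inverse c) * mat_norm A r (c \<odot>\<^bsub>mat_cstar r A\<^esub> X))"
      by (rule mult_left_mono) simp
    then have "cmod c * mat_norm A r X \<le> mat_norm A r (c \<odot>\<^bsub>mat_cstar r A\<^esub> X)"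
      using False by (simp add: mult.assoc[symmetric] Real_Vector_Spaces.norm_mult[symmetric])
    then show ?thesis using mat_norm_smult_le[OF X', of c] by simp
  qed
  have le: "mat_norm A r Z \<le> mat_norm A r (star (mat_cstar r A) Z)" if Z: "Z \<in> mats r (carrier A)" for Z
  proof (cases "mat_norm A r Z = 0")
    case False
    have "mat_norm A r Z * mat_norm A r Z \<le> mat_norm A r (star (mat_cstar r A) Z) * mat_norm A r Z"
      using mat_norm_self_adj_ge[OF Z] mat_norm_mult_le[OF mat_star_closed[OF Z] Z] by (simp add: power2_eq_square)
    then show ?thesis using False mat_norm_nonneg[OF Z] by simp
  qed (simp add: mat_norm_nonneg mat_closed Z)
  have "star (mat_cstar r A) (star (mat_cstar r A) X) = X"
    using X' by (intro mat_emb_eqI) (auto intro!: mat_closed simp: mat_emb mat_closed)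
  then have "mat_norm A r (star (mat_cstar r A) X) = mat_norm A r X"
    using le[OF X'] le[OF mat_star_closed[OF X']] by simp
  then show "cnorm (mat_cstar r A) (star (mat_cstar r A) X \<otimes>\<^bsub>mat_cstar r A\<^esub> X) = (cnorm (mat_cstar r A) X)\<^sup>2"
    using mat_norm_self_adj_ge[OF X'] mat_norm_mult_le[OF mat_star_closed[OF X'] X'] by (simp add: power2_eq_square)
  fix Y assume "Y \<in> carrier (mat_cstar r A)"
  then have Y: "Y \<in> mats r (carrier A)" by simp
  { fix c show "c \<odot>\<^bsub>mat_cstar r A\<^esub> (X \<oplus>\<^bsub>mat_cstar r A\<^esub> Y) = c \<odot>\<^bsub>mat_cstar r A\<^esub> X \<oplus>\<^bsub>mat_cstar r A\<^esub> c \<odot>\<^bsub>mat_cstar r A\<^esub> Y"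
      using X' Y by (intro mat_emb_eqI) (auto intro!: mat_closed simp: mat_emb mat_closed scaleC_add_right) }
  show "X \<otimes>\<^bsub>mat_cstar r A\<^esub> Y \<in> carrier (mat_cstar r A)" using X' Y by (simp add: mat_closed)
  { fix c show "(c \<odot>\<^bsub>mat_cstar r A\<^esub> X) \<otimes>\<^bsub>mat_cstar r A\<^esub> Y = c \<odot>\<^bsub>mat_cstar r A\<^esub> (X \<otimes>\<^bsub>mat_cstar r A\<^esub> Y)"
      using X' Y by (intro mat_emb_eqI) (auto intro!: mat_closed simp: mat_emb mat_closed scaleC_sum_right) }
  { fix c show "X \<otimes>\<^bsub>mat_cstar r A\<^esub> (c \<odot>\<^bsub>mat_cstar r A\<^esub> Y) = c \<odot>\<^bsub>mat_cstar r A\<^esub> (X \<otimes>\<^bsub>mat_cstar r A\<^esub> Y)"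
      using X' Y by (intro mat_emb_eqI) (auto intro!: mat_closed simp: mat_emb mat_closed scaleC_sum_right) }
  show "star (mat_cstar r A) (X \<oplus>\<^bsub>mat_cstar r A\<^esub> Y) = star (mat_cstar r A) X \<oplus>\<^bsub>mat_cstar r A\<^esub> star (mat_cstar r A) Y"
    using X' Y by (intro mat_emb_eqI) (auto intro!: mat_closed simp: mat_emb mat_closed adj_add)
  show "star (mat_cstar r A) (X \<otimes>\<^bsub>mat_cstar r A\<^esub> Y) = star (mat_cstar r A) Y \<otimes>\<^bsub>mat_cstar r A\<^esub> star (mat_cstar r A) X"
    using X' Y by (intro mat_emb_eqI) (auto intro!: mat_closed simp: mat_emb mat_closed adj_sum adj_mult)
  show "cnorm (mat_cstar r A) (X \<otimes>\<^bsub>mat_cstar r A\<^esub> Y) \<le> cnorm (mat_cstar r A) X * cnorm (mat_cstar r A) Y"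
    using mat_norm_mult_le[OF X' Y] by simp
  have XY: "X \<oplus>\<^bsub>mat_cstar r A\<^esub> Y \<in> mats r (carrier A)" using X' Y by (simp add: mat_closed)
  show "cnorm (mat_cstar r A) (X \<oplus>\<^bsub>mat_cstar r A\<^esub> Y) \<le> cnorm (mat_cstar r A) X + cnorm (mat_cstar r A) Y"
    unfolding mat_cstar_simps mat_norm_le_iff[OF XY]
  proof (intro conjI allI impI)
    fix v assume v': "\<forall>i<r. v i \<in> carrier A"
    then have v: "\<And>i. i < r \<Longrightarrow> v i \<in> carrier A" by blast
    let ?v = "\<lambda>i. emb A (v i)" and ?X = "\<lambda>i j. emb A (X i j)" and ?Y = "\<lambda>i j. emb A (Y i j)"
    have "cn r (mv r (\<lambda>i j. emb A ((X \<oplus>\<^bsub>mat_cstar r A\<^esub> Y) i j)) ?v) = cn r (\<lambda>i. mv r ?X ?v i + mv r ?Y ?v i)"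
      by (rule cn_cong) (simp add: mv_def mat_emb X' Y distrib_right sum.distrib)
    also have "\<dots> \<le> mat_norm A r X * cn r ?v + mat_norm A r Y * cn r ?v"
      using mat_norm_ge[OF X' v'] mat_norm_ge[OF Y v'] by (intro order_trans[OF cn_triangle] add_mono)
    finally show "cn r (mv r (\<lambda>i j. emb A ((X \<oplus>\<^bsub>mat_cstar r A\<^esub> Y) i j)) ?v) \<le> (mat_norm A r X + mat_norm A r Y) * cn r ?v"
      by (simp add: distrib_right)
  qed (simp add: mat_norm_nonneg X' Y)
  fix Z assume "Z \<in> carrier (mat_cstar r A)"
  then have Z: "Z \<in> mats r (carrier A)" by simp
  show "X \<otimes>\<^bsub>mat_cstar r A\<^esub> Y \<otimes>\<^bsub>mat_cstar r A\<^esub> Z = X \<otimes>\<^bsub>mat_cstar r A\<^esub> (Y \<otimes>\<^bsub>mat_cstar r A\<^esub> Z)"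
  proof (rule mat_emb_eqI)
    fix i j assume ij: "i < r" "j < r"
    have "(\<Sum>k<r. (\<Sum>l<r. emb A (X i l) * emb A (Y l k)) * emb A (Z k j)) =
       (\<Sum>l<r. emb A (X i l) * (\<Sum>k<r. emb A (Y l k) * emb A (Z k j)))"
      unfolding sum_distrib_left sum_distrib_right by (subst sum.swap) (simp add: mult.assoc)
    then show "emb A ((X \<otimes>\<^bsub>mat_cstar r A\<^esub> Y \<otimes>\<^bsub>mat_cstar r A\<^esub> Z) i j) = emb A ((X \<otimes>\<^bsub>mat_cstar r A\<^esub> (Y \<otimes>\<^bsub>mat_cstar r A\<^esub> Z)) i j)"
      using ij X' Y Z by (simp add: mat_emb mat_closed)
  qed (use X' Y Z in \<open>auto intro!: mat_closed\<close>)
  show "(X \<oplus>\<^bsub>mat_cstar r A\<^esub> Y) \<otimes>\<^bsub>mat_cstar r A\<^esub> Z = X \<otimes>\<^bsub>mat_cstar r A\<^esub> Z \<oplus>\<^bsub>mat_cstar r A\<^esub> Y \<otimes>\<^bsub>mat_cstar r A\<^esub> Z"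
    using X' Y Z by (intro mat_emb_eqI) (auto intro!: mat_closed simp: mat_emb mat_closed distrib_right sum.distrib)
  show "Z \<otimes>\<^bsub>mat_cstar r A\<^esub> (X \<oplus>\<^bsub>mat_cstar r A\<^esub> Y) = Z \<otimes>\<^bsub>mat_cstar r A\<^esub> X \<oplus>\<^bsub>mat_cstar r A\<^esub> Z \<otimes>\<^bsub>mat_cstar r A\<^esub> Y"
    using X' Y Z by (intro mat_emb_eqI) (auto intro!: mat_closed simp: mat_emb mat_closed distrib_left sum.distrib)
next
  fix s :: "nat \<Rightarrow> nat \<Rightarrow> nat \<Rightarrow> 'a"
  assume "range s \<subseteq> carrier (mat_cstar r A)"
  then have s: "s n \<in> mats r (carrier A)" for n by auto
  assume C: "\<forall>e>0. \<exists>N. \<forall>m\<ge>N. \<forall>n\<ge>N. cnorm (mat_cstar r A) (s m \<ominus>\<^bsub>mat_cstar r A\<^esub> s n) < e"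
  have in_diff: "mk_mat r (\<lambda>i j. s m i j \<ominus> s n i j) \<in> mats r (carrier A)" for m n
    using mats_entry[OF s] by (intro mk_mat_in) simp
  have "\<exists>x\<in>carrier A. (\<lambda>n. cnorm A (s n i j \<ominus> x)) \<longlonglongrightarrow> 0" if ij: "i < r" "j < r" for i j
  proof (rule complete)
    show "range (\<lambda>n. s n i j) \<subseteq> carrier A" using mats_entry[OF s ij] by auto
    have "cnorm A (s m i j \<ominus> s n i j) \<le> cnorm (mat_cstar r A) (s m \<ominus>\<^bsub>mat_cstar r A\<^esub> s n)" for m n
      using cnorm_entry_le_mat_norm[OF in_diff ij, of m n] ij by (simp add: mat_minus_apply s)
    then show "\<forall>e>0. \<exists>N. \<forall>m\<ge>N. \<forall>n\<ge>N. cnorm A (s m i j \<ominus> s n i j) < e"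
      using C by (meson order_le_less_trans)
  qed
  then obtain L where L: "\<And>i j. i < r \<Longrightarrow> j < r \<Longrightarrow> L i j \<in> carrier A"
    "\<And>i j. i < r \<Longrightarrow> j < r \<Longrightarrow> (\<lambda>n. cnorm A (s n i j \<ominus> L i j)) \<longlonglongrightarrow> 0" by metis
  have L': "mk_mat r L \<in> mats r (carrier A)" by (intro mk_mat_in L)
  have d: "s n \<ominus>\<^bsub>mat_cstar r A\<^esub> mk_mat r L \<in> mats r (carrier A)" for n
    unfolding mat_minus_apply[OF s L'] using mats_entry[OF s] mats_entry[OF L'] by (intro mk_mat_in) simp
  have le: "cnorm (mat_cstar r A) (s n \<ominus>\<^bsub>mat_cstar r A\<^esub> mk_mat r L) \<le> (\<Sum>i<r. \<Sum>j<r. cnorm A (s n i j \<ominus> L i j))" for n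
    using mat_norm_le_sum[OF d, of n] by (simp add: mat_minus_apply[OF s L'])
  have "(\<lambda>n. \<Sum>i<r. \<Sum>j<r. cnorm A (s n i j \<ominus> L i j)) \<longlonglongrightarrow> (\<Sum>i<r. \<Sum>j<r. 0)"
    by (intro tendsto_sum L) auto
  then have "(\<lambda>n. cnorm (mat_cstar r A) (s n \<ominus>\<^bsub>mat_cstar r A\<^esub> mk_mat r L)) \<longlonglongrightarrow> 0"
    by (intro tendsto_sandwich[of "\<lambda>_. 0" "\<lambda>n. cnorm (mat_cstar r A) (s n \<ominus>\<^bsub>mat_cstar r A\<^esub> mk_mat r L)" sequentially
          "\<lambda>n. \<Sum>i<r. \<Sum>j<r. cnorm A (s n i j \<ominus> L i j)"] always_eventually allI le)
      (simp_all add: mat_norm_nonneg[OF d])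
  then show "\<exists>x\<in>carrier (mat_cstar r A). (\<lambda>n. cnorm (mat_cstar r A) (s n \<ominus>\<^bsub>mat_cstar r A\<^esub> x)) \<longlonglongrightarrow> 0"
    using L' by (intro bexI[of _ "mk_mat r L"]) auto
qed

end

section \<open>Completely positive contractions\<close>

context cstar_algebra
begin

text \<open>The approximate unit found in the ambient algebra is \<open>1 - (1 - s)^N\<close> with
  \<open>s\<close> coming from \<open>A\<close>. It lies in the image of \<open>A\<close> by
  induction on \<open>N\<close>: if \<open>e\<close> realizes exponent \<open>N\<close>, then
  \<open>s + e - s e\<close> realizes \<open>N + 1\<close>.\<close>

lemma approx_unit:
  assumes "finite I" "\<And>i. i \<in> I \<Longrightarrow> z i \<in> carrier A" "\<epsilon> > 0"
  obtains e where "e \<in> carrier A" "star A e = e" "cnorm A e \<le> 1" "\<And>i. i \<in> I \<Longrightarrow> cnorm A (z i \<ominus> e \<otimes> z i) < \<epsilon>"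
proof -
  let ?S = "\<Sum>i\<in>I. emb A (z i) * adj (emb A (z i))"
  obtain t N u where u: "u = 1 - (1 - t *\<^sub>R ?S) ^ N" "adj u = u" "norm u \<le> 1"
    "\<And>i. i \<in> I \<Longrightarrow> norm (emb A (z i) - u * emb A (z i)) < \<epsilon>"
    by (rule approx_unit_exists[OF assms(1,3), of "\<lambda>i. emb A (z i)"]) (rule that)
  define s where "s = complex_of_real t \<odot> (\<Oplus>i\<in>I. z i \<otimes> star A (z i))"
  have s: "s \<in> carrier A" unfolding s_def using assms by (intro smult_in finsum_mult_closed star_closed) auto
  have "emb A s = t *\<^sub>R ?S"
    unfolding s_def using assms
    by (subst emb_smult) (auto intro!: finsum_mult_closed star_closed sum.cong simp: emb_finsum_mult scaleR_scaleC star_closed emb_star)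
  moreover have "\<exists>e\<in>carrier A. emb A e = 1 - (1 - emb A s) ^ N" for N
  proof (induction N)
    case 0 show ?case by (intro bexI[of _ \<zero>]) auto
  next
    case (Suc N)
    then obtain e where e: "e \<in> carrier A" "emb A e = 1 - (1 - emb A s) ^ N" by blast
    have "(1 - emb A s) ^ Suc N = (1 - emb A s) * (1 - emb A e)" by (simp add: e)
    then have "emb A (s \<oplus> e \<ominus> s \<otimes> e) = 1 - (1 - emb A s) ^ Suc N"
      using s e(1) by (simp add: emb_add emb_diff emb_mult m_closed algebra_simps)
    then show ?case using s e(1) m_closed by (intro bexI[of _ "s \<oplus> e \<ominus> s \<otimes> e"]) auto
  qed
  ultimately obtain e where e: "e \<in> carrier A" "emb A e = u" using u(1) by metis
  show ?thesis
  proof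
    show "e \<in> carrier A" by (rule e)
    show "star A e = e" using u(2) e emb_inject[of "star A e" e] by (simp add: emb_star star_closed)
    show "cnorm A e \<le> 1" using u(3) norm_emb[OF e(1)] e by simp
    fix i assume i: "i \<in> I"
    show "cnorm A (z i \<ominus> e \<otimes> z i) < \<epsilon>"
      using u(4)[OF i] assms(2)[OF i] e by (simp add: norm_emb[symmetric] emb_diff emb_mult m_closed)
  qed
qed

text \<open>If X is D^*D, the form at \<open>v\<close> is the inner product of Dv with itself. The
  entries of \<open>v\<close> may be arbitrary in the ambient algebra, so its unit is available as a
  coefficient.\<close>

lemma pos_quad_form:
  assumes X: "X \<in> mats r (carrier A)" and p: "positive (mat_cstar r A) X"
  shows "pos (ip r v (mv r (\<lambda>i j. emb A (X i j)) v))"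
proof -
  obtain D where D: "D \<in> mats r (carrier A)" "X = star (mat_cstar r A) D \<otimes>\<^bsub>mat_cstar r A\<^esub> D"
    using p by (auto simp: positive_def)
  let ?D = "\<lambda>i j. emb A (D i j)"
  have "ip r (mv r ?D v) (mv r ?D v) = ip r v (mv r (\<lambda>i j. \<Sum>k<r. adj (?D k i) * ?D k j) v)"
    unfolding ip_mv_left mv_mult ..
  also have "\<dots> = ip r v (mv r (\<lambda>i j. emb A (X i j)) v)"
    unfolding D(2) by (rule ip_cong) (simp_all add: mv_def mat_emb mat_closed D(1))
  finally show ?thesis using pos_ip by metis
qed

end

section \<open>The Schwarz inequality and complete contractivity\<close>

locale cpc_map = A: cstar_algebra A + B: cstar_algebra B
  for A :: "'a cstar" and B :: "'b cstar" +
  fixes \<theta> :: "'a \<Rightarrow> 'b"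
  assumes cpc: "cpc A B \<theta>"
begin

lemma map_closed [simp, intro]: "x \<in> carrier A \<Longrightarrow> \<theta> x \<in> carrier B"
  and map_add: "x \<in> carrier A \<Longrightarrow> y \<in> carrier A \<Longrightarrow> \<theta> (x \<oplus>\<^bsub>A\<^esub> y) = \<theta> x \<oplus>\<^bsub>B\<^esub> \<theta> y"
  and map_smult: "x \<in> carrier A \<Longrightarrow> \<theta> (c \<odot>\<^bsub>A\<^esub> x) = c \<odot>\<^bsub>B\<^esub> \<theta> x"
  and map_star: "x \<in> carrier A \<Longrightarrow> \<theta> (star A x) = star B (\<theta> x)"
  and map_norm_le: "x \<in> carrier A \<Longrightarrow> cnorm B (\<theta> x) \<le> cnorm A x"
  and map_positive: "r \<ge> 1 \<Longrightarrow> X \<in> mats r (carrier A) \<Longrightarrow> positive (mat_cstar r A) X \<Longrightarrow>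
    positive (mat_cstar r B) (amplify r \<theta> X)"
  using cpc unfolding cpc_def completely_positive_def star_linear_def by auto

lemma map_minus: "x \<in> carrier A \<Longrightarrow> \<theta> (\<ominus>\<^bsub>A\<^esub> x) = \<ominus>\<^bsub>B\<^esub> \<theta> x"
  by (simp add: A.minus_eq_smult B.minus_eq_smult map_smult)

lemma map_diff: "x \<in> carrier A \<Longrightarrow> y \<in> carrier A \<Longrightarrow> \<theta> (x \<ominus>\<^bsub>A\<^esub> y) = \<theta> x \<ominus>\<^bsub>B\<^esub> \<theta> y"
  by (simp add: a_minus_def map_add map_minus)

lemma map_zero [simp]: "\<theta> \<zero>\<^bsub>A\<^esub> = \<zero>\<^bsub>B\<^esub>"
  using map_smult[of "\<zero>\<^bsub>A\<^esub>" 0] B.smult_l_null[of "\<theta> \<zero>\<^bsub>A\<^esub>"] by simp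

lemma map_finsum: "finite S \<Longrightarrow> f \<in> S \<rightarrow> carrier A \<Longrightarrow> \<theta> (\<Oplus>\<^bsub>A\<^esub>i\<in>S. f i) = (\<Oplus>\<^bsub>B\<^esub>i\<in>S. \<theta> (f i))"
  by (induction S rule: finite_induct) (auto simp: map_add Pi_iff)

lemma amplify_in: "X \<in> mats r (carrier A) \<Longrightarrow> amplify r \<theta> X \<in> mats r (carrier B)"
  unfolding amplify_def by (intro mk_mat_in map_closed) (rule mats_entry)

lemma map_pos_quad_form:
  assumes "r \<ge> 1" "X \<in> mats r (carrier A)" "positive (mat_cstar r A) X"
  shows "pos (ip r v (mv r (\<lambda>i j. emb B (\<theta> (X i j))) v))"
proof -
  have "pos (ip r v (mv r (\<lambda>i j. emb B (amplify r \<theta> X i j)) v))"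
    by (rule B.pos_quad_form[OF amplify_in[OF assms(2)] map_positive[OF assms]])
  also have "ip r v (mv r (\<lambda>i j. emb B (amplify r \<theta> X i j)) v) = ip r v (mv r (\<lambda>i j. emb B (\<theta> (X i j))) v)"
    by (rule ip_cong) (simp_all add: mv_def amplify_def)
  finally show ?thesis .
qed

lemma norm_emb_map_diff_le:
  assumes "x \<in> carrier A" "y \<in> carrier A"
  shows "norm (emb B (\<theta> x) - emb B (\<theta> y)) \<le> cnorm A (x \<ominus>\<^bsub>A\<^esub> y)"
proof -
  have "emb B (\<theta> x) - emb B (\<theta> y) = emb B (\<theta> (x \<ominus>\<^bsub>A\<^esub> y))" using assms by (simp add: map_diff B.emb_diff)
  then show ?thesis using map_norm_le[of "x \<ominus>\<^bsub>A\<^esub> y"] assms by (simp add: B.norm_emb)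
qed

lemma tendsto_emb_map:
  assumes "\<And>n. f n \<in> carrier A" "x \<in> carrier A" "(\<lambda>n. cnorm A (x \<ominus>\<^bsub>A\<^esub> f n)) \<longlonglongrightarrow> 0"
  shows "(\<lambda>n. emb B (\<theta> (f n))) \<longlonglongrightarrow> emb B (\<theta> x)"
proof -
  have "(\<lambda>n. emb B (\<theta> (f n)) - emb B (\<theta> x)) \<longlonglongrightarrow> 0"
  proof (rule Lim_null_comparison[OF always_eventually assms(3)], rule allI)
    fix n show "norm (emb B (\<theta> (f n)) - emb B (\<theta> x)) \<le> cnorm A (x \<ominus>\<^bsub>A\<^esub> f n)"
      using norm_emb_map_diff_le[of "f n" x] A.cnorm_diff_commute[of x "f n"] assms by simp
  qed
  then show ?thesis by (rule LIM_zero_cancel)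
qed

text \<open>The Schwarz inequality, from positivity of the matrix \<open>\<theta> (z\<^sub>i\<^sup>* z\<^sub>j)\<close> with an approximate unit
  adjoined to the \<open>z\<^sub>i\<close>.\<close>

lemma schwarz:
  assumes z: "\<And>i. i < n \<Longrightarrow> z i \<in> carrier A"
  shows "pos (ip n v (mv n (\<lambda>i j. emb B (\<theta> (star A (z i) \<otimes>\<^bsub>A\<^esub> z j))) v)
    - adj (\<Sum>i<n. emb B (\<theta> (z i)) * v i) * (\<Sum>i<n. emb B (\<theta> (z i)) * v i))"
proof -
  let ?\<Theta> = "\<lambda>i j. emb B (\<theta> (star A (z i) \<otimes>\<^bsub>A\<^esub> z j))"
  have approx: "pos (ip n v (mv n ?\<Theta> v) - adj (\<Sum>i<n. emb B (\<theta> (e \<otimes>\<^bsub>A\<^esub> z i)) * v i) * (\<Sum>i<n. emb B (\<theta> (e \<otimes>\<^bsub>A\<^esub> z i)) * v i))"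
    if e: "e \<in> carrier A" "star A e = e" "cnorm A e \<le> 1" for e
  proof -
    define y where "y = z(n := e)"
    have y: "y i \<in> carrier A" if "i < Suc n" for i using that z e by (auto simp: y_def less_Suc_eq)
    define X where "X = mk_mat (Suc n) (\<lambda>i j. star A (y i) \<otimes>\<^bsub>A\<^esub> y j)"
    have X: "X \<in> mats (Suc n) (carrier A)" unfolding X_def by (intro mk_mat_in A.m_closed A.star_closed y)
    \<comment> \<open>\<open>D\<close> has the family \<open>y\<close> as its row 0 and zeros
      elsewhere, so that \<open>X\<close> is \<open>D^* D\<close>.\<close>
    define D where "D = mk_mat (Suc n) (\<lambda>k j. if k = 0 then y j else \<zero>\<^bsub>A\<^esub>)"
    have D: "D \<in> mats (Suc n) (carrier A)" unfolding D_def using y by (intro mk_mat_in) auto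
    have "X = star (mat_cstar (Suc n) A) D \<otimes>\<^bsub>mat_cstar (Suc n) A\<^esub> D"
    proof (rule A.mat_emb_eqI[OF X])
      fix i j assume ij: "i < Suc n" "j < Suc n"
      have "emb A ((star (mat_cstar (Suc n) A) D \<otimes>\<^bsub>mat_cstar (Suc n) A\<^esub> D) i j)
        = (\<Sum>k<Suc n. adj (emb A (D k i)) * emb A (D k j))"
        using ij D by (simp add: A.mat_emb A.mat_closed del: sum.lessThan_Suc)
      also have "\<dots> = (\<Sum>k<Suc n. if k = 0 then adj (emb A (y i)) * emb A (y j) else 0)"
        using ij by (intro sum.cong) (auto simp: D_def)
      also have "\<dots> = emb A (X i j)" using ij y by (simp add: X_def A.emb_mult A.emb_star A.star_closed del: sum.lessThan_Suc)
      finally show "emb A (X i j) = emb A ((star (mat_cstar (Suc n) A) D \<otimes>\<^bsub>mat_cstar (Suc n) A\<^esub> D) i j)" ..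
    qed (intro A.mat_closed D)
    then have "positive (mat_cstar (Suc n) A) X" using D unfolding positive_def by auto
    define w where "w = (\<Sum>i<n. emb B (\<theta> (e \<otimes>\<^bsub>A\<^esub> z i)) * v i)"
    \<comment> \<open>This entry completes the square. In the form at \<open>u\<close> the element
      \<open>adj w * w\<close> is subtracted twice and
      \<open>adj w * emb B (\<theta> (e \<otimes> e)) * w\<close> is added; the latter is at most
      \<open>adj w * w\<close>, so one subtraction survives.\<close>
    define u where "u = v(n := - w)"
    let ?X = "\<lambda>i j. emb B (\<theta> (X i j))"
    have "pos (ip (Suc n) u (mv (Suc n) ?X u))"
      by (rule map_pos_quad_form[OF _ X \<open>positive (mat_cstar (Suc n) A) X\<close>]) simp
    also have "ip (Suc n) u (mv (Suc n) ?X u) = ip n v (mv n ?\<Theta> v) - adj w * w - adj w * w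
        + adj w * emb B (\<theta> (e \<otimes>\<^bsub>A\<^esub> e)) * w"
    proof -
      have Xij: "?X i j = ?\<Theta> i j" if "i < n" "j < n" for i j using that by (simp add: X_def y_def)
      have Xnj: "?X n j = emb B (\<theta> (e \<otimes>\<^bsub>A\<^esub> z j))" if "j < n" for j using that e by (simp add: X_def y_def)
      have Xin: "?X i n = adj (emb B (\<theta> (e \<otimes>\<^bsub>A\<^esub> z i)))" if "i < n" for i
      proof -
        have "star A (e \<otimes>\<^bsub>A\<^esub> z i) = star A (z i) \<otimes>\<^bsub>A\<^esub> e" using that z e by (simp add: A.star_mult)
        then show ?thesis using that z e
          by (simp add: X_def y_def B.emb_star[symmetric] map_star[symmetric] A.m_closed)
      qed
      have Xnn: "?X n n = emb B (\<theta> (e \<otimes>\<^bsub>A\<^esub> e))" using e by (simp add: X_def y_def)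
      have 1: "mv (Suc n) ?X u i = mv n ?\<Theta> v i - adj (emb B (\<theta> (e \<otimes>\<^bsub>A\<^esub> z i))) * w" if "i < n" for i
        using that by (simp add: mv_def u_def Xij Xin)
      have 2: "mv (Suc n) ?X u n = w - emb B (\<theta> (e \<otimes>\<^bsub>A\<^esub> e)) * w"
        by (simp add: mv_def u_def Xnn) (simp add: w_def Xnj)
      have "ip (Suc n) u (mv (Suc n) ?X u) = (\<Sum>i<n. adj (v i) * mv (Suc n) ?X u i) - adj w * mv (Suc n) ?X u n"
        by (simp add: ip_def u_def adj_minus)
      also have "(\<Sum>i<n. adj (v i) * mv (Suc n) ?X u i)
        = (\<Sum>i<n. adj (v i) * mv n ?\<Theta> v i - adj (emb B (\<theta> (e \<otimes>\<^bsub>A\<^esub> z i)) * v i) * w)"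
        by (intro sum.cong refl) (simp add: 1 right_diff_distrib adj_mult mult.assoc)
      also have "\<dots> = ip n v (mv n ?\<Theta> v) - adj w * w"
        by (simp add: ip_def sum_subtractf w_def adj_sum sum_distrib_right)
      finally show ?thesis by (simp add: 2 right_diff_distrib mult.assoc)
    qed
    finally have 1: "pos (ip n v (mv n ?\<Theta> v) - adj w * w - adj w * w + adj w * emb B (\<theta> (e \<otimes>\<^bsub>A\<^esub> e)) * w)" .
    have ee: "e \<otimes>\<^bsub>A\<^esub> e \<in> carrier A" "star A (e \<otimes>\<^bsub>A\<^esub> e) = e \<otimes>\<^bsub>A\<^esub> e" using e by (auto simp: A.m_closed A.star_mult)
    have "pos (1 *\<^sub>R (adj w * w) - adj w * emb B (\<theta> (e \<otimes>\<^bsub>A\<^esub> e)) * w)"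
    proof (rule pos_conj_le)
      show "adj (emb B (\<theta> (e \<otimes>\<^bsub>A\<^esub> e))) = emb B (\<theta> (e \<otimes>\<^bsub>A\<^esub> e))"
        using ee by (simp add: B.emb_star[symmetric] map_star[symmetric])
      have "cnorm A (e \<otimes>\<^bsub>A\<^esub> e) \<le> 1"
        using A.norm_mult[OF e(1) e(1)] mult_mono[OF e(3) e(3)] A.norm_nonneg[OF e(1)] by simp
      then show "norm (emb B (\<theta> (e \<otimes>\<^bsub>A\<^esub> e))) \<le> 1" using map_norm_le[OF ee(1)] ee by (simp add: B.norm_emb)
    qed
    from pos_add[OF 1 this] show ?thesis by (simp add: w_def)
  qed
  have "\<exists>e. e \<in> carrier A \<and> star A e = e \<and> cnorm A e \<le> 1 \<and> (\<forall>i<n. cnorm A (z i \<ominus>\<^bsub>A\<^esub> e \<otimes>\<^bsub>A\<^esub> z i) < inverse (real (Suc m)))" for m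
    using A.approx_unit[of "{..<n}" z "inverse (real (Suc m))"] z by (metis finite_lessThan lessThan_iff inverse_positive_iff_positive of_nat_0_less_iff zero_less_Suc)
  then obtain e where e: "\<And>m. e m \<in> carrier A" "\<And>m. star A (e m) = e m" "\<And>m. cnorm A (e m) \<le> 1"
    "\<And>m i. i < n \<Longrightarrow> cnorm A (z i \<ominus>\<^bsub>A\<^esub> e m \<otimes>\<^bsub>A\<^esub> z i) < inverse (real (Suc m))" by metis
  have lim: "(\<lambda>m. emb B (\<theta> (e m \<otimes>\<^bsub>A\<^esub> z i))) \<longlonglongrightarrow> emb B (\<theta> (z i))" if "i < n" for i
  proof (rule tendsto_emb_map)
    show "e m \<otimes>\<^bsub>A\<^esub> z i \<in> carrier A" for m using e z that by (simp add: A.m_closed)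
    then have "0 \<le> cnorm A (z i \<ominus>\<^bsub>A\<^esub> e m \<otimes>\<^bsub>A\<^esub> z i)" for m using z[OF that] by (simp add: A.norm_nonneg)
    then show "(\<lambda>m. cnorm A (z i \<ominus>\<^bsub>A\<^esub> e m \<otimes>\<^bsub>A\<^esub> z i)) \<longlonglongrightarrow> 0"
      by (intro tendsto_sandwich[OF _ _ tendsto_const LIMSEQ_inverse_real_of_nat] always_eventually allI)
        (auto intro: less_imp_le e(4)[OF that] simp del: of_nat_Suc)
  qed (rule z[OF that])
  show ?thesis
  proof (rule pos_limit)
    let ?w = "\<lambda>m. \<Sum>i<n. emb B (\<theta> (e m \<otimes>\<^bsub>A\<^esub> z i)) * v i"
    show "pos (ip n v (mv n ?\<Theta> v) - adj (?w m) * ?w m)" for m by (rule approx[OF e(1-3)])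
    show "(\<lambda>m. ip n v (mv n ?\<Theta> v) - adj (?w m) * ?w m) \<longlonglongrightarrow>
      ip n v (mv n ?\<Theta> v) - adj (\<Sum>i<n. emb B (\<theta> (z i)) * v i) * (\<Sum>i<n. emb B (\<theta> (z i)) * v i)"
      by (intro tendsto_intros tendsto_adj tendsto_sum lim) auto
  qed
qed

text \<open>A positive algebra-valued sesquilinear form, conjugate linear in \<open>u\<close>, that
  measures how far \<theta> is from being multiplicative.\<close>

definition defect :: "'a \<Rightarrow> 'a \<Rightarrow> 'b cfam unitz" where
  "defect u v = emb B (\<theta> (star A u \<otimes>\<^bsub>A\<^esub> v)) - adj (emb B (\<theta> u)) * emb B (\<theta> v)"

lemma pos_defect:
  assumes "u \<in> carrier A"
  shows "pos (defect u u)"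
  using schwarz[of 1 "\<lambda>_. u" "\<lambda>_. 1"] assms by (simp add: defect_def ip_def mv_def)

text \<open>The Schwarz inequality for the pair \<open>u\<close>, \<open>v\<close> says that the 2
  by 2 form of the defects is positive; \<open>quad_form_bound\<close> then gives Cauchy-Schwarz. A
  small defect at \<open>u\<close> alone thus forces small defects at \<open>u\<close> and any
  \<open>v\<close> with bounded defect.\<close>

lemma norm_defect_le:
  assumes u: "u \<in> carrier A" and v: "v \<in> carrier A"
  shows "(norm (defect u v))\<^sup>2 \<le> norm (defect u u) * norm (defect v v)"
proof (rule quad_form_bound)
  fix x y
  have "star A (star A u \<otimes>\<^bsub>A\<^esub> v) = star A v \<otimes>\<^bsub>A\<^esub> u"
    using u v by (simp add: A.star_mult A.star_closed A.star_star)
  then have ad: "adj (defect u v) = defect v u"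
    using u v by (simp add: defect_def adj_diff adj_mult B.emb_star[symmetric] map_star[symmetric] A.m_closed A.star_closed A.star_star)
  have "pos (ip 2 (\<lambda>i. if i = 0 then x else y)
       (mv 2 (\<lambda>i j. emb B (\<theta> (star A (if i = 0 then u else v) \<otimes>\<^bsub>A\<^esub> (if j = 0 then u else v)))) (\<lambda>i. if i = 0 then x else y))
    - adj (\<Sum>i<(2::nat). emb B (\<theta> (if i = 0 then u else v)) * (if i = 0 then x else y)) *
      (\<Sum>i<(2::nat). emb B (\<theta> (if i = 0 then u else v)) * (if i = 0 then x else y)))"
    by (rule schwarz) (use u v in auto)
  then show "pos (adj x * defect u u * x + adj x * defect u v * y + adj y * adj (defect u v) * x + adj y * defect v v * y)"
    unfolding ad
    by (simp add: ip_def mv_def numeral_2_eq_2 defect_def adj_add adj_mult algebra_simps)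
qed

text \<open>If \<open>x\<close> is \<open>star A b \<otimes> b\<close>, its image is the defect at
  \<open>b\<close> plus \<open>adj (emb B (\<theta> b)) * emb B (\<theta> b)\<close>, a sum of two
  positive elements.\<close>

lemma map_pos:
  assumes "x \<in> carrier A" "pos (emb A x)"
  shows "pos (emb B (\<theta> x))"
proof -
  obtain b where b: "b \<in> carrier A" "x = star A b \<otimes>\<^bsub>A\<^esub> b"
    using assms A.positive_iff by (auto simp: positive_def)
  from pos_add[OF pos_defect[OF b(1)] pos_adj_mult[of "emb B (\<theta> b)"]] show ?thesis
    by (simp add: defect_def b(2))
qed

text \<open>With \<open>H = X\<^sup>* X\<close>, the Schwarz inequality for the rows of \<open>X\<close> bounds \<open>\<parallel>\<theta>(X) v\<parallel>\<^sup>2\<close> by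
  \<open>\<parallel>\<langle>v, \<theta>(H) v\<rangle>\<parallel>\<close>, and \<open>e H e \<le> \<parallel>X\<parallel>\<^sup>2 e\<^sup>2\<close> for an approximate unit \<open>e\<close>.\<close>

theorem completely_contractive:
  assumes r: "r \<ge> 1" and X: "X \<in> mats r (carrier A)"
  shows "mat_norm B r (amplify r \<theta> X) \<le> mat_norm A r X"
proof -
  interpret M: cstar_algebra "mat_cstar r A" by (rule A.cstar_algebra_mat)
  define c where "c = mat_norm A r X"
  have c: "c \<ge> 0" by (simp add: c_def A.mat_norm_nonneg X)
  let ?M = "mat_cstar r A"
  have Xe: "\<And>i j. i < r \<Longrightarrow> j < r \<Longrightarrow> X i j \<in> carrier A" by (rule mats_entry[OF X])
  define H where "H = star ?M X \<otimes>\<^bsub>?M\<^esub> X"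
  have H: "H \<in> mats r (carrier A)" unfolding H_def by (intro A.mat_closed X)
  have He: "\<And>i j. i < r \<Longrightarrow> j < r \<Longrightarrow> H i j \<in> carrier A" by (rule mats_entry[OF H])
  have nH: "norm (emb ?M H) = c\<^sup>2"
    using M.norm_star_mult[of X] X H by (simp add: M.norm_emb H_def c_def)
  have sH: "star ?M H = H"
    using M.star_mult[of "star ?M X" X] M.star_star[of X] M.star_closed[of X] X by (simp add: H_def)
  have starH: "star A (H i j) = H j i" if "i < r" "j < r" for i j
    using that fun_cong[OF fun_cong[OF sH, of j], of i] by (simp add: mat_cstar_apply)
  show ?thesis
    unfolding B.mat_norm_le_iff[OF amplify_in[OF X]] c_def[symmetric]
  proof (intro conjI allI impI)
    show "0 \<le> c" by (rule c)
    fix v0 :: "nat \<Rightarrow> 'b"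
    define v where "v = (\<lambda>i. emb B (v0 i))"
    let ?H = "\<lambda>i j. emb B (\<theta> (H i j))"
    let ?Y = "mv r (\<lambda>i j. emb B (amplify r \<theta> X i j)) v"
    have 1: "pos (ip r v (mv r ?H v) - ip r ?Y ?Y)"
    proof -
      let ?T = "\<lambda>k i j. emb B (\<theta> (star A (X k i) \<otimes>\<^bsub>A\<^esub> X k j))"
      have "pos (\<Sum>k<r. ip r v (mv r (?T k) v)
          - adj (\<Sum>i<r. emb B (\<theta> (X k i)) * v i) * (\<Sum>i<r. emb B (\<theta> (X k i)) * v i))"
        by (intro pos_sum schwarz) (auto intro: Xe)
      also have "\<dots> = (\<Sum>k<r. ip r v (mv r (?T k) v)) - ip r ?Y ?Y"
        unfolding sum_subtractf ip_def[of r ?Y] by (simp add: mv_def amplify_def)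
      also have "(\<Sum>k<r. ip r v (mv r (?T k) v)) = ip r v (mv r (\<lambda>i j. \<Sum>k<r. ?T k i j) v)"
        unfolding ip_def mv_def sum_distrib_right sum_distrib_left
        by (subst sum.swap, rule sum.cong[OF refl], subst sum.swap) simp
      also have "\<dots> = ip r v (mv r ?H v)"
      proof (rule ip_cong)
        fix i assume i: "i < r"
        have "?H i j = (\<Sum>k<r. ?T k i j)" if "j < r" for j
        proof -
          have "H i j = (\<Oplus>\<^bsub>A\<^esub>k\<in>{..<r}. star A (X k i) \<otimes>\<^bsub>A\<^esub> X k j)"
            unfolding H_def mat_cstar_apply(1)[OF i that] using i that Xe
            by (intro A.finsum_cong') (auto simp: mat_cstar_apply A.m_closed A.star_closed)
          then show ?thesis using i that Xe
            by (simp add: map_finsum B.emb_finsum A.m_closed A.star_closed Pi_iff)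
        qed
        then show "mv r (\<lambda>i j. \<Sum>k<r. ?T k i j) v i = mv r ?H v i" by (simp add: mv_def)
      qed simp
      finally show ?thesis .
    qed
    have approx: "pos (c\<^sup>2 *\<^sub>R ip r v v - ip r v (mv r (\<lambda>i j. emb B (\<theta> (e \<otimes>\<^bsub>A\<^esub> (H i j \<otimes>\<^bsub>A\<^esub> e)))) v))"
      if e: "e \<in> carrier A" "star A e = e" "cnorm A e \<le> 1" for e
    proof -
      define E where "E = mk_mat r (\<lambda>i j. if i = j then e else \<zero>\<^bsub>A\<^esub>)"
      have E: "E \<in> mats r (carrier A)" unfolding E_def using e by (intro mk_mat_in) auto
      \<comment> \<open>\<open>G\<close> is \<open>E^* (c^2 - H) E\<close>. The scalar is attached
        to a copy of \<open>E\<close> because the matrix algebra need not have a unit; positivity is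
        read off in the ambient algebra from \<parallel>H\<parallel> = c^2.\<close>
      define G where "G = star ?M E \<otimes>\<^bsub>?M\<^esub> (complex_of_real (c\<^sup>2) \<odot>\<^bsub>?M\<^esub> E) \<ominus>\<^bsub>?M\<^esub> star ?M E \<otimes>\<^bsub>?M\<^esub> (H \<otimes>\<^bsub>?M\<^esub> E)"
      have G1: "star ?M E \<otimes>\<^bsub>?M\<^esub> (complex_of_real (c\<^sup>2) \<odot>\<^bsub>?M\<^esub> E) \<in> mats r (carrier A)"
        and G2: "star ?M E \<otimes>\<^bsub>?M\<^esub> (H \<otimes>\<^bsub>?M\<^esub> E) \<in> mats r (carrier A)"
        by (intro A.mat_closed E H)+
      have G: "G \<in> mats r (carrier A)"
        using M.minus_closed[of "star ?M E \<otimes>\<^bsub>?M\<^esub> (complex_of_real (c\<^sup>2) \<odot>\<^bsub>?M\<^esub> E)"] G1 G2 unfolding G_def by simp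
      have "emb ?M G = c\<^sup>2 *\<^sub>R (adj (emb ?M E) * emb ?M E) - adj (emb ?M E) * emb ?M H * emb ?M E"
        unfolding G_def using G1 G2 E H
        by (simp add: M.emb_diff M.emb_mult M.emb_star M.emb_smult M.star_closed[simplified] M.m_closed[simplified]
            A.mat_closed scaleR_scaleC mult.assoc)
      moreover have "pos \<dots>"
        by (rule pos_conj_le) (use nH sH H in \<open>simp_all add: M.emb_star[symmetric]\<close>)
      ultimately have "positive ?M G" using G by (simp add: M.positive_iff)
      have Gij: "G i j = (if i = j then complex_of_real (c\<^sup>2) \<odot>\<^bsub>A\<^esub> (e \<otimes>\<^bsub>A\<^esub> e) else \<zero>\<^bsub>A\<^esub>) \<ominus>\<^bsub>A\<^esub> e \<otimes>\<^bsub>A\<^esub> (H i j \<otimes>\<^bsub>A\<^esub> e)"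
        if ij: "i < r" "j < r" for i j
      proof -
        have Ekl: "emb A (E k l) = (if k = l then emb A e else 0)" if "k < r" "l < r" for k l
          using that by (simp add: E_def)
        have "emb A (G i j) = (\<Sum>k<r. adj (emb A (E k i)) * (complex_of_real (c\<^sup>2) *\<^sub>C emb A (E k j)))
            - (\<Sum>k<r. adj (emb A (E k i)) * (\<Sum>l<r. emb A (H k l) * emb A (E l j)))"
          unfolding G_def A.mat_minus_apply[OF G1 G2] mk_mat_apply[OF ij]
          using ij mats_entry[OF G1 ij] mats_entry[OF G2 ij] E H
          by (simp add: A.emb_diff A.mat_emb A.mat_closed)
        also have "(\<Sum>k<r. adj (emb A (E k i)) * (\<Sum>l<r. emb A (H k l) * emb A (E l j)))
          = (\<Sum>k<r. if k = i then adj (emb A e) * (\<Sum>l<r. if l = j then emb A (H k l) * emb A e else 0) else 0)"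
        proof -
          have "(\<Sum>l<r. f l * (if l = j then a else 0)) = f j * a" for f :: "nat \<Rightarrow> 'a cfam unitz" and a
            using ij by (simp add: if_distrib cong: if_cong)
          then show ?thesis using ij by (intro sum.cong refl) (auto simp: Ekl)
        qed
        also have "(\<Sum>k<r. adj (emb A (E k i)) * (complex_of_real (c\<^sup>2) *\<^sub>C emb A (E k j)))
          = (\<Sum>k<r. if k = i then adj (emb A e) * (complex_of_real (c\<^sup>2) *\<^sub>C emb A (E k j)) else 0)"
          using ij by (intro sum.cong refl) (auto simp: Ekl)
        finally have "emb A (G i j) = emb A ((if i = j then complex_of_real (c\<^sup>2) \<odot>\<^bsub>A\<^esub> (e \<otimes>\<^bsub>A\<^esub> e) else \<zero>\<^bsub>A\<^esub>) \<ominus>\<^bsub>A\<^esub> e \<otimes>\<^bsub>A\<^esub> (H i j \<otimes>\<^bsub>A\<^esub> e))"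
          using ij e He by (simp add: Ekl A.emb_diff A.emb_mult A.emb_smult A.m_closed A.emb_star[symmetric])
        then show ?thesis
          using mats_entry[OF G ij] e He[OF ij] by (subst (asm) A.emb_inject) (auto simp: A.m_closed)
      qed
      have "pos (ip r v (mv r (\<lambda>i j. emb B (\<theta> (G i j))) v))"
        by (rule map_pos_quad_form[OF r G \<open>positive ?M G\<close>])
      also have "ip r v (mv r (\<lambda>i j. emb B (\<theta> (G i j))) v)
        = c\<^sup>2 *\<^sub>R (\<Sum>i<r. adj (v i) * emb B (\<theta> (e \<otimes>\<^bsub>A\<^esub> e)) * v i) - ip r v (mv r (\<lambda>i j. emb B (\<theta> (e \<otimes>\<^bsub>A\<^esub> (H i j \<otimes>\<^bsub>A\<^esub> e)))) v)"
      proof -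
        have "mv r (\<lambda>i j. emb B (\<theta> (G i j))) v i = c\<^sup>2 *\<^sub>R (emb B (\<theta> (e \<otimes>\<^bsub>A\<^esub> e)) * v i)
            - mv r (\<lambda>i j. emb B (\<theta> (e \<otimes>\<^bsub>A\<^esub> (H i j \<otimes>\<^bsub>A\<^esub> e)))) v i" if i: "i < r" for i
        proof -
          have "mv r (\<lambda>i j. emb B (\<theta> (G i j))) v i
            = (\<Sum>j<r. (if i = j then c\<^sup>2 *\<^sub>R (emb B (\<theta> (e \<otimes>\<^bsub>A\<^esub> e)) * v j) else 0) - emb B (\<theta> (e \<otimes>\<^bsub>A\<^esub> (H i j \<otimes>\<^bsub>A\<^esub> e))) * v j)"
            unfolding mv_def using i e He
            by (intro sum.cong refl) (auto simp: Gij map_diff map_smult B.emb_diff B.emb_smult A.m_closed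
                scaleR_scaleC left_diff_distrib)
          then show ?thesis using i by (simp add: sum_subtractf mv_def)
        qed
        then show ?thesis
          by (simp add: ip_def right_diff_distrib sum_subtractf scaleR_sum_right mult.assoc)
      qed
      finally have G: "pos \<dots>" .
      have ee: "e \<otimes>\<^bsub>A\<^esub> e \<in> carrier A" "star A (e \<otimes>\<^bsub>A\<^esub> e) = e \<otimes>\<^bsub>A\<^esub> e" using e by (auto simp: A.m_closed A.star_mult)
      have "cnorm A (e \<otimes>\<^bsub>A\<^esub> e) \<le> 1"
        using A.norm_mult[OF e(1) e(1)] mult_mono[OF e(3) e(3)] A.norm_nonneg[OF e(1)] by simp
      then have "norm (emb B (\<theta> (e \<otimes>\<^bsub>A\<^esub> e))) \<le> 1" using map_norm_le[OF ee(1)] ee by (simp add: B.norm_emb)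
      moreover have "adj (emb B (\<theta> (e \<otimes>\<^bsub>A\<^esub> e))) = emb B (\<theta> (e \<otimes>\<^bsub>A\<^esub> e))"
        using ee by (simp add: B.emb_star[symmetric] map_star[symmetric])
      ultimately have "pos (\<Sum>i<r. 1 *\<^sub>R (adj (v i) * v i) - adj (v i) * emb B (\<theta> (e \<otimes>\<^bsub>A\<^esub> e)) * v i)"
        by (intro pos_sum pos_conj_le)
      then have "pos (c\<^sup>2 *\<^sub>R (ip r v v - (\<Sum>i<r. adj (v i) * emb B (\<theta> (e \<otimes>\<^bsub>A\<^esub> e)) * v i)))"
        by (intro pos_scaleR) (simp_all add: ip_def sum_subtractf)
      from pos_add[OF G this] show ?thesis by (simp add: scaleR_diff_right)
    qed
    have "\<exists>e. e \<in> carrier A \<and> star A e = e \<and> cnorm A e \<le> 1 \<and>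
      (\<forall>p\<in>{..<r}\<times>{..<r}. cnorm A (H (fst p) (snd p) \<ominus>\<^bsub>A\<^esub> e \<otimes>\<^bsub>A\<^esub> H (fst p) (snd p)) < inverse (real (Suc m)))" for m
    proof -
      have f: "finite ({..<r} \<times> {..<r})" by simp
      show ?thesis
        by (rule A.approx_unit[OF f, of "\<lambda>p. H (fst p) (snd p)" "inverse (real (Suc m))"])
          (use He in \<open>auto simp del: of_nat_Suc\<close>)
    qed
    then obtain e where e: "\<And>m. e m \<in> carrier A" "\<And>m. star A (e m) = e m" "\<And>m. cnorm A (e m) \<le> 1"
      "\<And>m i j. i < r \<Longrightarrow> j < r \<Longrightarrow> cnorm A (H i j \<ominus>\<^bsub>A\<^esub> e m \<otimes>\<^bsub>A\<^esub> H i j) < inverse (real (Suc m))"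
      by (metis (no_types, lifting) SigmaI fst_conv lessThan_iff snd_conv)
    \<comment> \<open>The approximate unit is chosen for left multiplication only. Splitting
      \<open>h - e h e = (h - e h) + e (h - h e)\<close> leaves a right-hand error for
      \<open>H i j\<close>, which is the adjoint of the left-hand error for
      \<open>H j i\<close>.\<close>
    have bound: "cnorm A (H i j \<ominus>\<^bsub>A\<^esub> e m \<otimes>\<^bsub>A\<^esub> (H i j \<otimes>\<^bsub>A\<^esub> e m)) \<le> inverse (real (Suc m)) + inverse (real (Suc m))"
      if ij: "i < r" "j < r" for i j m
    proof -
      let ?e = "emb A (e m)" and ?h = "emb A (H i j)"
      have "adj (emb A (H j i)) = ?h" using starH[of j i] He ij by (simp add: A.emb_star[symmetric])
      then have "?h - ?h * ?e = adj (emb A (H j i) - ?e * emb A (H j i))"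
        using e(1,2) by (simp add: adj_diff adj_mult A.emb_star[symmetric])
      then have 1: "norm (?h - ?h * ?e) < inverse (real (Suc m))"
        using e(4)[OF ij(2,1), of m] He[OF ij(2,1)] e(1)[of m] by (simp add: A.norm_emb[symmetric] A.emb_diff A.emb_mult A.m_closed del: of_nat_Suc)
      have 2: "norm (?h - ?e * ?h) < inverse (real (Suc m))"
        using e(4)[OF ij, of m] He[OF ij] e(1)[of m] by (simp add: A.norm_emb[symmetric] A.emb_diff A.emb_mult A.m_closed del: of_nat_Suc)
      have "norm (?e * (?h - ?h * ?e)) \<le> 1 * inverse (real (Suc m))"
        using 1 e(3)[of m] e(1)[of m] by (intro order_trans[OF norm_mult_ineq] mult_mono) (simp_all add: A.norm_emb del: of_nat_Suc)
      then have "norm ((?h - ?e * ?h) + ?e * (?h - ?h * ?e)) \<le> inverse (real (Suc m)) + inverse (real (Suc m))"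
        using 2 norm_triangle_ineq[of "?h - ?e * ?h" "?e * (?h - ?h * ?e)"] by linarith
      also have "(?h - ?e * ?h) + ?e * (?h - ?h * ?e) = ?h - ?e * (?h * ?e)" by (simp add: right_diff_distrib)
      finally have "norm (?h - ?e * (?h * ?e)) \<le> inverse (real (Suc m)) + inverse (real (Suc m))" .
      then show ?thesis
        using He[OF ij] e(1)[of m] by (simp add: A.norm_emb[symmetric] A.emb_diff A.emb_mult A.m_closed del: of_nat_Suc)
    qed
    have lim: "(\<lambda>m. emb B (\<theta> (e m \<otimes>\<^bsub>A\<^esub> (H i j \<otimes>\<^bsub>A\<^esub> e m)))) \<longlonglongrightarrow> ?H i j" if "i < r" "j < r" for i j
    proof (rule tendsto_emb_map)
      show in_A: "e m \<otimes>\<^bsub>A\<^esub> (H i j \<otimes>\<^bsub>A\<^esub> e m) \<in> carrier A" for m using e He that by (simp add: A.m_closed)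
      have l: "(\<lambda>m. inverse (real (Suc m)) + inverse (real (Suc m))) \<longlonglongrightarrow> 0"
        using tendsto_add[OF LIMSEQ_inverse_real_of_nat LIMSEQ_inverse_real_of_nat] by simp
      show "(\<lambda>m. cnorm A (H i j \<ominus>\<^bsub>A\<^esub> e m \<otimes>\<^bsub>A\<^esub> (H i j \<otimes>\<^bsub>A\<^esub> e m))) \<longlonglongrightarrow> 0"
        by (rule tendsto_sandwich[OF _ _ tendsto_const l])
          (intro always_eventually allI bound[OF that] A.norm_nonneg A.minus_closed He that in_A)+
    qed (rule He[OF that])
    have "pos (c\<^sup>2 *\<^sub>R ip r v v - ip r v (mv r ?H v))"
    proof (rule pos_limit)
      show "pos (c\<^sup>2 *\<^sub>R ip r v v - ip r v (mv r (\<lambda>i j. emb B (\<theta> (e m \<otimes>\<^bsub>A\<^esub> (H i j \<otimes>\<^bsub>A\<^esub> e m)))) v))" for m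
        by (rule approx[OF e(1-3)])
      show "(\<lambda>m. c\<^sup>2 *\<^sub>R ip r v v - ip r v (mv r (\<lambda>i j. emb B (\<theta> (e m \<otimes>\<^bsub>A\<^esub> (H i j \<otimes>\<^bsub>A\<^esub> e m)))) v))
        \<longlonglongrightarrow> c\<^sup>2 *\<^sub>R ip r v v - ip r v (mv r ?H v)"
        unfolding ip_def mv_def by (intro tendsto_intros tendsto_sum lim) auto
    qed
    from pos_add[OF this 1] have "pos (c\<^sup>2 *\<^sub>R ip r v v - ip r ?Y ?Y)" by simp
    then have "norm (ip r ?Y ?Y) \<le> norm (c\<^sup>2 *\<^sub>R ip r v v)" by (rule norm_mono[OF pos_ip])
    then have "(cn r ?Y)\<^sup>2 \<le> (c * cn r v)\<^sup>2" by (simp add: cn_power2 power_mult_distrib)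
    then have "cn r ?Y \<le> c * cn r v" by (rule power2_le_imp_le) (simp add: c)
    then show "cn r (mv r (\<lambda>i j. emb B (amplify r \<theta> X i j)) (\<lambda>i. emb B (v0 i))) \<le> c * cn r (\<lambda>i. emb B (v0 i))"
      by (simp add: v_def)
  qed
qed

end

lemma cpc_compose:
  assumes "cpc A B \<theta>" "cpc B C \<eta>"
  shows "cpc A C (\<eta> \<circ> \<theta>)"
proof -
  have amp: "amplify r (\<eta> \<circ> \<theta>) X = amplify r \<eta> (amplify r \<theta> X)" for r X
    by (auto simp: amplify_def mk_mat_def fun_eq_iff)
  have "amplify r \<theta> X \<in> mats r (carrier B)" if "X \<in> mats r (carrier A)" for r X
    using assms(1) mats_entry[OF that] unfolding amplify_def cpc_def completely_positive_def star_linear_def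
    by (intro mk_mat_in) blast
  moreover have "cnorm C (\<eta> (\<theta> x)) \<le> cnorm A x" if "x \<in> carrier A" for x
  proof -
    have "\<theta> x \<in> carrier B" "cnorm B (\<theta> x) \<le> cnorm A x" "\<And>y. y \<in> carrier B \<Longrightarrow> cnorm C (\<eta> y) \<le> cnorm B y"
      using assms that unfolding cpc_def completely_positive_def star_linear_def by auto
    then show ?thesis using order_trans by blast
  qed
  ultimately show ?thesis
    using assms unfolding cpc_def completely_positive_def star_linear_def
    by (auto simp: amp Pi_iff)
qed

section \<open>Systems of approximations\<close>

text \<open>A finite-dimensional subspace is closed. If \<open>s\<close> were a limit of elements of
  the span, their coefficients would be bounded, a subsequence of them would converge, and the limit
  coefficients would express \<open>s\<close> in the span.\<close>

lemma span_insert_distance: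
  fixes S :: "'a::real_normed_vector set"
  assumes fin: "finite S" and K: "\<And>x. x \<in> span S \<Longrightarrow> \<exists>c. x = (\<Sum>s\<in>S. c s *\<^sub>R s) \<and> (\<forall>s\<in>S. \<bar>c s\<bar> \<le> K * norm x)"
    and "K \<ge> 0" and s: "s \<notin> span S"
  shows "\<exists>d>0. \<forall>y\<in>span S. d \<le> norm (s - y)"
proof (rule ccontr)
  assume "\<not> ?thesis"
  then have "\<exists>y\<in>span S. norm (s - y) < inverse (real (Suc n))" for n
    by (meson not_le inverse_positive_iff_positive of_nat_0_less_iff zero_less_Suc)
  then obtain y where y: "\<And>n. y n \<in> span S" "\<And>n. norm (s - y n) < inverse (real (Suc n))" by metis
  have lim_y: "y \<longlonglongrightarrow> s"
  proof -
    have "(\<lambda>n. s - y n) \<longlonglongrightarrow> 0"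
      by (rule Lim_null_comparison[OF always_eventually LIMSEQ_inverse_real_of_nat]) (use y(2) less_imp_le in blast)
    from tendsto_diff[OF tendsto_const[of s] this] show ?thesis by simp
  qed
  obtain c where c: "\<And>n. y n = (\<Sum>t\<in>S. c n t *\<^sub>R t)" "\<And>n t. t \<in> S \<Longrightarrow> \<bar>c n t\<bar> \<le> K * norm (y n)"
    using K[OF y(1)] by metis
  have "norm (y n) \<le> norm s + 1" for n
  proof -
    have "norm (y n) \<le> norm s + norm (s - y n)" using norm_triangle_ineq4[of s "s - y n"] by simp
    moreover have "inverse (real (Suc n)) \<le> 1" by (simp add: field_simps)
    ultimately show ?thesis using y(2)[of n] by linarith
  qed
  then have cb: "\<bar>c n t\<bar> \<le> K * (norm s + 1)" if "t \<in> S" for n t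
    using c(2)[OF that, of n] mult_left_mono[OF _ \<open>K \<ge> 0\<close>, of "norm (y n)" "norm s + 1"] by (meson order_trans)
  have "\<exists>l r. strict_mono (r :: nat \<Rightarrow> nat) \<and> (\<forall>\<epsilon>>0. eventually (\<lambda>n. \<forall>t\<in>S. dist (c (r n) t) (l t) < \<epsilon>) sequentially)"
    by (rule compact_lemma_general[where proj = "\<lambda>x k. x k" and unproj = "\<lambda>x. x" and basis = S, OF fin, rule_format])
      (auto intro!: boundedI cb)
  then obtain l r where r: "strict_mono (r :: nat \<Rightarrow> nat)"
    and l: "\<And>\<epsilon>. \<epsilon> > 0 \<Longrightarrow> eventually (\<lambda>n. \<forall>t\<in>S. dist (c (r n) t) (l t) < \<epsilon>) sequentially" by blast
  have "(\<lambda>n. c (r n) t) \<longlonglongrightarrow> l t" if "t \<in> S" for t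
    unfolding tendsto_iff
  proof (intro allI impI)
    fix e :: real assume "e > 0"
    from l[OF this] show "eventually (\<lambda>n. dist (c (r n) t) (l t) < e) sequentially"
      by (rule eventually_mono) (use that in blast)
  qed
  then have "(\<lambda>n. y (r n)) \<longlonglongrightarrow> (\<Sum>t\<in>S. l t *\<^sub>R t)"
    unfolding c(1) by (intro tendsto_intros) auto
  moreover have "(\<lambda>n. y (r n)) \<longlonglongrightarrow> s"
    using LIMSEQ_subseq_LIMSEQ[OF lim_y r] by (simp add: o_def)
  ultimately have "s = (\<Sum>t\<in>S. l t *\<^sub>R t)" using LIMSEQ_unique by blast
  then have "s \<in> span S" by (simp add: span_sum span_scale span_base)
  then show False using s by blast
qed

text \<open>\<open>finite_dimensional\<close> supplies a spanning set and no basis, so independence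
  is not assumed: a vector in the span of the others receives coefficient 0. Otherwise its distance
  \<open>d\<close> from that span bounds its coefficient by \<parallel>x\<parallel> / d, and the
  induction hypothesis bounds the coefficients of what remains.\<close>

lemma span_coeff_bound:
  fixes S :: "'a::real_normed_vector set"
  assumes "finite S"
  shows "\<exists>K\<ge>0. \<forall>x\<in>span S. \<exists>c. x = (\<Sum>s\<in>S. c s *\<^sub>R s) \<and> (\<forall>s\<in>S. \<bar>c s\<bar> \<le> K * norm x)"
  using assms
proof (induction S rule: finite_induct)
  case empty
  then show ?case by (intro exI[of _ 0]) simp
next
  case (insert s S)
  then obtain K where K: "K \<ge> 0" "\<And>x. x \<in> span S \<Longrightarrow> \<exists>c. x = (\<Sum>s\<in>S. c s *\<^sub>R s) \<and> (\<forall>s\<in>S. \<bar>c s\<bar> \<le> K * norm x)"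
    by blast
  show ?case
  proof (cases "s \<in> span S")
    case True
    have "\<exists>c. x = (\<Sum>t\<in>insert s S. c t *\<^sub>R t) \<and> (\<forall>t\<in>insert s S. \<bar>c t\<bar> \<le> K * norm x)" if "x \<in> span (insert s S)" for x
    proof -
      have "x \<in> span S" using that by (simp add: span_redundant[OF True])
      then obtain c where c: "x = (\<Sum>s\<in>S. c s *\<^sub>R s)" "\<forall>s\<in>S. \<bar>c s\<bar> \<le> K * norm x" using K by blast
      have "(\<Sum>t\<in>insert s S. (c(s := 0)) t *\<^sub>R t) = (\<Sum>t\<in>S. c t *\<^sub>R t)"
        using insert by (simp, intro sum.cong) auto
      then show ?thesis using c K(1) by (intro exI[of _ "c(s := 0)"]) auto
    qed
    then show ?thesis using K(1) by blast
  next
    case False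
    obtain d where d: "d > 0" "\<And>y. y \<in> span S \<Longrightarrow> d \<le> norm (s - y)"
      using span_insert_distance[OF insert(1) K(2) K(1) False] by blast
    define K' where "K' = max (1 / d) (K * (1 + norm s / d))"
    have "\<exists>c. x = (\<Sum>t\<in>insert s S. c t *\<^sub>R t) \<and> (\<forall>t\<in>insert s S. \<bar>c t\<bar> \<le> K' * norm x)" if x: "x \<in> span (insert s S)" for x
    proof -
      obtain a where a: "x - a *\<^sub>R s \<in> span S" using x by (auto simp: span_breakdown_eq)
      define y where "y = x - a *\<^sub>R s"
      have ad: "\<bar>a\<bar> * d \<le> norm x"
      proof (cases "a = 0")
        case False
        \<comment> \<open>\<open>x\<close> is \<open>a\<close> times the difference of
          \<open>s\<close> and this element of the span, and that difference has norm at least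
          \<open>d\<close>.\<close>
        have "- (1 / a) *\<^sub>R y \<in> span S" using a by (auto simp: y_def intro!: span_neg intro: span_scale)
        from d(2)[OF this] have "\<bar>a\<bar> * d \<le> norm (a *\<^sub>R (s + (1 / a) *\<^sub>R y))" by (simp add: mult_left_mono)
        also have "a *\<^sub>R (s + (1 / a) *\<^sub>R y) = x" using False by (simp add: y_def algebra_simps)
        finally show ?thesis .
      qed simp
      then have a': "\<bar>a\<bar> \<le> (1 / d) * norm x" using d by (simp add: field_simps)
      have "norm y \<le> norm x + \<bar>a\<bar> * norm s" unfolding y_def using norm_triangle_ineq4[of x "a *\<^sub>R s"] by simp
      also have "\<dots> \<le> norm x + (1 / d) * norm x * norm s" using mult_right_mono[OF a', of "norm s"] by simp
      finally have ny: "norm y \<le> (1 + norm s / d) * norm x" by (simp add: algebra_simps)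
      obtain c where c: "y = (\<Sum>s\<in>S. c s *\<^sub>R s)" "\<forall>s\<in>S. \<bar>c s\<bar> \<le> K * norm y" using K(2)[of y] a by (auto simp: y_def)
      have "(\<Sum>t\<in>S. (c(s := a)) t *\<^sub>R t) = (\<Sum>t\<in>S. c t *\<^sub>R t)"
        using insert by (intro sum.cong) auto
      then have "x = (\<Sum>t\<in>insert s S. (c(s := a)) t *\<^sub>R t)"
        using insert c(1) by (simp add: y_def algebra_simps)
      moreover have "\<bar>(c(s := a)) t\<bar> \<le> K' * norm x" if "t \<in> insert s S" for t
      proof (cases "t = s")
        case True
        then show ?thesis using a' mult_right_mono[of "1 / d" K' "norm x"] by (simp add: K'_def)
      next
        case False
        have "K * norm y \<le> K * (1 + norm s / d) * norm x" using mult_left_mono[OF ny K(1)] by (simp add: mult.assoc)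
        also have "\<dots> \<le> K' * norm x" by (intro mult_right_mono) (simp_all add: K'_def)
        finally show ?thesis using c(2) that False by force
      qed
      ultimately show ?thesis by blast
    qed
    moreover have "K' \<ge> 0" using d by (simp add: K'_def max.coboundedI1)
    ultimately show ?thesis by blast
  qed
qed

context cstar_algebra
begin

lemma cnorm_diff_emb: "x \<in> carrier A \<Longrightarrow> y \<in> carrier A \<Longrightarrow> cnorm A (x \<ominus> y) = norm (emb A x - emb A y)"
  by (simp add: norm_emb[symmetric] emb_diff)

lemma diff_add_cancel: "x \<in> carrier A \<Longrightarrow> y \<in> carrier A \<Longrightarrow> (x \<ominus> y) \<oplus> y = x"
  by (simp add: a_minus_def M.a_assoc M.l_neg)

text \<open>Convergence on finitely many generators is uniform on the unit ball, since the
  coefficients of \<open>x\<close> are bounded by a multiple of its norm.\<close>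

lemma finite_dimensional_uniform:
  fixes L :: "nat \<Rightarrow> 'a \<Rightarrow> 'u::cstar_alg"
  assumes fd: "finite_dimensional A"
    and add: "\<And>m x y. x \<in> carrier A \<Longrightarrow> y \<in> carrier A \<Longrightarrow> L m (x \<oplus> y) = L m x + L m y"
    and smult: "\<And>m c x. x \<in> carrier A \<Longrightarrow> L m (c \<odot> x) = c *\<^sub>C L m x"
    and lim: "\<And>x. x \<in> carrier A \<Longrightarrow> (\<lambda>m. L m x) \<longlonglongrightarrow> 0"
    and "e > 0"
  shows "\<exists>N. \<forall>m\<ge>N. \<forall>x\<in>carrier A. norm (L m x) \<le> e * cnorm A x"
proof -
  obtain S where S: "S \<subseteq> carrier A" "finite S" "\<And>x. x \<in> carrier A \<Longrightarrow> \<exists>c. x = (\<Oplus>s\<in>S. c s \<odot> s)"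
    using fd unfolding finite_dimensional_def by blast
  \<comment> \<open>The coefficient bound is for real linear combinations; adding the multiples by
    \<i> makes a complex spanning set a real one.\<close>
  define T where "T = S \<union> (\<lambda>s. \<i> \<odot> s) ` S"
  have T: "finite T" "T \<subseteq> carrier A" using S by (auto simp: T_def)
  have inj: "inj_on (emb A) T" using T(2) emb_inject by (auto simp: inj_on_def)
  obtain K where K: "K \<ge> 0" "\<And>x. x \<in> span (emb A ` T) \<Longrightarrow> \<exists>c. x = (\<Sum>s\<in>emb A ` T. c s *\<^sub>R s) \<and> (\<forall>s\<in>emb A ` T. \<bar>c s\<bar> \<le> K * norm x)"
    using span_coeff_bound[of "emb A ` T"] T(1) by blast
  have coeff: "\<exists>c. x = (\<Oplus>t\<in>T. complex_of_real (c t) \<odot> t) \<and> (\<forall>t\<in>T. \<bar>c t\<bar> \<le> K * cnorm A x)" if x: "x \<in> carrier A" for x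
  proof -
    obtain c where c: "x = (\<Oplus>s\<in>S. c s \<odot> s)" using S(3)[OF x] by blast
    have "emb A x = (\<Sum>s\<in>S. c s *\<^sub>C emb A s)"
      unfolding c using S by (subst emb_finsum) (auto intro!: sum.cong simp: emb_smult)
    also have "\<dots> = (\<Sum>s\<in>S. Re (c s) *\<^sub>R emb A s + Im (c s) *\<^sub>R emb A (\<i> \<odot> s))"
    proof (rule sum.cong[OF refl])
      fix s assume "s \<in> S"
      then have "s \<in> carrier A" using S by blast
      moreover have "c s = complex_of_real (Re (c s)) + complex_of_real (Im (c s)) * \<i>" by (simp add: complex_eq_iff)
      ultimately show "c s *\<^sub>C emb A s = Re (c s) *\<^sub>R emb A s + Im (c s) *\<^sub>R emb A (\<i> \<odot> s)"
        by (metis emb_smult scaleC_add_left scaleC_scaleC scaleR_scaleC)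
    qed
    also have "\<dots> \<in> span (emb A ` T)"
      by (intro span_sum span_add span_scale span_base imageI) (auto simp: T_def)
    finally obtain d where d: "emb A x = (\<Sum>s\<in>emb A ` T. d s *\<^sub>R s)" "\<forall>s\<in>emb A ` T. \<bar>d s\<bar> \<le> K * norm (emb A x)"
      using K(2) by blast
    have "emb A x = (\<Sum>t\<in>T. d (emb A t) *\<^sub>R emb A t)" unfolding d(1) by (simp add: sum.reindex[OF inj])
    also have "\<dots> = emb A (\<Oplus>t\<in>T. complex_of_real (d (emb A t)) \<odot> t)"
      using T by (subst emb_finsum) (auto intro!: sum.cong simp: emb_smult scaleR_scaleC)
    finally have "x = (\<Oplus>t\<in>T. complex_of_real (d (emb A t)) \<odot> t)"
      using x T by (subst (asm) emb_inject) (auto intro!: M.finsum_closed)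
    then show ?thesis using d(2) x by (intro exI[of _ "\<lambda>t. d (emb A t)"]) (auto simp: norm_emb)
  qed
  have L0: "L m \<zero> = 0" for m using smult[of \<zero> m 0] by simp
  have Lsum: "L m (\<Oplus>t\<in>T'. f t) = (\<Sum>t\<in>T'. L m (f t))" if "finite T'" "f \<in> T' \<rightarrow> carrier A" for m f and T' :: "'a set"
    using that by (induction T' rule: finite_induct) (auto simp: L0 add Pi_iff)
  have bound: "norm (L m x) \<le> (\<Sum>t\<in>T. K * norm (L m t)) * cnorm A x" if x: "x \<in> carrier A" for m x
  proof -
    obtain c where c: "x = (\<Oplus>t\<in>T. complex_of_real (c t) \<odot> t)" "\<forall>t\<in>T. \<bar>c t\<bar> \<le> K * cnorm A x" using coeff[OF x] by blast
    have "L m x = (\<Sum>t\<in>T. c t *\<^sub>R L m t)"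
      unfolding c(1) using T by (subst Lsum) (auto intro!: sum.cong simp: smult scaleR_scaleC)
    also have "norm \<dots> \<le> (\<Sum>t\<in>T. K * norm (L m t) * cnorm A x)"
    proof (rule sum_norm_le)
      fix t assume "t \<in> T"
      then show "norm (c t *\<^sub>R L m t) \<le> K * norm (L m t) * cnorm A x"
        using c(2) mult_right_mono[of "\<bar>c t\<bar>" "K * cnorm A x" "norm (L m t)"] by (simp add: mult.commute mult.left_commute)
    qed
    finally show ?thesis by (simp add: sum_distrib_right)
  qed
  have "(\<lambda>m. \<Sum>t\<in>T. K * norm (L m t)) \<longlonglongrightarrow> (\<Sum>t\<in>T. K * norm (0::'u))"
    using T(2) by (intro tendsto_sum tendsto_mult tendsto_const tendsto_norm lim) auto
  then have "eventually (\<lambda>m. (\<Sum>t\<in>T. K * norm (L m t)) < e) sequentially"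
    using \<open>e > 0\<close> order_tendstoD(2) by fastforce
  then obtain N where N: "\<And>m. m \<ge> N \<Longrightarrow> (\<Sum>t\<in>T. K * norm (L m t)) < e" by (auto simp: eventually_sequentially)
  have "norm (L m x) \<le> e * cnorm A x" if "m \<ge> N" "x \<in> carrier A" for m x
    using bound[OF that(2), of m] mult_right_mono[of "\<Sum>t\<in>T. K * norm (L m t)" e "cnorm A x"] N[OF that(1)] norm_nonneg[OF that(2)]
    by linarith
  then show ?thesis by blast
qed

end

section \<open>Almost multiplicativity and the choice of the subsequence\<close>

locale approximations = A: cstar_algebra A for A :: "'a cstar" +
  fixes F :: "nat \<Rightarrow> 'f cstar" and \<psi> :: "nat \<Rightarrow> 'a \<Rightarrow> 'f" and \<phi> :: "nat \<Rightarrow> 'f \<Rightarrow> 'a"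
  assumes approx: "cpc_approximations A F \<psi> \<phi>"
begin

lemma cstar_F: "cstar_algebra (F n)"
  and fin_dim_F: "finite_dimensional (F n)"
  and cpc_psi: "cpc A (F n) (\<psi> n)"
  and cpc_phi: "cpc (F n) A (\<phi> n)"
  and approx_id: "a \<in> carrier A \<Longrightarrow> (\<lambda>n. cnorm A (\<phi> n (\<psi> n a) \<ominus>\<^bsub>A\<^esub> a)) \<longlonglongrightarrow> 0"
  using approx unfolding cpc_approximations_def by auto

lemma psi: "cpc_map A (F n) (\<psi> n)"
  by (intro cpc_map.intro cpc_map_axioms.intro A.cstar_algebra_axioms cstar_F cpc_psi)

lemma phi: "cpc_map (F n) A (\<phi> n)"
  by (intro cpc_map.intro cpc_map_axioms.intro A.cstar_algebra_axioms cstar_F cpc_phi)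

lemmas psi_closed [simp, intro] = cpc_map.map_closed[OF psi]
  and phi_closed [simp, intro] = cpc_map.map_closed[OF phi]

lemma norm_phi_diff_le: "x \<in> carrier (F n) \<Longrightarrow> y \<in> carrier (F n) \<Longrightarrow>
    norm (emb A (\<phi> n x) - emb A (\<phi> n y)) \<le> norm (emb (F n) x - emb (F n) y)"
  using cpc_map.norm_emb_map_diff_le[OF phi, of x n y] by (simp add: cstar_algebra.cnorm_diff_emb[OF cstar_F])

lemma norm_psi_diff_le: "x \<in> carrier A \<Longrightarrow> y \<in> carrier A \<Longrightarrow>
    norm (emb (F n) (\<psi> n x) - emb (F n) (\<psi> n y)) \<le> norm (emb A x - emb A y)"
  using cpc_map.norm_emb_map_diff_le[OF psi, of x y n] by (simp add: A.cnorm_diff_emb)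

lemma tendsto_approx_id: "a \<in> carrier A \<Longrightarrow> (\<lambda>n. emb A (\<phi> n (\<psi> n a))) \<longlonglongrightarrow> emb A a"
  using approx_id[of a] by (simp add: A.cnorm_diff_emb tendsto_norm_zero_iff LIM_zero_iff)

text \<open>By the Schwarz inequality for \<open>\<psi> n\<close>, the defect of \<open>\<phi> n\<close> at \<open>\<psi> n (a\<^sup>*)\<close> is dominated
  by the defect of the almost multiplicative map \<open>\<phi> n \<circ> \<psi> n\<close> at \<open>a\<^sup>*\<close>.\<close>

lemma almost_multiplicative:
  assumes a: "a \<in> carrier A" and b: "b \<in> carrier A"
  shows "(\<lambda>n. emb A (\<phi> n (\<psi> n a \<otimes>\<^bsub>F n\<^esub> \<psi> n b))) \<longlonglongrightarrow> emb A a * emb A b"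
proof -
  \<comment> \<open>The defect carries a star on its first argument, so the product of
    \<open>\<psi> n a\<close> and \<open>\<psi> n b\<close> is reached from the defect at
    \<open>\<psi> n a'\<close> and \<open>\<psi> n b\<close>.\<close>
  define a' where "a' = star A a"
  have a': "a' \<in> carrier A" using a by (simp add: a'_def A.star_closed)
  define D where "D = (\<lambda>n u v. cpc_map.defect (F n) A (\<phi> n) u v)"
  have D: "D n u v = emb A (\<phi> n (star (F n) u \<otimes>\<^bsub>F n\<^esub> v)) - adj (emb A (\<phi> n u)) * emb A (\<phi> n v)" for n u v
    by (simp add: D_def cpc_map.defect_def[OF phi])
  define E where "E = (\<lambda>n. emb A (\<phi> n (\<psi> n (star A a' \<otimes>\<^bsub>A\<^esub> a'))) - adj (emb A (\<phi> n (\<psi> n a'))) * emb A (\<phi> n (\<psi> n a')))"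
  have "E \<longlonglongrightarrow> emb A (star A a' \<otimes>\<^bsub>A\<^esub> a') - adj (emb A a') * emb A a'"
    unfolding E_def using a' by (intro tendsto_intros tendsto_adj tendsto_approx_id A.m_closed A.star_closed)
  then have E0: "E \<longlonglongrightarrow> 0" using a' by (simp add: A.emb_mult A.emb_star A.star_closed)
  have D1: "norm (D n (\<psi> n a') (\<psi> n a')) \<le> norm (E n)" for n
  proof (rule norm_mono)
    interpret Fn: cstar_algebra "F n" by (rule cstar_F)
    interpret psi: cpc_map A "F n" "\<psi> n" by (rule psi)
    interpret phi: cpc_map "F n" A "\<phi> n" by (rule phi)
    show "pos (D n (\<psi> n a') (\<psi> n a'))" unfolding D_def using a' by (intro phi.pos_defect psi_closed)
    let ?x = "\<psi> n (star A a' \<otimes>\<^bsub>A\<^esub> a')" and ?y = "star (F n) (\<psi> n a') \<otimes>\<^bsub>F n\<^esub> \<psi> n a'"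
    have x: "?x \<in> carrier (F n)" "?y \<in> carrier (F n)"
      using a' by (auto intro!: psi_closed A.m_closed A.star_closed Fn.m_closed Fn.star_closed)
    have "pos (emb (F n) ?x - adj (emb (F n) (\<psi> n a')) * emb (F n) (\<psi> n a'))"
      using psi.pos_defect[OF a'] by (simp add: psi.defect_def)
    then have "pos (emb (F n) (?x \<ominus>\<^bsub>F n\<^esub> ?y))"
      using x a' by (simp add: Fn.emb_diff Fn.emb_mult Fn.emb_star Fn.star_closed)
    then have "pos (emb A (\<phi> n (?x \<ominus>\<^bsub>F n\<^esub> ?y)))" using x by (intro phi.map_pos) auto
    then show "pos (E n - D n (\<psi> n a') (\<psi> n a'))"
      using x by (simp add: phi.map_diff A.emb_diff E_def D)
  qed
  \<comment> \<open>Only boundedness in \<open>n\<close> matters here; the 2 counts the two terms of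
    the defect, each at most the square of \<parallel>b\<parallel>.\<close>
  have D2: "norm (D n (\<psi> n b) (\<psi> n b)) \<le> 2 * (cnorm A b)\<^sup>2" for n
  proof -
    interpret Fn: cstar_algebra "F n" by (rule cstar_F)
    interpret psi: cpc_map A "F n" "\<psi> n" by (rule psi)
    interpret phi: cpc_map "F n" A "\<phi> n" by (rule phi)
    let ?y = "star (F n) (\<psi> n b) \<otimes>\<^bsub>F n\<^esub> \<psi> n b"
    have y: "?y \<in> carrier (F n)" using b by (auto intro!: Fn.m_closed Fn.star_closed)
    have nb: "cnorm (F n) (\<psi> n b) \<le> cnorm A b" using b by (rule psi.map_norm_le)
    have "norm (emb A (\<phi> n ?y)) \<le> cnorm (F n) ?y" using y phi.map_norm_le[OF y] by (simp add: A.norm_emb)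
    also have "\<dots> \<le> (cnorm A b)\<^sup>2"
      using Fn.norm_star_mult[of "\<psi> n b"] nb b Fn.norm_nonneg[of "\<psi> n b"] by (simp add: power_mono)
    finally have 1: "norm (emb A (\<phi> n ?y)) \<le> (cnorm A b)\<^sup>2" .
    have "cnorm A (\<phi> n (\<psi> n b)) \<le> cnorm A b" using phi.map_norm_le[of "\<psi> n b"] nb b by simp
    then have 2: "norm (adj (emb A (\<phi> n (\<psi> n b))) * emb A (\<phi> n (\<psi> n b))) \<le> (cnorm A b)\<^sup>2"
      using b A.norm_nonneg[of "\<phi> n (\<psi> n b)"] by (simp add: norm_adj_mult A.norm_emb power_mono)
    show ?thesis unfolding D
      using 1 2 norm_triangle_ineq4[of "emb A (\<phi> n ?y)" "adj (emb A (\<phi> n (\<psi> n b))) * emb A (\<phi> n (\<psi> n b))"] by linarith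
  qed
  have "(\<lambda>n. (norm (D n (\<psi> n a') (\<psi> n b)))\<^sup>2) \<longlonglongrightarrow> 0"
  proof (rule tendsto_sandwich[OF always_eventually always_eventually tendsto_const])
    show "\<forall>n. 0 \<le> (norm (D n (\<psi> n a') (\<psi> n b)))\<^sup>2" by simp
    show "\<forall>n. (norm (D n (\<psi> n a') (\<psi> n b)))\<^sup>2 \<le> norm (E n) * (2 * (cnorm A b)\<^sup>2)"
    proof
      fix n
      have "(norm (D n (\<psi> n a') (\<psi> n b)))\<^sup>2 \<le> norm (D n (\<psi> n a') (\<psi> n a')) * norm (D n (\<psi> n b) (\<psi> n b))"
        unfolding D_def using a' b by (intro cpc_map.norm_defect_le[OF phi] psi_closed)
      also have "\<dots> \<le> norm (E n) * (2 * (cnorm A b)\<^sup>2)" by (intro mult_mono D1 D2) auto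
      finally show "(norm (D n (\<psi> n a') (\<psi> n b)))\<^sup>2 \<le> norm (E n) * (2 * (cnorm A b)\<^sup>2)" .
    qed
    show "(\<lambda>n. norm (E n) * (2 * (cnorm A b)\<^sup>2)) \<longlonglongrightarrow> 0"
      using tendsto_mult_left_zero[OF tendsto_norm_zero[OF E0]] .
  qed
  then have "(\<lambda>n. sqrt ((norm (D n (\<psi> n a') (\<psi> n b)))\<^sup>2)) \<longlonglongrightarrow> sqrt 0" by (rule tendsto_real_sqrt)
  then have "(\<lambda>n. D n (\<psi> n a') (\<psi> n b)) \<longlonglongrightarrow> 0" by (simp add: tendsto_norm_zero_iff)
  then have "(\<lambda>n. D n (\<psi> n a') (\<psi> n b) + adj (emb A (\<phi> n (\<psi> n a'))) * emb A (\<phi> n (\<psi> n b))) \<longlonglongrightarrow> 0 + adj (emb A a') * emb A b"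
    using a' b by (intro tendsto_intros tendsto_adj tendsto_approx_id)
  moreover have "D n (\<psi> n a') (\<psi> n b) + adj (emb A (\<phi> n (\<psi> n a'))) * emb A (\<phi> n (\<psi> n b))
      = emb A (\<phi> n (\<psi> n a \<otimes>\<^bsub>F n\<^esub> \<psi> n b))" for n
  proof -
    have "star (F n) (\<psi> n a') = \<psi> n a"
      using a by (simp add: a'_def cpc_map.map_star[OF psi] cstar_algebra.star_star[OF cstar_F] A.star_closed)
    then show ?thesis by (simp add: D)
  qed
  moreover have "adj (emb A a') = emb A a" using a by (simp add: a'_def A.emb_star)
  ultimately show ?thesis by simp
qed

text \<open>For fixed \<open>n\<close> the differences are linear in \<open>x\<close> and tend to 0
  at every \<open>x\<close>, because \<open>\<phi> m \<circ> \<psi> m\<close> converges pointwise to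
  the identity at \<open>\<phi> n x\<close>. Finite dimension of \<open>F n\<close> makes this
  uniform.\<close>

lemma op_norm_uniform:
  assumes "e > 0"
  shows "\<exists>N. \<forall>m\<ge>N. \<forall>x\<in>carrier (F n). cnorm A (\<phi> n x \<ominus>\<^bsub>A\<^esub> \<phi> m (\<psi> m (\<phi> n x))) \<le> e * cnorm (F n) x"
proof -
  define L where "L = (\<lambda>m x. emb A (\<phi> n x) - emb A (\<phi> m (\<psi> m (\<phi> n x))))"
  interpret Fn: cstar_algebra "F n" by (rule cstar_F)
  note lin = cpc_map.map_add[OF phi] cpc_map.map_add[OF psi] cpc_map.map_smult[OF phi] cpc_map.map_smult[OF psi]
  have "\<exists>N. \<forall>m\<ge>N. \<forall>x\<in>carrier (F n). norm (L m x) \<le> e * cnorm (F n) x"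
  proof (rule Fn.finite_dimensional_uniform[OF fin_dim_F _ _ _ assms])
    show "L m (x \<oplus>\<^bsub>F n\<^esub> y) = L m x + L m y" if "x \<in> carrier (F n)" "y \<in> carrier (F n)" for m x y
      using that by (simp add: L_def lin A.emb_add)
    show "L m (c \<odot>\<^bsub>F n\<^esub> x) = c *\<^sub>C L m x" if "x \<in> carrier (F n)" for m c x
      using that by (simp add: L_def lin A.emb_smult scaleC_diff_right)
    show "(\<lambda>m. L m x) \<longlonglongrightarrow> 0" if "x \<in> carrier (F n)" for x
      using tendsto_diff[OF tendsto_const tendsto_approx_id[of "\<phi> n x"], of "emb A (\<phi> n x)"] that by (simp add: L_def)
  qed
  then show ?thesis by (simp add: L_def A.cnorm_diff_emb)
qed

text \<open>Each new index is chosen to serve every earlier index of the original system up to the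
  current one, so all pairs \<open>j < m\<close> are covered at once. The exponent
  \<open>m + 2\<close> is half of the final \<open>(1/2)^(m+1)\<close>, which leaves room for the
  strict inequality that summability demands of the operator norm.\<close>

lemma summable_subsequence:
  obtains r :: "nat \<Rightarrow> nat" where "strict_mono r"
    "\<And>j m x. j < m \<Longrightarrow> x \<in> carrier (F (r j)) \<Longrightarrow>
      cnorm A (\<phi> (r j) x \<ominus>\<^bsub>A\<^esub> \<phi> (r m) (\<psi> (r m) (\<phi> (r j) x))) \<le> (1/2) ^ Suc (Suc m) * cnorm (F (r j)) x"
proof -
  define P where "P = (\<lambda>k N M. N < M \<and> (\<forall>n\<le>N. \<forall>m\<ge>M. \<forall>x\<in>carrier (F n).
    cnorm A (\<phi> n x \<ominus>\<^bsub>A\<^esub> \<phi> m (\<psi> m (\<phi> n x))) \<le> (1/2) ^ Suc (Suc k) * cnorm (F n) x))"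
  have "\<exists>M. P k N M" for k N
  proof -
    obtain f where f: "\<And>n m x. m \<ge> f n \<Longrightarrow> x \<in> carrier (F n) \<Longrightarrow>
      cnorm A (\<phi> n x \<ominus>\<^bsub>A\<^esub> \<phi> m (\<psi> m (\<phi> n x))) \<le> (1/2) ^ Suc (Suc k) * cnorm (F n) x"
      using op_norm_uniform[of "(1/2) ^ Suc (Suc k)"] by (metis zero_less_power half_gt_zero zero_less_one)
    have "f n \<le> Max (f ` {..N})" if "n \<le> N" for n using that by simp
    \<comment> \<open>\<open>Suc N\<close> makes the chosen indices strictly increasing; the maximum
      makes one index serve all \<open>n\<close> \<le> \<open>N\<close>.\<close>
    then have "P k N (max (Suc N) (Max (f ` {..N})))" unfolding P_def using f by fastforce
    then show ?thesis by blast
  qed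
  then obtain g where g: "\<And>k N. P k N (g k N)" by metis
  define r where "r = rec_nat 0 (\<lambda>k. g (Suc k))"
  have r: "r (Suc k) = g (Suc k) (r k)" for k by (simp add: r_def)
  have "strict_mono r" unfolding strict_mono_Suc_iff r using g by (auto simp: P_def)
  moreover have "cnorm A (\<phi> (r j) x \<ominus>\<^bsub>A\<^esub> \<phi> (r m) (\<psi> (r m) (\<phi> (r j) x))) \<le> (1/2) ^ Suc (Suc m) * cnorm (F (r j)) x"
    if jm: "j < m" and x: "x \<in> carrier (F (r j))" for j m x
  proof -
    obtain k where k: "m = Suc k" "j \<le> k" using jm by (cases m) auto
    have "r j \<le> r k" using k \<open>strict_mono r\<close> by (simp add: strict_mono_less_eq)
    then show ?thesis using g[of "Suc k" "r k"] x unfolding P_def k(1) r by blast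
  qed
  ultimately show ?thesis using that by blast
qed

end

section \<open>Summable systems and the encoding condition\<close>

locale summable_system = approximations +
  fixes \<epsilon> :: "nat \<Rightarrow> real"
  assumes eps_nonneg: "0 \<le> \<epsilon> m" and eps_summable: "summable \<epsilon>"
    and close: "n < m \<Longrightarrow> x \<in> carrier (F n) \<Longrightarrow> cnorm A (\<phi> n x \<ominus>\<^bsub>A\<^esub> \<phi> m (\<psi> m (\<phi> n x))) \<le> \<epsilon> m * cnorm (F n) x"
begin

abbreviation "\<rho> \<equiv> connecting (associated_maps \<psi> \<phi>)"

lemma rho_refl [simp]: "\<rho> n n x = x"
  by (simp add: connecting_def)

lemma rho_Suc: "n \<le> m \<Longrightarrow> \<rho> (Suc m) n x = \<psi> (Suc m) (\<phi> m (\<rho> m n x))"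
  by (simp add: connecting_def associated_maps_def)

lemma rho_split: "k \<le> n \<Longrightarrow> n \<le> m \<Longrightarrow> \<rho> m k x = \<rho> m n (\<rho> n k x)"
  using upt_add_eq_append[of k n "m - n"] by (simp add: connecting_def)

lemma rho_closed: "n \<le> m \<Longrightarrow> x \<in> carrier (F n) \<Longrightarrow> \<rho> m n x \<in> carrier (F m)"
  by (induction m rule: dec_induct) (auto simp: rho_Suc)

lemma rho_norm_le: "n \<le> m \<Longrightarrow> x \<in> carrier (F n) \<Longrightarrow> cnorm (F m) (\<rho> m n x) \<le> cnorm (F n) x"
proof (induction m rule: dec_induct)
  case (step m)
  then show ?case
    using cpc_map.map_norm_le[OF psi, of "\<phi> m (\<rho> m n x)" "Suc m"] cpc_map.map_norm_le[OF phi, of "\<rho> m n x" m]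
    by (simp add: rho_Suc rho_closed)
qed simp

text \<open>The index \<open>n\<close> itself is excluded, so \<open>S (Suc m) - S (Suc n)\<close>
  is the sum over \<open>n\<close> < j \<le> \<open>m\<close>.\<close>

definition "S n = (\<Sum>j<n. \<epsilon> j)"

text \<open>Passing from \<open>m\<close> to \<open>m + 1\<close> replaces \<open>\<phi> m y\<close>
  by \<open>\<phi> (Suc m) (\<psi> (Suc m) (\<phi> m y))\<close> for
  \<open>y = \<rho> m n x\<close>. This costs \<open>\<epsilon> (Suc m)\<close> times the norm of
  \<open>y\<close>, which does not exceed that of \<open>x\<close>.\<close>

lemma phi_rho_close:
  assumes "n \<le> m" "x \<in> carrier (F n)"
  shows "norm (emb A (\<phi> m (\<rho> m n x)) - emb A (\<phi> n x)) \<le> (S (Suc m) - S (Suc n)) * cnorm (F n) x"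
  using assms(1)
proof (induction m rule: dec_induct)
  case (step m)
  let ?y = "\<rho> m n x"
  have y: "?y \<in> carrier (F m)" using step assms rho_closed by simp
  have "norm (emb A (\<phi> m ?y) - emb A (\<phi> (Suc m) (\<rho> (Suc m) n x))) \<le> \<epsilon> (Suc m) * cnorm (F m) ?y"
    using close[of m "Suc m" ?y] y step by (simp add: rho_Suc A.cnorm_diff_emb)
  also have "\<dots> \<le> \<epsilon> (Suc m) * cnorm (F n) x"
    using step assms by (intro mult_left_mono eps_nonneg rho_norm_le) auto
  finally have "norm (emb A (\<phi> (Suc m) (\<rho> (Suc m) n x)) - emb A (\<phi> m ?y)) \<le> \<epsilon> (Suc m) * cnorm (F n) x"
    by (simp add: norm_minus_commute)
  with step.IH have "norm ((emb A (\<phi> (Suc m) (\<rho> (Suc m) n x)) - emb A (\<phi> m ?y)) + (emb A (\<phi> m ?y) - emb A (\<phi> n x)))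
     \<le> \<epsilon> (Suc m) * cnorm (F n) x + (S (Suc m) - S (Suc n)) * cnorm (F n) x"
    by (intro norm_triangle_le add_mono)
  then show ?case by (simp add: S_def algebra_simps)
qed simp

text \<open>The last connecting map is \<open>\<psi> m \<circ> \<phi> (m - 1)\<close>, so this is
  the previous estimate at \<open>m - 1\<close> after the contraction \<open>\<psi> m\<close>; hence
  \<open>S m\<close> in place of \<open>S (Suc m)\<close>.\<close>

lemma rho_close:
  assumes "n < m" "x \<in> carrier (F n)"
  shows "norm (emb (F m) (\<rho> m n x) - emb (F m) (\<psi> m (\<phi> n x))) \<le> (S m - S (Suc n)) * cnorm (F n) x"
proof -
  obtain k where k: "m = Suc k" "n \<le> k" using assms(1) by (cases m) auto
  have "norm (emb (F m) (\<rho> m n x) - emb (F m) (\<psi> m (\<phi> n x))) \<le> norm (emb A (\<phi> k (\<rho> k n x)) - emb A (\<phi> n x))"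
    unfolding k(1) rho_Suc[OF k(2)] using k assms by (intro norm_psi_diff_le phi_closed rho_closed)
  then show ?thesis using phi_rho_close[OF k(2) assms(2)] k by simp
qed

lemma S_tendsto: "S \<longlonglongrightarrow> suminf \<epsilon>"
  unfolding S_def using eps_summable by (rule summable_LIMSEQ)

lemma S_le: "S n \<le> suminf \<epsilon>"
  unfolding S_def using eps_summable by (intro sum_le_suminf) (auto simp: eps_nonneg)

lemma tail_tendsto: "(\<lambda>n. (suminf \<epsilon> - S (Suc n)) * c) \<longlonglongrightarrow> 0"
proof -
  have "(\<lambda>n. (suminf \<epsilon> - S (Suc n)) * c) \<longlonglongrightarrow> (suminf \<epsilon> - suminf \<epsilon>) * c"
    by (intro tendsto_intros LIMSEQ_Suc S_tendsto)
  then show ?thesis by simp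
qed

lemma rho_close_tail:
  assumes "n < m" "x \<in> carrier (F n)"
  shows "norm (emb (F m) (\<rho> m n x) - emb (F m) (\<psi> m (\<phi> n x))) \<le> (suminf \<epsilon> - S (Suc n)) * cnorm (F n) x"
proof -
  have "(S m - S (Suc n)) * cnorm (F n) x \<le> (suminf \<epsilon> - S (Suc n)) * cnorm (F n) x"
    using S_le[of m] cstar_algebra.norm_nonneg[OF cstar_F assms(2)] by (intro mult_right_mono) auto
  then show ?thesis using rho_close[OF assms] by linarith
qed

text \<open>By \<open>phi_rho_close\<close> the images \<open>s n\<close> in \<open>A\<close> form a
  Cauchy sequence, and \<open>a\<close> is their limit. Since \<open>\<psi> (n + Suc k)\<close> maps
  \<open>s n\<close> to the next image of \<open>x\<close> in the system, contractivity bounds the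
  asserted distance by that from \<open>s n\<close> to \<open>a\<close>.\<close>

lemma limit_element:
  assumes x: "x \<in> carrier (F k)"
  obtains a where "a \<in> carrier A" "(\<lambda>n. norm (emb (F n) (\<rho> n k x) - emb (F n) (\<psi> n a))) \<longlonglongrightarrow> 0"
proof -
  define s where "s = (\<lambda>n. \<phi> (n + k) (\<rho> (n + k) k x))"
  have s: "s n \<in> carrier A" for n unfolding s_def using x by (intro phi_closed rho_closed) auto
  have c0: "0 \<le> cnorm (F k) x" using cstar_algebra.norm_nonneg[OF cstar_F x] .
  have mono: "norm (emb A (s m) - emb A (s n)) \<le> (suminf \<epsilon> - S (Suc (n + k))) * cnorm (F k) x" if "n \<le> m" for m n
  proof -
    have y: "\<rho> (n + k) k x \<in> carrier (F (n + k))" "cnorm (F (n + k)) (\<rho> (n + k) k x) \<le> cnorm (F k) x"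
      using x by (auto intro: rho_closed rho_norm_le)
    have "s m = \<phi> (m + k) (\<rho> (m + k) (n + k) (\<rho> (n + k) k x))"
      unfolding s_def using that by (subst rho_split[of k "n + k" "m + k"]) auto
    then have "norm (emb A (s m) - emb A (s n)) \<le> (S (Suc (m + k)) - S (Suc (n + k))) * cnorm (F (n + k)) (\<rho> (n + k) k x)"
      using phi_rho_close[of "n + k" "m + k", OF _ y(1)] that by (simp add: s_def)
    also have "\<dots> \<le> (suminf \<epsilon> - S (Suc (n + k))) * cnorm (F k) x"
      using S_le[of "Suc (m + k)"] S_le[of "Suc (n + k)"] y cstar_algebra.norm_nonneg[OF cstar_F y(1)] by (intro mult_mono) auto
    finally show ?thesis .
  qed
  have tail: "(\<lambda>n. (suminf \<epsilon> - S (Suc (n + k))) * cnorm (F k) x) \<longlonglongrightarrow> 0"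
    using LIMSEQ_ignore_initial_segment[OF tail_tendsto, of k] by simp
  have "\<exists>a\<in>carrier A. (\<lambda>n. cnorm A (s n \<ominus>\<^bsub>A\<^esub> a)) \<longlonglongrightarrow> 0"
  proof (rule A.complete)
    show "range s \<subseteq> carrier A" using s by auto
    show "\<forall>e>0. \<exists>N. \<forall>m\<ge>N. \<forall>n\<ge>N. cnorm A (s m \<ominus>\<^bsub>A\<^esub> s n) < e"
    proof (intro allI impI)
      fix e :: real assume "e > 0"
      then obtain N where N: "\<And>n. n \<ge> N \<Longrightarrow> (suminf \<epsilon> - S (Suc (n + k))) * cnorm (F k) x < e"
        using order_tendstoD(2)[OF tail, of e] by (auto simp: eventually_sequentially)
      have "norm (emb A (s m) - emb A (s n)) < e" if "m \<ge> N" "n \<ge> N" for m n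
        using mono[of n m] mono[of m n] N[OF that(1)] N[OF that(2)]
        by (cases "n \<le> m") (auto simp: norm_minus_commute)
      then show "\<exists>N. \<forall>m\<ge>N. \<forall>n\<ge>N. cnorm A (s m \<ominus>\<^bsub>A\<^esub> s n) < e" using s by (auto simp: A.cnorm_diff_emb)
    qed
  qed
  then obtain a where a: "a \<in> carrier A" "(\<lambda>n. cnorm A (s n \<ominus>\<^bsub>A\<^esub> a)) \<longlonglongrightarrow> 0" by blast
  have "(\<lambda>n. norm (emb (F (n + Suc k)) (\<rho> (n + Suc k) k x) - emb (F (n + Suc k)) (\<psi> (n + Suc k) a))) \<longlonglongrightarrow> 0"
  proof (rule tendsto_sandwich[OF always_eventually always_eventually tendsto_const a(2)])
    show "\<forall>n. norm (emb (F (n + Suc k)) (\<rho> (n + Suc k) k x) - emb (F (n + Suc k)) (\<psi> (n + Suc k) a)) \<le> cnorm A (s n \<ominus>\<^bsub>A\<^esub> a)"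
    proof
      fix n
      have "\<rho> (n + Suc k) k x = \<psi> (n + Suc k) (s n)" using rho_Suc[of k "n + k" x] by (simp add: s_def)
      then show "norm (emb (F (n + Suc k)) (\<rho> (n + Suc k) k x) - emb (F (n + Suc k)) (\<psi> (n + Suc k) a)) \<le> cnorm A (s n \<ominus>\<^bsub>A\<^esub> a)"
        using norm_psi_diff_le[OF s a(1)] by (simp add: A.cnorm_diff_emb s a)
    qed
  qed simp
  then have "(\<lambda>n. norm (emb (F n) (\<rho> n k x) - emb (F n) (\<psi> n a))) \<longlonglongrightarrow> 0"
    by (rule LIMSEQ_offset)
  with a(1) show ?thesis by (rule that)
qed

lemma cpc_system: "cpc_system F (associated_maps \<psi> \<phi>)"
  unfolding cpc_system_def associated_maps_def
  using cstar_F cpc_compose[OF cpc_phi cpc_psi] by blast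

theorem encoding: "cstar_encoding F (associated_maps \<psi> \<phi>)"
  unfolding cstar_encoding_def
proof (intro conjI cpc_system allI ballI impI)
  fix k x y and e :: real
  assume x: "x \<in> carrier (F k)" and y: "y \<in> carrier (F k)" and "e > 0"
  obtain a where a: "a \<in> carrier A" "(\<lambda>n. norm (emb (F n) (\<rho> n k x) - emb (F n) (\<psi> n a))) \<longlonglongrightarrow> 0"
    by (rule limit_element[OF x])
  obtain b where b: "b \<in> carrier A" "(\<lambda>n. norm (emb (F n) (\<rho> n k y) - emb (F n) (\<psi> n b))) \<longlonglongrightarrow> 0"
    by (rule limit_element[OF y])
  define z where "z = (\<lambda>n. \<rho> n k x \<otimes>\<^bsub>F n\<^esub> \<rho> n k y)"
  have z: "z n \<in> carrier (F n)" if "k \<le> n" for n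
    unfolding z_def using that x y by (intro cstar_algebra.m_closed[OF cstar_F] rho_closed)
  have nz: "cnorm (F n) (z n) \<le> cnorm (F k) x * cnorm (F k) y" if "k \<le> n" for n
  proof -
    interpret Fn: cstar_algebra "F n" by (rule cstar_F)
    have "cnorm (F n) (z n) \<le> cnorm (F n) (\<rho> n k x) * cnorm (F n) (\<rho> n k y)"
      unfolding z_def using that x y by (intro Fn.norm_mult rho_closed)
    also have "\<dots> \<le> cnorm (F k) x * cnorm (F k) y"
      using that x y cstar_algebra.norm_nonneg[OF cstar_F x]
      by (intro mult_mono rho_norm_le Fn.norm_nonneg rho_closed)
    finally show ?thesis .
  qed
  \<comment> \<open>Bounds the distance of \<open>\<phi> n (z n)\<close> from the product of
    \<open>a\<close> and \<open>b\<close>: two terms for replacing the factors of \<open>z n\<close>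
    by \<open>\<psi> n a\<close> and \<open>\<psi> n b\<close>, and one for almost
    multiplicativity.\<close>
  define g where "g = (\<lambda>n. cnorm (F k) x * norm (emb (F n) (\<rho> n k y) - emb (F n) (\<psi> n b))
      + norm (emb (F n) (\<rho> n k x) - emb (F n) (\<psi> n a)) * cnorm A b
      + norm (emb A (\<phi> n (\<psi> n a \<otimes>\<^bsub>F n\<^esub> \<psi> n b)) - emb A a * emb A b))"
  have g: "g \<longlonglongrightarrow> 0"
    unfolding g_def
    using tendsto_add[OF tendsto_add[OF tendsto_mult_right_zero[OF b(2), of "cnorm (F k) x"] tendsto_mult_left_zero[OF a(2), of "cnorm A b"]]
        tendsto_norm_zero[OF LIM_zero[OF almost_multiplicative[OF a(1) b(1)]]]] by simp
  have phi_z: "norm (emb A (\<phi> n (z n)) - emb A a * emb A b) \<le> g n" if kn: "k \<le> n" for n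
  proof -
    interpret Fn: cstar_algebra "F n" by (rule cstar_F)
    let ?x = "emb (F n) (\<rho> n k x)" and ?y = "emb (F n) (\<rho> n k y)" and ?a = "emb (F n) (\<psi> n a)" and ?b = "emb (F n) (\<psi> n b)"
    have c: "\<rho> n k x \<in> carrier (F n)" "\<rho> n k y \<in> carrier (F n)" using kn x y by (auto intro: rho_closed)
    have "norm (emb A (\<phi> n (z n)) - emb A (\<phi> n (\<psi> n a \<otimes>\<^bsub>F n\<^esub> \<psi> n b))) \<le> norm (emb (F n) (z n) - emb (F n) (\<psi> n a \<otimes>\<^bsub>F n\<^esub> \<psi> n b))"
      using z[OF kn] a b by (intro norm_phi_diff_le Fn.m_closed) auto
    also have "emb (F n) (z n) - emb (F n) (\<psi> n a \<otimes>\<^bsub>F n\<^esub> \<psi> n b) = ?x * (?y - ?b) + (?x - ?a) * ?b"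
      using c a b by (simp add: z_def Fn.emb_mult algebra_simps)
    also have "norm \<dots> \<le> norm ?x * norm (?y - ?b) + norm (?x - ?a) * norm ?b"
      by (intro norm_triangle_le add_mono norm_mult_ineq)
    also have "\<dots> \<le> cnorm (F k) x * norm (?y - ?b) + norm (?x - ?a) * cnorm A b"
      using rho_norm_le[OF kn x] cpc_map.map_norm_le[OF psi b(1), of n] c b
      by (intro add_mono mult_right_mono mult_left_mono) (auto simp: Fn.norm_emb)
    finally show ?thesis
      using norm_triangle_ineq[of "emb A (\<phi> n (z n)) - emb A (\<phi> n (\<psi> n a \<otimes>\<^bsub>F n\<^esub> \<psi> n b))" "emb A (\<phi> n (\<psi> n a \<otimes>\<^bsub>F n\<^esub> \<psi> n b)) - emb A a * emb A b"]
      by (simp add: g_def)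
  qed
  define h where "h = (\<lambda>n. (suminf \<epsilon> - S (Suc n)) * (cnorm (F k) x * cnorm (F k) y) + g n)"
  have "h \<longlonglongrightarrow> 0" unfolding h_def using tendsto_add[OF tail_tendsto g] by simp
  then obtain M where M: "\<And>n. n \<ge> M \<Longrightarrow> h n < e / 2"
    using order_tendstoD(2)[of h 0 sequentially "e / 2"] \<open>e > 0\<close> by (auto simp: eventually_sequentially)
  \<comment> \<open>The target \<open>\<psi> m (a \<otimes> b)\<close> does not depend on
    \<open>n\<close>, so the same estimate serves for \<open>n\<close> and for \<open>j\<close>;
    each is allowed half of \<open>e\<close>.\<close>
  have main: "norm (emb (F m) (\<rho> m n (z n)) - emb (F m) (\<psi> m (a \<otimes>\<^bsub>A\<^esub> b))) < e / 2" if "k \<le> n" "M \<le> n" "n < m" for m n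
  proof -
    have "norm (emb (F m) (\<rho> m n (z n)) - emb (F m) (\<psi> m (\<phi> n (z n)))) \<le> (suminf \<epsilon> - S (Suc n)) * cnorm (F n) (z n)"
      by (rule rho_close_tail[OF that(3) z[OF that(1)]])
    also have "\<dots> \<le> (suminf \<epsilon> - S (Suc n)) * (cnorm (F k) x * cnorm (F k) y)"
      using S_le[of "Suc n"] nz[OF that(1)] by (intro mult_left_mono) auto
    finally have 1: "norm (emb (F m) (\<rho> m n (z n)) - emb (F m) (\<psi> m (\<phi> n (z n)))) \<le> (suminf \<epsilon> - S (Suc n)) * (cnorm (F k) x * cnorm (F k) y)" .
    have "norm (emb (F m) (\<psi> m (\<phi> n (z n))) - emb (F m) (\<psi> m (a \<otimes>\<^bsub>A\<^esub> b))) \<le> norm (emb A (\<phi> n (z n)) - emb A (a \<otimes>\<^bsub>A\<^esub> b))"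
      using z[OF that(1)] a b by (intro norm_psi_diff_le phi_closed A.m_closed)
    also have "\<dots> \<le> g n" using phi_z[OF that(1)] a b by (simp add: A.emb_mult)
    finally show ?thesis
      using 1 M[OF that(2)] norm_triangle_ineq[of "emb (F m) (\<rho> m n (z n)) - emb (F m) (\<psi> m (\<phi> n (z n)))" "emb (F m) (\<psi> m (\<phi> n (z n))) - emb (F m) (\<psi> m (a \<otimes>\<^bsub>A\<^esub> b))"]
      by (simp add: h_def)
  qed
  show "\<exists>M>k. \<forall>m n j. n > M \<and> j > M \<and> m > max n j \<longrightarrow>
        cnorm (F m)
          (\<rho> m n (\<rho> n k x \<otimes>\<^bsub>F n\<^esub> \<rho> n k y) \<ominus>\<^bsub>F m\<^esub> \<rho> m j (\<rho> j k x \<otimes>\<^bsub>F j\<^esub> \<rho> j k y)) < e"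
  \<comment> \<open>\<open>Suc k\<close> because the threshold has to exceed \<open>k\<close>; it
    also supplies the condition \<open>k \<le> n\<close> of \<open>main\<close>.\<close>
  proof (intro exI[of _ "max (Suc k) M"] conjI allI impI)
    fix m n j assume *: "n > max (Suc k) M \<and> j > max (Suc k) M \<and> m > max n j"
    interpret Fm: cstar_algebra "F m" by (rule cstar_F)
    have "\<rho> m n (z n) \<in> carrier (F m)" "\<rho> m j (z j) \<in> carrier (F m)"
      using * by (auto intro!: rho_closed z)
    moreover have "norm (emb (F m) (\<rho> m n (z n)) - emb (F m) (\<psi> m (a \<otimes>\<^bsub>A\<^esub> b))) < e / 2"
      and "norm (emb (F m) (\<rho> m j (z j)) - emb (F m) (\<psi> m (a \<otimes>\<^bsub>A\<^esub> b))) < e / 2"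
      using * by (simp_all only: max_less_iff_conj) (rule main; simp)+
    then have "norm (emb (F m) (\<rho> m n (z n)) - emb (F m) (\<rho> m j (z j))) < e"
      using norm_diff_triangle_less[of "emb (F m) (\<rho> m n (z n))" "emb (F m) (\<psi> m (a \<otimes>\<^bsub>A\<^esub> b))" "e / 2" "emb (F m) (\<rho> m j (z j))" "e / 2"]
      by (simp add: norm_minus_commute)
    ultimately show "cnorm (F m) (\<rho> m n (\<rho> n k x \<otimes>\<^bsub>F n\<^esub> \<rho> n k y) \<ominus>\<^bsub>F m\<^esub> \<rho> m j (\<rho> j k x \<otimes>\<^bsub>F j\<^esub> \<rho> j k y)) < e"
      by (simp add: Fm.cnorm_diff_emb z_def)
  qed simp
qed

end

section \<open>Bounded sequences modulo null sequences\<close>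

lemma tendsto_0_le:
  fixes f g :: "nat \<Rightarrow> real"
  assumes "g \<longlonglongrightarrow> 0" "\<And>n. 0 \<le> f n" "\<And>n. f n \<le> g n"
  shows "f \<longlonglongrightarrow> 0"
  by (rule tendsto_sandwich[OF always_eventually always_eventually tendsto_const assms(1)]) (use assms in auto)

lemma prod_cstar_simps:
  "s \<oplus>\<^bsub>prod_cstar F\<^esub> t = (\<lambda>n. s n \<oplus>\<^bsub>F n\<^esub> t n)"
  "s \<otimes>\<^bsub>prod_cstar F\<^esub> t = (\<lambda>n. s n \<otimes>\<^bsub>F n\<^esub> t n)"
  "c \<odot>\<^bsub>prod_cstar F\<^esub> s = (\<lambda>n. c \<odot>\<^bsub>F n\<^esub> s n)"
  "star (prod_cstar F) s = (\<lambda>n. star (F n) (s n))"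
  "cnorm (prod_cstar F) s = (SUP n. cnorm (F n) (s n))"
  by (simp_all add: prod_cstar_def)

lemma seq_class_eq: "seq_class F s = {\<lambda>n. h n \<oplus>\<^bsub>F n\<^esub> s n | h. h \<in> null_seqs F}"
  unfolding seq_class_def a_r_coset_def' prod_cstar_simps by blast

lemma seq_cstar_simps:
  "X \<oplus>\<^bsub>seq_cstar F\<^esub> Y = {\<lambda>n. s n \<oplus>\<^bsub>F n\<^esub> t n | s t. s \<in> X \<and> t \<in> Y}"
  "X \<otimes>\<^bsub>seq_cstar F\<^esub> Y = (\<Union>s\<in>X. \<Union>t\<in>Y. seq_class F (\<lambda>n. s n \<otimes>\<^bsub>F n\<^esub> t n))"
  "c \<odot>\<^bsub>seq_cstar F\<^esub> X = (\<Union>s\<in>X. seq_class F (\<lambda>n. c \<odot>\<^bsub>F n\<^esub> s n))"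
  "star (seq_cstar F) X = (\<Union>s\<in>X. seq_class F (\<lambda>n. star (F n) (s n)))"
  "\<zero>\<^bsub>seq_cstar F\<^esub> = null_seqs F"
  "cnorm (seq_cstar F) X = (INF s\<in>X. SUP n. cnorm (F n) (s n))"
proof -
  have "X \<oplus>\<^bsub>seq_cstar F\<^esub> Y = X <+>\<^bsub>prod_cstar F\<^esub> Y" by (simp add: seq_cstar_def quot_cstar_def)
  also have "\<dots> = {\<lambda>n. s n \<oplus>\<^bsub>F n\<^esub> t n | s t. s \<in> X \<and> t \<in> Y}"
    unfolding set_add_def' prod_cstar_simps by blast
  finally show "X \<oplus>\<^bsub>seq_cstar F\<^esub> Y = {\<lambda>n. s n \<oplus>\<^bsub>F n\<^esub> t n | s t. s \<in> X \<and> t \<in> Y}" .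
qed (simp_all add: seq_cstar_def quot_cstar_def rcoset_mult_def seq_class_def prod_cstar_simps)

lemma seq_cstar_carrier: "carrier (seq_cstar F) = seq_class F ` carrier (prod_cstar F)"
  by (auto simp: seq_cstar_def quot_cstar_def A_RCOSETS_def' seq_class_def)

text \<open>Product, scalar multiple and star of cosets are defined as unions over all
  representatives. Once the resulting class is independent of the representatives, the union
  collapses to that class.\<close>

lemma UN_eq_const: "a \<in> C \<Longrightarrow> (\<And>h. h \<in> C \<Longrightarrow> f h = X) \<Longrightarrow> (\<Union>h\<in>C. f h) = X"
  by auto

locale cstar_sequence =
  fixes F :: "nat \<Rightarrow> 'f cstar"
  assumes cstar: "cstar_algebra (F n)"
begin

sublocale F: cstar_algebra "F n" for n
  by (rule cstar)

abbreviation "bnd s \<equiv> s \<in> carrier (prod_cstar F)"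

abbreviation "e s n \<equiv> emb (F n) (s n)"

lemma bnd_iff: "bnd s \<longleftrightarrow> (\<forall>n. s n \<in> carrier (F n)) \<and> (\<exists>K. \<forall>n. cnorm (F n) (s n) \<le> K)"
  by (simp add: prod_cstar_def)

lemma bndI: "(\<And>n. s n \<in> carrier (F n)) \<Longrightarrow> (\<And>n. cnorm (F n) (s n) \<le> K) \<Longrightarrow> bnd s"
  by (auto simp: bnd_iff)

lemma bnd_carrier [simp, intro]: "bnd s \<Longrightarrow> s n \<in> carrier (F n)"
  by (simp add: bnd_iff)

lemma bnd_bound:
  assumes "bnd s"
  obtains K where "K \<ge> 0" "\<And>n. norm (e s n) \<le> K" "\<And>n. cnorm (F n) (s n) \<le> K"
proof -
  obtain K where K: "\<And>n. cnorm (F n) (s n) \<le> K" using assms by (auto simp: bnd_iff)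
  have "0 \<le> K" using K[of 0] F.norm_nonneg[of "s 0" 0] assms by auto
  then show ?thesis using that[of K] K assms by (simp add: F.norm_emb)
qed

lemma bnd_zero: "bnd (\<lambda>n. \<zero>\<^bsub>F n\<^esub>)"
  by (rule bndI[where K = 0]) auto

lemma bnd_add: assumes "bnd s" "bnd t" shows "bnd (\<lambda>n. s n \<oplus>\<^bsub>F n\<^esub> t n)"
proof -
  obtain K where K: "\<And>n. cnorm (F n) (s n) \<le> K" using bnd_bound[OF assms(1)] by metis
  obtain L where L: "\<And>n. cnorm (F n) (t n) \<le> L" using bnd_bound[OF assms(2)] by metis
  show ?thesis
  proof (rule bndI[where K = "K + L"])
    fix n show "cnorm (F n) (s n \<oplus>\<^bsub>F n\<^esub> t n) \<le> K + L"
      using F.norm_triangle[of "s n" n "t n"] K[of n] L[of n] assms by auto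
  qed (use assms in auto)
qed

lemma bnd_diff: assumes "bnd s" "bnd t" shows "bnd (\<lambda>n. s n \<ominus>\<^bsub>F n\<^esub> t n)"
proof -
  obtain K where K: "\<And>n. cnorm (F n) (s n) \<le> K" using bnd_bound[OF assms(1)] by metis
  obtain L where L: "\<And>n. cnorm (F n) (t n) \<le> L" using bnd_bound[OF assms(2)] by metis
  show ?thesis
  proof (rule bndI[where K = "K + L"])
    fix n show "cnorm (F n) (s n \<ominus>\<^bsub>F n\<^esub> t n) \<le> K + L"
      using F.cnorm_diff_le[of "s n" n "t n"] K[of n] L[of n] assms by auto
  qed (use assms in auto)
qed

lemma bnd_mult: assumes "bnd s" "bnd t" shows "bnd (\<lambda>n. s n \<otimes>\<^bsub>F n\<^esub> t n)"
proof -
  obtain K where K: "K \<ge> 0" "\<And>n. cnorm (F n) (s n) \<le> K" using bnd_bound[OF assms(1)] by metis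
  obtain L where L: "L \<ge> 0" "\<And>n. cnorm (F n) (t n) \<le> L" using bnd_bound[OF assms(2)] by metis
  show ?thesis
  proof (rule bndI[where K = "K * L"])
    fix n show "cnorm (F n) (s n \<otimes>\<^bsub>F n\<^esub> t n) \<le> K * L"
      using F.norm_mult[of "s n" n "t n"] mult_mono[OF K(2)[of n] L(2)[of n] K(1)] F.norm_nonneg[of "t n" n] assms by auto
  qed (use assms F.m_closed in auto)
qed

lemma bnd_smult: assumes "bnd s" shows "bnd (\<lambda>n. c \<odot>\<^bsub>F n\<^esub> s n)"
proof -
  obtain K where K: "\<And>n. cnorm (F n) (s n) \<le> K" using bnd_bound[OF assms(1)] by metis
  show ?thesis
    by (rule bndI[where K = "cmod c * K"]) (use assms K in \<open>auto simp: F.norm_smult intro: mult_left_mono\<close>)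
qed

lemma bnd_star: assumes "bnd s" shows "bnd (\<lambda>n. star (F n) (s n))"
proof -
  obtain K where K: "\<And>n. cnorm (F n) (s n) \<le> K" using bnd_bound[OF assms(1)] by metis
  show ?thesis
    by (rule bndI[where K = K]) (use assms K in \<open>auto simp: F.star_closed F.cnorm_star\<close>)
qed

lemma bnd_finsum: "finite S \<Longrightarrow> (\<And>i. i \<in> S \<Longrightarrow> bnd (s i)) \<Longrightarrow> bnd (\<lambda>n. \<Oplus>\<^bsub>F n\<^esub>i\<in>S. s i n)"
proof (induction S rule: finite_induct)
  case (insert i S)
  have "(\<Oplus>\<^bsub>F n\<^esub>i\<in>insert i S. s i n) = s i n \<oplus>\<^bsub>F n\<^esub> (\<Oplus>\<^bsub>F n\<^esub>i\<in>S. s i n)" for n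
    using insert by (intro F.M.finsum_insert) auto
  then show ?case using insert by (simp add: bnd_add)
qed (simp add: bnd_zero)

lemma mem_seq_class:
  assumes s: "bnd s"
  shows "t \<in> seq_class F s \<longleftrightarrow> bnd t \<and> (\<lambda>n. norm (e t n - e s n)) \<longlonglongrightarrow> 0"
proof
  assume "t \<in> seq_class F s"
  then obtain h where h: "h \<in> null_seqs F" "t = (\<lambda>n. h n \<oplus>\<^bsub>F n\<^esub> s n)"
    unfolding seq_class_eq by blast
  then have "bnd h" "(\<lambda>n. cnorm (F n) (h n)) \<longlonglongrightarrow> 0" by (auto simp: null_seqs_def)
  then show "bnd t \<and> (\<lambda>n. norm (e t n - e s n)) \<longlonglongrightarrow> 0"
    using s by (auto simp: h(2) F.emb_add F.norm_emb intro!: bnd_add)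
next
  assume *: "bnd t \<and> (\<lambda>n. norm (e t n - e s n)) \<longlonglongrightarrow> 0"
  define h where "h = (\<lambda>n. t n \<ominus>\<^bsub>F n\<^esub> s n)"
  have "bnd h" unfolding h_def using * s by (intro bnd_diff) auto
  moreover have "cnorm (F n) (h n) = norm (e t n - e s n)" for n
    using * s by (auto simp: h_def F.cnorm_diff_emb)
  ultimately have "h \<in> null_seqs F" using * by (simp add: null_seqs_def)
  moreover have "t n = h n \<oplus>\<^bsub>F n\<^esub> s n" for n
  proof -
    have "e t n = emb (F n) (h n \<oplus>\<^bsub>F n\<^esub> s n)" using * s by (auto simp: h_def F.emb_add F.emb_diff)
    moreover have "t n \<in> carrier (F n)" "h n \<oplus>\<^bsub>F n\<^esub> s n \<in> carrier (F n)" using * s by (auto simp: h_def)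
    ultimately show ?thesis using F.emb_inject by blast
  qed
  then have "t = (\<lambda>n. h n \<oplus>\<^bsub>F n\<^esub> s n)" by blast
  ultimately show "t \<in> seq_class F s" unfolding seq_class_eq by blast
qed

lemma seq_class_self: "bnd s \<Longrightarrow> s \<in> seq_class F s"
  by (simp add: mem_seq_class)

lemma seq_class_eqI:
  assumes "bnd s" "bnd t" "(\<lambda>n. norm (e s n - e t n)) \<longlonglongrightarrow> 0"
  shows "seq_class F s = seq_class F t"
proof -
  have "seq_class F s \<subseteq> seq_class F t" if "bnd s" "bnd t" "(\<lambda>n. norm (e s n - e t n)) \<longlonglongrightarrow> 0" for s t
  proof
    fix u assume "u \<in> seq_class F s"
    then have u: "bnd u" "(\<lambda>n. norm (e u n - e s n)) \<longlonglongrightarrow> 0" using that by (auto simp: mem_seq_class)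
    have "(\<lambda>n. norm (e u n - e t n)) \<longlonglongrightarrow> 0"
    proof (rule tendsto_0_le)
      show "(\<lambda>n. norm (e u n - e s n) + norm (e s n - e t n)) \<longlonglongrightarrow> 0" using tendsto_add[OF u(2) that(3)] by simp
      show "norm (e u n - e t n) \<le> norm (e u n - e s n) + norm (e s n - e t n)" for n
        using norm_triangle_ineq[of "e u n - e s n" "e s n - e t n"] by simp
    qed simp
    then show "u \<in> seq_class F t" using u that by (simp add: mem_seq_class)
  qed
  from this[OF assms] this[OF assms(2,1)] show ?thesis using assms(3) by (simp add: norm_minus_commute)
qed

lemma seq_class_eq_iff:
  assumes "bnd s" "bnd t"
  shows "seq_class F s = seq_class F t \<longleftrightarrow> (\<lambda>n. norm (e s n - e t n)) \<longlonglongrightarrow> 0"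
  using seq_class_eqI[OF assms] seq_class_self[OF assms(1)] assms by (auto simp: mem_seq_class)

lemma seq_class_in [simp, intro]: "bnd s \<Longrightarrow> seq_class F s \<in> carrier (seq_cstar F)"
  by (simp add: seq_cstar_carrier)

lemma seq_carrierE:
  assumes "X \<in> carrier (seq_cstar F)"
  obtains s where "bnd s" "X = seq_class F s"
  using assms by (auto simp: seq_cstar_carrier)

lemma seq_zero: "\<zero>\<^bsub>seq_cstar F\<^esub> = seq_class F (\<lambda>n. \<zero>\<^bsub>F n\<^esub>)"
proof -
  have "t \<in> null_seqs F \<longleftrightarrow> t \<in> seq_class F (\<lambda>n. \<zero>\<^bsub>F n\<^esub>)" for t
    unfolding mem_seq_class[OF bnd_zero] null_seqs_def by (auto simp: F.norm_emb)
  then show ?thesis unfolding seq_cstar_simps by blast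
qed

lemma seq_add:
  assumes s: "bnd s" and t: "bnd t"
  shows "seq_class F s \<oplus>\<^bsub>seq_cstar F\<^esub> seq_class F t = seq_class F (\<lambda>n. s n \<oplus>\<^bsub>F n\<^esub> t n)"
proof -
  have "seq_class F s \<oplus>\<^bsub>seq_cstar F\<^esub> seq_class F t = {u. \<exists>h\<in>seq_class F s. \<exists>k\<in>seq_class F t. u = (\<lambda>n. h n \<oplus>\<^bsub>F n\<^esub> k n)}"
    unfolding seq_cstar_simps by blast
  also have "\<dots> = seq_class F (\<lambda>n. s n \<oplus>\<^bsub>F n\<^esub> t n)"
  proof safe
    fix h k assume "h \<in> seq_class F s" "k \<in> seq_class F t"
    then have hk: "bnd h" "bnd k" "(\<lambda>n. norm (e h n - e s n)) \<longlonglongrightarrow> 0" "(\<lambda>n. norm (e k n - e t n)) \<longlonglongrightarrow> 0"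
      using s t by (auto simp: mem_seq_class)
    have "(\<lambda>n. norm (emb (F n) (h n \<oplus>\<^bsub>F n\<^esub> k n) - emb (F n) (s n \<oplus>\<^bsub>F n\<^esub> t n))) \<longlonglongrightarrow> 0"
    proof (rule tendsto_0_le)
      show "(\<lambda>n. norm (e h n - e s n) + norm (e k n - e t n)) \<longlonglongrightarrow> 0" using tendsto_add[OF hk(3,4)] by simp
      show "norm (emb (F n) (h n \<oplus>\<^bsub>F n\<^esub> k n) - emb (F n) (s n \<oplus>\<^bsub>F n\<^esub> t n)) \<le> norm (e h n - e s n) + norm (e k n - e t n)" for n
        using norm_triangle_ineq[of "e h n - e s n" "e k n - e t n"] hk s t by (simp add: F.emb_add algebra_simps)
    qed simp
    then show "(\<lambda>n. h n \<oplus>\<^bsub>F n\<^esub> k n) \<in> seq_class F (\<lambda>n. s n \<oplus>\<^bsub>F n\<^esub> t n)"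
      using hk s t by (simp add: mem_seq_class bnd_add)
  next
    fix u assume "u \<in> seq_class F (\<lambda>n. s n \<oplus>\<^bsub>F n\<^esub> t n)"
    then have u: "bnd u" "(\<lambda>n. norm (e u n - emb (F n) (s n \<oplus>\<^bsub>F n\<^esub> t n))) \<longlonglongrightarrow> 0" using s t by (auto simp: mem_seq_class bnd_add)
    have "(\<lambda>n. u n \<ominus>\<^bsub>F n\<^esub> t n) \<in> seq_class F s"
      using u s t by (simp add: mem_seq_class bnd_diff F.emb_add F.emb_diff algebra_simps)
    moreover have "u n = (u n \<ominus>\<^bsub>F n\<^esub> t n) \<oplus>\<^bsub>F n\<^esub> t n" for n
    proof -
      have "e u n = emb (F n) ((u n \<ominus>\<^bsub>F n\<^esub> t n) \<oplus>\<^bsub>F n\<^esub> t n)" using u t by (auto simp: F.emb_add F.emb_diff)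
      moreover have "u n \<in> carrier (F n)" "(u n \<ominus>\<^bsub>F n\<^esub> t n) \<oplus>\<^bsub>F n\<^esub> t n \<in> carrier (F n)" using u t by auto
      ultimately show ?thesis using F.emb_inject by blast
    qed
    then have "u = (\<lambda>n. (u n \<ominus>\<^bsub>F n\<^esub> t n) \<oplus>\<^bsub>F n\<^esub> t n)" by blast
    ultimately show "\<exists>h\<in>seq_class F s. \<exists>k\<in>seq_class F t. u = (\<lambda>n. h n \<oplus>\<^bsub>F n\<^esub> k n)"
      using seq_class_self[OF t] by (intro bexI[of _ "\<lambda>n. u n \<ominus>\<^bsub>F n\<^esub> t n"] bexI[of _ t])
  qed
  finally show ?thesis .
qed

lemma seq_mult:
  assumes s: "bnd s" and t: "bnd t"
  shows "seq_class F s \<otimes>\<^bsub>seq_cstar F\<^esub> seq_class F t = seq_class F (\<lambda>n. s n \<otimes>\<^bsub>F n\<^esub> t n)"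
proof -
  have eq: "seq_class F (\<lambda>n. h n \<otimes>\<^bsub>F n\<^esub> k n) = seq_class F (\<lambda>n. s n \<otimes>\<^bsub>F n\<^esub> t n)"
    if "h \<in> seq_class F s" "k \<in> seq_class F t" for h k
  proof (rule seq_class_eqI)
    have hk: "bnd h" "bnd k" "(\<lambda>n. norm (e h n - e s n)) \<longlonglongrightarrow> 0" "(\<lambda>n. norm (e k n - e t n)) \<longlonglongrightarrow> 0"
      using that s t by (auto simp: mem_seq_class)
    then show "bnd (\<lambda>n. h n \<otimes>\<^bsub>F n\<^esub> k n)" by (intro bnd_mult)
    show "bnd (\<lambda>n. s n \<otimes>\<^bsub>F n\<^esub> t n)" using s t by (rule bnd_mult)
    obtain K where K: "\<And>n. norm (e h n) \<le> K" using bnd_bound[OF hk(1)] by metis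
    obtain L where L: "\<And>n. norm (e t n) \<le> L" using bnd_bound[OF t] by metis
    show "(\<lambda>n. norm (emb (F n) (h n \<otimes>\<^bsub>F n\<^esub> k n) - emb (F n) (s n \<otimes>\<^bsub>F n\<^esub> t n))) \<longlonglongrightarrow> 0"
    proof (rule tendsto_0_le)
      show "(\<lambda>n. K * norm (e k n - e t n) + norm (e h n - e s n) * L) \<longlonglongrightarrow> 0"
        using tendsto_add[OF tendsto_mult_right_zero[OF hk(4), of K] tendsto_mult_left_zero[OF hk(3), of L]] by simp
      fix n
      have eq': "emb (F n) (h n \<otimes>\<^bsub>F n\<^esub> k n) - emb (F n) (s n \<otimes>\<^bsub>F n\<^esub> t n) = e h n * (e k n - e t n) + (e h n - e s n) * e t n"
        using hk s t by (simp add: F.emb_mult algebra_simps)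
      have "norm (e h n * (e k n - e t n) + (e h n - e s n) * e t n) \<le> norm (e h n) * norm (e k n - e t n) + norm (e h n - e s n) * norm (e t n)"
        by (intro norm_triangle_le add_mono norm_mult_ineq)
      moreover have "norm (e h n) * norm (e k n - e t n) + norm (e h n - e s n) * norm (e t n) \<le> K * norm (e k n - e t n) + norm (e h n - e s n) * L"
        by (intro add_mono mult_right_mono mult_left_mono K L) auto
      ultimately show "norm (emb (F n) (h n \<otimes>\<^bsub>F n\<^esub> k n) - emb (F n) (s n \<otimes>\<^bsub>F n\<^esub> t n))
          \<le> K * norm (e k n - e t n) + norm (e h n - e s n) * L"
        unfolding eq' by linarith
    qed simp
  qed
  show ?thesis
    unfolding seq_cstar_simps
    by (rule UN_eq_const[OF seq_class_self[OF s]], rule UN_eq_const[OF seq_class_self[OF t]], rule eq)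
qed

lemma seq_smult:
  assumes s: "bnd s"
  shows "c \<odot>\<^bsub>seq_cstar F\<^esub> seq_class F s = seq_class F (\<lambda>n. c \<odot>\<^bsub>F n\<^esub> s n)"
proof -
  have eq: "seq_class F (\<lambda>n. c \<odot>\<^bsub>F n\<^esub> h n) = seq_class F (\<lambda>n. c \<odot>\<^bsub>F n\<^esub> s n)" if "h \<in> seq_class F s" for h
  proof (rule seq_class_eqI)
    have h: "bnd h" "(\<lambda>n. norm (e h n - e s n)) \<longlonglongrightarrow> 0" using that s by (auto simp: mem_seq_class)
    then show "bnd (\<lambda>n. c \<odot>\<^bsub>F n\<^esub> h n)" "bnd (\<lambda>n. c \<odot>\<^bsub>F n\<^esub> s n)" using s by (auto intro: bnd_smult)
    have "norm (emb (F n) (c \<odot>\<^bsub>F n\<^esub> h n) - emb (F n) (c \<odot>\<^bsub>F n\<^esub> s n)) = cmod c * norm (e h n - e s n)" for n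
      using h s by (simp add: F.emb_smult scaleC_diff_right[symmetric] norm_scaleC)
    then show "(\<lambda>n. norm (emb (F n) (c \<odot>\<^bsub>F n\<^esub> h n) - emb (F n) (c \<odot>\<^bsub>F n\<^esub> s n))) \<longlonglongrightarrow> 0"
      using tendsto_mult_right_zero[OF h(2), of "cmod c"] by simp
  qed
  show ?thesis
    unfolding seq_cstar_simps by (rule UN_eq_const[OF seq_class_self[OF s]], rule eq)
qed

lemma seq_star:
  assumes s: "bnd s"
  shows "star (seq_cstar F) (seq_class F s) = seq_class F (\<lambda>n. star (F n) (s n))"
proof -
  have eq: "seq_class F (\<lambda>n. star (F n) (h n)) = seq_class F (\<lambda>n. star (F n) (s n))" if "h \<in> seq_class F s" for h
  proof (rule seq_class_eqI)
    have h: "bnd h" "(\<lambda>n. norm (e h n - e s n)) \<longlonglongrightarrow> 0" using that s by (auto simp: mem_seq_class)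
    then show "bnd (\<lambda>n. star (F n) (h n))" "bnd (\<lambda>n. star (F n) (s n))" using s by (auto intro: bnd_star)
    have "norm (emb (F n) (star (F n) (h n)) - emb (F n) (star (F n) (s n))) = norm (e h n - e s n)" for n
      using h s by (simp add: F.emb_star adj_diff[symmetric])
    then show "(\<lambda>n. norm (emb (F n) (star (F n) (h n)) - emb (F n) (star (F n) (s n)))) \<longlonglongrightarrow> 0"
      using h(2) by simp
  qed
  show ?thesis
    unfolding seq_cstar_simps by (rule UN_eq_const[OF seq_class_self[OF s]], rule eq)
qed

lemma seq_class_cong:
  assumes "bnd s" "bnd t" "\<And>n. e s n = e t n"
  shows "seq_class F s = seq_class F t"
  using assms by (intro seq_class_eqI) auto

lemma abelian_group_seq: "abelian_group (seq_cstar F)"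
proof (rule abelian_groupI)
  show "\<zero>\<^bsub>seq_cstar F\<^esub> \<in> carrier (seq_cstar F)" unfolding seq_zero using bnd_zero by auto
  fix X assume X: "X \<in> carrier (seq_cstar F)"
  then obtain s where s: "bnd s" "X = seq_class F s" by (rule seq_carrierE)
  show "\<zero>\<^bsub>seq_cstar F\<^esub> \<oplus>\<^bsub>seq_cstar F\<^esub> X = X"
    unfolding seq_zero s(2) seq_add[OF bnd_zero s(1)]
    using s(1) by (intro seq_class_cong bnd_add bnd_zero) (auto simp: F.emb_add)
  have m: "bnd (\<lambda>n. (-1) \<odot>\<^bsub>F n\<^esub> s n)" using s(1) by (rule bnd_smult)
  have "seq_class F (\<lambda>n. (-1) \<odot>\<^bsub>F n\<^esub> s n) \<oplus>\<^bsub>seq_cstar F\<^esub> X = \<zero>\<^bsub>seq_cstar F\<^esub>"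
    unfolding seq_zero s(2) seq_add[OF m s(1)]
    using s(1) m by (intro seq_class_cong bnd_add bnd_zero) (auto simp: F.emb_add F.emb_smult scaleC_minus_one)
  then show "\<exists>Y\<in>carrier (seq_cstar F). Y \<oplus>\<^bsub>seq_cstar F\<^esub> X = \<zero>\<^bsub>seq_cstar F\<^esub>" using m by blast
  fix Y assume "Y \<in> carrier (seq_cstar F)"
  then obtain t where t: "bnd t" "Y = seq_class F t" by (rule seq_carrierE)
  show "X \<oplus>\<^bsub>seq_cstar F\<^esub> Y \<in> carrier (seq_cstar F)"
    unfolding s(2) t(2) seq_add[OF s(1) t(1)] using s t by (intro seq_class_in bnd_add)
  show "X \<oplus>\<^bsub>seq_cstar F\<^esub> Y = Y \<oplus>\<^bsub>seq_cstar F\<^esub> X"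
    unfolding s(2) t(2) seq_add[OF s(1) t(1)] seq_add[OF t(1) s(1)]
    using s t by (intro seq_class_cong bnd_add) (auto simp: F.emb_add)
  fix Z assume "Z \<in> carrier (seq_cstar F)"
  then obtain u where u: "bnd u" "Z = seq_class F u" by (rule seq_carrierE)
  show "X \<oplus>\<^bsub>seq_cstar F\<^esub> Y \<oplus>\<^bsub>seq_cstar F\<^esub> Z = X \<oplus>\<^bsub>seq_cstar F\<^esub> (Y \<oplus>\<^bsub>seq_cstar F\<^esub> Z)"
    using s t u by (simp add: seq_add bnd_add) (intro seq_class_cong bnd_add; auto simp: F.emb_add)
qed

lemma seq_minus:
  assumes s: "bnd s"
  shows "\<ominus>\<^bsub>seq_cstar F\<^esub> seq_class F s = seq_class F (\<lambda>n. \<ominus>\<^bsub>F n\<^esub> s n)"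
proof -
  interpret N: abelian_group "seq_cstar F" by (rule abelian_group_seq)
  have eq: "(\<lambda>n. \<ominus>\<^bsub>F n\<^esub> s n) = (\<lambda>n. (-1) \<odot>\<^bsub>F n\<^esub> s n)" using s by (auto simp: F.minus_eq_smult)
  have m: "bnd (\<lambda>n. \<ominus>\<^bsub>F n\<^esub> s n)" unfolding eq using s by (rule bnd_smult)
  show ?thesis
  proof (rule N.minus_equality)
    show "seq_class F (\<lambda>n. \<ominus>\<^bsub>F n\<^esub> s n) \<oplus>\<^bsub>seq_cstar F\<^esub> seq_class F s = \<zero>\<^bsub>seq_cstar F\<^esub>"
      unfolding seq_zero seq_add[OF m s]
      using s m by (intro seq_class_cong bnd_add bnd_zero) (auto simp: F.emb_add F.emb_minus)
  qed (use s m in auto)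
qed

lemma seq_diff:
  assumes s: "bnd s" and t: "bnd t"
  shows "seq_class F s \<ominus>\<^bsub>seq_cstar F\<^esub> seq_class F t = seq_class F (\<lambda>n. s n \<ominus>\<^bsub>F n\<^esub> t n)"
proof -
  have "(\<lambda>n. \<ominus>\<^bsub>F n\<^esub> t n) = (\<lambda>n. (-1) \<odot>\<^bsub>F n\<^esub> t n)" using t by (auto simp: F.minus_eq_smult)
  then have "bnd (\<lambda>n. \<ominus>\<^bsub>F n\<^esub> t n)" using bnd_smult[OF t] by simp
  then show ?thesis
    unfolding a_minus_def[of "seq_cstar F"] seq_minus[OF t] by (simp add: seq_add[OF s]) (simp add: a_minus_def)
qed

lemma seq_finsum:
  assumes "finite S" "\<And>i. i \<in> S \<Longrightarrow> bnd (s i)"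
  shows "(\<Oplus>\<^bsub>seq_cstar F\<^esub>i\<in>S. seq_class F (s i)) = seq_class F (\<lambda>n. \<Oplus>\<^bsub>F n\<^esub>i\<in>S. s i n)"
  using assms
proof (induction S rule: finite_induct)
  case empty
  interpret N: abelian_group "seq_cstar F" by (rule abelian_group_seq)
  show ?case by (simp add: seq_zero)
next
  case (insert i S)
  interpret N: abelian_group "seq_cstar F" by (rule abelian_group_seq)
  have "(\<Oplus>\<^bsub>seq_cstar F\<^esub>i\<in>insert i S. seq_class F (s i)) = seq_class F (s i) \<oplus>\<^bsub>seq_cstar F\<^esub> (\<Oplus>\<^bsub>seq_cstar F\<^esub>i\<in>S. seq_class F (s i))"
    using insert by (intro N.finsum_insert) auto
  also have "\<dots> = seq_class F (\<lambda>n. s i n \<oplus>\<^bsub>F n\<^esub> (\<Oplus>\<^bsub>F n\<^esub>i\<in>S. s i n))"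
    using insert by (simp add: seq_add bnd_finsum)
  also have "(\<lambda>n. s i n \<oplus>\<^bsub>F n\<^esub> (\<Oplus>\<^bsub>F n\<^esub>i\<in>S. s i n)) = (\<lambda>n. \<Oplus>\<^bsub>F n\<^esub>i\<in>insert i S. s i n)"
  proof
    fix n show "s i n \<oplus>\<^bsub>F n\<^esub> (\<Oplus>\<^bsub>F n\<^esub>i\<in>S. s i n) = (\<Oplus>\<^bsub>F n\<^esub>i\<in>insert i S. s i n)"
      using insert by (intro F.M.finsum_insert[symmetric]) auto
  qed
  finally show ?case .
qed

text \<open>The quotient norm is the limit superior of the norms of the entries. In one direction a
  nearly optimal representative differs from \<open>s\<close> by a null sequence; in the other,
  setting finitely many entries to zero stays in the class and brings the supremum down to the
  eventual bound.\<close>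

lemma seq_norm_le_iff:
  assumes s: "bnd s"
  shows "cnorm (seq_cstar F) (seq_class F s) \<le> c \<longleftrightarrow>
    (\<forall>\<epsilon>>0. eventually (\<lambda>n. cnorm (F n) (s n) \<le> c + \<epsilon>) sequentially)"
proof -
  let ?N = "\<lambda>t. SUP n. cnorm (F n) (t n)"
  have nrm: "cnorm (seq_cstar F) (seq_class F s) = (INF t\<in>seq_class F s. ?N t)"
    by (rule seq_cstar_simps)
  have bdd: "bdd_above (range (\<lambda>n. cnorm (F n) (t n)))" if "bnd t" for t
    using that unfolding bnd_iff by (auto intro: bdd_aboveI)
  have N0: "0 \<le> ?N t" if "bnd t" for t
    using cSUP_upper[OF _ bdd[OF that], of 0] F.norm_nonneg[of "t 0" 0] that by auto
  have bb: "bdd_below (?N ` seq_class F s)" using N0 s by (intro bdd_belowI2[of _ 0]) (auto simp: mem_seq_class)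
  show ?thesis
  proof safe
    fix \<epsilon> :: real assume le: "cnorm (seq_cstar F) (seq_class F s) \<le> c" and "\<epsilon> > 0"
    then have "(INF t\<in>seq_class F s. ?N t) < c + \<epsilon> / 2" unfolding nrm by linarith
    then obtain t where t: "t \<in> seq_class F s" "?N t < c + \<epsilon> / 2"
      using cINF_less_iff[OF _ bb] seq_class_self[OF s] by blast
    then have t': "bnd t" "(\<lambda>n. norm (e t n - e s n)) \<longlonglongrightarrow> 0" using s by (auto simp: mem_seq_class)
    have "eventually (\<lambda>n. norm (e t n - e s n) < \<epsilon> / 2) sequentially"
      using \<open>\<epsilon> > 0\<close> by (intro order_tendstoD(2)[OF t'(2)]) simp
    then show "eventually (\<lambda>n. cnorm (F n) (s n) \<le> c + \<epsilon>) sequentially"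
    proof (rule eventually_mono)
      fix n assume *: "norm (e t n - e s n) < \<epsilon> / 2"
      have "cnorm (F n) (t n) \<le> ?N t" by (rule cSUP_upper[OF _ bdd[OF t'(1)]]) simp
      moreover have "norm (e s n) \<le> norm (e t n) + norm (e t n - e s n)" using norm_triangle_ineq4[of "e t n" "e t n - e s n"] by simp
      ultimately show "cnorm (F n) (s n) \<le> c + \<epsilon>" using * t(2) s t' by (simp add: F.norm_emb)
    qed
  next
    assume ev: "\<forall>\<epsilon>>0. eventually (\<lambda>n. cnorm (F n) (s n) \<le> c + \<epsilon>) sequentially"
    have "cnorm (seq_cstar F) (seq_class F s) \<le> c + \<epsilon>" if \<epsilon>: "\<epsilon> > 0" for \<epsilon>
    proof -
      obtain M where M: "\<And>n. n \<ge> M \<Longrightarrow> cnorm (F n) (s n) \<le> c + \<epsilon>" using ev \<epsilon> by (auto simp: eventually_sequentially)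
      define t where "t = (\<lambda>n. if n < M then \<zero>\<^bsub>F n\<^esub> else s n)"
      obtain K where K: "K \<ge> 0" "\<And>n. cnorm (F n) (s n) \<le> K" using bnd_bound[OF s] by metis
      have t: "bnd t" by (rule bndI[where K = K]) (use s K in \<open>auto simp: t_def\<close>)
      have "(\<lambda>n. norm (e t n - e s n)) \<longlonglongrightarrow> 0"
        by (rule tendsto_eventually) (auto simp: eventually_sequentially t_def intro!: exI[of _ M])
      then have tin: "t \<in> seq_class F s" using t s by (simp add: mem_seq_class)
      have c0: "0 \<le> c + \<epsilon>" using M[of M] F.norm_nonneg[of "s M" M] s by auto
      have "?N t \<le> c + \<epsilon>" by (rule cSUP_least) (use M c0 in \<open>auto simp: t_def\<close>)
      then show ?thesis unfolding nrm using cINF_lower[OF bb tin] by linarith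
    qed
    then show "cnorm (seq_cstar F) (seq_class F s) \<le> c" by (rule field_le_epsilon)
  qed
qed

lemma seq_norm_nonneg:
  assumes s: "bnd s"
  shows "0 \<le> cnorm (seq_cstar F) (seq_class F s)"
proof -
  let ?c = "cnorm (seq_cstar F) (seq_class F s)"
  have "0 \<le> ?c + \<epsilon>" if \<epsilon>: "\<epsilon> > 0" for \<epsilon>
  proof -
    have "eventually (\<lambda>n. cnorm (F n) (s n) \<le> ?c + \<epsilon>) sequentially" using seq_norm_le_iff[OF s, of ?c] \<epsilon> by simp
    then obtain n where "cnorm (F n) (s n) \<le> ?c + \<epsilon>" by (auto simp: eventually_sequentially)
    then show ?thesis using F.norm_nonneg[of "s n" n] s by auto
  qed
  then show ?thesis by (rule field_le_epsilon)
qed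

lemma seq_col_norm:
  assumes v: "\<And>i. i < r \<Longrightarrow> bnd (v i)" and V: "\<And>i. i < r \<Longrightarrow> V i = seq_class F (v i)"
  shows "col_norm (seq_cstar F) r V = sqrt (cnorm (seq_cstar F) (seq_class F (\<lambda>n. \<Oplus>\<^bsub>F n\<^esub>i\<in>{..<r}. star (F n) (v i n) \<otimes>\<^bsub>F n\<^esub> v i n)))"
    and "bnd (\<lambda>n. \<Oplus>\<^bsub>F n\<^esub>i\<in>{..<r}. star (F n) (v i n) \<otimes>\<^bsub>F n\<^esub> v i n)"
proof -
  interpret N: abelian_group "seq_cstar F" by (rule abelian_group_seq)
  show "bnd (\<lambda>n. \<Oplus>\<^bsub>F n\<^esub>i\<in>{..<r}. star (F n) (v i n) \<otimes>\<^bsub>F n\<^esub> v i n)" using v by (intro bnd_finsum bnd_mult bnd_star) auto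
  have "(\<Oplus>\<^bsub>seq_cstar F\<^esub>i\<in>{..<r}. star (seq_cstar F) (V i) \<otimes>\<^bsub>seq_cstar F\<^esub> V i)
     = (\<Oplus>\<^bsub>seq_cstar F\<^esub>i\<in>{..<r}. seq_class F (\<lambda>n. star (F n) (v i n) \<otimes>\<^bsub>F n\<^esub> v i n))"
    using v by (intro N.finsum_cong') (auto simp: V seq_star seq_mult bnd_star bnd_mult)
  also have "\<dots> = seq_class F (\<lambda>n. \<Oplus>\<^bsub>F n\<^esub>i\<in>{..<r}. star (F n) (v i n) \<otimes>\<^bsub>F n\<^esub> v i n)"
    using v by (intro seq_finsum bnd_mult bnd_star) auto
  finally show "col_norm (seq_cstar F) r V = sqrt (cnorm (seq_cstar F) (seq_class F (\<lambda>n. \<Oplus>\<^bsub>F n\<^esub>i\<in>{..<r}. star (F n) (v i n) \<otimes>\<^bsub>F n\<^esub> v i n)))"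
    by (simp add: col_norm_def)
qed

lemma seq_col_norm_nonneg:
  assumes "\<And>i. i < r \<Longrightarrow> bnd (v i)" "\<And>i. i < r \<Longrightarrow> V i = seq_class F (v i)"
  shows "0 \<le> col_norm (seq_cstar F) r V"
  using seq_col_norm[of r v V, OF assms] by (simp add: seq_norm_nonneg)

text \<open>The square of the column norm is the quotient norm of the sequence of column squares, so
  this is \<open>seq_norm_le_iff\<close> with \<open>c^2\<close>. What remains is to convert the
  slack added to \<open>c^2\<close> into slack added to \<open>c\<close>, and back.\<close>

lemma seq_col_norm_le_iff:
  assumes v: "\<And>i. i < r \<Longrightarrow> bnd (v i)" and V: "\<And>i. i < r \<Longrightarrow> V i = seq_class F (v i)" and c: "0 \<le> c"
  shows "col_norm (seq_cstar F) r V \<le> c \<longleftrightarrow>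
    (\<forall>\<epsilon>>0. eventually (\<lambda>n. cn r (\<lambda>i. e (v i) n) \<le> c + \<epsilon>) sequentially)"
proof -
  define s where "s = (\<lambda>n. \<Oplus>\<^bsub>F n\<^esub>i\<in>{..<r}. star (F n) (v i n) \<otimes>\<^bsub>F n\<^esub> v i n)"
  have s: "bnd s" and sq: "col_norm (seq_cstar F) r V = sqrt (cnorm (seq_cstar F) (seq_class F s))"
    unfolding s_def using seq_col_norm[of r v V, OF v V] by auto
  have sn: "cnorm (F n) (s n) = (cn r (\<lambda>i. e (v i) n))\<^sup>2" for n
  proof -
    have "col_norm (F n) r (\<lambda>i. v i n) = cn r (\<lambda>i. e (v i) n)" using v by (intro F.col_norm_eq) auto
    moreover have "col_norm (F n) r (\<lambda>i. v i n) = sqrt (cnorm (F n) (s n))" by (simp only: col_norm_def s_def)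
    moreover have "0 \<le> cnorm (F n) (s n)" using s by (intro F.norm_nonneg bnd_carrier)
    ultimately show ?thesis by (metis real_sqrt_pow2)
  qed
  have "col_norm (seq_cstar F) r V \<le> c \<longleftrightarrow> cnorm (seq_cstar F) (seq_class F s) \<le> c\<^sup>2"
    unfolding sq using real_sqrt_le_iff[of "cnorm (seq_cstar F) (seq_class F s)" "c\<^sup>2"] c by simp
  also have "\<dots> \<longleftrightarrow> (\<forall>\<epsilon>>0. eventually (\<lambda>n. (cn r (\<lambda>i. e (v i) n))\<^sup>2 \<le> c\<^sup>2 + \<epsilon>) sequentially)"
    unfolding seq_norm_le_iff[OF s] sn ..
  also have "\<dots> \<longleftrightarrow> (\<forall>\<epsilon>>0. eventually (\<lambda>n. cn r (\<lambda>i. e (v i) n) \<le> c + \<epsilon>) sequentially)"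
  proof safe
    fix \<epsilon> :: real assume ev: "\<forall>\<epsilon>>0. eventually (\<lambda>n. (cn r (\<lambda>i. e (v i) n))\<^sup>2 \<le> c\<^sup>2 + \<epsilon>) sequentially" and \<epsilon>: "\<epsilon> > 0"
    have "eventually (\<lambda>n. (cn r (\<lambda>i. e (v i) n))\<^sup>2 \<le> c\<^sup>2 + \<epsilon>\<^sup>2) sequentially" using ev \<epsilon> by simp
    then show "eventually (\<lambda>n. cn r (\<lambda>i. e (v i) n) \<le> c + \<epsilon>) sequentially"
    proof (rule eventually_mono)
      fix n assume "(cn r (\<lambda>i. e (v i) n))\<^sup>2 \<le> c\<^sup>2 + \<epsilon>\<^sup>2"
      also have "c\<^sup>2 + \<epsilon>\<^sup>2 \<le> (c + \<epsilon>)\<^sup>2" using mult_nonneg_nonneg[OF c less_imp_le[OF \<epsilon>]] by (simp add: power2_sum mult.commute)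
      finally show "cn r (\<lambda>i. e (v i) n) \<le> c + \<epsilon>" by (rule power2_le_imp_le) (use c \<epsilon> in linarith)
    qed
  next
    fix \<epsilon> :: real assume ev: "\<forall>\<epsilon>>0. eventually (\<lambda>n. cn r (\<lambda>i. e (v i) n) \<le> c + \<epsilon>) sequentially" and \<epsilon>: "\<epsilon> > 0"
    \<comment> \<open>Chosen so that \<open>(c + d)^2 = c^2 + d (2 c + d)\<close> is at most
      \<open>c^2 + d (2 c + 1)\<close> and hence at most \<open>c^2 + \<epsilon>\<close>.\<close>
    define d where "d = min 1 (\<epsilon> / (2 * c + 1))"
    have d: "d > 0" "d \<le> 1" using c \<epsilon> by (simp_all add: d_def)
    have "d \<le> \<epsilon> / (2 * c + 1)" by (simp add: d_def)
    then have d3: "d * (2 * c + 1) \<le> \<epsilon>" using c by (simp add: pos_le_divide_eq)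
    have "eventually (\<lambda>n. cn r (\<lambda>i. e (v i) n) \<le> c + d) sequentially" using ev d by simp
    then show "eventually (\<lambda>n. (cn r (\<lambda>i. e (v i) n))\<^sup>2 \<le> c\<^sup>2 + \<epsilon>) sequentially"
    proof (rule eventually_mono)
      fix n assume "cn r (\<lambda>i. e (v i) n) \<le> c + d"
      then have "(cn r (\<lambda>i. e (v i) n))\<^sup>2 \<le> (c + d)\<^sup>2" by (intro power_mono) auto
      also have "\<dots> = c\<^sup>2 + d * (2 * c + d)" by (simp add: power2_eq_square algebra_simps)
      also have "\<dots> \<le> c\<^sup>2 + d * (2 * c + 1)" using d by (intro add_left_mono mult_left_mono) auto
      finally show "(cn r (\<lambda>i. e (v i) n))\<^sup>2 \<le> c\<^sup>2 + \<epsilon>" using d3 by linarith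
    qed
  qed
  finally show ?thesis .
qed

end

section \<open>The limit of a summable system\<close>

context cstar_algebra
begin

lemma mat_norm_witness:
  assumes X: "X \<in> mats r (carrier A)" and "\<epsilon> > 0"
  obtains v where "\<forall>i<r. v i \<in> carrier A" "cn r (\<lambda>i. emb A (v i)) \<le> 1"
    "mat_norm A r X - \<epsilon> < cn r (mv r (\<lambda>i j. emb A (X i j)) (\<lambda>i. emb A (v i)))"
proof -
  let ?S = "{col_norm A r (\<lambda>i\<in>{..<r}. \<Oplus>j\<in>{..<r}. X i j \<otimes> v j) | v.
          v \<in> {..<r} \<rightarrow>\<^sub>E carrier A \<and> col_norm A r v \<le> 1}"
  define z where "z = (\<lambda>i\<in>{..<r}. \<zero>)"
  have "col_norm A r z = cn r (\<lambda>i. emb A (z i))" by (rule col_norm_eq) (simp add: z_def)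
  also have "\<dots> = 0" using cn_cong[of r "\<lambda>i. emb A (z i)" "\<lambda>i. 0"] by (simp add: z_def)
  finally have "col_norm A r z \<le> 1" by simp
  moreover have "z \<in> {..<r} \<rightarrow>\<^sub>E carrier A" by (auto simp: z_def)
  ultimately have "?S \<noteq> {}" by blast
  moreover have "mat_norm A r X - \<epsilon> < Sup ?S" using assms(2) by (simp add: mat_norm_def)
  ultimately have "\<exists>x\<in>?S. mat_norm A r X - \<epsilon> < x" by (intro less_cSupD)
  then obtain x where x: "x \<in> ?S" "mat_norm A r X - \<epsilon> < x" by (elim bexE)
  obtain v where v0: "x = col_norm A r (\<lambda>i\<in>{..<r}. \<Oplus>j\<in>{..<r}. X i j \<otimes> v j)"
    and v: "v \<in> {..<r} \<rightarrow>\<^sub>E carrier A" "col_norm A r v \<le> 1" using x(1) unfolding mem_Collect_eq by blast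
  note v = v x(2)[unfolded v0]
  have vi: "v i \<in> carrier A" if "i < r" for i using v(1) that by (blast dest: PiE_mem)
  show ?thesis
    by (rule that[of v]) (use v vi in \<open>simp_all add: col_norm_eq col_norm_mat_col[OF X]\<close>)
qed

lemma mat_norm_diff_le_sum:
  assumes X: "X \<in> mats r (carrier A)" and Y: "Y \<in> mats r (carrier A)"
  shows "mat_norm A r (X \<ominus>\<^bsub>mat_cstar r A\<^esub> Y) \<le> (\<Sum>i<r. \<Sum>j<r. cnorm A (X i j \<ominus> Y i j))"
proof -
  have "mk_mat r (\<lambda>i j. X i j \<ominus> Y i j) \<in> mats r (carrier A)"
    using mats_entry[OF X] mats_entry[OF Y] by (intro mk_mat_in) auto
  from mat_norm_le_sum[OF this] show ?thesis unfolding mat_minus_apply[OF X Y] by simp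
qed

lemma positive_limit:
  assumes x: "x \<in> carrier A" and y: "\<And>n. y n \<in> carrier A" "\<And>n. positive A (y n)"
    and lim: "(\<lambda>n. cnorm A (y n \<ominus> x)) \<longlonglongrightarrow> 0"
  shows "positive A x"
proof -
  have "(\<lambda>n. emb A (y n)) \<longlonglongrightarrow> emb A x"
    using lim by (simp add: cnorm_diff_emb x y tendsto_norm_zero_iff LIM_zero_iff)
  then have "pos (emb A x)" by (rule pos_limit[rotated]) (use y in \<open>simp add: positive_iff\<close>)
  then show ?thesis using x by (simp add: positive_iff)
qed

end

context cstar_sequence
begin

lemma seq_star_mult_apply:
  assumes b: "\<And>i j. i < r \<Longrightarrow> j < r \<Longrightarrow> bnd (b i j)" "\<And>i j. i < r \<Longrightarrow> j < r \<Longrightarrow> B i j = seq_class F (b i j)"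
    and ij: "i < r" "j < r"
  shows "(star (mat_cstar r (seq_cstar F)) B \<otimes>\<^bsub>mat_cstar r (seq_cstar F)\<^esub> B) i j
    = seq_class F (\<lambda>n. \<Oplus>\<^bsub>F n\<^esub>k\<in>{..<r}. star (F n) (b k i n) \<otimes>\<^bsub>F n\<^esub> b k j n)"
proof -
  interpret N: abelian_group "seq_cstar F" by (rule abelian_group_seq)
  have "(star (mat_cstar r (seq_cstar F)) B \<otimes>\<^bsub>mat_cstar r (seq_cstar F)\<^esub> B) i j
    = (\<Oplus>\<^bsub>seq_cstar F\<^esub>k\<in>{..<r}. star (mat_cstar r (seq_cstar F)) B i k \<otimes>\<^bsub>seq_cstar F\<^esub> B k j)"
    by (rule mat_cstar_apply(1)[OF ij])
  also have "\<dots> = (\<Oplus>\<^bsub>seq_cstar F\<^esub>k\<in>{..<r}. seq_class F (\<lambda>n. star (F n) (b k i n) \<otimes>\<^bsub>F n\<^esub> b k j n))"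
    using b ij by (intro N.finsum_cong') (auto simp: mat_cstar_apply(4) seq_star seq_mult bnd_star bnd_mult)
  also have "\<dots> = seq_class F (\<lambda>n. \<Oplus>\<^bsub>F n\<^esub>k\<in>{..<r}. star (F n) (b k i n) \<otimes>\<^bsub>F n\<^esub> b k j n)"
    using b ij by (intro seq_finsum bnd_mult bnd_star) auto
  finally show ?thesis .
qed

end

section \<open>The map \<Psi> and its inverse\<close>

context approximations
begin

sublocale Q: cstar_sequence F
  by (rule cstar_sequence.intro) (rule cstar_F)

abbreviation "\<Psi> \<equiv> Psi_map F \<psi>"

lemma bnd_psi: "a \<in> carrier A \<Longrightarrow> Q.bnd (\<lambda>m. \<psi> m a)"
  by (rule Q.bndI[where K = "cnorm A a"]) (auto intro: cpc_map.map_norm_le[OF psi])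

lemma Psi_in [simp, intro]: "a \<in> carrier A \<Longrightarrow> \<Psi> a \<in> carrier (seq_cstar F)"
  unfolding Psi_map_def by (intro Q.seq_class_in bnd_psi)

lemma Psi_add: "a \<in> carrier A \<Longrightarrow> b \<in> carrier A \<Longrightarrow> \<Psi> (a \<oplus>\<^bsub>A\<^esub> b) = \<Psi> a \<oplus>\<^bsub>seq_cstar F\<^esub> \<Psi> b"
  by (simp add: Psi_map_def Q.seq_add bnd_psi cpc_map.map_add[OF psi])

lemma Psi_smult: "a \<in> carrier A \<Longrightarrow> \<Psi> (c \<odot>\<^bsub>A\<^esub> a) = c \<odot>\<^bsub>seq_cstar F\<^esub> \<Psi> a"
  by (simp add: Psi_map_def Q.seq_smult bnd_psi cpc_map.map_smult[OF psi])

lemma Psi_star: "a \<in> carrier A \<Longrightarrow> \<Psi> (star A a) = star (seq_cstar F) (\<Psi> a)"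
  by (simp add: Psi_map_def Q.seq_star bnd_psi cpc_map.map_star[OF psi])

lemma Psi_minus: "a \<in> carrier A \<Longrightarrow> \<Psi> (\<ominus>\<^bsub>A\<^esub> a) = \<ominus>\<^bsub>seq_cstar F\<^esub> \<Psi> a"
  by (simp add: Psi_map_def Q.seq_minus bnd_psi cpc_map.map_minus[OF psi])

lemma Psi_zero: "\<Psi> \<zero>\<^bsub>A\<^esub> = \<zero>\<^bsub>seq_cstar F\<^esub>"
  by (simp add: Psi_map_def Q.seq_zero cpc_map.map_zero[OF psi])

text \<open>Since \<open>\<phi> n\<close> is contractive,
  \<parallel>\<open>\<phi> n (\<psi> n a)\<close>\<parallel> is at most
  \<parallel>\<open>\<psi> n a\<close>\<parallel>, and its limit is the norm of \<open>a\<close>.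
  This keeps \<Psi> from shrinking norms and gives its injectivity.\<close>

lemma cnorm_le_of_psi:
  assumes a: "a \<in> carrier A" and ev: "\<And>\<epsilon>. \<epsilon> > 0 \<Longrightarrow> eventually (\<lambda>n. norm (emb (F n) (\<psi> n a)) \<le> c + \<epsilon>) sequentially"
  shows "cnorm A a \<le> c"
proof (rule field_le_epsilon)
  fix \<epsilon> :: real assume "\<epsilon> > 0"
  have "eventually (\<lambda>n. norm (emb A (\<phi> n (\<psi> n a))) \<le> c + \<epsilon>) sequentially"
    using ev[OF \<open>\<epsilon> > 0\<close>]
  proof (rule eventually_mono)
    fix n assume "norm (emb (F n) (\<psi> n a)) \<le> c + \<epsilon>"
    then show "norm (emb A (\<phi> n (\<psi> n a))) \<le> c + \<epsilon>"
      using cpc_map.map_norm_le[OF phi, of "\<psi> n a" n] a by (simp add: A.norm_emb Q.F.norm_emb)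
  qed
  then have "norm (emb A a) \<le> c + \<epsilon>"
    by (rule tendsto_upperbound[OF tendsto_norm[OF tendsto_approx_id[OF a]]]) simp
  then show "cnorm A a \<le> c + \<epsilon>" using a by (simp add: A.norm_emb)
qed

lemma eq_of_psi:
  assumes a: "a \<in> carrier A" and b: "b \<in> carrier A"
    and lim: "(\<lambda>n. norm (emb (F n) (\<psi> n a) - emb (F n) (\<psi> n b))) \<longlonglongrightarrow> 0"
  shows "a = b"
proof -
  have "cnorm A (a \<ominus>\<^bsub>A\<^esub> b) \<le> 0"
  proof (rule cnorm_le_of_psi)
    fix \<epsilon> :: real assume "\<epsilon> > 0"
    from order_tendstoD(2)[OF lim this]
    show "eventually (\<lambda>n. norm (emb (F n) (\<psi> n (a \<ominus>\<^bsub>A\<^esub> b))) \<le> 0 + \<epsilon>) sequentially"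
      by (rule eventually_mono) (use a b in \<open>simp add: cpc_map.map_diff[OF psi] Q.F.emb_diff\<close>)
  qed (use a b in simp)
  then show ?thesis using a b by (simp add: A.cnorm_diff_emb A.emb_inject)
qed

lemma Psi_inj: "inj_on \<Psi> (carrier A)"
  by (rule inj_onI) (simp add: Psi_map_def Q.seq_class_eq_iff bnd_psi eq_of_psi)

lemma inv_Psi: "a \<in> carrier A \<Longrightarrow> inv_into (carrier A) \<Psi> (\<Psi> a) = a"
  using Psi_inj by simp

lemma subspace_carrier: "selfadjoint_subspace A (carrier A)"
  using cpc_psi[of 0] unfolding cpc_def completely_positive_def star_linear_def by blast

lemma subspace_range: "selfadjoint_subspace (seq_cstar F) (\<Psi> ` carrier A)"
proof -
  interpret N: abelian_group "seq_cstar F" by (rule Q.abelian_group_seq)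
  have "subgroup (\<Psi> ` carrier A) (add_monoid (seq_cstar F))"
  proof
    show "\<Psi> ` carrier A \<subseteq> carrier (add_monoid (seq_cstar F))" by auto
    show "x \<otimes>\<^bsub>add_monoid (seq_cstar F)\<^esub> y \<in> \<Psi> ` carrier A" if "x \<in> \<Psi> ` carrier A" "y \<in> \<Psi> ` carrier A" for x y
      using that by (auto simp: Psi_add[symmetric])
    show "\<one>\<^bsub>add_monoid (seq_cstar F)\<^esub> \<in> \<Psi> ` carrier A"
      using Psi_zero by (auto intro!: image_eqI[of _ \<Psi> "\<zero>\<^bsub>A\<^esub>"])
    show "inv\<^bsub>add_monoid (seq_cstar F)\<^esub> x \<in> \<Psi> ` carrier A" if "x \<in> \<Psi> ` carrier A" for x
      using that by (auto simp: a_inv_def[symmetric] Psi_minus[symmetric])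
  qed
  then show ?thesis
    unfolding selfadjoint_subspace_def
    by (auto intro!: submodule.intro submodule_axioms.intro simp: Psi_smult[symmetric] Psi_star[symmetric] A.star_closed)
qed

lemma star_linear_Psi: "star_linear A (carrier A) (seq_cstar F) (\<Psi> ` carrier A) \<Psi>"
  unfolding star_linear_def using subspace_carrier subspace_range
  by (auto simp: Psi_add Psi_smult Psi_star)

lemma star_linear_inv_Psi: "star_linear (seq_cstar F) (\<Psi> ` carrier A) A (carrier A) (inv_into (carrier A) \<Psi>)"
  unfolding star_linear_def using subspace_carrier subspace_range
  by (auto simp: Psi_add[symmetric] Psi_smult[symmetric] Psi_star[symmetric] inv_Psi A.star_closed)

lemma amplify_Psi_apply: "i < r \<Longrightarrow> j < r \<Longrightarrow> amplify r \<Psi> X i j = seq_class F (\<lambda>n. \<psi> n (X i j))"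
  by (simp add: amplify_def Psi_map_def)

text \<open>Each \<open>amplify r (\<psi> n) X\<close> factors as D^*D in the matrices over
  \<open>F n\<close>. By the C*-identity and complete contractivity of \<open>\<psi> n\<close>, the
  norms of these factors are at most the square root of that of \<open>X\<close>, so their entries
  are bounded sequences and define a factor over the quotient.\<close>

lemma Psi_positive:
  assumes r: "r \<ge> 1" and X: "X \<in> mats r (carrier A)" and pX: "positive (mat_cstar r A) X"
  shows "positive (mat_cstar r (seq_cstar F)) (amplify r \<Psi> X)"
proof -
  have "\<exists>D\<in>mats r (carrier (F n)). amplify r (\<psi> n) X = star (mat_cstar r (F n)) D \<otimes>\<^bsub>mat_cstar r (F n)\<^esub> D" for n
    using cpc_map.map_positive[OF psi r X pX, of n] by (auto simp: positive_def)
  then obtain D where D: "\<And>n. D n \<in> mats r (carrier (F n))"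
    "\<And>n. amplify r (\<psi> n) X = star (mat_cstar r (F n)) (D n) \<otimes>\<^bsub>mat_cstar r (F n)\<^esub> D n" by metis
  define b where "b = (\<lambda>i j n. D n i j)"
  have b: "Q.bnd (b i j)" if ij: "i < r" "j < r" for i j
  proof (rule Q.bndI)
    fix n show "b i j n \<in> carrier (F n)" unfolding b_def by (rule mats_entry[OF D(1) ij])
    interpret M: cstar_algebra "mat_cstar r (F n)" by (rule Q.F.cstar_algebra_mat)
    have "(mat_norm (F n) r (D n))\<^sup>2 \<le> mat_norm A r X"
      using M.norm_star_mult[of "D n"] D(1)[of n] cpc_map.completely_contractive[OF psi r X, of n] by (simp add: D(2)[symmetric])
    then have "mat_norm (F n) r (D n) \<le> sqrt (mat_norm A r X)" by (rule real_le_rsqrt)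
    then show "cnorm (F n) (b i j n) \<le> sqrt (mat_norm A r X)"
      unfolding b_def using Q.F.cnorm_entry_le_mat_norm[OF D(1) ij, of n] by linarith
  qed
  define B where "B = mk_mat r (\<lambda>i j. seq_class F (b i j))"
  have B: "B \<in> mats r (carrier (seq_cstar F))" unfolding B_def by (intro mk_mat_in Q.seq_class_in b)
  have Bij: "B i j = seq_class F (b i j)" if "i < r" "j < r" for i j using that by (simp add: B_def)
  have "amplify r \<Psi> X = star (mat_cstar r (seq_cstar F)) B \<otimes>\<^bsub>mat_cstar r (seq_cstar F)\<^esub> B"
  proof (rule mats_eqI)
    show "amplify r \<Psi> X \<in> mats r UNIV" unfolding amplify_def by (rule mk_mat_in) simp
    show "star (mat_cstar r (seq_cstar F)) B \<otimes>\<^bsub>mat_cstar r (seq_cstar F)\<^esub> B \<in> mats r UNIV"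
      by (simp add: mat_cstar_def mk_mat_in)
    fix i j assume ij: "i < r" "j < r"
    have "\<psi> n (X i j) = (\<Oplus>\<^bsub>F n\<^esub>k\<in>{..<r}. star (F n) (b k i n) \<otimes>\<^bsub>F n\<^esub> b k j n)" for n
    proof -
      have "\<psi> n (X i j) = (star (mat_cstar r (F n)) (D n) \<otimes>\<^bsub>mat_cstar r (F n)\<^esub> D n) i j"
        unfolding D(2)[symmetric] using ij by (simp add: amplify_def)
      also have "\<dots> = (\<Oplus>\<^bsub>F n\<^esub>k\<in>{..<r}. star (mat_cstar r (F n)) (D n) i k \<otimes>\<^bsub>F n\<^esub> D n k j)"
        by (rule mat_cstar_apply(1)[OF ij])
      also have "\<dots> = (\<Oplus>\<^bsub>F n\<^esub>k\<in>{..<r}. star (F n) (b k i n) \<otimes>\<^bsub>F n\<^esub> b k j n)"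
        using ij mats_entry[OF D(1)]
        by (intro Q.F.M.finsum_cong') (auto simp: mat_cstar_apply(4) b_def intro!: Q.F.m_closed Q.F.star_closed)
      finally show ?thesis .
    qed
    then show "amplify r \<Psi> X i j = (star (mat_cstar r (seq_cstar F)) B \<otimes>\<^bsub>mat_cstar r (seq_cstar F)\<^esub> B) i j"
      using Q.seq_star_mult_apply[of r b B i j, OF b Bij ij] ij by (simp add: amplify_Psi_apply)
  qed
  then show ?thesis using B unfolding positive_def by auto
qed

text \<open>Representatives \<open>C n\<close> of a factor \<open>B\<close> over the quotient give
  positive matrices \<open>P n\<close> over \<open>F n\<close> that differ from
  \<open>amplify r (\<psi> n) X\<close> by a null sequence. Their images under
  \<open>\<phi> n\<close> are positive and converge to \<open>X\<close>.\<close>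

lemma inv_Psi_positive:
  assumes r: "r \<ge> 1" and X: "X \<in> mats r (carrier A)" and pX: "positive (mat_cstar r (seq_cstar F)) (amplify r \<Psi> X)"
  shows "positive (mat_cstar r A) X"
proof -
  interpret MA: cstar_algebra "mat_cstar r A" by (rule A.cstar_algebra_mat)
  obtain B where B: "B \<in> mats r (carrier (seq_cstar F))"
    "amplify r \<Psi> X = star (mat_cstar r (seq_cstar F)) B \<otimes>\<^bsub>mat_cstar r (seq_cstar F)\<^esub> B"
    using pX by (auto simp: positive_def)
  have "\<exists>s. Q.bnd s \<and> B i j = seq_class F s" if "i < r" "j < r" for i j
    using mats_entry[OF B(1) that] by (auto simp: seq_cstar_carrier)
  then obtain b where b: "\<And>i j. i < r \<Longrightarrow> j < r \<Longrightarrow> Q.bnd (b i j)" "\<And>i j. i < r \<Longrightarrow> j < r \<Longrightarrow> B i j = seq_class F (b i j)"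
    by metis
  define C where "C = (\<lambda>n. mk_mat r (\<lambda>i j. b i j n))"
  have C: "C n \<in> mats r (carrier (F n))" for n unfolding C_def using b by (intro mk_mat_in) auto
  define P where "P = (\<lambda>n. star (mat_cstar r (F n)) (C n) \<otimes>\<^bsub>mat_cstar r (F n)\<^esub> C n)"
  have P: "P n \<in> mats r (carrier (F n))" for n unfolding P_def by (intro Q.F.mat_closed C)
  have pP: "positive (mat_cstar r (F n)) (P n)" for n unfolding positive_def P_def using C by auto
  define Y where "Y = (\<lambda>n. amplify r (\<phi> n) (P n))"
  have Y: "Y n \<in> mats r (carrier A)" for n unfolding Y_def by (rule cpc_map.amplify_in[OF phi P])
  have pY: "positive (mat_cstar r A) (Y n)" for n unfolding Y_def by (rule cpc_map.map_positive[OF phi r P pP])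
  have Pij: "P n i j = (\<Oplus>\<^bsub>F n\<^esub>k\<in>{..<r}. star (F n) (b k i n) \<otimes>\<^bsub>F n\<^esub> b k j n)" if ij: "i < r" "j < r" for n i j
  proof -
    have "P n i j = (\<Oplus>\<^bsub>F n\<^esub>k\<in>{..<r}. star (mat_cstar r (F n)) (C n) i k \<otimes>\<^bsub>F n\<^esub> C n k j)"
      unfolding P_def by (rule mat_cstar_apply(1)[OF ij])
    also have "\<dots> = (\<Oplus>\<^bsub>F n\<^esub>k\<in>{..<r}. star (F n) (b k i n) \<otimes>\<^bsub>F n\<^esub> b k j n)"
      using ij b by (intro Q.F.M.finsum_cong') (auto simp: mat_cstar_apply(4) C_def intro!: Q.F.m_closed Q.F.star_closed)
    finally show ?thesis .
  qed
  have lim: "(\<lambda>n. cnorm A (Y n i j \<ominus>\<^bsub>A\<^esub> X i j)) \<longlonglongrightarrow> 0" if ij: "i < r" "j < r" for i j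
  proof -
    have x: "X i j \<in> carrier A" by (rule mats_entry[OF X ij])
    have p: "P n i j \<in> carrier (F n)" for n by (rule mats_entry[OF P ij])
    have bP: "Q.bnd (\<lambda>n. P n i j)"
      unfolding Pij[OF ij] using b ij by (intro Q.bnd_finsum Q.bnd_mult Q.bnd_star) auto
    have "seq_class F (\<lambda>n. \<psi> n (X i j)) = seq_class F (\<lambda>n. P n i j)"
    proof -
      have "seq_class F (\<lambda>n. \<psi> n (X i j)) = amplify r \<Psi> X i j" using ij by (simp add: amplify_Psi_apply)
      also have "\<dots> = seq_class F (\<lambda>n. P n i j)"
        unfolding Pij[OF ij] B(2) by (rule Q.seq_star_mult_apply[OF b ij])
      finally show ?thesis .
    qed
    then have 1: "(\<lambda>n. norm (emb (F n) (\<psi> n (X i j)) - emb (F n) (P n i j))) \<longlonglongrightarrow> 0"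
      using Q.seq_class_eq_iff[OF bnd_psi[OF x] bP] by simp
    have 2: "(\<lambda>n. norm (emb A (\<phi> n (\<psi> n (X i j))) - emb A (X i j))) \<longlonglongrightarrow> 0"
      by (intro tendsto_norm_zero LIM_zero tendsto_approx_id x)
    show ?thesis
    proof (rule tendsto_0_le)
      show "(\<lambda>n. norm (emb (F n) (\<psi> n (X i j)) - emb (F n) (P n i j)) + norm (emb A (\<phi> n (\<psi> n (X i j))) - emb A (X i j))) \<longlonglongrightarrow> 0"
        using tendsto_add[OF 1 2] by simp
      fix n
      have y: "Y n i j = \<phi> n (P n i j)" using ij by (simp add: Y_def amplify_def)
      show "0 \<le> cnorm A (Y n i j \<ominus>\<^bsub>A\<^esub> X i j)" using x p by (simp add: y A.norm_nonneg)
      have "norm (emb A (\<phi> n (P n i j)) - emb A (\<phi> n (\<psi> n (X i j)))) \<le> norm (emb (F n) (\<psi> n (X i j)) - emb (F n) (P n i j))"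
        using norm_phi_diff_le[of "P n i j" n "\<psi> n (X i j)"] x p by (simp add: norm_minus_commute)
      then show "cnorm A (Y n i j \<ominus>\<^bsub>A\<^esub> X i j) \<le> norm (emb (F n) (\<psi> n (X i j)) - emb (F n) (P n i j)) + norm (emb A (\<phi> n (\<psi> n (X i j))) - emb A (X i j))"
        using norm_triangle_ineq[of "emb A (\<phi> n (P n i j)) - emb A (\<phi> n (\<psi> n (X i j)))" "emb A (\<phi> n (\<psi> n (X i j))) - emb A (X i j)"] x p
        by (simp add: y A.cnorm_diff_emb)
    qed
  qed
  have "(\<lambda>n. \<Sum>i<r. \<Sum>j<r. cnorm A (Y n i j \<ominus>\<^bsub>A\<^esub> X i j)) \<longlonglongrightarrow> (\<Sum>i<r. \<Sum>j<r. 0)"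
    by (intro tendsto_sum lim) auto
  then have "(\<lambda>n. \<Sum>i<r. \<Sum>j<r. cnorm A (Y n i j \<ominus>\<^bsub>A\<^esub> X i j)) \<longlonglongrightarrow> 0" by simp
  then have "(\<lambda>n. mat_norm A r (Y n \<ominus>\<^bsub>mat_cstar r A\<^esub> X)) \<longlonglongrightarrow> 0"
  proof (rule tendsto_0_le)
    fix n
    show "mat_norm A r (Y n \<ominus>\<^bsub>mat_cstar r A\<^esub> X) \<le> (\<Sum>i<r. \<Sum>j<r. cnorm A (Y n i j \<ominus>\<^bsub>A\<^esub> X i j))"
      by (rule A.mat_norm_diff_le_sum[OF Y X])
    show "0 \<le> mat_norm A r (Y n \<ominus>\<^bsub>mat_cstar r A\<^esub> X)"
      using MA.norm_nonneg[of "Y n \<ominus>\<^bsub>mat_cstar r A\<^esub> X"] MA.minus_closed[of "Y n" X] X Y by simp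
  qed
  then show ?thesis
    using X Y pY by (intro MA.positive_limit[of X Y]) simp_all
qed

text \<open>Going forth and back along \<open>\<psi> n\<close> and \<open>\<phi> n\<close>
  approximates \<open>X\<close> entry by entry, hence in the matrix norm, and the way back does not
  increase norms.\<close>

lemma mat_norm_psi_lower:
  assumes r: "r \<ge> 1" and X: "X \<in> mats r (carrier A)" and "\<epsilon> > 0"
  shows "eventually (\<lambda>n. mat_norm A r X < mat_norm (F n) r (amplify r (\<psi> n) X) + \<epsilon>) sequentially"
proof -
  interpret MA: cstar_algebra "mat_cstar r A" by (rule A.cstar_algebra_mat)
  define Y where "Y = (\<lambda>n. amplify r (\<phi> n) (amplify r (\<psi> n) X))"
  have pX: "amplify r (\<psi> n) X \<in> mats r (carrier (F n))" for n by (rule cpc_map.amplify_in[OF psi X])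
  have Y: "Y n \<in> mats r (carrier A)" for n unfolding Y_def by (rule cpc_map.amplify_in[OF phi pX])
  have Yij: "Y n i j = \<phi> n (\<psi> n (X i j))" if "i < r" "j < r" for n i j using that by (simp add: Y_def amplify_def)
  have "(\<lambda>n. \<Sum>i<r. \<Sum>j<r. cnorm A (X i j \<ominus>\<^bsub>A\<^esub> Y n i j)) \<longlonglongrightarrow> (\<Sum>i<r. \<Sum>j<r. 0)"
  proof (intro tendsto_sum)
    fix i j assume "i \<in> {..<r}" "j \<in> {..<r}"
    then have ij: "i < r" "j < r" by auto
    have x: "X i j \<in> carrier A" by (rule mats_entry[OF X ij])
    then have "cnorm A (X i j \<ominus>\<^bsub>A\<^esub> Y n i j) = cnorm A (\<phi> n (\<psi> n (X i j)) \<ominus>\<^bsub>A\<^esub> X i j)" for n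
      using ij by (simp add: Yij A.cnorm_diff_commute[of "X i j"])
    then show "(\<lambda>n. cnorm A (X i j \<ominus>\<^bsub>A\<^esub> Y n i j)) \<longlonglongrightarrow> 0" using approx_id[OF x] by simp
  qed
  then have "(\<lambda>n. \<Sum>i<r. \<Sum>j<r. cnorm A (X i j \<ominus>\<^bsub>A\<^esub> Y n i j)) \<longlonglongrightarrow> 0" by simp
  from order_tendstoD(2)[OF this \<open>\<epsilon> > 0\<close>] show ?thesis
  proof (rule eventually_mono)
    fix n assume *: "(\<Sum>i<r. \<Sum>j<r. cnorm A (X i j \<ominus>\<^bsub>A\<^esub> Y n i j)) < \<epsilon>"
    have "(X \<ominus>\<^bsub>mat_cstar r A\<^esub> Y n) \<oplus>\<^bsub>mat_cstar r A\<^esub> Y n = X"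
      using X Y by (intro MA.diff_add_cancel) simp_all
    moreover have "mat_norm A r ((X \<ominus>\<^bsub>mat_cstar r A\<^esub> Y n) \<oplus>\<^bsub>mat_cstar r A\<^esub> Y n) \<le> mat_norm A r (X \<ominus>\<^bsub>mat_cstar r A\<^esub> Y n) + mat_norm A r (Y n)"
      using MA.norm_triangle[of "X \<ominus>\<^bsub>mat_cstar r A\<^esub> Y n" "Y n"] MA.minus_closed[of X "Y n"] X Y by simp
    moreover have "mat_norm A r (Y n) \<le> mat_norm (F n) r (amplify r (\<psi> n) X)"
      unfolding Y_def by (rule cpc_map.completely_contractive[OF phi r pX])
    ultimately show "mat_norm A r X < mat_norm (F n) r (amplify r (\<psi> n) X) + \<epsilon>"
      using A.mat_norm_diff_le_sum[OF X Y, of n] * by simp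
  qed
qed

text \<open>The supremum defining the matrix norm over the quotient is evaluated on representatives.
  A column of norm at most 1 there is represented by columns over \<open>F n\<close> whose norms
  eventually come arbitrarily close to at most 1, which gives the upper bound. For the lower bound,
  nearly optimal columns over the separate \<open>F n\<close> are assembled into one column of
  bounded sequences.\<close>

theorem Psi_isometric:
  assumes r: "r \<ge> 1" and X: "X \<in> mats r (carrier A)"
  shows "mat_norm (seq_cstar F) r (amplify r \<Psi> X) = mat_norm A r X"
proof -
  interpret N: abelian_group "seq_cstar F" by (rule Q.abelian_group_seq)
  let ?c = "mat_norm A r X"
  let ?S = "{col_norm (seq_cstar F) r (\<lambda>i\<in>{..<r}. \<Oplus>\<^bsub>seq_cstar F\<^esub>j\<in>{..<r}. amplify r \<Psi> X i j \<otimes>\<^bsub>seq_cstar F\<^esub> V j) | V.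
          V \<in> {..<r} \<rightarrow>\<^sub>E carrier (seq_cstar F) \<and> col_norm (seq_cstar F) r V \<le> 1}"
  have c: "0 \<le> ?c" by (rule A.mat_norm_nonneg[OF X])
  have Xij: "X i j \<in> carrier A" if "i < r" "j < r" for i j by (rule mats_entry[OF X that])
  have pX: "amplify r (\<psi> n) X \<in> mats r (carrier (F n))" for n by (rule cpc_map.amplify_in[OF psi X])
  define m where "m = (\<lambda>v n. mv r (\<lambda>i j. emb (F n) (amplify r (\<psi> n) X i j)) (\<lambda>i. emb (F n) (v i n)))"
  define XV where "XV = (\<lambda>V. \<lambda>i\<in>{..<r}. \<Oplus>\<^bsub>seq_cstar F\<^esub>j\<in>{..<r}. amplify r \<Psi> X i j \<otimes>\<^bsub>seq_cstar F\<^esub> V j)"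
  define w where "w = (\<lambda>v i n. \<Oplus>\<^bsub>F n\<^esub>j\<in>{..<r}. amplify r (\<psi> n) X i j \<otimes>\<^bsub>F n\<^esub> v j n)"
  have am: "(\<lambda>n. amplify r (\<psi> n) X i j) = (\<lambda>n. \<psi> n (X i j))" if "i < r" "j < r" for i j
    using that by (simp add: amplify_def)
  have bnd_am: "Q.bnd (\<lambda>n. amplify r (\<psi> n) X i j)" if "i < r" "j < r" for i j
    unfolding am[OF that] by (rule bnd_psi[OF Xij[OF that]])
  have w: "Q.bnd (w v i)" if v: "\<And>i. i < r \<Longrightarrow> Q.bnd (v i)" and "i < r" for v i
    unfolding w_def using that by (intro Q.bnd_finsum Q.bnd_mult bnd_am) auto
  have Vw: "XV V i = seq_class F (w v i)"
    if v: "\<And>i. i < r \<Longrightarrow> Q.bnd (v i)" "\<And>i. i < r \<Longrightarrow> V i = seq_class F (v i)" and i: "i < r" for v V i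
  proof -
    have "(\<Oplus>\<^bsub>seq_cstar F\<^esub>j\<in>{..<r}. amplify r \<Psi> X i j \<otimes>\<^bsub>seq_cstar F\<^esub> V j)
      = (\<Oplus>\<^bsub>seq_cstar F\<^esub>j\<in>{..<r}. seq_class F (\<lambda>n. amplify r (\<psi> n) X i j \<otimes>\<^bsub>F n\<^esub> v j n))"
    proof (rule N.finsum_cong'[OF refl])
      fix j assume "j \<in> {..<r}"
      then have j: "j < r" by simp
      show "amplify r \<Psi> X i j \<otimes>\<^bsub>seq_cstar F\<^esub> V j = seq_class F (\<lambda>n. amplify r (\<psi> n) X i j \<otimes>\<^bsub>F n\<^esub> v j n)"
        using Q.seq_mult[OF bnd_am[OF i j] v(1)[OF j]] i j v(2)[OF j] by (simp add: amplify_Psi_apply am)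
    qed (use i v bnd_am in \<open>auto intro!: Q.seq_class_in Q.bnd_mult\<close>)
    also have "\<dots> = seq_class F (w v i)"
      unfolding w_def using i v by (intro Q.seq_finsum Q.bnd_mult bnd_am) auto
    finally show ?thesis using i by (simp add: XV_def)
  qed
  have col: "col_norm (seq_cstar F) r (XV V) \<le> d \<longleftrightarrow> (\<forall>\<epsilon>>0. eventually (\<lambda>n. cn r (m v n) \<le> d + \<epsilon>) sequentially)"
    if v: "\<And>i. i < r \<Longrightarrow> Q.bnd (v i)" "\<And>i. i < r \<Longrightarrow> V i = seq_class F (v i)" and d: "0 \<le> d" for v V d
  proof -
    have "cn r (\<lambda>i. emb (F n) (w v i n)) = cn r (m v n)" for n
      by (rule cn_cong) (use v in \<open>auto simp: w_def m_def intro!: Q.F.emb_mat_col[OF pX]\<close>)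
    then show ?thesis
      using Q.seq_col_norm_le_iff[of r "w v" "XV V" d, OF w[OF v(1)] Vw[OF v] d] by simp
  qed
  have m_le: "cn r (m v n) \<le> ?c * cn r (\<lambda>i. emb (F n) (v i n))" if v: "\<And>i. i < r \<Longrightarrow> v i n \<in> carrier (F n)" for v n
  proof -
    have "cn r (m v n) \<le> mat_norm (F n) r (amplify r (\<psi> n) X) * cn r (\<lambda>i. emb (F n) (v i n))"
      unfolding m_def using v by (intro Q.F.mat_norm_ge[OF pX]) simp
    also have "\<dots> \<le> ?c * cn r (\<lambda>i. emb (F n) (v i n))"
      by (intro mult_right_mono cpc_map.completely_contractive[OF psi r X]) simp
    finally show ?thesis .
  qed
  have S: "?S = {col_norm (seq_cstar F) r (XV V) | V. V \<in> {..<r} \<rightarrow>\<^sub>E carrier (seq_cstar F) \<and> col_norm (seq_cstar F) r V \<le> 1}"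
    by (simp add: XV_def)
  have upper: "x \<le> ?c" if x: "x \<in> ?S" for x
  proof -
    obtain V where V: "x = col_norm (seq_cstar F) r (XV V)"
      "V \<in> {..<r} \<rightarrow>\<^sub>E carrier (seq_cstar F)" "col_norm (seq_cstar F) r V \<le> 1" using x unfolding S by blast
    have "\<exists>s. Q.bnd s \<and> V i = seq_class F s" if "i < r" for i
      using PiE_mem[OF V(2), of i] that by (auto simp: seq_cstar_carrier)
    then obtain v where v: "\<And>i. i < r \<Longrightarrow> Q.bnd (v i)" "\<And>i. i < r \<Longrightarrow> V i = seq_class F (v i)" by metis
    have ev: "eventually (\<lambda>n. cn r (\<lambda>i. emb (F n) (v i n)) \<le> 1 + \<epsilon>) sequentially" if "\<epsilon> > 0" for \<epsilon>
      using Q.seq_col_norm_le_iff[of r v V 1, OF v zero_le_one] V(3) that by simp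
    have "eventually (\<lambda>n. cn r (m v n) \<le> ?c + \<epsilon>) sequentially" if \<epsilon>: "\<epsilon> > 0" for \<epsilon>
    proof -
      \<comment> \<open>Scaled so that multiplying the slack by \<open>?c\<close> leaves at most
        \<epsilon>; the 1 covers the case \<open>?c = 0\<close>.\<close>
      have "\<epsilon> / (?c + 1) > 0" using c \<epsilon> by simp
      from ev[OF this] show ?thesis
      proof (rule eventually_mono)
        fix n assume "cn r (\<lambda>i. emb (F n) (v i n)) \<le> 1 + \<epsilon> / (?c + 1)"
        then have "cn r (m v n) \<le> ?c * (1 + \<epsilon> / (?c + 1))"
          using m_le[of v n] v c by (meson Q.bnd_carrier mult_left_mono order_trans)
        also have "\<dots> = ?c + \<epsilon> * (?c / (?c + 1))" by (simp add: distrib_left)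
        also have "\<dots> \<le> ?c + \<epsilon> * 1" using c \<epsilon> by (intro add_left_mono mult_left_mono) auto
        finally show "cn r (m v n) \<le> ?c + \<epsilon>" by simp
      qed
    qed
    then show ?thesis using col[of v V ?c] v c V(1) by simp
  qed
  then have bdd: "bdd_above ?S" by (rule bdd_aboveI)
  have lower: "\<exists>x\<in>?S. ?c \<le> x + \<epsilon>" if \<epsilon>: "\<epsilon> > 0" for \<epsilon>
  proof -
    have "\<exists>v. (\<forall>i<r. v i \<in> carrier (F n)) \<and> cn r (\<lambda>i. emb (F n) (v i)) \<le> 1 \<and>
      mat_norm (F n) r (amplify r (\<psi> n) X) - \<epsilon> / 3 < cn r (mv r (\<lambda>i j. emb (F n) (amplify r (\<psi> n) X i j)) (\<lambda>i. emb (F n) (v i)))" for n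
      by (rule Q.F.mat_norm_witness[OF pX, of "\<epsilon> / 3" n]) (use \<epsilon> in auto)
    then obtain u where u: "\<And>n i. i < r \<Longrightarrow> u n i \<in> carrier (F n)" "\<And>n. cn r (\<lambda>i. emb (F n) (u n i)) \<le> 1"
      "\<And>n. mat_norm (F n) r (amplify r (\<psi> n) X) - \<epsilon> / 3 < cn r (mv r (\<lambda>i j. emb (F n) (amplify r (\<psi> n) X i j)) (\<lambda>i. emb (F n) (u n i)))"
      by metis
    \<comment> \<open>The column chosen for each \<open>n\<close> is read as a sequence for each
      row. The entries stay within norm 1 because the columns do, so the sequences are
      bounded.\<close>
    define v where "v = (\<lambda>i n. u n i)"
    have v: "Q.bnd (v i)" if "i < r" for i
    proof (rule Q.bndI)
      fix n show "v i n \<in> carrier (F n)" using u(1) that by (simp add: v_def)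
      show "cnorm (F n) (v i n) \<le> 1"
        using norm_le_cn[OF that, of "\<lambda>i. emb (F n) (u n i)"] u(2)[of n] u(1)[OF that, of n] by (simp add: v_def Q.F.norm_emb)
    qed
    define V where "V = (\<lambda>i\<in>{..<r}. seq_class F (v i))"
    have V: "V \<in> {..<r} \<rightarrow>\<^sub>E carrier (seq_cstar F)" using v by (auto simp: V_def)
    have Vi: "V i = seq_class F (v i)" if "i < r" for i using that by (simp add: V_def)
    have "cn r (\<lambda>i. emb (F n) (v i n)) \<le> 1 + \<epsilon>'" if "\<epsilon>' > 0" for \<epsilon>' n
      using u(2)[of n] that by (simp add: v_def)
    then have nV: "col_norm (seq_cstar F) r V \<le> 1"
      using Q.seq_col_norm_le_iff[of r v V 1] v Vi by simp
    define x where "x = col_norm (seq_cstar F) r (XV V)"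
    have xS: "x \<in> ?S" unfolding S x_def using V nV by blast
    have x0: "0 \<le> x"
      unfolding x_def using Q.seq_col_norm_nonneg[of r "w v" "XV V", OF w[OF v] Vw[OF v Vi]] .
    have "eventually (\<lambda>n. cn r (m v n) \<le> x + \<epsilon> / 3) sequentially"
      using col[of v V x, OF v Vi x0] \<epsilon> by (simp add: x_def)
    moreover have "eventually (\<lambda>n. ?c < mat_norm (F n) r (amplify r (\<psi> n) X) + \<epsilon> / 3) sequentially"
      using \<epsilon> by (intro mat_norm_psi_lower r X) simp
    ultimately have "eventually (\<lambda>n. ?c \<le> x + \<epsilon>) sequentially"
    proof (rule eventually_elim2)
      fix n assume "cn r (m v n) \<le> x + \<epsilon> / 3" "?c < mat_norm (F n) r (amplify r (\<psi> n) X) + \<epsilon> / 3"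
      moreover have "mat_norm (F n) r (amplify r (\<psi> n) X) - \<epsilon> / 3 < cn r (m v n)" using u(3)[of n] by (simp add: m_def v_def)
      ultimately show "?c \<le> x + \<epsilon>" by linarith
    qed
    then have "?c \<le> x + \<epsilon>" by simp
    then show ?thesis using xS by blast
  qed
  show ?thesis
  proof (rule antisym)
    obtain x where "x \<in> ?S" using lower[of 1] by auto
    then show "mat_norm (seq_cstar F) r (amplify r \<Psi> X) \<le> ?c"
      unfolding mat_norm_def[of "seq_cstar F"] using upper by (intro cSup_least) blast+
    show "?c \<le> mat_norm (seq_cstar F) r (amplify r \<Psi> X)"
    proof (rule field_le_epsilon)
      fix \<epsilon> :: real assume "\<epsilon> > 0"
      then obtain x where x: "x \<in> ?S" "?c \<le> x + \<epsilon>" using lower by blast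
      then show "?c \<le> mat_norm (seq_cstar F) r (amplify r \<Psi> X) + \<epsilon>"
        unfolding mat_norm_def[of "seq_cstar F"] using cSup_upper[OF x(1) bdd] by linarith
    qed
  qed
qed

lemma complete_order_isomorphism_range:
  "complete_order_isomorphism A (carrier A) (seq_cstar F) (\<Psi> ` carrier A) \<Psi>"
  unfolding complete_order_isomorphism_def
proof (intro conjI refl)
  show "completely_positive A (carrier A) (seq_cstar F) (\<Psi> ` carrier A) \<Psi>"
    unfolding completely_positive_def using star_linear_Psi Psi_positive by blast
  show "completely_isometric A (carrier A) (seq_cstar F) (\<Psi> ` carrier A) \<Psi>"
    unfolding completely_isometric_def using star_linear_Psi Psi_isometric by simp
  show "completely_positive (seq_cstar F) (\<Psi> ` carrier A) A (carrier A) (inv_into (carrier A) \<Psi>)"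
    unfolding completely_positive_def
  proof (intro conjI star_linear_inv_Psi allI ballI impI)
    fix r :: nat and Y
    assume r: "1 \<le> r" and Y: "Y \<in> mats r (\<Psi> ` carrier A)" and pY: "positive (mat_cstar r (seq_cstar F)) Y"
    let ?X = "amplify r (inv_into (carrier A) \<Psi>) Y"
    have X: "?X \<in> mats r (carrier A)"
      unfolding amplify_def using mats_entry[OF Y] by (intro mk_mat_in) (auto intro: inv_into_into)
    have "amplify r \<Psi> ?X = Y"
    proof (rule mats_eqI[OF _ Y])
      show "amplify r \<Psi> ?X \<in> mats r UNIV" unfolding amplify_def by (rule mk_mat_in) simp
      fix i j assume ij: "i < r" "j < r"
      then show "amplify r \<Psi> ?X i j = Y i j"
        using mats_entry[OF Y ij] by (simp add: amplify_def f_inv_into_f)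
    qed
    then show "positive (mat_cstar r A) ?X" using inv_Psi_positive[OF r X] pY by simp
  qed
qed

end

section \<open>The limit of the system as the range of \<Psi>\<close>

context summable_system
begin

lemma bnd_to_limit:
  assumes "x \<in> carrier (F n)"
  shows "Q.bnd (\<lambda>m. if n < m then \<rho> m n x else \<zero>\<^bsub>F m\<^esub>)"
  using assms cstar_algebra.norm_nonneg[OF cstar_F assms]
  by (intro Q.bndI[where K = "cnorm (F n) x"]) (auto intro: rho_closed rho_norm_le)

lemma to_limit_in_range:
  assumes x: "x \<in> carrier (F n)"
  shows "\<exists>a\<in>carrier A. to_limit F (associated_maps \<psi> \<phi>) n x = \<Psi> a"
proof -
  obtain a where a: "a \<in> carrier A" "(\<lambda>m. norm (emb (F m) (\<rho> m n x) - emb (F m) (\<psi> m a))) \<longlonglongrightarrow> 0"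
    by (rule limit_element[OF x])
  have "to_limit F (associated_maps \<psi> \<phi>) n x = \<Psi> a"
    unfolding to_limit_def Psi_map_def
  proof (rule Q.seq_class_eqI[OF bnd_to_limit[OF x] bnd_psi[OF a(1)]])
    show "(\<lambda>m. norm (emb (F m) (if n < m then \<rho> m n x else \<zero>\<^bsub>F m\<^esub>) - emb (F m) (\<psi> m a))) \<longlonglongrightarrow> 0"
      by (rule Lim_transform_eventually[OF a(2)]) (auto simp: eventually_sequentially intro!: exI[of _ "Suc n"])
  qed
  then show ?thesis using a by blast
qed

text \<open>Every \<open>to_limit\<close> element is some \<Psi> a, so what has to be seen is that
  the range of \<Psi> is closed. Elements whose images approximate \<open>y\<close> form a Cauchy
  sequence by \<open>cnorm_le_of_psi\<close>, and the image of their limit is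
  \<open>y\<close>.\<close>

lemma system_limit_subset: "system_limit F (associated_maps \<psi> \<phi>) \<subseteq> \<Psi> ` carrier A"
proof
  fix y assume y: "y \<in> system_limit F (associated_maps \<psi> \<phi>)"
  then have "y \<in> carrier (seq_cstar F)" by (simp add: system_limit_def)
  then obtain t where t: "Q.bnd t" "y = seq_class F t" by (rule Q.seq_carrierE)
  let ?\<delta> = "\<lambda>k. inverse (real (Suc k))"
  have "\<exists>a\<in>carrier A. cnorm (seq_cstar F) (y \<ominus>\<^bsub>seq_cstar F\<^esub> \<Psi> a) < ?\<delta> k" for k
  proof -
    have "?\<delta> k > 0" by simp
    then obtain n x where x: "x \<in> carrier (F n)" "cnorm (seq_cstar F) (y \<ominus>\<^bsub>seq_cstar F\<^esub> to_limit F (associated_maps \<psi> \<phi>) n x) < ?\<delta> k"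
      using y unfolding system_limit_def by blast
    then show ?thesis using to_limit_in_range[OF x(1)] by auto
  qed
  then obtain a where a: "\<And>k. a k \<in> carrier A" "\<And>k. cnorm (seq_cstar F) (y \<ominus>\<^bsub>seq_cstar F\<^esub> \<Psi> (a k)) < ?\<delta> k" by metis
  \<comment> \<open>A bound on the quotient norm controls the entries eventually and only with
    additional slack; a second copy of \<open>?\<delta> k\<close> is spent on it.\<close>
  have ev: "eventually (\<lambda>m. norm (emb (F m) (t m) - emb (F m) (\<psi> m (a k))) \<le> 2 * ?\<delta> k) sequentially" for k
  proof -
    have b: "Q.bnd (\<lambda>m. \<psi> m (a k))" by (rule bnd_psi[OF a(1)])
    have "?\<delta> k > 0" by simp
    have "cnorm (seq_cstar F) (seq_class F (\<lambda>m. t m \<ominus>\<^bsub>F m\<^esub> \<psi> m (a k))) \<le> ?\<delta> k"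
      using a(2)[of k] unfolding t(2) Psi_map_def Q.seq_diff[OF t(1) b] by simp
    then have "eventually (\<lambda>m. cnorm (F m) (t m \<ominus>\<^bsub>F m\<^esub> \<psi> m (a k)) \<le> ?\<delta> k + ?\<delta> k) sequentially"
      unfolding Q.seq_norm_le_iff[OF Q.bnd_diff[OF t(1) b]] by (elim allE impE) (rule \<open>?\<delta> k > 0\<close>)
    then show ?thesis
      by (rule eventually_mono) (use t b a in \<open>simp add: Q.F.cnorm_diff_emb del: of_nat_Suc\<close>)
  qed
  have diff: "cnorm A (a k \<ominus>\<^bsub>A\<^esub> a l) \<le> 2 * ?\<delta> k + 2 * ?\<delta> l" for k l
  proof (rule cnorm_le_of_psi)
    fix \<epsilon> :: real assume "\<epsilon> > 0"
    from ev[of k] ev[of l]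
    show "eventually (\<lambda>m. norm (emb (F m) (\<psi> m (a k \<ominus>\<^bsub>A\<^esub> a l))) \<le> 2 * ?\<delta> k + 2 * ?\<delta> l + \<epsilon>) sequentially"
    proof (rule eventually_elim2)
      fix m
      assume "norm (emb (F m) (t m) - emb (F m) (\<psi> m (a k))) \<le> 2 * ?\<delta> k" "norm (emb (F m) (t m) - emb (F m) (\<psi> m (a l))) \<le> 2 * ?\<delta> l"
      then have "norm ((emb (F m) (t m) - emb (F m) (\<psi> m (a l))) - (emb (F m) (t m) - emb (F m) (\<psi> m (a k)))) \<le> 2 * ?\<delta> k + 2 * ?\<delta> l + \<epsilon>"
        using norm_triangle_ineq4[of "emb (F m) (t m) - emb (F m) (\<psi> m (a l))" "emb (F m) (t m) - emb (F m) (\<psi> m (a k))"] \<open>\<epsilon> > 0\<close> by linarith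
      then show "norm (emb (F m) (\<psi> m (a k \<ominus>\<^bsub>A\<^esub> a l))) \<le> 2 * ?\<delta> k + 2 * ?\<delta> l + \<epsilon>"
        using a by (simp add: cpc_map.map_diff[OF psi] Q.F.emb_diff del: of_nat_Suc)
    qed
  qed (simp add: a)
  have "\<exists>b\<in>carrier A. (\<lambda>k. cnorm A (a k \<ominus>\<^bsub>A\<^esub> b)) \<longlonglongrightarrow> 0"
  proof (rule A.complete)
    show "range a \<subseteq> carrier A" using a by auto
    show "\<forall>e>0. \<exists>N. \<forall>m\<ge>N. \<forall>n\<ge>N. cnorm A (a m \<ominus>\<^bsub>A\<^esub> a n) < e"
    proof (intro allI impI)
      fix e :: real assume "e > 0"
      then obtain N where N: "\<And>n. n \<ge> N \<Longrightarrow> ?\<delta> n < e / 4"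
        using order_tendstoD(2)[OF LIMSEQ_inverse_real_of_nat, of "e / 4"] by (auto simp: eventually_sequentially)
      have "cnorm A (a m \<ominus>\<^bsub>A\<^esub> a n) < e" if "m \<ge> N" "n \<ge> N" for m n
        using diff[of m n] N[OF that(1)] N[OF that(2)] by linarith
      then show "\<exists>N. \<forall>m\<ge>N. \<forall>n\<ge>N. cnorm A (a m \<ominus>\<^bsub>A\<^esub> a n) < e" by blast
    qed
  qed
  then obtain b where b: "b \<in> carrier A" "(\<lambda>k. cnorm A (a k \<ominus>\<^bsub>A\<^esub> b)) \<longlonglongrightarrow> 0" by blast
  have "(\<lambda>m. norm (emb (F m) (t m) - emb (F m) (\<psi> m b))) \<longlonglongrightarrow> 0"
    unfolding tendsto_iff
  proof (intro allI impI)
    fix e :: real assume e: "e > 0"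
    have "eventually (\<lambda>k. ?\<delta> k < e / 4 \<and> cnorm A (a k \<ominus>\<^bsub>A\<^esub> b) < e / 2) sequentially"
      using e by (intro eventually_conj order_tendstoD(2)[OF LIMSEQ_inverse_real_of_nat] order_tendstoD(2)[OF b(2)]) auto
    then obtain k where k: "?\<delta> k < e / 4" "cnorm A (a k \<ominus>\<^bsub>A\<^esub> b) < e / 2" by (auto simp: eventually_sequentially)
    from ev[of k] show "eventually (\<lambda>m. dist (norm (emb (F m) (t m) - emb (F m) (\<psi> m b))) 0 < e) sequentially"
    proof (rule eventually_mono)
      fix m assume "norm (emb (F m) (t m) - emb (F m) (\<psi> m (a k))) \<le> 2 * ?\<delta> k"
      moreover have "norm (emb (F m) (\<psi> m (a k)) - emb (F m) (\<psi> m b)) < e / 2"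
        using norm_psi_diff_le[OF a(1) b(1), of m k] k(2) by (simp add: A.cnorm_diff_emb a b)
      ultimately show "dist (norm (emb (F m) (t m) - emb (F m) (\<psi> m b))) 0 < e"
        using norm_triangle_ineq[of "emb (F m) (t m) - emb (F m) (\<psi> m (a k))" "emb (F m) (\<psi> m (a k)) - emb (F m) (\<psi> m b)"] k(1)
        by (simp del: of_nat_Suc)
    qed
  qed
  then have "y = \<Psi> b" unfolding t(2) Psi_map_def by (rule Q.seq_class_eqI[OF t(1) bnd_psi[OF b(1)]])
  then show "y \<in> \<Psi> ` carrier A" using b by blast
qed

text \<open>The element \<open>x = \<psi> n a\<close> works for large \<open>n\<close>:
  \<open>\<rho> m n x\<close> is within a tail of the series of
  \<open>\<psi> m (\<phi> n (\<psi> n a))\<close>, and this is within the approximation error at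
  \<open>a\<close> of \<open>\<psi> m a\<close>, both uniformly in \<open>m > n\<close>.\<close>

lemma range_subset_system_limit: "\<Psi> ` carrier A \<subseteq> system_limit F (associated_maps \<psi> \<phi>)"
proof safe
  fix a assume a: "a \<in> carrier A"
  have "\<exists>n. \<exists>x\<in>carrier (F n). cnorm (seq_cstar F) (\<Psi> a \<ominus>\<^bsub>seq_cstar F\<^esub> to_limit F (associated_maps \<psi> \<phi>) n x) < e" if e: "e > 0" for e
  proof -
    have "eventually (\<lambda>n. (suminf \<epsilon> - S (Suc n)) * cnorm A a < e / 3 \<and> cnorm A (\<phi> n (\<psi> n a) \<ominus>\<^bsub>A\<^esub> a) < e / 3) sequentially"
      using e by (intro eventually_conj order_tendstoD(2)[OF tail_tendsto] order_tendstoD(2)[OF approx_id[OF a]]) auto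
    then obtain n where n: "(suminf \<epsilon> - S (Suc n)) * cnorm A a < e / 3" "cnorm A (\<phi> n (\<psi> n a) \<ominus>\<^bsub>A\<^esub> a) < e / 3"
      by (auto simp: eventually_sequentially)
    define x where "x = \<psi> n a"
    have x: "x \<in> carrier (F n)" using a by (simp add: x_def)
    have nx: "cnorm (F n) x \<le> cnorm A a" unfolding x_def by (rule cpc_map.map_norm_le[OF psi a])
    let ?T = "\<lambda>m. if n < m then \<rho> m n x else \<zero>\<^bsub>F m\<^esub>"
    have bT: "Q.bnd ?T" by (rule bnd_to_limit[OF x])
    have "cnorm (seq_cstar F) (seq_class F (\<lambda>m. \<psi> m a \<ominus>\<^bsub>F m\<^esub> ?T m)) \<le> e / 3 + e / 3"
      unfolding Q.seq_norm_le_iff[OF Q.bnd_diff[OF bnd_psi[OF a] bT]]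
    proof (intro allI impI)
      fix \<delta> :: real assume "\<delta> > 0"
      show "eventually (\<lambda>m. cnorm (F m) (\<psi> m a \<ominus>\<^bsub>F m\<^esub> ?T m) \<le> e / 3 + e / 3 + \<delta>) sequentially"
        using eventually_gt_at_top[of n]
      proof (rule eventually_mono)
        fix m assume m: "n < m"
        have "norm (emb (F m) (\<rho> m n x) - emb (F m) (\<psi> m (\<phi> n x))) \<le> (suminf \<epsilon> - S (Suc n)) * cnorm (F n) x"
          by (rule rho_close_tail[OF m x])
        also have "\<dots> \<le> (suminf \<epsilon> - S (Suc n)) * cnorm A a" using nx S_le[of "Suc n"] by (intro mult_left_mono) auto
        finally have 1: "norm (emb (F m) (\<rho> m n x) - emb (F m) (\<psi> m (\<phi> n x))) < e / 3" using n(1) by linarith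
        have "norm (emb (F m) (\<psi> m (\<phi> n x)) - emb (F m) (\<psi> m a)) < e / 3"
          using norm_psi_diff_le[of "\<phi> n x" a m] n(2) a x by (simp add: A.cnorm_diff_emb x_def)
        then have "norm (emb (F m) (\<rho> m n x) - emb (F m) (\<psi> m a)) < e / 3 + e / 3"
          using 1 norm_triangle_ineq[of "emb (F m) (\<rho> m n x) - emb (F m) (\<psi> m (\<phi> n x))" "emb (F m) (\<psi> m (\<phi> n x)) - emb (F m) (\<psi> m a)"] by simp
        then show "cnorm (F m) (\<psi> m a \<ominus>\<^bsub>F m\<^esub> ?T m) \<le> e / 3 + e / 3 + \<delta>"
          using m a x \<open>\<delta> > 0\<close> by (simp add: Q.F.cnorm_diff_emb rho_closed norm_minus_commute)
      qed
    qed
    then have "cnorm (seq_cstar F) (\<Psi> a \<ominus>\<^bsub>seq_cstar F\<^esub> to_limit F (associated_maps \<psi> \<phi>) n x) < e"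
      unfolding to_limit_def Psi_map_def Q.seq_diff[OF bnd_psi[OF a] bT] using e by simp
    then show ?thesis using x by blast
  qed
  then show "\<Psi> a \<in> system_limit F (associated_maps \<psi> \<phi>)" using a by (simp add: system_limit_def)
qed

theorem limit_isomorphism:
  "complete_order_isomorphism A (carrier A) (seq_cstar F) (system_limit F (associated_maps \<psi> \<phi>)) \<Psi>"
proof -
  have "system_limit F (associated_maps \<psi> \<phi>) = \<Psi> ` carrier A"
    using system_limit_subset range_subset_system_limit by (rule equalityI)
  then show ?thesis using complete_order_isomorphism_range by simp
qed

end

theorem theoremC:
  fixes A :: "'a cstar" and F :: "nat \<Rightarrow> 'f cstar"
    and \<psi> :: "nat \<Rightarrow> 'a \<Rightarrow> 'f" and \<phi> :: "nat \<Rightarrow> 'f \<Rightarrow> 'a"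
  assumes "cstar_algebra A" and "separable A" and "nuclear A"
    and "cpc_approximations A F \<psi> \<phi>"
  shows "\<exists>r :: nat \<Rightarrow> nat. strict_mono r \<and>
    summable_approximations A (F \<circ> r) (\<psi> \<circ> r) (\<phi> \<circ> r) \<and>
    cstar_encoding (F \<circ> r) (associated_maps (\<psi> \<circ> r) (\<phi> \<circ> r)) \<and>
    complete_order_isomorphism A (carrier A) (seq_cstar (F \<circ> r))
      (system_limit (F \<circ> r) (associated_maps (\<psi> \<circ> r) (\<phi> \<circ> r)))
      (Psi_map (F \<circ> r) (\<psi> \<circ> r))"
proof -
  interpret A: cstar_algebra A by fact
  interpret orig: approximations A F \<psi> \<phi>
    by (intro approximations.intro approximations_axioms.intro assms A.cstar_algebra_axioms)
  obtain r :: "nat \<Rightarrow> nat" where r: "strict_mono r"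
    and close: "\<And>j m x. j < m \<Longrightarrow> x \<in> carrier (F (r j)) \<Longrightarrow>
      cnorm A (\<phi> (r j) x \<ominus>\<^bsub>A\<^esub> \<phi> (r m) (\<psi> (r m) (\<phi> (r j) x))) \<le> (1/2) ^ Suc (Suc m) * cnorm (F (r j)) x"
    by (rule orig.summable_subsequence) blast
  have sub: "cpc_approximations A (F \<circ> r) (\<psi> \<circ> r) (\<phi> \<circ> r)"
    using assms(4) LIMSEQ_subseq_LIMSEQ[OF _ r] unfolding cpc_approximations_def by (fastforce simp: o_def)
  \<comment> \<open>These are the bounds for summability, with sum exactly 1. The interpretation
    that follows is made with half of them.\<close>
  have half: "(\<lambda>m. (1/2::real) ^ Suc m) sums 1" by (rule power_half_series)
  interpret sys: summable_system A "F \<circ> r" "\<psi> \<circ> r" "\<phi> \<circ> r" "\<lambda>m. (1/2) ^ Suc (Suc m)"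
  proof (intro summable_system.intro approximations.intro approximations_axioms.intro summable_system_axioms.intro
      sub A.cstar_algebra_axioms)
    show "summable (\<lambda>m. (1/2::real) ^ Suc (Suc m))"
      using summable_mult[OF sums_summable[OF half], of "1/2"] by simp
    show "cnorm A ((\<phi> \<circ> r) n x \<ominus>\<^bsub>A\<^esub> (\<phi> \<circ> r) m ((\<psi> \<circ> r) m ((\<phi> \<circ> r) n x))) \<le> (1/2) ^ Suc (Suc m) * cnorm ((F \<circ> r) n) x"
      if "n < m" "x \<in> carrier ((F \<circ> r) n)" for n m x
      using close[OF that(1), of x] that(2) by simp
  qed simp
  \<comment> \<open>A supremum of elements bounded by \<open>(1/2)^(m+2)\<close> is again at most
    that; strictness comes from passing to \<open>(1/2)^(m+1)\<close>.\<close>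
  have "op_norm ((F \<circ> r) n) A (\<lambda>x. (\<phi> \<circ> r) n x \<ominus>\<^bsub>A\<^esub> (\<phi> \<circ> r) m ((\<psi> \<circ> r) m ((\<phi> \<circ> r) n x))) < (1/2) ^ Suc m"
    if nm: "n < m" for n m
  proof -
    have "op_norm ((F \<circ> r) n) A (\<lambda>x. (\<phi> \<circ> r) n x \<ominus>\<^bsub>A\<^esub> (\<phi> \<circ> r) m ((\<psi> \<circ> r) m ((\<phi> \<circ> r) n x))) \<le> (1/2) ^ Suc (Suc m)"
      unfolding op_norm_def
    proof (rule cSup_least)
      show "{cnorm A ((\<phi> \<circ> r) n x \<ominus>\<^bsub>A\<^esub> (\<phi> \<circ> r) m ((\<psi> \<circ> r) m ((\<phi> \<circ> r) n x))) |x.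
         x \<in> carrier ((F \<circ> r) n) \<and> cnorm ((F \<circ> r) n) x \<le> 1} \<noteq> {}"
        by (auto simp del: o_apply intro!: exI[of _ "\<zero>\<^bsub>(F \<circ> r) n\<^esub>"])
      fix z assume "z \<in> {cnorm A ((\<phi> \<circ> r) n x \<ominus>\<^bsub>A\<^esub> (\<phi> \<circ> r) m ((\<psi> \<circ> r) m ((\<phi> \<circ> r) n x))) |x.
         x \<in> carrier ((F \<circ> r) n) \<and> cnorm ((F \<circ> r) n) x \<le> 1}"
      then obtain x where x: "z = cnorm A ((\<phi> \<circ> r) n x \<ominus>\<^bsub>A\<^esub> (\<phi> \<circ> r) m ((\<psi> \<circ> r) m ((\<phi> \<circ> r) n x)))"
        "x \<in> carrier ((F \<circ> r) n)" "cnorm ((F \<circ> r) n) x \<le> 1" by blast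
      have "(1/2) ^ Suc (Suc m) * cnorm ((F \<circ> r) n) x \<le> (1/2) ^ Suc (Suc m) * 1"
        using x(3) by (intro mult_left_mono) auto
      moreover have "z \<le> (1/2) ^ Suc (Suc m) * cnorm ((F \<circ> r) n) x" unfolding x(1) by (rule sys.close[OF nm x(2)])
      ultimately show "z \<le> (1/2) ^ Suc (Suc m)" by linarith
    qed
    also have "(1/2::real) ^ Suc (Suc m) < (1/2) ^ Suc m" by simp
    finally show ?thesis .
  qed
  moreover have "decseq (\<lambda>m. (1/2::real) ^ Suc m)" by (rule decseq_SucI) simp
  ultimately have "summable_approximations A (F \<circ> r) (\<psi> \<circ> r) (\<phi> \<circ> r)"
    unfolding summable_approximations_def using sub sums_summable[OF half] sums_unique[OF half]
    by (intro conjI exI[of _ "\<lambda>m. (1/2) ^ Suc m"]) auto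
  then show ?thesis using r sys.encoding sys.limit_isomorphism by blast
qed

end
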